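(* For every non-empty bounded open convex set $\Omega\subset\mathbb{R}^2$, $$\frac{\pi^4}{4}<|\Omega|^2\lambda_1(\Omega)\mu_1(\Omega)<9\pi^2 j_{0,1}^2,$$ where $j_{0,1}$ denotes the first positive zero of the Bessel function $J_0$.
   Context: $|\Omega|$ denotes the area of $\Omega$. $\lambda_1(\Omega)$ is the first eigenvalue of the Dirichlet Laplacian on $\Omega$ ($-\Delta u=\lambda u$ in $\Omega$, $u=0$ on $\partial\Omega$). $\mu_1(\Omega)$ is the first non-trivial eigenvalue of the Neumann Laplacian on $\Omega$ ($-\Delta u=\mu u$ in $\Omega$, $\partial_\nu u=0$ on $\partial\Omega$): $\mu_1(\Omega)=\min\left\{\frac{\int_\Omega|\nabla u|^2dx}{\int_\Omega u^2dx}: u\in H^1(\Omega)\setminus\{0\},\ \int_\Omega u\,dx=0\right\}$. *)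

theory Defs
  imports "HOL-Analysis.Analysis"
begin

primrec Ck :: "nat \<Rightarrow> ('a::euclidean_space \<Rightarrow> real) \<Rightarrow> bool" where
  "Ck 0 f \<longleftrightarrow> continuous_on UNIV f"
| "Ck (Suc k) f \<longleftrightarrow> (\<forall>x. f differentiable (at x)) \<and>
     (\<forall>v. Ck k (\<lambda>x. frechet_derivative f (at x) v))"

(* C_c^infinity(Omega), each function extended by zero to the whole space *)
definition test_functions :: "'a::euclidean_space set \<Rightarrow> ('a \<Rightarrow> real) set" where
  "test_functions \<Omega> =
     {\<phi>. (\<forall>k. Ck k \<phi>) \<and> compact (closure {x. \<phi> x \<noteq> 0}) \<and> closure {x. \<phi> x \<noteq> 0} \<subseteq> \<Omega>}"

definition grad :: "('a::euclidean_space \<Rightarrow> real) \<Rightarrow> 'a \<Rightarrow> 'a" where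
  "grad f x = (THE D. GDERIV f x :> D)"

definition square_integrable_on ::
    "('a::euclidean_space \<Rightarrow> 'b::euclidean_space) \<Rightarrow> 'a set \<Rightarrow> bool"
    (infix "square'_integrable'_on" 50) where
  "f square_integrable_on \<Omega> \<longleftrightarrow>
     f \<in> borel_measurable (lebesgue_on \<Omega>) \<and>
     integrable (lebesgue_on \<Omega>) (\<lambda>x. (norm (f x))\<^sup>2)"

(* Elements of H^1(Omega) are handled through representatives: H1_with_grad \<Omega> u g says that
   the class of u lies in H^1(Omega) and that g represents its weak gradient, which is
   determined almost everywhere in Omega.  Values outside Omega are irrelevant. *)
definition H1_with_grad ::
    "'a::euclidean_space set \<Rightarrow> ('a \<Rightarrow> real) \<Rightarrow> ('a \<Rightarrow> 'a) \<Rightarrow> bool" where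
  "H1_with_grad \<Omega> u g \<longleftrightarrow>
     u square_integrable_on \<Omega> \<and> g square_integrable_on \<Omega> \<and>
     (\<forall>\<phi>\<in>test_functions \<Omega>.
        (LINT x|lebesgue_on \<Omega>. u x *\<^sub>R grad \<phi> x) = - (LINT x|lebesgue_on \<Omega>. \<phi> x *\<^sub>R g x))"

(* H^1_0(Omega) is the closure of C_c^infinity(Omega) in the H^1 norm. *)
definition H10_with_grad ::
    "'a::euclidean_space set \<Rightarrow> ('a \<Rightarrow> real) \<Rightarrow> ('a \<Rightarrow> 'a) \<Rightarrow> bool" where
  "H10_with_grad \<Omega> u g \<longleftrightarrow>
     H1_with_grad \<Omega> u g \<and>
     (\<exists>\<phi>::nat \<Rightarrow> 'a \<Rightarrow> real. (\<forall>n. \<phi> n \<in> test_functions \<Omega>) \<and>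
        (\<lambda>n. LINT x|lebesgue_on \<Omega>. (u x - \<phi> n x)\<^sup>2) \<longlonglongrightarrow> 0 \<and>
        (\<lambda>n. LINT x|lebesgue_on \<Omega>. (norm (g x - grad (\<phi> n) x))\<^sup>2) \<longlonglongrightarrow> 0)"

definition nonzero_on :: "'a::euclidean_space set \<Rightarrow> ('a \<Rightarrow> real) \<Rightarrow> bool" where
  "nonzero_on \<Omega> u \<longleftrightarrow> \<not> (AE x in lebesgue_on \<Omega>. u x = 0)"

(* Weak form of - Laplace u = l u in Omega, u = 0 on the boundary. *)
definition dirichlet_eigenvalue :: "'a::euclidean_space set \<Rightarrow> real \<Rightarrow> bool" where
  "dirichlet_eigenvalue \<Omega> l \<longleftrightarrow>
     (\<exists>u g. H10_with_grad \<Omega> u g \<and> nonzero_on \<Omega> u \<and>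
        (\<forall>\<phi>\<in>test_functions \<Omega>.
           (LINT x|lebesgue_on \<Omega>. g x \<bullet> grad \<phi> x) = l * (LINT x|lebesgue_on \<Omega>. u x * \<phi> x)))"

definition lambda1 :: "'a::euclidean_space set \<Rightarrow> real" where
  "lambda1 \<Omega> = (LEAST l. dirichlet_eigenvalue \<Omega> l)"

(* For bounded convex Omega the infimum is attained, since H^1(Omega) embeds compactly
   into L^2(Omega). *)
definition mu1 :: "'a::euclidean_space set \<Rightarrow> real" where
  "mu1 \<Omega> = Inf {(LINT x|lebesgue_on \<Omega>. (norm (g x))\<^sup>2) / (LINT x|lebesgue_on \<Omega>. (u x)\<^sup>2) | u g.
     H1_with_grad \<Omega> u g \<and> nonzero_on \<Omega> u \<and> (LINT x|lebesgue_on \<Omega>. u x) = 0}"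

definition bessel_J0 :: "real \<Rightarrow> real" where
  "bessel_J0 x = (\<Sum>k. (-1) ^ k / (fact k)\<^sup>2 * (x / 2) ^ (2 * k))"

definition j01 :: real where
  "j01 = (LEAST x. 0 < x \<and> bessel_J0 x = 0)"

end

theory Submission
  imports Defs "HOL-Library.Diagonal_Subsequence"
begin

text \<open>
  Write \<open>A\<close>, \<open>D\<close>, \<open>w\<close> for the area, the diameter and a width of \<open>\<Omega>\<close>.

  Lower bound: the one-dimensional Dirichlet inequality on the chords in two orthogonal directions gives
  \<open>\<lambda>\<^sub>1 \<ge> \<pi>\<^sup>2 / D\<^sup>2 + \<pi>\<^sup>2 / w\<^sup>2 > \<pi>\<^sup>2 / w\<^sup>2\<close>, where \<open>w\<close> is the width orthogonal to a diameter; the inequality of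
  Payne and Weinberger gives \<open>\<mu>\<^sub>1 \<ge> \<pi>\<^sup>2 / D\<^sup>2\<close>, and two triangles over a diameter give \<open>A \<ge> D w / 2\<close>.

  Upper bound: let \<open>w\<close> be the minimal width.  A disc of radius \<open>w / 3\<close> fits into \<open>\<Omega>\<close>, so
  \<open>\<lambda>\<^sub>1 \<le> 9 j\<^sub>0\<^sub>1\<^sup>2 / w\<^sup>2\<close>.  A sine profile of length \<open>A / w\<close> orthogonal to the strip of width \<open>w\<close>
  containing \<open>\<Omega>\<close>, continued by \<open>\<plusminus>1\<close>, is a Neumann trial function with quotient at most
  \<open>\<pi>\<^sup>2 w\<^sup>2 / A\<^sup>2\<close>.  Equality forces \<open>\<Omega>\<close> to be a rectangle, which contains a larger disc.
\<close>

section \<open>Smooth functions and classical gradients\<close>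

text \<open>\<open>lambda1\<close> is a least element and \<open>mu1\<close> an infimum over weak
  gradients, so estimates need existence first: a Dirichlet eigenvalue, and one admissible Neumann
  function. The eigenvalue comes from a minimising sequence made compact by the Neumann side:
  Payne-Weinberger on small squares bounds the L2 norm by a small multiple of the energy plus
  finitely many averages. That inequality is proved for functions that are C1 on the whole plane,
  because thin pieces are compared with a line that may leave them. It reaches H1 by mollifying on
  shrunken copies of the domain, which convexity provides, so that no boundary regularity enters.
  The constant 1/4 is the square of the factor 1/2 in the area bound, and 9 is the square of 3 in
  the radius; the equilateral triangle shows that this radius cannot be improved. The lower bound is
  strict because a positive summand of the Dirichlet bound is dropped. The upper bound has no such
  slack on either side: it is strict because the two factors cannot be extremal together. Equality
  in the trial quotient leaves a rectangle, where even a disc of radius 2/5 of the width fits, and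
  2/5 exceeds 1/3.\<close>

lemma Ck_continuous: "Ck k f \<Longrightarrow> continuous_on UNIV f"
  by (cases k) (auto intro: differentiable_imp_continuous_on simp: differentiable_on_def)

lemma Ck_SucD: "Ck (Suc k) f \<Longrightarrow> Ck k f"
proof (induction k arbitrary: f)
  case 0
  then show ?case using Ck_continuous by fastforce
next
  case (Suc k)
  then show ?case by (metis Ck.simps(2))
qed

lemma Ck_SucI:
  assumes "\<And>x. (f has_derivative D x) (at x)" "\<And>v. Ck k (\<lambda>x. D x v)"
  shows "Ck (Suc k) f"
proof -
  have "frechet_derivative f (at x) = D x" for x
    using assms(1) frechet_derivative_at by metis
  then show ?thesis using assms by (auto simp: differentiable_def)
qed

lemma Ck_has_derivative:
  assumes "Ck (Suc k) f" shows "(f has_derivative frechet_derivative f (at x)) (at x)"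
  using assms by (auto simp: frechet_derivative_works)

lemma Ck_const: "Ck k (\<lambda>_. c)"
proof (induction k arbitrary: c)
  case (Suc k)
  show ?case by (rule Ck_SucI[where D="\<lambda>_ _. 0"]) (auto intro: Suc)
qed auto

lemma Ck_add: "Ck k f \<Longrightarrow> Ck k g \<Longrightarrow> Ck k (\<lambda>x. f x + g x)"
proof (induction k arbitrary: f g)
  case (Suc k)
  show ?case
    by (rule Ck_SucI[where D="\<lambda>x v. frechet_derivative f (at x) v + frechet_derivative g (at x) v"])
      (use Suc.prems in \<open>auto intro!: Suc.IH has_derivative_add Ck_has_derivative[OF Suc.prems(1)] Ck_has_derivative[OF Suc.prems(2)]\<close>)
qed (auto intro: continuous_on_add)

lemma Ck_mult: "Ck k f \<Longrightarrow> Ck k g \<Longrightarrow> Ck k (\<lambda>x. f x * g x)"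
proof (induction k arbitrary: f g)
  case (Suc k)
  have "(\<And>v. Ck k (\<lambda>x. frechet_derivative f (at x) v))" "(\<And>v. Ck k (\<lambda>x. frechet_derivative g (at x) v))"
    using Suc.prems by auto
  moreover have "Ck k f" "Ck k g" using Suc.prems Ck_SucD by blast+
  ultimately show ?case
    by (intro Ck_SucI[where D="\<lambda>x v. f x * frechet_derivative g (at x) v + frechet_derivative f (at x) v * g x"])
      (auto intro!: Suc.IH has_derivative_mult Ck_has_derivative[OF Suc.prems(1)] Ck_has_derivative[OF Suc.prems(2)] Ck_add)
qed (auto intro: continuous_on_mult)

lemma Ck_compose:
  fixes h :: "real \<Rightarrow> real" and f :: "'a::euclidean_space \<Rightarrow> real"
  shows "Ck k h \<Longrightarrow> Ck k f \<Longrightarrow> Ck k (\<lambda>x. h (f x))"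
proof (induction k arbitrary: h f)
  case (Suc k)
  \<comment> \<open>A linear map on the reals is multiplication by its value at 1. In this form the
    chain rule is a product, to which the induction hypothesis applies.\<close>
  let ?D = "\<lambda>x v. frechet_derivative f (at x) v * frechet_derivative h (at (f x)) 1"
  have h': "Ck k (\<lambda>t. frechet_derivative h (at t) 1)" and f': "\<And>v. Ck k (\<lambda>x. frechet_derivative f (at x) v)"
    using Suc.prems by auto
  show ?case
  proof (rule Ck_SucI[where D="?D"])
    fix x
    have "((\<lambda>x. h (f x)) has_derivative (\<lambda>v. frechet_derivative h (at (f x)) (frechet_derivative f (at x) v))) (at x)"
      by (rule has_derivative_compose[OF Ck_has_derivative[OF Suc.prems(2)] Ck_has_derivative[OF Suc.prems(1)]])
    moreover have "frechet_derivative h (at (f x)) (frechet_derivative f (at x) v) = ?D x v" for v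
    proof -
      have "linear (frechet_derivative h (at (f x)))"
        using Ck_has_derivative[OF Suc.prems(1), of "f x"] has_derivative_linear by blast
      from linear_cmul[OF this, of "frechet_derivative f (at x) v" 1] show ?thesis by simp
    qed
    ultimately show "((\<lambda>x. h (f x)) has_derivative ?D x) (at x)"
      by simp
  next
    fix v
    show "Ck k (\<lambda>x. ?D x v)"
      using Suc.IH[OF h' Ck_SucD[OF Suc.prems(2)]] f' by (intro Ck_mult)
  qed
qed (auto intro: continuous_on_compose2)

lemma Ck_inner: "Ck k (\<lambda>x. x \<bullet> a)"
proof (cases k)
  case (Suc j)
  show ?thesis unfolding Suc
    by (rule Ck_SucI[where D="\<lambda>_ v. v \<bullet> a"]) (auto intro!: derivative_eq_intros Ck_const)
qed (auto intro: continuous_intros)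

lemma Ck_norm_diff_square: "Ck k (\<lambda>x. (norm (x - a))\<^sup>2)"
proof (cases k)
  case (Suc j)
  have "Ck j (\<lambda>x. 2 * (x \<bullet> v) + (- 2 * (a \<bullet> v)))" for v
    by (intro Ck_add Ck_mult Ck_const Ck_inner)
  then have "Ck j (\<lambda>x. 2 * ((x - a) \<bullet> v))" for v
    by (simp add: algebra_simps)
  then show ?thesis unfolding Suc power2_norm_eq_inner
    by (intro Ck_SucI[where D="\<lambda>x v. 2 * ((x - a) \<bullet> v)"])
      (auto intro!: derivative_eq_intros simp: inner_commute algebra_simps)
qed (auto intro!: continuous_intros)

text \<open>Serves functions given by cases: the cut-off eigenfunction of a disc is glued to zero
  with it.\<close>

lemma Ck_local:
  assumes "\<And>x. \<exists>U g. open U \<and> x \<in> U \<and> Ck k g \<and> (\<forall>y\<in>U. f y = g y)"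
  shows "Ck k f"
  using assms
proof (induction k arbitrary: f)
  case 0
  have "isCont f x" for x
  proof -
    obtain U g where U: "open U" "x \<in> U" "Ck 0 g" "\<forall>y\<in>U. f y = g y" using 0 by blast
    then have "isCont g x" by (simp add: continuous_on_eq_continuous_at)
    moreover have "eventually (\<lambda>y. g y = f y) (nhds x)" using U by (auto simp: eventually_nhds)
    ultimately show ?thesis using isCont_cong by blast
  qed
  then show ?case by (simp add: continuous_on_eq_continuous_at)
next
  case (Suc k)
  have D: "f differentiable at x" for x
  proof -
    obtain U g where U: "open U" "x \<in> U" "Ck (Suc k) g" "\<forall>y\<in>U. f y = g y" using Suc.prems by blast
    have "(f has_derivative frechet_derivative g (at x)) (at x)"
      by (rule has_derivative_transform_within_open[OF Ck_has_derivative[OF U(3)] U(1,2)]) (use U in auto)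
    then show ?thesis by (auto simp: differentiable_def)
  qed
  have "Ck k (\<lambda>x. frechet_derivative f (at x) v)" for v
  proof (rule Suc.IH)
    fix x
    obtain U g where U: "open U" "x \<in> U" "Ck (Suc k) g" "\<forall>y\<in>U. f y = g y" using Suc.prems by blast
    have "frechet_derivative f (at y) = frechet_derivative g (at y)" if "y \<in> U" for y
    proof -
      have "(f has_derivative frechet_derivative g (at y)) (at y)"
        by (rule has_derivative_transform_within_open[OF Ck_has_derivative[OF U(3)] U(1) that]) (use U in auto)
      then show ?thesis using frechet_derivative_at by metis
    qed
    then show "\<exists>U g. open U \<and> x \<in> U \<and> Ck k g \<and> (\<forall>y\<in>U. frechet_derivative f (at y) v = g y)"
      using U by (intro exI[of _ U] exI[of _ "\<lambda>x. frechet_derivative g (at x) v"]) auto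
  qed
  with D show ?case by simp
qed

section \<open>Flat functions and bumps\<close>

definition flat_poly :: "real poly \<Rightarrow> real \<Rightarrow> real" where
  "flat_poly p t = (if t > 0 then poly p (1 / t) * exp (- (1 / t)) else 0)"

lemma poly_exp_tendsto_0: "((\<lambda>y::real. poly p y * exp (- y)) \<longlongrightarrow> 0) at_top"
proof -
  have "((\<lambda>y. \<Sum>i\<le>degree p. coeff p i * (y ^ i / exp y)) \<longlongrightarrow> (\<Sum>i\<le>degree p. coeff p i * 0)) at_top"
    by (intro tendsto_sum tendsto_mult tendsto_const tendsto_power_div_exp_0)
  moreover have "(\<Sum>i\<le>degree p. coeff p i * (y ^ i / exp y)) = poly p y * exp (- y)" for y
    by (simp add: poly_altdef exp_minus sum_distrib_right divide_inverse mult.assoc)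
  ultimately show ?thesis by simp
qed

lemma flat_poly_tendsto_0: "(flat_poly p \<longlongrightarrow> 0) (at 0)"
proof -
  have "((\<lambda>t. poly p (1 / t) * exp (- (1 / t))) \<longlongrightarrow> 0) (at_right 0)"
    using filterlim_compose[OF poly_exp_tendsto_0[of p] filterlim_inverse_at_top_right]
    by (simp add: inverse_eq_divide)
  then have "(flat_poly p \<longlongrightarrow> 0) (at_right 0)"
    by (rule Lim_transform_eventually) (auto simp: flat_poly_def eventually_at_filter)
  moreover have "(flat_poly p \<longlongrightarrow> 0) (at_left 0)"
    by (rule Lim_transform_eventually[OF tendsto_const]) (auto simp: flat_poly_def eventually_at_filter)
  ultimately show ?thesis by (simp add: filterlim_split_at)
qed

text \<open>With \<open>s = 1 / t\<close> the derivative in \<open>t\<close> of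
  \<open>p(s) exp(-s)\<close> is \<open>s^2 (p(s) - p'(s)) exp(-s)\<close>. The family is thus
  closed under differentiation, which is what the induction for smoothness needs; a statement about
  exp(-1/t) alone would not reproduce itself.\<close>

lemma flat_poly_deriv:
  "(flat_poly p has_real_derivative flat_poly ([:0, 0, 1:] * (p - pderiv p)) t) (at t)"
proof -
  consider "t > 0" | "t < 0" | "t = 0" by linarith
  then show ?thesis
  proof cases
    case 1
    have "((\<lambda>t. poly p (1 / t) * exp (- (1 / t))) has_real_derivative
        flat_poly ([:0, 0, 1:] * (p - pderiv p)) t) (at t)"
      using 1 by (auto intro!: derivative_eq_intros DERIV_chain'[OF _ poly_DERIV]
          simp: flat_poly_def power2_eq_square field_simps)
    then show ?thesis
      by (rule has_field_derivative_transform_within_open[where S="{0<..}"]) (use 1 in \<open>auto simp: flat_poly_def\<close>)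
  next
    case 2
    have "((\<lambda>t. 0) has_real_derivative flat_poly ([:0, 0, 1:] * (p - pderiv p)) t) (at t)"
      using 2 by (auto simp: flat_poly_def)
    then show ?thesis
      by (rule has_field_derivative_transform_within_open[where S="{..<0}"]) (use 2 in \<open>auto simp: flat_poly_def\<close>)
  next
    case 3
    \<comment> \<open>At 0 the difference quotient is again a member of the family, hence tends to
      0.\<close>
    have "flat_poly p h / h = flat_poly ([:0, 1:] * p) h" if "h \<noteq> 0" for h
      using that by (auto simp: flat_poly_def)
    then have "((\<lambda>h. flat_poly p h / h) \<longlongrightarrow> 0) (at 0)"
      by (intro Lim_transform_eventually[OF flat_poly_tendsto_0[of "[:0,1:] * p"]])
        (auto simp: eventually_at_filter)
    then show ?thesis using 3 by (simp add: DERIV_def flat_poly_def)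
  qed
qed

lemma Ck_flat_poly: "Ck k (flat_poly p)"
proof (induction k arbitrary: p)
  case 0
  have "isCont (flat_poly p) x" for x by (rule DERIV_isCont[OF flat_poly_deriv])
  then show ?case by (simp add: continuous_on_eq_continuous_at)
next
  case (Suc k)
  let ?q = "[:0, 0, 1:] * (p - pderiv p)"
  have "(flat_poly p has_derivative (\<lambda>v. v * flat_poly ?q x)) (at x)" for x
    by (rule has_derivative_eq_rhs[OF flat_poly_deriv[of p x, unfolded has_field_derivative_def]])
      (rule ext, rule mult.commute)
  moreover have "Ck k (\<lambda>x. v * flat_poly ?q x)" for v
    by (intro Ck_mult Ck_const Suc.IH)
  ultimately show ?case by (rule Ck_SucI)
qed

definition flat_exp :: "real \<Rightarrow> real" where
  "flat_exp t = (if t > 0 then exp (- (1 / t)) else 0)"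

lemma flat_exp_eq: "flat_exp = flat_poly 1"
  by (rule ext) (simp add: flat_exp_def flat_poly_def)

lemma Ck_flat_exp: "Ck k flat_exp"
  unfolding flat_exp_eq by (rule Ck_flat_poly)

text \<open>Using the squared norm keeps the function smooth at its centre. The kernel is left
  unnormalised, with values at most 1; its integral is \<open>bump_mass\<close>.\<close>

definition bump :: "'a::euclidean_space \<Rightarrow> real \<Rightarrow> 'a \<Rightarrow> real" where
  "bump a r x = flat_exp (r\<^sup>2 - (norm (x - a))\<^sup>2)"

lemma Ck_bump: "Ck k (bump a r)"
proof -
  have "Ck k (\<lambda>x. flat_exp (r\<^sup>2 + (- 1) * (norm (x - a))\<^sup>2))"
    by (rule Ck_compose[OF Ck_flat_exp]) (intro Ck_add Ck_mult Ck_const Ck_norm_diff_square)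
  moreover have "bump a r = (\<lambda>x. flat_exp (r\<^sup>2 + (- 1) * (norm (x - a))\<^sup>2))"
    by (rule ext) (simp add: bump_def)
  ultimately show ?thesis by simp
qed

lemma bump_nonneg: "bump a r x \<ge> 0"
  by (simp add: bump_def flat_exp_def)

lemma bump_eq_0: "r > 0 \<Longrightarrow> x \<notin> ball a r \<Longrightarrow> bump a r x = 0"
  by (auto simp: bump_def flat_exp_def dist_norm norm_minus_commute power_mono not_less)

section \<open>Functions with a continuous gradient on the whole space\<close>

definition C1_grad :: "('a::euclidean_space \<Rightarrow> real) \<Rightarrow> ('a \<Rightarrow> 'a) \<Rightarrow> bool" where
  "C1_grad u G \<longleftrightarrow> (\<forall>x. (u has_derivative (\<lambda>h. h \<bullet> G x)) (at x)) \<and> continuous_on UNIV G"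

lemma grad_eqI: "(f has_derivative (\<lambda>h. h \<bullet> D)) (at x) \<Longrightarrow> grad f x = D"
  unfolding grad_def gderiv_def
proof (rule the_equality)
  fix D' assume "(f has_derivative (\<lambda>h. h \<bullet> D)) (at x)" "(f has_derivative (\<lambda>h. h \<bullet> D')) (at x)"
  then have "(\<lambda>h. h \<bullet> D) = (\<lambda>h. h \<bullet> D')" by (rule has_derivative_unique)
  then have "(D' - D) \<bullet> (D' - D) = 0" by (metis inner_diff_right right_minus_eq)
  then show "D' = D" by simp
qed

lemma C1_grad_imp_grad: "C1_grad u G \<Longrightarrow> grad u = G"
  by (auto simp: C1_grad_def fun_eq_iff intro: grad_eqI)

lemma Ck_imp_C1_grad:
  assumes "Ck (Suc k) f" shows "C1_grad f (grad f)"
proof -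
  let ?G = "\<lambda>x. \<Sum>b\<in>Basis. frechet_derivative f (at x) b *\<^sub>R b"
  have eq: "frechet_derivative f (at x) = (\<lambda>h. h \<bullet> ?G x)" for x
  proof
    fix h
    have lin: "linear (frechet_derivative f (at x))"
      using Ck_has_derivative[OF assms] has_derivative_linear by blast
    have "frechet_derivative f (at x) h = frechet_derivative f (at x) (\<Sum>b\<in>Basis. (h \<bullet> b) *\<^sub>R b)"
      by (simp add: euclidean_representation)
    also have "\<dots> = h \<bullet> ?G x"
      by (simp add: linear_sum[OF lin] linear_cmul[OF lin] inner_sum_right mult.commute)
    finally show "frechet_derivative f (at x) h = h \<bullet> ?G x" .
  qed
  have "C1_grad f ?G"
    unfolding C1_grad_def
  proof (intro conjI allI)
    fix x show "(f has_derivative (\<lambda>h. h \<bullet> ?G x)) (at x)"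
      by (rule has_derivative_eq_rhs[OF Ck_has_derivative[OF assms] eq])
    have "continuous_on UNIV (\<lambda>x. frechet_derivative f (at x) b)" for b
      using assms by (auto intro: Ck_continuous)
    then show "continuous_on UNIV ?G" by (intro continuous_intros)
  qed
  from C1_grad_imp_grad[OF this] this show ?thesis by simp
qed

lemma C1_grad_continuous: "C1_grad u G \<Longrightarrow> continuous_on UNIV u"
  by (auto simp: C1_grad_def continuous_on_eq_continuous_at intro: has_derivative_continuous)

lemma C1_grad_add: "C1_grad u G \<Longrightarrow> C1_grad v H \<Longrightarrow> C1_grad (\<lambda>x. u x + v x) (\<lambda>x. G x + H x)"
  by (auto simp: C1_grad_def inner_add_right intro!: continuous_intros derivative_intros)

lemma C1_grad_cmult: "C1_grad u G \<Longrightarrow> C1_grad (\<lambda>x. c * u x) (\<lambda>x. c *\<^sub>R G x)"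
  by (auto simp: C1_grad_def intro!: continuous_intros derivative_intros)

lemma C1_grad_const: "C1_grad (\<lambda>x. c) (\<lambda>x. 0)"
  by (auto simp: C1_grad_def)

lemma C1_grad_mult:
  assumes "C1_grad u G" "C1_grad v H"
  shows "C1_grad (\<lambda>x. u x * v x) (\<lambda>x. u x *\<^sub>R H x + v x *\<^sub>R G x)"
  unfolding C1_grad_def
proof (intro conjI allI)
  fix x
  have "(u has_derivative (\<lambda>h. h \<bullet> G x)) (at x)" "(v has_derivative (\<lambda>h. h \<bullet> H x)) (at x)"
    using assms by (auto simp: C1_grad_def)
  then have "((\<lambda>x. u x * v x) has_derivative (\<lambda>h. u x * (h \<bullet> H x) + (h \<bullet> G x) * v x)) (at x)"
    by (rule has_derivative_mult)
  then show "((\<lambda>x. u x * v x) has_derivative (\<lambda>h. h \<bullet> (u x *\<^sub>R H x + v x *\<^sub>R G x))) (at x)"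
    by (simp add: inner_add_right mult.commute)
next
  show "continuous_on UNIV (\<lambda>x. u x *\<^sub>R H x + v x *\<^sub>R G x)"
    using assms by (intro continuous_intros C1_grad_continuous) (auto simp: C1_grad_def)
qed

lemma C1_grad_compose:
  assumes "C1_grad u G" "\<And>t. (h has_real_derivative h' t) (at t)" "continuous_on UNIV h'"
  shows "C1_grad (\<lambda>x. h (u x)) (\<lambda>x. h' (u x) *\<^sub>R G x)"
  unfolding C1_grad_def
proof (intro conjI allI)
  fix x
  have "((\<lambda>x. h (u x)) has_derivative (\<lambda>v. h' (u x) * (v \<bullet> G x))) (at x)"
  proof -
    have 1: "(u has_derivative (\<lambda>v. v \<bullet> G x)) (at x)" using assms(1) by (simp add: C1_grad_def)
    have 2: "(h has_derivative (\<lambda>v. h' (u x) * v)) (at (u x))"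
      using assms(2) unfolding has_field_derivative_def .
    show ?thesis by (rule has_derivative_compose[OF 1 2])
  qed
  then show "((\<lambda>x. h (u x)) has_derivative (\<lambda>v. v \<bullet> h' (u x) *\<^sub>R G x)) (at x)"
    by simp
  show "continuous_on UNIV (\<lambda>x. h' (u x) *\<^sub>R G x)"
    using assms(1) continuous_on_compose2[OF assms(3) C1_grad_continuous[OF assms(1)]]
    by (intro continuous_on_scaleR) (auto simp: C1_grad_def)
qed

lemma C1_grad_inner: "C1_grad (\<lambda>x. x \<bullet> a - c) (\<lambda>x. a)"
  unfolding C1_grad_def by (intro conjI allI) (rule derivative_eq_intros refl continuous_intros | simp)+

lemma C1_grad_support:
  assumes "C1_grad u G" "closed K" "\<And>x. x \<notin> K \<Longrightarrow> u x = 0" "x \<notin> K"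
  shows "G x = 0"
proof -
  have "(u has_derivative (\<lambda>h. h \<bullet> 0)) (at x)"
    by (rule has_derivative_transform_within_open[of "\<lambda>_. 0" _ _ _ "-K"]) (use assms in auto)
  then have "grad u x = 0" by (rule grad_eqI)
  then show ?thesis using C1_grad_imp_grad[OF assms(1)] by simp
qed

section \<open>Test functions\<close>

lemma test_functionsI:
  assumes "\<And>k. Ck k \<phi>" "compact K" "K \<subseteq> \<Omega>" "\<And>x. x \<notin> K \<Longrightarrow> \<phi> x = 0"
  shows "\<phi> \<in> test_functions \<Omega>"
proof -
  have "closure {x. \<phi> x \<noteq> 0} \<subseteq> K"
    using assms by (intro closure_minimal compact_imp_closed) auto
  moreover from this have "compact (closure {x. \<phi> x \<noteq> 0})"
    using assms(2) by (metis closed_closure compact_Int_closed inf.absorb_iff2)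
  ultimately show ?thesis using assms unfolding test_functions_def by blast
qed

lemma test_functionsE:
  assumes "\<phi> \<in> test_functions \<Omega>"
  obtains K where "compact K" "K \<subseteq> \<Omega>" "\<And>x. x \<notin> K \<Longrightarrow> \<phi> x = 0" "\<And>x. x \<notin> K \<Longrightarrow> grad \<phi> x = 0"
    "C1_grad \<phi> (grad \<phi>)"
proof -
  let ?K = "closure {x. \<phi> x \<noteq> 0}"
  have C: "C1_grad \<phi> (grad \<phi>)" and K: "compact ?K" "?K \<subseteq> \<Omega>"
    using assms Ck_imp_C1_grad[of 0] unfolding test_functions_def by blast+
  have z: "\<phi> x = 0" if "x \<notin> ?K" for x using that closure_subset by force
  have "grad \<phi> x = 0" if "x \<notin> ?K" for x
    by (rule C1_grad_support[OF C compact_imp_closed[OF K(1)] z that])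
  then show ?thesis using that[OF K z _ C] by blast
qed

lemma test_functions_lin:
  assumes "\<phi> \<in> test_functions \<Omega>" "\<psi> \<in> test_functions \<Omega>"
  shows "(\<lambda>x. a * \<phi> x + b * \<psi> x) \<in> test_functions \<Omega>"
proof -
  obtain K where K: "compact K" "K \<subseteq> \<Omega>" "\<And>x. x \<notin> K \<Longrightarrow> \<phi> x = 0" using test_functionsE[OF assms(1)] by metis
  obtain L where L: "compact L" "L \<subseteq> \<Omega>" "\<And>x. x \<notin> L \<Longrightarrow> \<psi> x = 0" using test_functionsE[OF assms(2)] by metis
  show ?thesis
    by (rule test_functionsI[of _ "K \<union> L"])
      (use K L assms in \<open>auto intro!: Ck_add Ck_mult Ck_const simp: test_functions_def\<close>)
qed

lemma bump_test_function: "r > 0 \<Longrightarrow> cball a r \<subseteq> \<Omega> \<Longrightarrow> bump a r \<in> test_functions \<Omega>"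
  by (rule test_functionsI[of _ "cball a r"]) (auto intro: Ck_bump bump_eq_0)

section \<open>Integration by parts and orthonormal frames of the plane\<close>

lemma borel_measurable_lebesgue_on_borel:
  "f \<in> borel_measurable borel \<Longrightarrow> f \<in> borel_measurable (lebesgue_on S)"
  by (intro measurable_restrict_space1 measurable_completion) simp

lemma lebesgue_on_measurable_continuous:
  fixes f :: "'a::euclidean_space \<Rightarrow> 'b::topological_space"
  shows "continuous_on UNIV f \<Longrightarrow> f \<in> borel_measurable (lebesgue_on S)"
  by (intro borel_measurable_lebesgue_on_borel borel_measurable_continuous_onI)

lemma integrable_bounded_lmeasurable:
  fixes f :: "'a::euclidean_space \<Rightarrow> 'b::euclidean_space"
  assumes "S \<in> lmeasurable" "f \<in> borel_measurable (lebesgue_on S)" "\<And>x. x \<in> S \<Longrightarrow> norm (f x) \<le> B"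
  shows "integrable (lebesgue_on S) f"
proof -
  interpret finite_measure "lebesgue_on S" using assms(1) by (rule finite_measure_lebesgue_on)
  show ?thesis using assms(2,3) by (intro integrable_const_bound[of _ B]) auto
qed

lemma bounded_continuous_image:
  fixes f :: "'a::euclidean_space \<Rightarrow> 'b::euclidean_space"
  assumes "bounded S" "continuous_on UNIV f"
  obtains B where "B > 0" "\<And>x. x \<in> S \<Longrightarrow> norm (f x) \<le> B"
proof -
  have "compact (f ` closure S)"
    using assms by (intro compact_continuous_image continuous_on_subset[OF assms(2)]) (auto simp: compact_closure)
  then obtain B where "B > 0" "\<forall>y\<in>f ` closure S. norm y \<le> B"
    using bounded_pos compact_imp_bounded by metis
  then show ?thesis using that closure_subset by (metis image_eqI subsetD)
qed

lemma integrable_continuous_bounded: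
  fixes f :: "'a::euclidean_space \<Rightarrow> 'b::euclidean_space"
  assumes "bounded S" "S \<in> sets lebesgue" "continuous_on UNIV f"
  shows "integrable (lebesgue_on S) f"
proof -
  obtain B where "\<And>x. x \<in> S \<Longrightarrow> norm (f x) \<le> B" using bounded_continuous_image assms(1,3) by metis
  moreover have "S \<in> lmeasurable" using assms by (simp add: bounded_set_imp_lmeasurable)
  ultimately show ?thesis using assms lebesgue_on_measurable_continuous by (intro integrable_bounded_lmeasurable)
qed

lemma integral_lebesgue_on_support:
  fixes f :: "'a::euclidean_space \<Rightarrow> 'b::euclidean_space"
  assumes "S \<in> sets lebesgue" "\<And>x. x \<notin> S \<Longrightarrow> f x = 0" "f \<in> borel_measurable borel"
  shows "integral\<^sup>L (lebesgue_on S) f = integral\<^sup>L lborel f"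
proof -
  have "integral\<^sup>L (lebesgue_on S) f = integral\<^sup>L lebesgue (\<lambda>x. if x \<in> S then f x else 0)"
    by (rule Lebesgue_Measure.integral_restrict_UNIV[OF assms(1), symmetric])
  also have "(\<lambda>x. if x \<in> S then f x else 0) = f" using assms(2) by auto
  also have "integral\<^sup>L lebesgue f = integral\<^sup>L lborel f"
    using assms(3) by (intro integral_completion) simp
  finally show ?thesis .
qed

lemma integral_lebesgue_on_borel:
  fixes f :: "'a::euclidean_space \<Rightarrow> real"
  assumes "S \<in> sets borel" "f \<in> borel_measurable borel"
  shows "integral\<^sup>L (lebesgue_on S) f = integral\<^sup>L lborel (\<lambda>x. indicator S x * f x)"
proof -
  have "integral\<^sup>L (lebesgue_on S) f = integral\<^sup>L lebesgue (\<lambda>x. indicator S x *\<^sub>R f x)"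
    using assms(1) by (intro integral_restrict_space) auto
  also have "\<dots> = integral\<^sup>L lborel (\<lambda>x. indicator S x *\<^sub>R f x)"
    using assms by (intro integral_completion) auto
  finally show ?thesis by simp
qed

lemma integrable_lebesgue_on_borel:
  fixes f :: "'a::euclidean_space \<Rightarrow> real"
  assumes "S \<in> sets borel" "f \<in> borel_measurable borel"
  shows "integrable (lebesgue_on S) f \<longleftrightarrow> integrable lborel (\<lambda>x. indicator S x * f x)"
proof -
  have "integrable (lebesgue_on S) f \<longleftrightarrow> integrable lebesgue (\<lambda>x. indicator S x *\<^sub>R f x)"
    using assms(1) by (intro integrable_restrict_space) auto
  also have "\<dots> \<longleftrightarrow> integrable lborel (\<lambda>x. indicator S x *\<^sub>R f x)"
    using assms by (intro integrable_completion) auto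
  finally show ?thesis by simp
qed

lemma integrable_compact_support:
  fixes f :: "'a::euclidean_space \<Rightarrow> real"
  assumes "continuous_on UNIV f" "compact K" "\<And>x. x \<notin> K \<Longrightarrow> f x = 0"
  shows "integrable lborel f"
proof -
  have "K \<in> sets borel" using assms(2) by (simp add: borel_compact)
  have "integrable (lebesgue_on K) f"
    using assms(1,2) by (intro integrable_continuous_bounded compact_imp_bounded) (auto intro: lmeasurable_compact fmeasurableD)
  then have "integrable lborel (\<lambda>x. indicator K x * f x)"
    using integrable_lebesgue_on_borel[OF \<open>K \<in> sets borel\<close>] assms(1) by (simp add: borel_measurable_continuous_onI)
  moreover have "(\<lambda>x. indicator K x * f x) = f" using assms(3) by (auto simp: indicator_def fun_eq_iff)
  ultimately show ?thesis by simp
qed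

lemma integral_lborel_translate:
  fixes f :: "'a::euclidean_space \<Rightarrow> real"
  assumes "f \<in> borel_measurable borel"
  shows "(LINT x|lborel. f (c + x)) = (LINT x|lborel. f x)"
proof -
  have "(LINT x|lborel. f x) = (LINT x|distr lborel borel ((+) c). f x)" by (simp add: lborel_distr_plus)
  also have "\<dots> = (LINT x|lborel. f (c + x))" using assms by (intro integral_distr) auto
  finally show ?thesis by simp
qed

lemma integrable_lborel_translate:
  fixes f :: "'a::euclidean_space \<Rightarrow> real"
  assumes "integrable lborel f"
  shows "integrable lborel (\<lambda>x. f (c + x))"
proof -
  have "integrable (distr lborel borel ((+) c)) f" using assms by (simp add: lborel_distr_plus)
  then show ?thesis by (rule integrable_distr[rotated]) auto
qed

section \<open>Integration by parts against compactly supported functions\<close>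

lemma C1_grad_lipschitz:
  assumes "C1_grad F DF" "convex S" "\<And>x. x \<in> S \<Longrightarrow> norm (DF x) \<le> B" "x \<in> S" "y \<in> S"
  shows "\<bar>F x - F y\<bar> \<le> B * norm (x - y)"
proof -
  have "norm (F x - F y) \<le> B * norm (x - y)"
  proof (rule differentiable_bound[OF assms(2) _ _ assms(4,5), where f'="\<lambda>x h. h \<bullet> DF x"])
    fix z assume z: "z \<in> S"
    show "(F has_derivative (\<lambda>h. h \<bullet> DF z)) (at z within S)"
      using assms(1) has_derivative_at_withinI unfolding C1_grad_def by blast
    show "onorm (\<lambda>h. h \<bullet> DF z) \<le> B"
    proof (rule onorm_le)
      fix h
      have "norm (h \<bullet> DF z) \<le> norm h * norm (DF z)" by (simp add: Cauchy_Schwarz_ineq2)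
      also have "\<dots> \<le> norm h * B" using assms(3)[OF z] by (intro mult_left_mono) auto
      finally show "norm (h \<bullet> DF z) \<le> B * norm h" by (simp add: mult.commute)
    qed
  qed
  then show ?thesis by simp
qed

text \<open>Translation invariance makes every difference quotient of \<open>F\<close> integrate to
  0, and dominated convergence carries this over to the derivative.\<close>

lemma integral_grad_zero:
  assumes "C1_grad F DF" "compact K" "\<And>x. x \<notin> K \<Longrightarrow> F x = 0"
  shows "(LINT x|lborel. v \<bullet> DF x) = 0"
proof -
  \<comment> \<open>Steps of length at most \<open>norm v\<close> that meet \<open>K\<close> start
    in \<open>K'\<close>; so one compact set carries all difference quotients below.\<close>
  define K' where "K' = {x + y | x y. x \<in> K \<and> y \<in> cball 0 (norm v)}"
  have K': "compact K'" unfolding K'_def using assms(2) compact_cball by (rule compact_sums)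
  have DF0: "DF x = 0" if "x \<notin> K" for x
    using C1_grad_support[OF assms(1) compact_imp_closed[OF assms(2)] assms(3) that] .
  have cF: "continuous_on UNIV F" and cDF: "continuous_on UNIV DF"
    using assms(1) C1_grad_continuous by (auto simp: C1_grad_def)
  obtain B where B: "B > 0" "\<And>x. x \<in> K \<Longrightarrow> norm (DF x) \<le> B"
    using bounded_continuous_image[OF compact_imp_bounded[OF assms(2)] cDF] by metis
  then have B': "norm (DF x) \<le> B" for x using DF0 by (cases "x \<in> K") auto
  have iF: "integrable lborel F" by (rule integrable_compact_support[OF cF assms(2,3)])
  define q where "q n x = real (Suc n) * (F ((1 / real (Suc n)) *\<^sub>R v + x) - F x)" for n x
  have q0: "(LINT x|lborel. q n x) = 0" for n
  proof -
    have "(LINT x|lborel. q n x) = real (Suc n) * ((LINT x|lborel. F ((1 / real (Suc n)) *\<^sub>R v + x)) - (LINT x|lborel. F x))"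
      unfolding q_def using iF integrable_lborel_translate[OF iF] by simp
    also have "\<dots> = 0" by (subst integral_lborel_translate) (use cF in \<open>auto simp: borel_measurable_continuous_onI\<close>)
    finally show ?thesis .
  qed
  have qb: "norm (q n x) \<le> indicator K' x *\<^sub>R (B * norm v)" for n x
  proof (cases "x \<in> K'")
    case True
    have "\<bar>F ((1 / real (Suc n)) *\<^sub>R v + x) - F x\<bar> \<le> B * norm ((1 / real (Suc n)) *\<^sub>R v + x - x)"
      using C1_grad_lipschitz[OF assms(1) convex_UNIV B'] by blast
    also have "\<dots> = B * norm v / real (Suc n)" by simp
    finally have "real (Suc n) * \<bar>F ((1 / real (Suc n)) *\<^sub>R v + x) - F x\<bar> \<le> B * norm v"
      by (simp add: field_simps)
    then show ?thesis using True by (simp add: q_def abs_mult)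
  next
    case False
    have "x \<notin> K" using False unfolding K'_def by (force intro: exI[of _ x] exI[of _ 0])
    moreover have "(1 / real (Suc n)) *\<^sub>R v + x \<notin> K"
    proof
      assume *: "(1 / real (Suc n)) *\<^sub>R v + x \<in> K"
      have "norm (- ((1 / real (Suc n)) *\<^sub>R v)) \<le> norm v"
        by (simp add: field_simps mult_left_le)
      then have "x \<in> K'" unfolding K'_def using * 
        by (intro CollectI exI[of _ "(1 / real (Suc n)) *\<^sub>R v + x"] exI[of _ "- ((1 / real (Suc n)) *\<^sub>R v)"]) auto
      then show False using False by simp
    qed
    ultimately show ?thesis using False assms(3) by (simp add: q_def)
  qed
  have lim: "(\<lambda>n. q n x) \<longlonglongrightarrow> v \<bullet> DF x" for x
  proof -
    have "((\<lambda>t. F (x + t *\<^sub>R v)) has_real_derivative v \<bullet> DF x) (at 0)"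
    proof -
      have a: "((\<lambda>t. x + t *\<^sub>R v) has_derivative (\<lambda>t. t *\<^sub>R v)) (at 0)" by (auto intro!: derivative_eq_intros)
      have b: "(F has_derivative (\<lambda>h. h \<bullet> DF x)) (at (x + 0 *\<^sub>R v))" using assms(1) by (simp add: C1_grad_def)
      show ?thesis using has_derivative_compose[OF a b]
        by (simp add: has_field_derivative_def mult_commute_abs)
    qed
    then have "((\<lambda>t. (F (x + t *\<^sub>R v) - F x) / t) \<longlongrightarrow> v \<bullet> DF x) (at 0)"
      by (simp add: has_field_derivative_iff)
    moreover have "filterlim (\<lambda>n. 1 / real (Suc n)) (at 0) sequentially"
      using LIMSEQ_inverse_real_of_nat by (auto simp: filterlim_at inverse_eq_divide)
    ultimately have "(\<lambda>n. (F (x + (1 / real (Suc n)) *\<^sub>R v) - F x) / (1 / real (Suc n))) \<longlonglongrightarrow> v \<bullet> DF x"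
      by (rule filterlim_compose)
    then show ?thesis by (simp add: q_def[abs_def] field_simps add.commute)
  qed
  have "(\<lambda>n. LINT x|lborel. q n x) \<longlonglongrightarrow> (LINT x|lborel. v \<bullet> DF x)"
  proof (rule integral_dominated_convergence[where w="\<lambda>x. indicator K' x *\<^sub>R (B * norm v)"])
    show "(\<lambda>x. v \<bullet> DF x) \<in> borel_measurable lborel" 
      using cDF by (simp add: borel_measurable_continuous_onI continuous_on_inner)
    show "q n \<in> borel_measurable lborel" for n
    proof -
      have "continuous_on UNIV (q n)" unfolding q_def
        by (intro continuous_intros continuous_on_compose2[OF cF]) auto
      then show ?thesis by (simp add: borel_measurable_continuous_onI)
    qed
    show "integrable lborel (\<lambda>x. indicator K' x *\<^sub>R (B * norm v))"
      using K' emeasure_bounded_finite[OF compact_imp_bounded[OF K']]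
      by (intro integrable_scaleR_left integrable_real_indicator) (auto simp: borel_compact)
  qed (use lim qb in auto)
  then show ?thesis using q0 by (simp add: LIMSEQ_const_iff)
qed

text \<open>The gradient of the product of \<open>u\<close> and \<open>\<phi>\<close> integrates to
  0 in every direction \<open>v\<close>; a vector orthogonal to all \<open>v\<close> is 0.\<close>

lemma C1_grad_integration_by_parts:
  fixes \<Omega> :: "'a::euclidean_space set"
  assumes u: "C1_grad u G" and \<Omega>: "\<Omega> \<in> sets lebesgue" and \<phi>: "\<phi> \<in> test_functions \<Omega>"
  shows "(LINT x|lebesgue_on \<Omega>. u x *\<^sub>R grad \<phi> x) = - (LINT x|lebesgue_on \<Omega>. \<phi> x *\<^sub>R G x)"
proof -
  obtain K where K: "compact K" "K \<subseteq> \<Omega>" "\<And>x. x \<notin> K \<Longrightarrow> \<phi> x = 0" "\<And>x. x \<notin> K \<Longrightarrow> grad \<phi> x = 0"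
    and C: "C1_grad \<phi> (grad \<phi>)" using test_functionsE[OF \<phi>] by metis
  have c: "continuous_on UNIV u" "continuous_on UNIV G" "continuous_on UNIV \<phi>" "continuous_on UNIV (grad \<phi>)"
    using u C C1_grad_continuous by (auto simp: C1_grad_def)
  have cont1: "continuous_on UNIV (\<lambda>x. u x *\<^sub>R grad \<phi> x)" and cont2: "continuous_on UNIV (\<lambda>x. \<phi> x *\<^sub>R G x)"
    using c by (auto intro!: continuous_intros)
  have b: "f \<in> borel_measurable borel" if "continuous_on UNIV f" for f :: "'a \<Rightarrow> 'a"
    using that by (rule borel_measurable_continuous_onI)
  have eq: "(LINT x|lebesgue_on \<Omega>. u x *\<^sub>R grad \<phi> x) = (LINT x|lborel. u x *\<^sub>R grad \<phi> x)"
    "(LINT x|lebesgue_on \<Omega>. \<phi> x *\<^sub>R G x) = (LINT x|lborel. \<phi> x *\<^sub>R G x)"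
    by (rule integral_lebesgue_on_support[OF \<Omega> _ b[OF cont1]], use K in force)
       (rule integral_lebesgue_on_support[OF \<Omega> _ b[OF cont2]], use K in force)
  have int: "integrable lborel f" if "continuous_on UNIV f" "\<And>x. x \<notin> K \<Longrightarrow> f x = 0" for f :: "'a \<Rightarrow> 'a"
  proof -
    have "integrable lborel (\<lambda>x. norm (f x))"
      using that by (intro integrable_compact_support[OF _ K(1)] continuous_on_norm) auto
    then show ?thesis using b[OF that(1)] by (subst (asm) integrable_norm_iff) auto
  qed
  have i1: "integrable lborel (\<lambda>x. u x *\<^sub>R grad \<phi> x)" and i2: "integrable lborel (\<lambda>x. \<phi> x *\<^sub>R G x)"
    using K by (auto intro!: int cont1 cont2)
  have "((LINT x|lborel. u x *\<^sub>R grad \<phi> x) + (LINT x|lborel. \<phi> x *\<^sub>R G x)) \<bullet> v = 0" for v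
  proof -
    have "(LINT x|lborel. v \<bullet> (u x *\<^sub>R grad \<phi> x + \<phi> x *\<^sub>R G x)) = 0"
      using K by (intro integral_grad_zero[OF C1_grad_mult[OF u C] K(1)]) auto
    moreover have "(LINT x|lborel. v \<bullet> (u x *\<^sub>R grad \<phi> x + \<phi> x *\<^sub>R G x)) = v \<bullet> (LINT x|lborel. u x *\<^sub>R grad \<phi> x + \<phi> x *\<^sub>R G x)"
      using i1 i2 by (intro integral_inner_right) auto
    ultimately show ?thesis using i1 i2 by (simp add: inner_commute)
  qed
  then have "(LINT x|lborel. u x *\<^sub>R grad \<phi> x) + (LINT x|lborel. \<phi> x *\<^sub>R G x) = 0"
    using inner_eq_zero_iff by blast
  then show ?thesis unfolding eq by (simp add: add_eq_0_iff2)
qed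

lemma square_integrable_continuous:
  fixes f :: "'a::euclidean_space \<Rightarrow> 'b::euclidean_space"
  assumes "bounded S" "S \<in> sets lebesgue" "continuous_on UNIV f"
  shows "f square_integrable_on S"
  unfolding square_integrable_on_def using assms
  by (auto intro!: lebesgue_on_measurable_continuous integrable_continuous_bounded continuous_intros)

text \<open>Lets classical functions serve as Neumann trial functions; no boundary condition is
  involved.\<close>

lemma C1_grad_H1:
  assumes "C1_grad u G" "bounded \<Omega>" "\<Omega> \<in> sets lebesgue"
  shows "H1_with_grad \<Omega> u G"
  unfolding H1_with_grad_def
  using assms C1_grad_continuous[OF assms(1)]
  by (auto intro!: square_integrable_continuous C1_grad_integration_by_parts simp: C1_grad_def)

section \<open>Orthonormal frames and iterated integrals\<close>

definition rot2 :: "real^2 \<Rightarrow> real^2" where "rot2 v = vector [- v $ 2, v $ 1]"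

lemma rot2_nth [simp]: "rot2 v $ 1 = - v $ 2" "rot2 v $ 2 = v $ 1"
  by (simp_all add: rot2_def)

lemma inner_real2: "(x :: real^2) \<bullet> y = x $ 1 * y $ 1 + x $ 2 * y $ 2"
  by (simp add: inner_vec_def sum_2)

lemma rot2_orthogonal [simp]: "v \<bullet> rot2 v = 0" "rot2 v \<bullet> v = 0"
  by (simp_all add: inner_real2)

lemma norm_rot2 [simp]: "norm (rot2 v) = norm v"
  by (simp add: norm_eq_sqrt_inner inner_real2)

text \<open>Coordinates \<open>(s, t)\<close> with respect to \<open>v\<close> and
  \<open>rot2 v\<close>. They turn slicing in an arbitrary direction into an iterated integral over
  pairs of reals.\<close>

definition frame2 :: "real^2 \<Rightarrow> real \<times> real \<Rightarrow> real^2" where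
  "frame2 v p = fst p *\<^sub>R v + snd p *\<^sub>R rot2 v"

lemma frame2_inner:
  assumes "norm v = 1"
  shows "frame2 v (s, t) \<bullet> v = s" "frame2 v (s, t) \<bullet> rot2 v = t"
proof -
  have "v \<bullet> v = 1" "rot2 v \<bullet> rot2 v = 1" using assms by (simp_all add: dot_square_norm)
  then show "frame2 v (s, t) \<bullet> v = s" "frame2 v (s, t) \<bullet> rot2 v = t"
    by (simp_all add: frame2_def inner_add_left)
qed

lemma frame2_decompose:
  assumes "norm v = 1"
  shows "frame2 v (x \<bullet> v, x \<bullet> rot2 v) = x"
proof -
  have *: "v $ 1 * v $ 1 + v $ 2 * v $ 2 = 1"
    using assms by (simp add: norm_eq_1 inner_real2)
  have "(x $ 1 * v $ 1 + x $ 2 * v $ 2) * v $ 1 - (- x $ 1 * v $ 2 + x $ 2 * v $ 1) * v $ 2 = x $ 1 * (v $ 1 * v $ 1 + v $ 2 * v $ 2)"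
    "(x $ 1 * v $ 1 + x $ 2 * v $ 2) * v $ 2 + (- x $ 1 * v $ 2 + x $ 2 * v $ 1) * v $ 1 = x $ 2 * (v $ 1 * v $ 1 + v $ 2 * v $ 2)"
    by algebra+
  then show ?thesis using *
    by (simp add: vec_eq_iff forall_2 frame2_def inner_real2)
qed

lemma frame2_measurable [measurable]: "frame2 v \<in> borel_measurable borel"
  unfolding frame2_def by (intro borel_measurable_continuous_onI continuous_intros)

text \<open>In the standard frame the map merely identifies pairs with vectors. Boxes correspond to
  boxes of the same volume, and boxes determine the measure.\<close>

lemma frame2_distr_axis:
  "distr (lborel :: (real \<times> real) measure) borel (frame2 (axis 1 1)) = lborel"
proof (rule lborel_eqI[symmetric])
  fix l u :: "real^2" assume lu: "\<And>b. b \<in> Basis \<Longrightarrow> l \<bullet> b \<le> u \<bullet> b"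
  have le: "l $ 1 \<le> u $ 1" "l $ 2 \<le> u $ 2"
    using lu[of "axis 1 1"] lu[of "axis 2 1"] by (auto simp: inner_axis axis_in_Basis_iff)
  have co: "frame2 (axis 1 1) p $ 1 = fst p" "frame2 (axis 1 1) p $ 2 = snd p" for p
    by (simp_all add: frame2_def axis_def)
  have "box (l $ 1, l $ 2) (u $ 1, u $ 2) = box (l $ 1) (u $ 1) \<times> box (l $ 2) (u $ 2)"
    by (auto simp: box_def Basis_prod_def inner_Pair ball_Un)
  then have "frame2 (axis 1 1) -` box l u = box (l $ 1, l $ 2) (u $ 1, u $ 2)"
    by (auto simp: mem_box_cart forall_2 co)
  then have "emeasure (distr lborel borel (frame2 (axis 1 1))) (box l u) = emeasure lborel (box (l $ 1, l $ 2) (u $ 1, u $ 2))"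
    by (subst emeasure_distr) auto
  also have "\<dots> = ennreal ((u $ 1 - l $ 1) * (u $ 2 - l $ 2))"
    using le by (subst emeasure_lborel_box) (auto simp: Basis_prod_def prod.union_disjoint inner_Pair prod.reindex inj_on_def)
  also have "(u $ 1 - l $ 1) * (u $ 2 - l $ 2) = (\<Prod>b\<in>Basis. (u - l) \<bullet> b)"
  proof -
    have "(Basis :: (real^2) set) = {axis 1 1, axis 2 1}"
      by (auto simp: Basis_vec_def exhaust_2) (metis exhaust_2)
    then have "(\<Prod>b\<in>Basis. (u - l) \<bullet> b) = (\<Prod>b\<in>{axis 1 1, axis 2 1}. (u - l) \<bullet> b)" by (rule arg_cong)
    also have "\<dots> = (u $ 1 - l $ 1) * (u $ 2 - l $ 2)"
      by (simp add: inner_axis axis_eq_axis)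
    finally show ?thesis by simp
  qed
  finally show "emeasure (distr lborel borel (frame2 (axis 1 1))) (box l u) = ennreal (\<Prod>b\<in>Basis. (u - l) \<bullet> b)" .
qed simp

text \<open>A general frame is the standard one followed by an orthogonal map \<open>R\<close>, and
  orthogonal maps preserve the measure of boxes.\<close>

lemma frame2_distr:
  assumes v: "norm v = 1"
  shows "distr (lborel :: (real \<times> real) measure) borel (frame2 v) = lborel"
proof -
  define R where "R x = (x $ 1) *\<^sub>R v + (x $ 2) *\<^sub>R rot2 v" for x :: "real^2"
  have vv: "v $ 1 * v $ 1 + v $ 2 * v $ 2 = 1" using v by (simp add: norm_eq_1 inner_real2)
  have R: "orthogonal_transformation R"
    unfolding orthogonal_transformation_def
  proof (intro conjI allI)
    show "linear R" unfolding R_def by (intro linearI) (auto simp: algebra_simps)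
    fix x y :: "real^2"
    have "R x \<bullet> R y = (v $ 1 * v $ 1 + v $ 2 * v $ 2) * (x $ 1 * y $ 1 + x $ 2 * y $ 2)"
      unfolding inner_real2 R_def by (simp add: algebra_simps)
    then show "R x \<bullet> R y = x \<bullet> y" using vv by (simp add: inner_real2)
  qed
  have Rm [measurable]: "R \<in> borel_measurable borel"
    unfolding R_def by (intro borel_measurable_continuous_onI continuous_intros)
  obtain R' where R': "orthogonal_transformation R'" "\<And>x. R' (R x) = x" "\<And>x. R (R' x) = x"
    using R by (metis orthogonal_transformation_bij orthogonal_transformation_inv bij_inv_eq_iff)
  have "distr lborel borel R = lborel"
  proof (rule lborel_eqI[symmetric])
    fix l u :: "real^2" assume lu: "\<And>b. b \<in> Basis \<Longrightarrow> l \<bullet> b \<le> u \<bullet> b"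
    have "R -` box l u = R' ` box l u"
    proof (intro set_eqI iffI)
      fix x assume "x \<in> R -` box l u"
      then show "x \<in> R' ` box l u" using R'(2)[of x] by (intro image_eqI[of _ _ "R x"]) auto
    qed (auto simp: R'(3))
    moreover have "R -` box l u \<in> sets borel" using measurable_sets[OF Rm, of "box l u"] by simp
    ultimately have "emeasure (distr lborel borel R) (box l u) = emeasure lebesgue (R' ` box l u)"
      by (simp add: emeasure_distr)
    also have "\<dots> = ennreal (measure lebesgue (R' ` box l u))"
      by (intro emeasure_eq_measure2 measurable_orthogonal_image R'(1) lmeasurable_box)
    also have "\<dots> = ennreal (measure lebesgue (box l u))"
      using measure_orthogonal_image[OF R'(1)] by simp
    also have "\<dots> = ennreal (\<Prod>b\<in>Basis. (u - l) \<bullet> b)"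
      using lu by (simp add: measure_def emeasure_lborel_box_eq enn2real_ennreal prod_nonneg)
    finally show "emeasure (distr lborel borel R) (box l u) = ennreal (\<Prod>b\<in>Basis. (u - l) \<bullet> b)" .
  qed simp
  moreover have "frame2 v = R \<circ> frame2 (axis 1 1)"
    by (auto simp: fun_eq_iff R_def frame2_def axis_def)
  ultimately show ?thesis
    using distr_distr[of R borel borel "frame2 (axis 1 1)" lborel] frame2_distr_axis by simp
qed

lemma integrable_frame2:
  fixes f :: "real^2 \<Rightarrow> real"
  assumes "norm v = 1" "integrable lborel f"
  shows "integrable (lborel \<Otimes>\<^sub>M lborel) (\<lambda>p. f (frame2 v p))"
proof -
  have "integrable (distr (lborel :: (real \<times> real) measure) borel (frame2 v)) f"
    using assms(2) by (simp only: frame2_distr[OF assms(1)])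
  then have "integrable lborel (\<lambda>p. f (frame2 v p))"
    by (rule integrable_distr[rotated]) simp
  then show ?thesis by (simp add: lborel_prod)
qed

lemma integral_frame2:
  fixes f :: "real^2 \<Rightarrow> real"
  assumes v: "norm v = 1" and f: "integrable lborel f"
  shows "(LINT x|lborel. f x) = (LINT s|lborel. LINT t|lborel. f (frame2 v (s, t)))"
proof -
  have "(LINT x|lborel. f x) = (LINT x|distr (lborel :: (real \<times> real) measure) borel (frame2 v). f x)"
    by (simp only: frame2_distr[OF v])
  also have "\<dots> = (LINT p|lborel. f (frame2 v p))"
    using f by (intro integral_distr) auto
  also have "\<dots> = (LINT s|lborel. LINT t|lborel. f (frame2 v (s, t)))"
    using lborel_pair.integral_fst'[OF integrable_frame2[OF v f]] by (simp add: lborel_prod)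
  finally show ?thesis .
qed

section \<open>One-dimensional eigenvalue inequalities\<close>

text \<open>Jacobi's trick: compare \<open>w\<close> with \<open>sin (\<kappa> (x - a) + \<tau>)\<close>, which is positive on the whole interval.\<close>

lemma wirtinger_aux:
  fixes w w' :: "real \<Rightarrow> real"
  assumes ab: "a < b" and w: "\<And>x. x \<in> {a..b} \<Longrightarrow> (w has_real_derivative w' x) (at x within {a..b})"
    and cw': "continuous_on {a..b} w'" and w0: "w a = 0" "w b = 0"
    and \<kappa>: "0 < \<kappa>" "\<kappa> < pi / (b - a)"
  shows "\<kappa>\<^sup>2 * integral {a..b} (\<lambda>x. (w x)\<^sup>2) \<le> integral {a..b} (\<lambda>x. (w' x)\<^sup>2)"
proof -
  \<comment> \<open>Since \<open>\<kappa> (b - a) < \<pi>\<close> there is room to spare; split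
    evenly, it keeps the angle \<open>\<theta>\<close> within [\<open>\<tau>\<close>, \<pi> -
    \<open>\<tau>\<close>].\<close>
  define \<tau> where "\<tau> = (pi - \<kappa> * (b - a)) / 2"
  define \<theta> where "\<theta> x = \<kappa> * (x - a) + \<tau>" for x
  \<comment> \<open>Logarithmic derivative of the comparison sine; it solves the Riccati equation
    \<open>q' = -(\<kappa>^2 + q^2)\<close>.\<close>
  define q where "q x = \<kappa> * cos (\<theta> x) / sin (\<theta> x)" for x
  have \<tau>: "\<tau> > 0" using \<kappa> ab by (simp add: \<tau>_def field_simps)
  have sin_pos: "sin (\<theta> x) > 0" if "x \<in> {a..b}" for x
  proof (rule sin_gt_zero)
    show "0 < \<theta> x" using that \<kappa> \<tau> by (auto simp: \<theta>_def intro!: add_nonneg_pos)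
    have "\<theta> x \<le> \<kappa> * (b - a) + \<tau>" using that \<kappa> by (auto simp: \<theta>_def)
    also have "\<dots> = pi - \<tau>" by (simp add: \<tau>_def field_simps)
    finally show "\<theta> x < pi" using \<tau> by simp
  qed
  have cw: "continuous_on {a..b} w" using w by (intro DERIV_continuous_on) auto
  have q': "(q has_real_derivative - (\<kappa>\<^sup>2 + (q x)\<^sup>2)) (at x within {a..b})" if "x \<in> {a..b}" for x
  proof -
    have s: "sin (\<theta> x) \<noteq> 0" using sin_pos[OF that] by simp
    have e: "\<kappa> * (- (sin (\<theta> x) * \<kappa>)) * sin (\<theta> x) - \<kappa> * cos (\<theta> x) * (cos (\<theta> x) * \<kappa>)
        = - (\<kappa>\<^sup>2 + (q x)\<^sup>2) * (sin (\<theta> x) * sin (\<theta> x))"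
      using s by (simp add: q_def field_simps power2_eq_square)
    have "((\<lambda>x. \<kappa> * cos (\<theta> x)) has_real_derivative \<kappa> * (- (sin (\<theta> x) * \<kappa>))) (at x within {a..b})"
      "((\<lambda>x. sin (\<theta> x)) has_real_derivative cos (\<theta> x) * \<kappa>) (at x within {a..b})"
      unfolding \<theta>_def by (auto intro!: derivative_eq_intros)
    from DERIV_divide[OF this s] show ?thesis unfolding q_def[symmetric] e using s by simp
  qed
  \<comment> \<open>The derivative of \<open>w^2 q\<close>; its integral is 0 because
    \<open>w\<close> vanishes at both ends. Subtracting it from the integrand completes the square
    \<open>(w' - q w)^2\<close>.\<close>
  let ?F' = "\<lambda>x. 2 * w x * w' x * q x - (w x)\<^sup>2 * (\<kappa>\<^sup>2 + (q x)\<^sup>2)"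
  have "((\<lambda>x. (w x)\<^sup>2 * q x) has_real_derivative ?F' x) (at x within {a..b})" if "x \<in> {a..b}" for x
    by (rule derivative_eq_intros w[OF that] q'[OF that] refl)+ (simp add: algebra_simps)
  then have F: "(?F' has_integral ((w b)\<^sup>2 * q b - (w a)\<^sup>2 * q a)) {a..b}"
    using ab by (intro fundamental_theorem_of_calculus) (auto simp: has_real_derivative_iff_has_vector_derivative)
  have int: "(\<lambda>x. (w x)\<^sup>2) integrable_on {a..b}" "(\<lambda>x. (w' x)\<^sup>2) integrable_on {a..b}"
    using cw cw' by (auto intro!: integrable_continuous_interval continuous_intros)
  have "((\<lambda>x. (w' x)\<^sup>2 - \<kappa>\<^sup>2 * (w x)\<^sup>2 - ?F' x) has_integral
      (integral {a..b} (\<lambda>x. (w' x)\<^sup>2) - \<kappa>\<^sup>2 * integral {a..b} (\<lambda>x. (w x)\<^sup>2) - 0)) {a..b}"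
    using F w0 by (intro has_integral_diff has_integral_mult_right integrable_integral int) auto
  moreover have "(w' x)\<^sup>2 - \<kappa>\<^sup>2 * (w x)\<^sup>2 - ?F' x = (w' x - q x * w x)\<^sup>2" for x
    by (simp add: power2_eq_square algebra_simps)
  ultimately have "((\<lambda>x. (w' x - q x * w x)\<^sup>2) has_integral
      (integral {a..b} (\<lambda>x. (w' x)\<^sup>2) - \<kappa>\<^sup>2 * integral {a..b} (\<lambda>x. (w x)\<^sup>2))) {a..b}" by simp
  then have "0 \<le> integral {a..b} (\<lambda>x. (w' x)\<^sup>2) - \<kappa>\<^sup>2 * integral {a..b} (\<lambda>x. (w x)\<^sup>2)"
    by (rule has_integral_nonneg) simp
  then show ?thesis by simp
qed

text \<open>Supplies the endpoint value of \<open>\<kappa>\<close>, at which the comparison sine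
  would vanish at both ends.\<close>

lemma square_limit_le:
  fixes K I J :: real
  assumes "K > 0" "\<And>\<kappa>. 0 < \<kappa> \<Longrightarrow> \<kappa> < K \<Longrightarrow> \<kappa>\<^sup>2 * I \<le> J"
  shows "K\<^sup>2 * I \<le> J"
proof (rule tendsto_upperbound)
  show "((\<lambda>\<kappa>. \<kappa>\<^sup>2 * I) \<longlongrightarrow> K\<^sup>2 * I) (at_left K)" by (intro tendsto_intros)
  show "\<forall>\<^sub>F \<kappa> in at_left K. \<kappa>\<^sup>2 * I \<le> J"
    using eventually_at_left_real[OF assms(1)] by eventually_elim (use assms(2) in auto)
qed simp

lemma wirtinger:
  fixes w w' :: "real \<Rightarrow> real"
  assumes "a < b" "\<And>x. x \<in> {a..b} \<Longrightarrow> (w has_real_derivative w' x) (at x within {a..b})"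
    and "continuous_on {a..b} w'" "w a = 0" "w b = 0"
  shows "(pi / (b - a))\<^sup>2 * integral {a..b} (\<lambda>x. (w x)\<^sup>2) \<le> integral {a..b} (\<lambda>x. (w' x)\<^sup>2)"
  by (rule square_limit_le) (use assms in \<open>auto intro: wirtinger_aux\<close>)

section \<open>The Payne-Weinberger inequality on an interval with a concave weight\<close>

lemma monotone_weight_integral_nonneg:
  fixes q h :: "real \<Rightarrow> real"
  assumes ab: "a < b" and q: "\<And>x y. a \<le> x \<Longrightarrow> x \<le> y \<Longrightarrow> y \<le> b \<Longrightarrow> q y \<le> q x"
    and h: "\<And>x. x \<in> {a..b} \<Longrightarrow> (h has_real_derivative h' x) (at x within {a..b})"
    and h0: "h a = 0" "h b = 0" "\<And>x. x \<in> {a..b} \<Longrightarrow> h x \<ge> 0"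
  shows "integral {a..b} (\<lambda>x. q x * h' x) \<ge> 0"
proof -
  have FTC: "(h' has_integral (h d - h c)) {c..d}" if "a \<le> c" "c \<le> d" "d \<le> b" for c d
  proof (rule fundamental_theorem_of_calculus[OF that(2)])
    fix x assume "x \<in> {c..d}"
    then have "(h has_real_derivative h' x) (at x within {c..d})"
      using that by (intro DERIV_subset[OF h]) auto
    then show "(h has_vector_derivative h' x) (at x within {c..d})"
      by (simp add: has_real_derivative_iff_has_vector_derivative)
  qed
  have "h' integrable_on {a..b}" using FTC[of a b] ab by (auto simp: integrable_on_def)
  \<comment> \<open>The second mean value theorem replaces an integration by parts, for
    \<open>q\<close> is monotone but need not be differentiable.\<close>
  then obtain c where c: "c \<in> {a..b}"
    "integral {a..b} (\<lambda>x. - q x * h' x) = - q a * integral {a..c} h' + - q b * integral {c..b} h'"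
    using second_mean_value_theorem[of h' a b "\<lambda>x. - q x"] q ab by (metis less_imp_le neg_le_iff_le)
  have "integral {a..c} h' = h c" "integral {c..b} h' = - h c"
    using FTC[of a c] FTC[of c b] c h0 by (auto intro!: integral_unique)
  then have "integral {a..b} (\<lambda>x. q x * h' x) = (q a - q b) * h c"
    using c(2) by (simp add: algebra_simps)
  then show ?thesis using q[of a b] h0(3)[OF c(1)] ab by simp
qed

lemma integral_add3:
  fixes f g h :: "real \<Rightarrow> real"
  assumes "continuous_on {a..b} f" "continuous_on {a..b} g" "continuous_on {a..b} h"
  shows "integral {a..b} (\<lambda>x. f x + g x + h x) = integral {a..b} f + integral {a..b} g + integral {a..b} h"
  using assms by (simp add: integral_add integrable_add integrable_continuous_interval)

text \<open>With \<open>V = \<integral> U f\<close> and \<open>w = V / sqrt f\<close> the weighted inequality for \<open>U\<close> is dual to the unweighted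
  Dirichlet inequality for \<open>w\<close>; concavity of \<open>f\<close> enters through the monotonicity of \<open>f' / f\<close>.\<close>

lemma payne_weinberger_C1:
  fixes f f' U U' :: "real \<Rightarrow> real"
  assumes ab: "a < b"
    and f: "\<And>x. x \<in> {a..b} \<Longrightarrow> (f has_real_derivative f' x) (at x within {a..b})"
    and cf': "continuous_on {a..b} f'" and fpos: "\<And>x. x \<in> {a..b} \<Longrightarrow> f x > 0"
    and mono: "\<And>x y. a \<le> x \<Longrightarrow> x \<le> y \<Longrightarrow> y \<le> b \<Longrightarrow> f' y \<le> f' x"
    and U: "\<And>x. x \<in> {a..b} \<Longrightarrow> (U has_real_derivative U' x) (at x within {a..b})"
    and cU': "continuous_on {a..b} U'"
    and mean: "integral {a..b} (\<lambda>x. U x * f x) = 0"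
  shows "(pi / (b - a))\<^sup>2 * integral {a..b} (\<lambda>x. (U x)\<^sup>2 * f x) \<le> integral {a..b} (\<lambda>x. (U' x)\<^sup>2 * f x)"
proof -
  define k where "k = pi / (b - a)"
  define V where "V x = integral {a..x} (\<lambda>x. U x * f x)" for x
  define g where "g x = sqrt (f x)" for x
  define q where "q x = f' x / (2 * f x)" for x
  define w where "w x = V x / g x" for x
  have cf: "continuous_on {a..b} f" and cU: "continuous_on {a..b} U"
    by (rule DERIV_continuous_on[OF f], simp, rule DERIV_continuous_on[OF U], simp)
  have V: "(V has_real_derivative U x * f x) (at x within {a..b})" if "x \<in> {a..b}" for x
    unfolding V_def using cf cU that by (intro integral_has_real_derivative continuous_intros)
  have cV: "continuous_on {a..b} V" by (rule DERIV_continuous_on[OF V])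
  have V0: "V a = 0" "V b = 0" using mean by (auto simp: V_def)
  have g: "g x > 0" "g x * g x = f x" if "x \<in> {a..b}" for x using fpos[OF that] by (auto simp: g_def)
  have cg: "continuous_on {a..b} g" unfolding g_def using cf by (intro continuous_intros)
  have g': "(g has_real_derivative q x * g x) (at x within {a..b})" if "x \<in> {a..b}" for x
  proof -
    have "((\<lambda>x. sqrt (f x)) has_real_derivative inverse (sqrt (f x)) / 2 * f' x) (at x within {a..b})"
      using DERIV_chain2[OF DERIV_real_sqrt[OF fpos[OF that]] f[OF that]] .
    moreover have "inverse (sqrt (f x)) / 2 * f' x = q x * g x"
      using fpos[OF that] by (simp add: q_def g_def field_simps)
    ultimately show ?thesis by (simp add: g_def[abs_def])
  qed
  have cq: "continuous_on {a..b} q"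
    unfolding q_def using cf' cf fpos by (intro continuous_intros) force+
  \<comment> \<open>From \<open>V' = U g^2\<close> and \<open>g' = q g\<close>.\<close>
  let ?w' = "\<lambda>x. U x * g x - q x * w x"
  have w': "(w has_real_derivative ?w' x) (at x within {a..b})" if "x \<in> {a..b}" for x
  proof -
    have "g x \<noteq> 0" using g[OF that] by simp
    from DERIV_divide[OF V[OF that] g'[OF that] this]
    have "((\<lambda>x. V x / g x) has_real_derivative (U x * f x * g x - V x * (q x * g x)) / (g x * g x)) (at x within {a..b})" .
    moreover have "(U x * f x * g x - V x * (q x * g x)) / (g x * g x) = ?w' x"
    proof -
      have "(u * (c * c) * c - V x * (p * c)) / (c * c) = u * c - p * (V x / c)" if "c > 0" for u c p
        using that by (simp add: field_simps)
      from this[OF g(1)[OF that], of "U x" "q x"] show ?thesis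
        unfolding w_def g(2)[OF that] by simp
    qed
    ultimately show ?thesis by (simp add: w_def[abs_def])
  qed
  have cw: "continuous_on {a..b} w" by (rule DERIV_continuous_on[OF w'])
  have cw': "continuous_on {a..b} ?w'" using cU cg cq cw by (intro continuous_intros)
  \<comment> \<open>Concavity of log \<open>f\<close>. The claim
    \<open>f' y * f x \<le> f' x * f y\<close> is settled by the signs of \<open>f'\<close>, since
    \<open>f\<close> itself may rise and fall.\<close>
  have qmono: "q y \<le> q x" if "a \<le> x" "x \<le> y" "y \<le> b" for x y
  proof -
    have x: "x \<in> {a..b}" and y: "y \<in> {a..b}" using that by auto
    have m: "f' y \<le> f' x" using mono that by auto
    have mv: "\<exists>z. x \<le> z \<and> z \<le> y \<and> f y - f x = f' z * (y - x)"
    proof (cases "x = y")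
      case False
      have "(f has_derivative (\<lambda>v. f' z * v)) (at z within {x..y})" if "x \<le> z" "z \<le> y" for z
        using f[of z] that \<open>a \<le> x\<close> \<open>y \<le> b\<close> has_derivative_subset[of f _ z "{a..b}" "{x..y}"]
        by (simp add: has_field_derivative_def)
      then have "\<exists>z\<in>{x<..<y}. f y - f x = f' z * (y - x)"
        using False that by (intro mvt_simple[of x y f "\<lambda>x v. f' x * v"]) auto
      then obtain z where "z \<in> {x<..<y}" "f y - f x = f' z * (y - x)" by blast
      then show ?thesis by (intro exI[of _ z]) simp
    qed auto
    then obtain z where z: "x \<le> z" "z \<le> y" "f y - f x = f' z * (y - x)" by blast
    have fz: "f' y \<le> f' z" "f' z \<le> f' x" using mono z that by auto
    have "f' y * f x \<le> f' x * f y"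
    proof (cases "f' y \<ge> 0")
      case True
      then have "0 \<le> f' z * (y - x)" using fz that by simp
      then have "f x \<le> f y" using z(3) by linarith
      then show ?thesis using True m fpos[OF x] by (intro mult_mono) auto
    next
      case False
      show ?thesis
      proof (cases "f' x \<ge> 0")
        case True
        then have "f' y * f x \<le> 0" "0 \<le> f' x * f y" using False fpos[OF x] fpos[OF y] 
          by (auto simp: mult_le_0_iff)
        then show ?thesis by linarith
      next
        case neg: False
        then have "f' z * (y - x) \<le> 0" using fz that by (auto simp: mult_le_0_iff)
        then have "f y \<le> f x" using z(3) by linarith
        then have "f' y * f x \<le> f' y * f y" using False by (intro mult_left_mono_neg) auto
        also have "\<dots> \<le> f' x * f y" using m fpos[OF y] by (intro mult_right_mono) auto
        finally show ?thesis .
      qed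
    qed
    then show ?thesis using fpos[OF x] fpos[OF y] by (simp add: q_def field_simps)
  qed
  have w0: "w a = 0" "w b = 0" using V0 by (auto simp: w_def)
  \<comment> \<open>The cross term is \<open>q (w^2)'\<close>; its sign is where concavity of the
    weight is spent.\<close>
  have qpos: "integral {a..b} (\<lambda>x. q x * (2 * w x * ?w' x)) \<ge> 0"
  proof (rule monotone_weight_integral_nonneg[OF ab qmono, where h="\<lambda>x. (w x)\<^sup>2"])
    fix x assume x: "x \<in> {a..b}"
    show "((\<lambda>x. (w x)\<^sup>2) has_real_derivative 2 * w x * ?w' x) (at x within {a..b})"
      by (rule derivative_eq_intros w'[OF x] refl)+ simp
  qed (use w0 in auto)
  have int: "h integrable_on {a..b}" if "continuous_on {a..b} h" for h :: "real \<Rightarrow> real"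
    using that by (rule integrable_continuous_interval)
  \<comment> \<open>Adding the cross term and \<open>(q w)^2\<close> completes the square of
    \<open>w' + q w = U g\<close>, whose square is \<open>U^2 f\<close>.\<close>
  have "k\<^sup>2 * integral {a..b} (\<lambda>x. (w x)\<^sup>2) \<le> integral {a..b} (\<lambda>x. (?w' x)\<^sup>2)"
    unfolding k_def by (rule wirtinger[OF ab w' cw' w0])
  also have "\<dots> \<le> integral {a..b} (\<lambda>x. (?w' x)\<^sup>2) + integral {a..b} (\<lambda>x. q x * (2 * w x * ?w' x))
      + integral {a..b} (\<lambda>x. (q x * w x)\<^sup>2)"
    using qpos by (simp add: integral_nonneg int cq cw continuous_intros)
  also have "\<dots> = integral {a..b} (\<lambda>x. (?w' x)\<^sup>2 + q x * (2 * w x * ?w' x) + (q x * w x)\<^sup>2)"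
    by (rule integral_add3[symmetric]) (use cq cw cw' in \<open>auto intro!: continuous_on_mult continuous_on_power continuous_on_const\<close>)
  also have "\<dots> = integral {a..b} (\<lambda>x. (U x)\<^sup>2 * f x)"
  proof (rule integral_cong)
    fix x assume "x \<in> {a..b}"
    have "(?w' x)\<^sup>2 + q x * (2 * w x * ?w' x) + (q x * w x)\<^sup>2 = (U x)\<^sup>2 * (g x * g x)"
      by (simp add: power2_eq_square algebra_simps)
    then show "(?w' x)\<^sup>2 + q x * (2 * w x * ?w' x) + (q x * w x)\<^sup>2 = (U x)\<^sup>2 * f x"
      using g[OF \<open>x \<in> {a..b}\<close>] by simp
  qed
  finally have 1: "k\<^sup>2 * integral {a..b} (\<lambda>x. (w x)\<^sup>2) \<le> integral {a..b} (\<lambda>x. (U x)\<^sup>2 * f x)" .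
  \<comment> \<open>Integration by parts: \<open>V' = U f\<close>, and \<open>V\<close> vanishes at
    \<open>a\<close> by definition and at \<open>b\<close> by the mean condition.\<close>
  have "((\<lambda>x. U x * V x) has_real_derivative U' x * V x + U x * (U x * f x)) (at x within {a..b})" if "x \<in> {a..b}" for x
    by (rule derivative_eq_intros U[OF that] V[OF that] refl)+ simp
  then have "((\<lambda>x. U' x * V x + U x * (U x * f x)) has_integral (U b * V b - U a * V a)) {a..b}"
    using ab by (intro fundamental_theorem_of_calculus) (auto simp: has_real_derivative_iff_has_vector_derivative)
  then have "integral {a..b} (\<lambda>x. U' x * V x + (U x)\<^sup>2 * f x) = 0"
    using V0 by (auto dest: integral_unique simp: power2_eq_square mult.assoc)
  moreover have "integral {a..b} (\<lambda>x. U' x * V x + (U x)\<^sup>2 * f x) =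
      integral {a..b} (\<lambda>x. U' x * V x) + integral {a..b} (\<lambda>x. (U x)\<^sup>2 * f x)"
    using cU' cV cU cf by (intro integral_add int continuous_intros)
  ultimately have 2: "integral {a..b} (\<lambda>x. U' x * V x) = - integral {a..b} (\<lambda>x. (U x)\<^sup>2 * f x)" by simp
  \<comment> \<open>The square is that of \<open>sqrt f\<close> times \<open>U'\<close>, plus
    \<open>k^2 w\<close>. Expanded, it bounds the energy from below by \<open>2 k^2\<close> times
    the mass minus \<open>k^4\<close> times the integral of \<open>w^2\<close>, and estimate
    \<open>1\<close> leaves \<open>k^2\<close> times the mass.\<close>
  have "0 \<le> integral {a..b} (\<lambda>x. (U' x * g x + k\<^sup>2 * w x)\<^sup>2)"
    using cU' cg cw by (intro integral_nonneg int continuous_intros) auto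
  also have "\<dots> = integral {a..b} (\<lambda>x. (U' x)\<^sup>2 * f x + 2 * k\<^sup>2 * (U' x * V x) + k^4 * (w x)\<^sup>2)"
  proof (rule integral_cong)
    fix x assume x: "x \<in> {a..b}"
    have "g x * w x = V x" using g[OF x] by (simp add: w_def)
    moreover have "(U' x * g x + k\<^sup>2 * w x)\<^sup>2 = (U' x)\<^sup>2 * (g x * g x) + 2 * k\<^sup>2 * (U' x * (g x * w x)) + k^4 * (w x)\<^sup>2"
      by (simp add: power2_eq_square power4_eq_xxxx algebra_simps)
    ultimately show "(U' x * g x + k\<^sup>2 * w x)\<^sup>2 = (U' x)\<^sup>2 * f x + 2 * k\<^sup>2 * (U' x * V x) + k^4 * (w x)\<^sup>2"
      using g[OF x] by simp
  qed
  also have "\<dots> = integral {a..b} (\<lambda>x. (U' x)\<^sup>2 * f x) + 2 * k\<^sup>2 * integral {a..b} (\<lambda>x. U' x * V x)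
      + k^4 * integral {a..b} (\<lambda>x. (w x)\<^sup>2)"
    by (subst integral_add3) (use cU' cf cV cw in \<open>auto intro!: continuous_on_mult continuous_on_power continuous_on_const\<close>)
  also have "k^4 * integral {a..b} (\<lambda>x. (w x)\<^sup>2) \<le> k\<^sup>2 * integral {a..b} (\<lambda>x. (U x)\<^sup>2 * f x)"
    using mult_left_mono[OF 1, of "k\<^sup>2"] by (simp add: power2_eq_square power4_eq_xxxx mult.assoc)
  finally show ?thesis unfolding 2 k_def by simp
qed

text \<open>\<open>x + e\<close> and \<open>y\<close> are convex combinations of \<open>x\<close>
  and \<open>y + e\<close> with exchanged weights; the two concavity inequalities are added.\<close>

lemma concave_increment:
  fixes f :: "real \<Rightarrow> real"
  assumes "concave_on S f" "x \<in> S" "y + e \<in> S" "x \<le> y" "e > 0"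
  shows "f (y + e) - f y \<le> f (x + e) - f x"
proof -
  define T where "T = y + e - x"
  have T: "T > 0" "e \<le> T" using assms by (auto simp: T_def)
  define l where "l = e / T"
  have l: "0 \<le> l" "l \<le> 1" using T assms by (auto simp: l_def)
  have eq: "(1 - l) * x + l * (y + e) = x + e" "l * x + (1 - l) * (y + e) = y"
  proof -
    have "l * T = e" using T by (simp add: l_def)
    then have "l * (y + e) - l * x = e" unfolding T_def by (simp add: algebra_simps)
    then show "(1 - l) * x + l * (y + e) = x + e" "l * x + (1 - l) * (y + e) = y"
      by (simp_all add: algebra_simps)
  qed
  have "f ((1 - l) *\<^sub>R x + l *\<^sub>R (y + e)) \<ge> (1 - l) * f x + l * f (y + e)"
    by (rule concave_onD[OF assms(1) l assms(2,3)])
  moreover have "f ((1 - (1 - l)) *\<^sub>R x + (1 - l) *\<^sub>R (y + e)) \<ge> (1 - (1 - l)) * f x + (1 - l) * f (y + e)"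
    using l by (intro concave_onD[OF assms(1) _ _ assms(2,3)]) auto
  ultimately have "f (x + e) + f y \<ge> f x + f (y + e)" using eq by (simp add: algebra_simps)
  then show ?thesis by simp
qed

lemma integral_Icc_lborel:
  fixes h :: "real \<Rightarrow> real"
  assumes "continuous_on {a..b} h"
  shows "integral {a..b} h = (LINT x|lborel. indicator {a..b} x * h x)"
  using set_borel_integral_eq_integral(2)[OF borel_integrable_atLeastAtMost'[OF assms]]
  by (simp add: set_lebesgue_integral_def)

text \<open>The variance form, cleared of its denominator: it has no mean condition that an
  approximation of \<open>f\<close> could destroy, and \<open>D\<close> covers intervals of varying
  length.\<close>

lemma payne_weinberger_C1_mean:
  fixes f f' U U' :: "real \<Rightarrow> real"
  assumes ab: "a < b" "b - a \<le> D"
    and f: "\<And>x. x \<in> {a..b} \<Longrightarrow> (f has_real_derivative f' x) (at x within {a..b})"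
    and cf': "continuous_on {a..b} f'" and fpos: "\<And>x. x \<in> {a..b} \<Longrightarrow> f x > 0"
    and mono: "\<And>x y. a \<le> x \<Longrightarrow> x \<le> y \<Longrightarrow> y \<le> b \<Longrightarrow> f' y \<le> f' x"
    and U: "\<And>x. x \<in> {a..b} \<Longrightarrow> (U has_real_derivative U' x) (at x within {a..b})"
    and cU': "continuous_on {a..b} U'"
  shows "(pi / D)\<^sup>2 * (integral {a..b} (\<lambda>x. (U x)\<^sup>2 * f x) * integral {a..b} f - (integral {a..b} (\<lambda>x. U x * f x))\<^sup>2)
     \<le> integral {a..b} (\<lambda>x. (U' x)\<^sup>2 * f x) * integral {a..b} f"
proof -
  let ?I = "\<lambda>h. integral {a..b} (\<lambda>x. h x * f x)"
  let ?A = "integral {a..b} f"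
  have cf: "continuous_on {a..b} f" and cU: "continuous_on {a..b} U"
    by (rule DERIV_continuous_on[OF f], simp, rule DERIV_continuous_on[OF U], simp)
  have int: "h integrable_on {a..b}" if "continuous_on {a..b} h" for h :: "real \<Rightarrow> real"
    using that by (rule integrable_continuous_interval)
  have "?A \<ge> 0" using fpos by (intro integral_nonneg int cf) (auto intro: less_imp_le)
  moreover have "?A \<noteq> 0"
  proof
    assume "?A = 0"
    then have "(f has_integral 0) (cbox a b)" using int[OF cf] by (auto simp: has_integral_integrable_integral)
    have "f a = 0"
    proof (rule has_integral_0_cbox_imp_0[OF _ _ \<open>(f has_integral 0) (cbox a b)\<close>])
      show "0 \<le> f x" if "x \<in> box a b" for x using that fpos[of x] by (auto simp: less_imp_le)
    qed (use cf ab in auto)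
    then show False using fpos[of a] ab by simp
  qed
  ultimately have A: "?A > 0" by simp
  define m where "m = ?I U / ?A"
  have "integral {a..b} (\<lambda>x. (U x - m) * f x) = ?I U - m * ?A"
    using cU cf by (simp add: left_diff_distrib integral_diff int continuous_intros)
  then have mean: "integral {a..b} (\<lambda>x. (U x - m) * f x) = 0" using A by (simp add: m_def)
  have U2: "((\<lambda>x. U x - m) has_real_derivative U' x) (at x within {a..b})" if "x \<in> {a..b}" for x
    using DERIV_diff[OF U[OF that] DERIV_const[of m]] by simp
  have *: "(pi / (b - a))\<^sup>2 * ?I (\<lambda>x. (U x - m)\<^sup>2) \<le> ?I (\<lambda>x. (U' x)\<^sup>2)"
    using payne_weinberger_C1[OF ab(1) f cf' fpos mono U2 cU' mean] by simp
  have nn: "0 \<le> ?I (\<lambda>x. (U x - m)\<^sup>2)"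
    using fpos cU cf by (intro integral_nonneg int continuous_intros) (auto simp: less_imp_le)
  have "(pi / D)\<^sup>2 \<le> (pi / (b - a))\<^sup>2"
    using ab by (intro power_mono divide_left_mono) auto
  then have **: "(pi / D)\<^sup>2 * ?I (\<lambda>x. (U x - m)\<^sup>2) \<le> ?I (\<lambda>x. (U' x)\<^sup>2)"
    using * mult_right_mono[OF _ nn] order_trans by blast
  have "?I (\<lambda>x. (U x - m)\<^sup>2) = integral {a..b} (\<lambda>x. (U x)\<^sup>2 * f x - 2 * m * (U x * f x) + m\<^sup>2 * f x)"
    by (intro integral_cong) (simp add: power2_eq_square algebra_simps)
  also have "\<dots> = ?I (\<lambda>x. (U x)\<^sup>2) - 2 * m * ?I U + m\<^sup>2 * ?A"
    using cU cf by (simp add: integral_diff integral_add int continuous_intros)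
  finally have I: "?I (\<lambda>x. (U x - m)\<^sup>2) = ?I (\<lambda>x. (U x)\<^sup>2) - 2 * m * ?I U + m\<^sup>2 * ?A" .
  have "(p - 2 * m * q + m\<^sup>2 * ?A) * ?A = p * ?A - 2 * m * ?A * q + (m * ?A)\<^sup>2" for p q
    by (simp add: power2_eq_square algebra_simps)
  then have e: "?I (\<lambda>x. (U x - m)\<^sup>2) * ?A = ?I (\<lambda>x. (U x)\<^sup>2) * ?A - 2 * m * ?A * ?I U + (m * ?A)\<^sup>2"
    unfolding I .
  have "m * ?A = ?I U" using A by (simp add: m_def)
  with e have "?I (\<lambda>x. (U x - m)\<^sup>2) * ?A = ?I (\<lambda>x. (U x)\<^sup>2) * ?A - (?I U)\<^sup>2"
    by (simp add: power2_eq_square)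
  with mult_right_mono[OF **, of ?A] A show ?thesis by (simp add: mult.assoc)
qed

text \<open>The average of \<open>f\<close> over \<open>[x, x + e]\<close>. Its derivative is a
  difference quotient of \<open>f\<close>, which decreases by concavity, and by the mean value
  theorem its value is taken by \<open>f\<close> nearby.\<close>

lemma concave_moving_average:
  fixes f :: "real \<Rightarrow> real"
  assumes e: "e > 0" "3 * e < \<beta> - \<alpha>" and conc: "concave_on {\<alpha><..<\<beta>} f"
  obtains F where
    "\<And>x. x \<in> {\<alpha> + e..\<beta> - 2 * e} \<Longrightarrow> (F has_real_derivative (f (x + e) - f x) / e) (at x)"
    "\<And>x. x \<in> {\<alpha> + e..\<beta> - 2 * e} \<Longrightarrow> \<exists>\<xi>. x < \<xi> \<and> \<xi> < x + e \<and> F x = f \<xi>"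
proof -
  have cf: "continuous_on {\<alpha><..<\<beta>} f"
    using convex_on_continuous[of "{\<alpha><..<\<beta>}" "\<lambda>x. - f x"] conc
    by (auto simp: concave_on_def dest: continuous_on_minus)
  \<comment> \<open>Starting at \<open>\<alpha> + e / 2\<close> avoids the end of the interval,
    where \<open>f\<close> may jump.\<close>
  define P where "P x = integral {\<alpha> + e / 2..x} f" for x
  have P: "(P has_real_derivative f x) (at x)" if "\<alpha> + e / 2 < x" "x < \<beta> - e / 2" for x
  proof -
    have "continuous_on {\<alpha> + e / 2..\<beta> - e / 2} f"
      using e by (intro continuous_on_subset[OF cf]) auto
    then have "(P has_real_derivative f x) (at x within {\<alpha> + e / 2..\<beta> - e / 2})"
      unfolding P_def using that by (intro integral_has_real_derivative) auto
    then show ?thesis using that at_within_Icc_at by metis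
  qed
  define F where "F x = (P (x + e) - P x) / e" for x
  show thesis
  proof (rule that[of F])
    fix x assume x: "x \<in> {\<alpha> + e..\<beta> - 2 * e}"
    have "((\<lambda>x. P (x + e)) has_real_derivative f (x + e)) (at x)"
      using P[of "x + e"] x e by (simp add: DERIV_shift)
    then show "(F has_real_derivative (f (x + e) - f x) / e) (at x)"
      unfolding F_def using P[of x] x e by (intro DERIV_cdivide DERIV_diff) auto
    have "\<exists>\<xi>. x < \<xi> \<and> \<xi> < x + e \<and> P (x + e) - P x = (x + e - x) * f \<xi>"
      using x e by (intro MVT2 P) auto
    then show "\<exists>\<xi>. x < \<xi> \<and> \<xi> < x + e \<and> F x = f \<xi>" using e by (auto simp: F_def)
  qed
qed

text \<open>Chord lengths are concave but may have corners. Their moving averages satisfy the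
  differentiable version on slightly shorter intervals and converge pointwise under a common
  bound.\<close>

lemma payne_weinberger_concave:
  fixes f U U' :: "real \<Rightarrow> real"
  assumes ab: "\<alpha> < \<beta>" "\<beta> - \<alpha> \<le> D" and conc: "concave_on {\<alpha><..<\<beta>} f"
    and pos: "\<And>x. x \<in> {\<alpha><..<\<beta>} \<Longrightarrow> f x > 0" and zero: "\<And>x. x \<notin> {\<alpha><..<\<beta>} \<Longrightarrow> f x = 0"
    and bound: "\<And>x. f x \<le> M" and fm: "f \<in> borel_measurable borel"
    and U: "\<And>x. (U has_real_derivative U' x) (at x)" and cU': "continuous_on UNIV U'"
  shows "(pi / D)\<^sup>2 * ((LINT x|lborel. (U x)\<^sup>2 * f x) * (LINT x|lborel. f x) - (LINT x|lborel. U x * f x)\<^sup>2)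
     \<le> (LINT x|lborel. (U' x)\<^sup>2 * f x) * (LINT x|lborel. f x)"
proof -
  have cf: "continuous_on {\<alpha><..<\<beta>} f"
    using convex_on_continuous[of "{\<alpha><..<\<beta>}" "\<lambda>x. - f x"] conc
    by (auto simp: concave_on_def dest: continuous_on_minus)
  have cU: "continuous_on UNIV U" using U by (intro DERIV_continuous_on[of _ _ U']) auto
  \<comment> \<open>The 4 ensures \<open>3 * e n < \<beta> - \<alpha>\<close> from
    \<open>n = 0\<close> on.\<close>
  define e where "e n = (\<beta> - \<alpha>) / (real n + 4)" for n
  define a where "a n = \<alpha> + e n" for n
  define b where "b n = \<beta> - 2 * e n" for n
  have e: "e n > 0" "3 * e n < \<beta> - \<alpha>" for n
  proof -
    have "(\<beta> - \<alpha>) * 3 < (\<beta> - \<alpha>) * (real n + 4)" using ab by (intro mult_strict_left_mono) auto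
    then show "e n > 0" "3 * e n < \<beta> - \<alpha>" using ab by (auto simp: e_def divide_less_eq mult.commute)
  qed
  have "filterlim (\<lambda>n. 4 + real n) at_top sequentially"
    by (rule filterlim_tendsto_add_at_top[OF tendsto_const filterlim_real_sequentially])
  then have e0: "e \<longlonglongrightarrow> 0" unfolding e_def
    by (intro tendsto_divide_0[OF tendsto_const] filterlim_at_top_imp_at_infinity) (simp add: add.commute)
  have "\<forall>n. \<exists>F. (\<forall>x \<in> {a n..b n}. (F has_real_derivative (f (x + e n) - f x) / e n) (at x)) \<and>
     (\<forall>x\<in>{a n..b n}. \<exists>\<xi>. x < \<xi> \<and> \<xi> < x + e n \<and> F x = f \<xi>)"
    unfolding a_def b_def using concave_moving_average[OF e conc] by metis
  then obtain F where F': "\<And>n x. x \<in> {a n..b n} \<Longrightarrow> (F n has_real_derivative (f (x + e n) - f x) / e n) (at x)"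
    and ex: "\<And>n x. x \<in> {a n..b n} \<Longrightarrow> \<exists>\<xi>. x < \<xi> \<and> \<xi> < x + e n \<and> F n x = f \<xi>" by metis
  define \<xi> where "\<xi> n x = (SOME \<xi>. x < \<xi> \<and> \<xi> < x + e n \<and> F n x = f \<xi>)" for n x
  have \<xi>: "x < \<xi> n x \<and> \<xi> n x < x + e n \<and> F n x = f (\<xi> n x)" if "x \<in> {a n..b n}" for n x
    unfolding \<xi>_def by (rule someI_ex[OF ex[OF that]])
  have sub: "\<alpha> < x \<and> x + e n < \<beta>" if "x \<in> {a n..b n}" for x n
    using that e[of n] by (auto simp: a_def b_def)
  have Fpos: "0 < F n x" "F n x \<le> M" if "x \<in> {a n..b n}" for n x
    using \<xi>[OF that] sub[OF that] pos[of "\<xi> n x"] bound by auto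
  have M: "0 \<le> M" using bound[of \<alpha>] zero[of \<alpha>] by simp
  have cF: "continuous_on {a n..b n} (F n)" for n
    using F' by (intro DERIV_continuous_on[of _ _ "\<lambda>x. (f (x + e n) - f x) / e n"]) (auto intro: has_field_derivative_at_within)
  have lim: "(\<lambda>n. integral {a n..b n} (\<lambda>x. G x * F n x)) \<longlonglongrightarrow> (LINT x|lborel. G x * f x)"
    if G: "continuous_on UNIV G" for G
  proof -
    have eq: "integral {a n..b n} (\<lambda>x. G x * F n x) = (LINT x|lborel. indicator {a n..b n} x * (G x * F n x))" for n
      using cF continuous_on_subset[OF G] by (intro integral_Icc_lborel continuous_intros) auto
    obtain B where B: "B > 0" "\<And>x. x \<in> {\<alpha>..\<beta>} \<Longrightarrow> norm (G x) \<le> B"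
      using bounded_continuous_image[OF _ G, of "{\<alpha>..\<beta>}"] by auto
    show ?thesis unfolding eq
    proof (rule integral_dominated_convergence[where w="\<lambda>x. indicator {\<alpha>..\<beta>} x * (B * M)"])
      show "(\<lambda>x. G x * f x) \<in> borel_measurable lborel"
        using fm borel_measurable_continuous_onI[OF G] by simp
      show "(\<lambda>x. indicator {a n..b n} x * (G x * F n x)) \<in> borel_measurable lborel" for n
        using borel_measurable_continuous_on_indicator[of "{a n..b n}" "\<lambda>x. G x * F n x"]
          continuous_on_mult[OF continuous_on_subset[OF G] cF[of n]] by simp
      show "integrable lborel (\<lambda>x. indicator {\<alpha>..\<beta>} x * (B * M))" using ab by simp
      show "AE x in lborel. norm (indicator {a n..b n} x * (G x * F n x)) \<le> indicator {\<alpha>..\<beta>} x * (B * M)" for n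
      proof (rule AE_I2)
        fix x
        show "norm (indicator {a n..b n} x * (G x * F n x)) \<le> indicator {\<alpha>..\<beta>} x * (B * M)"
        proof (cases "x \<in> {a n..b n}")
          case True
          then have "x \<in> {\<alpha>..\<beta>}" using sub[OF True] e[of n] by auto
          moreover have "\<bar>G x\<bar> * \<bar>F n x\<bar> \<le> B * M"
            using Fpos[OF True] B(2)[OF \<open>x \<in> {\<alpha>..\<beta>}\<close>] B(1) by (intro mult_mono) auto
          ultimately show ?thesis using True by (simp add: abs_mult)
        qed (use B M in auto)
      qed
      show "AE x in lborel. (\<lambda>n. indicator {a n..b n} x * (G x * F n x)) \<longlonglongrightarrow> G x * f x"
      proof (rule AE_I2)
        fix x
        show "(\<lambda>n. indicator {a n..b n} x * (G x * F n x)) \<longlonglongrightarrow> G x * f x"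
        proof (cases "x \<in> {\<alpha><..<\<beta>}")
          case True
          have ev: "\<forall>\<^sub>F n in sequentially. x \<in> {a n..b n}"
          proof -
            have "\<forall>\<^sub>F n in sequentially. e n < min (x - \<alpha>) ((\<beta> - x) / 2)"
              using True by (intro order_tendstoD(2)[OF e0]) auto
            then show ?thesis by eventually_elim (auto simp: a_def b_def)
          qed
          have cx: "isCont f x" using cf True by (auto simp: continuous_on_eq_continuous_at)
          \<comment> \<open>\<open>F n x\<close> is the value of \<open>f\<close> at
            \<open>y n\<close>, which is squeezed between \<open>x\<close> and
            \<open>x + e n\<close>; continuity of \<open>f\<close> at \<open>x\<close> gives the
            limit.\<close>
          define y where "y n = (if x \<in> {a n..b n} then \<xi> n x else x)" for n
          have "y \<longlonglongrightarrow> x"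
          proof (rule real_tendsto_sandwich)
            show "\<forall>\<^sub>F n in sequentially. x \<le> y n" "\<forall>\<^sub>F n in sequentially. y n \<le> x + e n"
              using \<xi> e by (auto simp: y_def less_imp_le intro!: always_eventually)
            show "(\<lambda>n. x + e n) \<longlonglongrightarrow> x" using tendsto_add[OF tendsto_const[of x] e0] by simp
          qed auto
          then have "(\<lambda>n. G x * f (y n)) \<longlonglongrightarrow> G x * f x"
            using isCont_tendsto_compose[OF cx] by (intro tendsto_intros)
          then show ?thesis
            by (rule Lim_transform_eventually) (use ev in eventually_elim, use \<xi> in \<open>auto simp: y_def\<close>)
        next
          case False
          then have "indicator {a n..b n} x = (0::real)" for n using sub[of x n] e[of n] by (auto simp: indicator_def)
          then show ?thesis using zero[OF False] by simp
        qed
      qed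
    qed
  qed
  have ineq: "(pi / D)\<^sup>2 * (integral {a n..b n} (\<lambda>x. (U x)\<^sup>2 * F n x) * integral {a n..b n} (\<lambda>x. 1 * F n x)
       - (integral {a n..b n} (\<lambda>x. U x * F n x))\<^sup>2)
     \<le> integral {a n..b n} (\<lambda>x. (U' x)\<^sup>2 * F n x) * integral {a n..b n} (\<lambda>x. 1 * F n x)" for n
    unfolding mult_1
  proof (rule payne_weinberger_C1_mean[of _ _ D "F n" "\<lambda>x. (f (x + e n) - f x) / e n"])
    show "a n < b n" using e[of n] by (auto simp: a_def b_def)
    show "b n - a n \<le> D" using e[of n] ab by (auto simp: a_def b_def)
    show "continuous_on {a n..b n} (\<lambda>x. (f (x + e n) - f x) / e n)"
      using e[of n] sub[of _ n] by (intro continuous_intros continuous_on_compose2[OF cf] continuous_on_subset[OF cf])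
        (force simp: less_imp_neq[THEN not_sym])+
    show "continuous_on {a n..b n} U'" using cU' continuous_on_subset by blast
    fix x y assume xy: "a n \<le> x" "x \<le> y" "y \<le> b n"
    have "f (y + e n) - f y \<le> f (x + e n) - f x"
      using xy sub[of x n] sub[of y n] e[of n] by (intro concave_increment[OF conc]) auto
    then show "(f (y + e n) - f y) / e n \<le> (f (x + e n) - f x) / e n" using e[of n] by (intro divide_right_mono) auto
  qed (use F' U Fpos in \<open>auto intro: has_field_derivative_at_within\<close>)
  have "(pi / D)\<^sup>2 * ((LINT x|lborel. (U x)\<^sup>2 * f x) * (LINT x|lborel. 1 * f x) - (LINT x|lborel. U x * f x)\<^sup>2)
     \<le> (LINT x|lborel. (U' x)\<^sup>2 * f x) * (LINT x|lborel. 1 * f x)"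
  proof (rule LIMSEQ_le[OF _ _ exI[of _ 0]])
    show "\<forall>n\<ge>0. (pi / D)\<^sup>2 * (integral {a n..b n} (\<lambda>x. (U x)\<^sup>2 * F n x) * integral {a n..b n} (\<lambda>x. 1 * F n x)
       - (integral {a n..b n} (\<lambda>x. U x * F n x))\<^sup>2)
     \<le> integral {a n..b n} (\<lambda>x. (U' x)\<^sup>2 * F n x) * integral {a n..b n} (\<lambda>x. 1 * F n x)"
      using ineq by blast
  qed (intro tendsto_mult tendsto_diff tendsto_power tendsto_const lim continuous_on_power continuous_on_const cU cU')+
  then show ?thesis by simp
qed

section \<open>Chords and widths of planar convex sets\<close>

lemma open_convex_real_interval:
  fixes S :: "real set"
  assumes "open S" "convex S" "bounded S" "S \<noteq> {}"
  shows "S = {Inf S<..<Sup S}"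
proof (intro set_eqI iffI)
  have bd: "bdd_above S" "bdd_below S" using assms(3) by (auto simp: bounded_imp_bdd_above bounded_imp_bdd_below)
  fix x
  assume "x \<in> S"
  then obtain e where e: "e > 0" "ball x e \<subseteq> S" using assms(1) open_contains_ball by blast
  have "x + e / 2 \<in> S" "x - e / 2 \<in> S" using e by (auto intro!: subsetD[OF e(2)] simp: dist_real_def)
  then have "x + e / 2 \<le> Sup S" "Inf S \<le> x - e / 2" using bd by (auto intro: cSup_upper cInf_lower)
  then show "x \<in> {Inf S<..<Sup S}" using e(1) by auto
next
  fix x assume x: "x \<in> {Inf S<..<Sup S}"
  then obtain y z where "y \<in> S" "z \<in> S" "y < x" "x < z"
    using assms(4) by (metis cInf_lessD greaterThanLessThan_iff less_cSupD)
  moreover have "{y..z} \<subseteq> S"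
    using \<open>y \<in> S\<close> \<open>z \<in> S\<close> assms(2) convex_contains_segment[of S] \<open>y < x\<close> \<open>x < z\<close>
    by (metis closed_segment_eq_real_ivl1 less_imp_le order.strict_trans)
  ultimately show "x \<in> S" by auto
qed

lemma frame2_combine:
  "frame2 v (a * s + b * s', a * t + b * t') = a *\<^sub>R frame2 v (s, t) + b *\<^sub>R frame2 v (s', t')"
  by (simp add: frame2_def algebra_simps)

lemma norm_frame2:
  assumes "norm v = 1" shows "norm (frame2 v (s, t)) = sqrt (s\<^sup>2 + t\<^sup>2)"
proof -
  have "v \<bullet> v = 1" "rot2 v \<bullet> rot2 v = 1" using assms by (simp_all add: dot_square_norm)
  then show ?thesis
    by (simp add: norm_eq_sqrt_inner frame2_def inner_add_left inner_add_right power2_eq_square)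
qed

section \<open>Slices and chord lengths\<close>

definition slice :: "real^2 \<Rightarrow> (real^2) set \<Rightarrow> real \<Rightarrow> real set" where
  "slice v P s = {t. frame2 v (s, t) \<in> P}"

text \<open>The line on which \<open>x \<bullet> v\<close> equals \<open>s\<close> is orthogonal to
  \<open>v\<close>, so this chord runs in direction \<open>rot2 v\<close>. Its length is 0 where the
  line misses \<open>P\<close>.\<close>

definition chord :: "real^2 \<Rightarrow> (real^2) set \<Rightarrow> real \<Rightarrow> real" where
  "chord v P s = measure lborel (slice v P s)"

lemma slice_open: assumes "open P" shows "open (slice v P s)"
proof -
  have "slice v P s = (\<lambda>t. frame2 v (s, t)) -` P" by (auto simp: slice_def)
  then show ?thesis using assms unfolding frame2_def by (auto intro!: continuous_intros open_vimage)
qed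

lemma slice_convex: assumes "convex P" shows "convex (slice v P s)"
proof (rule convexI)
  fix x y a b :: real assume xy: "x \<in> slice v P s" "y \<in> slice v P s" "0 \<le> a" "0 \<le> b" "a + b = 1"
  have "a * s + b * s = s" using xy(5) by (metis distrib_right mult_1)
  then have "frame2 v (s, a * x + b * y) = a *\<^sub>R frame2 v (s, x) + b *\<^sub>R frame2 v (s, y)"
    using frame2_combine[of v a s b s x y] by simp
  then show "a *\<^sub>R x + b *\<^sub>R y \<in> slice v P s"
    using convexD[OF assms _ _ xy(3-5)] xy(1,2) by (simp add: slice_def)
qed

lemma slice_bounds:
  assumes "norm v = 1" "t \<in> slice v P s" "\<And>x. x \<in> P \<Longrightarrow> c \<le> x \<bullet> rot2 v \<and> x \<bullet> rot2 v \<le> d"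
  shows "c \<le> t" "t \<le> d"
  using assms(3)[of "frame2 v (s, t)"] assms(2) frame2_inner(2)[OF assms(1), of s t] by (auto simp: slice_def)

lemma bounded_inner_bounds:
  assumes "bounded P" obtains B where "B > 0" "\<And>x v. x \<in> P \<Longrightarrow> norm v = 1 \<Longrightarrow> \<bar>x \<bullet> v\<bar> \<le> B"
proof -
  obtain B where B: "B > 0" "\<And>x. x \<in> P \<Longrightarrow> norm x \<le> B" using assms bounded_pos by metis
  have "\<bar>x \<bullet> v\<bar> \<le> B" if "x \<in> P" "norm v = 1" for x v
    using Cauchy_Schwarz_ineq2[of x v] B(2)[OF that(1)] that(2) by simp
  with B(1) show ?thesis using that by blast
qed

lemma slice_bounded: assumes "bounded P" "norm v = 1" shows "bounded (slice v P s)"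
proof -
  obtain B where B: "\<And>x v. x \<in> P \<Longrightarrow> norm v = 1 \<Longrightarrow> \<bar>x \<bullet> v\<bar> \<le> B" using bounded_inner_bounds[OF assms(1)] by metis
  have "slice v P s \<subseteq> {-B..B}"
    using slice_bounds[OF assms(2), of _ P s "-B" B] B[of _ "rot2 v"] assms(2) by (force simp: abs_le_iff)
  then show ?thesis using bounded_closed_interval bounded_subset by blast
qed

lemma chord_le:
  assumes "norm v = 1" "c \<le> d" "\<And>x. x \<in> P \<Longrightarrow> c \<le> x \<bullet> rot2 v \<and> x \<bullet> rot2 v \<le> d"
  shows "chord v P s \<le> d - c"
proof -
  have "slice v P s \<subseteq> {c..d}" using slice_bounds[OF assms(1) _ assms(3)] by auto
  then have "measure lborel (slice v P s) \<le> measure lborel {c..d}"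
  proof (cases "slice v P s \<in> sets lborel")
    case True
    have "{c..d} \<in> fmeasurable lborel" using fmeasurable_cbox[of c d] by simp
    with \<open>slice v P s \<subseteq> {c..d}\<close> True show ?thesis by (rule measure_mono_fmeasurable)
  qed (simp add: measure_notin_sets)
  then show ?thesis using assms(2) by (simp add: chord_def)
qed

lemma chord_eq:
  assumes "open P" "convex P" "bounded P" "norm v = 1" "slice v P s \<noteq> {}"
  shows "slice v P s = {Inf (slice v P s)<..<Sup (slice v P s)}"
    and "chord v P s = Sup (slice v P s) - Inf (slice v P s)" "chord v P s > 0"
proof -
  show *: "slice v P s = {Inf (slice v P s)<..<Sup (slice v P s)}"
    using assms by (intro open_convex_real_interval slice_open slice_convex slice_bounded)
  then have lt: "Inf (slice v P s) < Sup (slice v P s)" using assms(5) by auto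
  have "measure lborel (slice v P s) = measure lborel {Inf (slice v P s)<..<Sup (slice v P s)}"
    using * by (rule arg_cong)
  also have "\<dots> = Sup (slice v P s) - Inf (slice v P s)" using lt by simp
  finally show "chord v P s = Sup (slice v P s) - Inf (slice v P s)" by (simp add: chord_def)
  with lt show "chord v P s > 0" by simp
qed

lemma slice_nonempty_iff:
  assumes "norm v = 1" shows "slice v P s \<noteq> {} \<longleftrightarrow> s \<in> (\<lambda>x. x \<bullet> v) ` P"
proof
  assume "slice v P s \<noteq> {}"
  then obtain t where "frame2 v (s, t) \<in> P" by (auto simp: slice_def)
  then show "s \<in> (\<lambda>x. x \<bullet> v) ` P" using frame2_inner(1)[OF assms, of s t] by force
next
  assume "s \<in> (\<lambda>x. x \<bullet> v) ` P"
  then obtain x where "x \<in> P" "s = x \<bullet> v" by auto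
  then have "x \<bullet> rot2 v \<in> slice v P s" using frame2_decompose[OF assms, of x] by (simp add: slice_def)
  then show "slice v P s \<noteq> {}" by auto
qed

lemma inner_image_interval:
  fixes P :: "(real^2) set"
  assumes "open P" "convex P" "bounded P" "P \<noteq> {}" "norm v = 1"
  shows "(\<lambda>x. x \<bullet> v) ` P = {Inf ((\<lambda>x. x \<bullet> v) ` P)<..<Sup ((\<lambda>x. x \<bullet> v) ` P)}"
proof (rule open_convex_real_interval)
  have lin: "linear (\<lambda>x. x \<bullet> v)" by (intro linearI) (auto simp: inner_add_left)
  show "convex ((\<lambda>x. x \<bullet> v) ` P)" by (rule convex_linear_image[OF lin assms(2)])
  show "open ((\<lambda>x. x \<bullet> v) ` P)"
  proof (rule open_surjective_linear_image[OF assms(1) lin])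
    have "v \<bullet> v = 1" using assms(5) by (simp add: dot_square_norm)
    then show "surj (\<lambda>x. x \<bullet> v)" by (intro surjI[of _ "\<lambda>s. s *\<^sub>R v"]) simp
  qed
  obtain B where "\<And>x v. x \<in> P \<Longrightarrow> norm v = 1 \<Longrightarrow> \<bar>x \<bullet> v\<bar> \<le> B" using bounded_inner_bounds[OF assms(3)] by metis
  then show "bounded ((\<lambda>x. x \<bullet> v) ` P)" using assms(5) by (auto simp: bounded_iff)
qed (use assms in auto)

text \<open>Brunn-Minkowski in the plane: points that divide the chords at \<open>x\<close> and at
  \<open>y\<close> in the same ratio combine to a point of \<open>P\<close>, and these points fill
  an interval of the combined length.\<close>

lemma chord_concave:
  fixes P :: "(real^2) set"
  assumes P: "open P" "convex P" "bounded P" and v: "norm v = 1"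
    and S: "convex S" "S \<subseteq> (\<lambda>x. x \<bullet> v) ` P"
  shows "concave_on S (chord v P)"
  unfolding concave_on_iff
proof (intro conjI S(1) ballI allI impI)
  fix x y a b :: real assume xy: "x \<in> S" "y \<in> S" and ab: "0 \<le> a" "0 \<le> b" "a + b = 1"
  let ?z = "a * x + b * y"
  define l u where "l s = Inf (slice v P s)" and "u s = Sup (slice v P s)" for s
  have z: "?z \<in> S" using convexD[OF S(1) xy ab] by simp
  have eq: "slice v P s = {l s<..<u s}" "chord v P s = u s - l s" "l s < u s" if "s \<in> S" for s
    using chord_eq[OF P v, of s] slice_nonempty_iff[OF v, of P s] that S(2) unfolding l_def u_def by auto
  let ?L = "a * l x + b * l y" and ?U = "a * u x + b * u y"
  have LU: "?L < ?U"
  proof (cases "a = 0")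
    case True then show ?thesis using ab eq(3)[OF xy(2)] by simp
  next
    case False
    then have "a * l x < a * u x" using ab eq(3)[OF xy(1)] by simp
    moreover have "b * l y \<le> b * u y" using ab eq(3)[OF xy(2)] by (intro mult_left_mono) auto
    ultimately show ?thesis by linarith
  qed
  have sub: "{?L<..<?U} \<subseteq> slice v P ?z"
  proof
    fix t assume t: "t \<in> {?L<..<?U}"
    \<comment> \<open>The ratio in which \<open>t\<close> divides the combined interval; the same
      ratio is used on both chords.\<close>
    define \<theta> where "\<theta> = (t - ?L) / (?U - ?L)"
    have \<theta>: "0 < \<theta>" "\<theta> < 1" using t LU by (auto simp: \<theta>_def)
    have "\<theta> * (?U - ?L) = t - ?L" using LU by (simp add: \<theta>_def)
    then have t_eq: "t = a * (l x + \<theta> * (u x - l x)) + b * (l y + \<theta> * (u y - l y))"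
      by (simp add: algebra_simps)
    have "l s + \<theta> * (u s - l s) \<in> slice v P s" if "s \<in> S" for s
    proof -
      have "0 < \<theta> * (u s - l s)" "\<theta> * (u s - l s) < 1 * (u s - l s)"
        using \<theta> eq(3)[OF that] by (auto intro: mult_strict_right_mono)
      then show ?thesis unfolding eq(1)[OF that] by auto
    qed
    then have "frame2 v (x, l x + \<theta> * (u x - l x)) \<in> P" "frame2 v (y, l y + \<theta> * (u y - l y)) \<in> P"
      using xy by (auto simp: slice_def)
    from convexD[OF P(2) this ab] show "t \<in> slice v P ?z"
      unfolding slice_def t_eq frame2_combine[symmetric] by simp
  qed
  have "?U - ?L = measure lborel {?L<..<?U}" using LU by simp
  also have "\<dots> \<le> chord v P ?z"
    unfolding chord_def
  proof (rule measure_mono_fmeasurable[OF sub])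
    show "slice v P ?z \<in> fmeasurable lborel"
      using fmeasurable_box[of "l ?z" "u ?z"] eq(1)[OF z] by (simp only: box_real)
  qed simp
  finally show "a * chord v P x + b * chord v P y \<le> chord v P (a *\<^sub>R x + b *\<^sub>R y)"
  proof -
    assume le: "?U - ?L \<le> chord v P ?z"
    have "a * chord v P x + b * chord v P y = ?U - ?L"
      unfolding eq(2)[OF xy(1)] eq(2)[OF xy(2)] by (simp add: algebra_simps)
    with le show ?thesis by simp
  qed
qed

lemma chord_measurable: assumes "open P" shows "chord v P \<in> borel_measurable borel"
proof -
  define Q where "Q = frame2 v -` P"
  have "Q \<in> sets (lborel \<Otimes>\<^sub>M lborel)"
    unfolding Q_def lborel_prod using measurable_sets[OF frame2_measurable[of v], of P] assms by simp
  then have "(\<lambda>s. emeasure lborel (Pair s -` Q)) \<in> borel_measurable lborel"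
    by (rule lborel.measurable_emeasure_Pair)
  moreover have "Pair s -` Q = slice v P s" for s by (auto simp: Q_def slice_def)
  ultimately show ?thesis unfolding chord_def measure_def by simp
qed

text \<open>Fubini in the frame of \<open>v\<close>; the integrand is constant along each
  slice.\<close>

lemma integral_chord:
  fixes P :: "(real^2) set" and g :: "real \<Rightarrow> real"
  assumes P: "open P" "bounded P" and v: "norm v = 1" and g: "g \<in> borel_measurable borel"
    and int: "integrable (lebesgue_on P) (\<lambda>x. g (x \<bullet> v))"
  shows "(LINT x|lebesgue_on P. g (x \<bullet> v)) = (LINT s|lborel. g s * chord v P s)"
    "integrable lborel (\<lambda>s. g s * chord v P s)"
proof -
  have m: "(\<lambda>x. g (x \<bullet> v)) \<in> borel_measurable borel" using g by measurable
  have b: "P \<in> sets borel" using P(1) by simp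
  have i: "integrable lborel (\<lambda>x. indicator P x * g (x \<bullet> v))"
    using int integrable_lebesgue_on_borel[OF b m] by simp
  have in': "(LINT t|lborel. indicator P (frame2 v (s, t)) * g (frame2 v (s, t) \<bullet> v)) = g s * chord v P s" for s
  proof -
    have "(LINT t|lborel. indicator P (frame2 v (s, t)) * g (frame2 v (s, t) \<bullet> v))
        = (LINT t|lborel. indicator (slice v P s) t * g s)"
      by (intro Bochner_Integration.integral_cong) (auto simp: frame2_inner[OF v] slice_def indicator_def)
    also have "\<dots> = g s * chord v P s" by (simp add: chord_def slice_open[OF P(1)])
    finally show ?thesis .
  qed
  show "(LINT x|lebesgue_on P. g (x \<bullet> v)) = (LINT s|lborel. g s * chord v P s)"
    unfolding integral_lebesgue_on_borel[OF b m] integral_frame2[OF v i] in' ..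
  have "integrable lborel (\<lambda>s. LINT t|lborel. (\<lambda>p. indicator P (frame2 v p) * g (frame2 v p \<bullet> v)) (s, t))"
    by (rule lborel_pair.integrable_fst'[OF integrable_frame2[OF v i]])
  then show "integrable lborel (\<lambda>s. g s * chord v P s)" unfolding in' .
qed

section \<open>Widths, centroids and inscribed discs\<close>

definition width :: "(real^2) set \<Rightarrow> real^2 \<Rightarrow> real" where
  "width P v = (SUP x\<in>P. x \<bullet> v) - (INF x\<in>P. x \<bullet> v)"

lemma inner_Sup_Inf:
  assumes "bounded P" "x \<in> P"
  shows "x \<bullet> v \<le> (SUP x\<in>P. x \<bullet> v)" "(INF x\<in>P. x \<bullet> v) \<le> x \<bullet> v"
proof -
  obtain B where B: "\<And>x. x \<in> P \<Longrightarrow> norm x \<le> B" using assms(1) bounded_iff by metis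
  have "\<bar>x \<bullet> v\<bar> \<le> B * norm v" if "x \<in> P" for x
    using Cauchy_Schwarz_ineq2[of x v] mult_right_mono[OF B[OF that], of "norm v"] by simp
  then have "bdd_above ((\<lambda>x. x \<bullet> v) ` P)" "bdd_below ((\<lambda>x. x \<bullet> v) ` P)"
    by (auto intro!: bdd_aboveI2[of _ _ "B * norm v"] bdd_belowI2[of _ "- (B * norm v)"] simp: abs_le_iff)
       (metis minus_le_iff)
  then show "x \<bullet> v \<le> (SUP x\<in>P. x \<bullet> v)" "(INF x\<in>P. x \<bullet> v) \<le> x \<bullet> v"
    using assms(2) by (auto intro: cSUP_upper cINF_lower)
qed

lemma integral_homothety:
  fixes P :: "(real^2) set"
  assumes "open P" "s > 0" and f: "f \<in> borel_measurable borel"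
  shows "(LINT x|lborel. indicator ((\<lambda>x. q + s *\<^sub>R (x - q)) ` P) x * f x)
    = s\<^sup>2 * (LINT x|lborel. indicator P x * f (q + s *\<^sub>R (x - q)))"
proof -
  let ?T = "\<lambda>x. (q - s *\<^sub>R q) + s *\<^sub>R x"
  let ?P' = "(\<lambda>x. q + s *\<^sub>R (x - q)) ` P"
  have T: "?T x = q + s *\<^sub>R (x - q)" for x by (simp add: algebra_simps)
  have mem: "?T x \<in> ?P' \<longleftrightarrow> x \<in> P" for x using assms(2) by (auto simp: T)
  have "?P' = (\<lambda>y. q + (1 / s) *\<^sub>R (y - q)) -` P" using assms(2) by (force simp: image_iff)
  moreover have "open ((\<lambda>y. q + (1 / s) *\<^sub>R (y - q)) -` P)"
    using assms(1) by (intro open_vimage continuous_intros)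
  ultimately have "open ?P'" by simp
  then have m: "(\<lambda>x. indicator ?P' x * f x) \<in> borel_measurable borel" using f by simp
  have "(LINT x|lborel. indicator ?P' x * f x) =
    (LINT x|density (distr lborel borel ?T) (\<lambda>_. ennreal (\<bar>s\<bar> ^ DIM(real^2))). indicator ?P' x * f x)"
    using lborel_affine[of s "q - s *\<^sub>R q"] assms(2) by simp
  also have "\<dots> = (LINT x|distr lborel borel ?T. s\<^sup>2 * (indicator ?P' x * f x))"
    using m assms(2) by (subst integral_density) auto
  also have "\<dots> = (LINT x|lborel. s\<^sup>2 * (indicator ?P' (?T x) * f (?T x)))"
    using m by (subst integral_distr) auto
  also have "\<dots> = s\<^sup>2 * (LINT x|lborel. indicator P x * f (q + s *\<^sub>R (x - q)))"
  proof -
    have "indicator ?P' (?T x) * f (?T x) = indicator P x * f (q + s *\<^sub>R (x - q))" for x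
      using mem[of x] by (cases "x \<in> P") (simp_all add: T)
    then show ?thesis by simp
  qed
  finally show ?thesis .
qed

lemma measure_pos_open:
  fixes P :: "'a::euclidean_space set"
  assumes "open P" "bounded P" "P \<noteq> {}" shows "measure lebesgue P > 0"
proof -
  obtain x r where "r > 0" "ball x r \<subseteq> P" using assms by (meson all_not_in_conv openE)
  then have "measure lebesgue (ball x r) \<le> measure lebesgue P"
    using assms by (intro measure_mono_fmeasurable lmeasurable_open) auto
  moreover have "measure lebesgue (ball x r) > 0" using content_ball_pos[OF \<open>r > 0\<close>] by simp
  ultimately show ?thesis by linarith
qed

text \<open>Shrinking \<open>P\<close> towards \<open>q\<close> by the factor \<open>s\<close> multiplies the integral of \<open>(x - q) \<bullet> v\<close> by \<open>s\<^sup>3\<close>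
  but the area only by \<open>s\<^sup>2\<close>; comparing the two as \<open>s \<rightarrow> 1\<close> yields the factor \<open>2 / 3\<close>.\<close>

lemma first_moment_le:
  fixes P :: "(real^2) set"
  assumes P: "open P" "convex P" "bounded P" and q: "q \<in> P" and M: "\<And>x. x \<in> P \<Longrightarrow> (x - q) \<bullet> v \<le> M"
  shows "3 * (LINT x|lebesgue_on P. (x - q) \<bullet> v) \<le> 2 * (measure lebesgue P * M)"
proof -
  let ?I = "LINT x|lebesgue_on P. (x - q) \<bullet> v" and ?A = "measure lebesgue P"
  have Pb: "P \<in> sets borel" "P \<in> sets lebesgue" using P(1) by auto
  have cont: "continuous_on UNIV (\<lambda>x. (x - q) \<bullet> v)" by (intro continuous_intros)
  have m: "(\<lambda>x. (x - q) \<bullet> v) \<in> borel_measurable borel" by (rule borel_measurable_continuous_onI[OF cont])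
  have I: "?I = (LINT x|lborel. indicator P x * ((x - q) \<bullet> v))" by (rule integral_lebesgue_on_borel[OF Pb(1) m])
  have A: "?A = (LINT x|lborel. indicator P x)" using Pb by (simp add: measure_completion)
  have iP: "integrable lborel (\<lambda>x. indicator P x * ((x - q) \<bullet> v))"
    using integrable_continuous_bounded[OF P(3) Pb(2) cont] integrable_lebesgue_on_borel[OF Pb(1) m] by simp
  have iA: "integrable lborel (indicator Q :: real^2 \<Rightarrow> real)" if "Q \<subseteq> P" "Q \<in> sets borel" for Q
    using that emeasure_bounded_finite[OF bounded_subset[OF P(3) that(1)]] by (intro integrable_real_indicator) auto
  have main: "(1 + s + s\<^sup>2) * ?I \<le> (1 + s) * (?A * M)" if s: "0 < s" "s < 1" for s
  proof -
    let ?P' = "(\<lambda>x. q + s *\<^sub>R (x - q)) ` P"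
    have sub: "?P' \<subseteq> P"
    proof
      fix y assume "y \<in> ?P'"
      then obtain x where x: "x \<in> P" "y = (1 - s) *\<^sub>R q + s *\<^sub>R x" by (auto simp: algebra_simps)
      then show "y \<in> P" using convexD[OF P(2) q x(1), of "1 - s" s] s by simp
    qed
    have "?P' = (\<lambda>y. q + (1 / s) *\<^sub>R (y - q)) -` P" using s by (force simp: image_iff)
    moreover have "open ((\<lambda>y. q + (1 / s) *\<^sub>R (y - q)) -` P)"
      using P(1) by (intro open_vimage continuous_intros)
    ultimately have P'b: "?P' \<in> sets borel" by simp
    have I': "(LINT x|lborel. indicator ?P' x * ((x - q) \<bullet> v)) = s ^ 3 * ?I"
      unfolding integral_homothety[OF P(1) s(1) m] I
      by (simp add: power3_eq_cube power2_eq_square mult.left_commute mult.assoc)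
    have A': "(LINT x|lborel. indicator ?P' x) = s\<^sup>2 * ?A"
      using integral_homothety[OF P(1) s(1), of "\<lambda>_. 1" q] unfolding A by simp
    have i': "integrable lborel (\<lambda>x. indicator ?P' x * ((x - q) \<bullet> v))"
    proof (rule Bochner_Integration.integrable_bound[OF iP])
      show "(\<lambda>x. indicator ?P' x * ((x - q) \<bullet> v)) \<in> borel_measurable lborel" using P'b m by simp
      show "AE x in lborel. norm (indicator ?P' x * ((x - q) \<bullet> v)) \<le> norm (indicator P x * ((x - q) \<bullet> v))"
        using sub by (auto simp: indicator_def)
    qed
    \<comment> \<open>On \<open>P\<close> minus its shrunken copy the integrand is at most
      \<open>M\<close>; the two sides evaluate to \<open>(1 - s^3) I\<close> and
      \<open>(1 - s^2) A M\<close>, and a factor \<open>1 - s\<close> cancels.\<close>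
    have "(LINT x|lborel. indicator P x * ((x - q) \<bullet> v) - indicator ?P' x * ((x - q) \<bullet> v))
      \<le> (LINT x|lborel. (indicator P x - indicator ?P' x) * M)"
    proof (rule integral_mono)
      show "indicator P x * ((x - q) \<bullet> v) - indicator ?P' x * ((x - q) \<bullet> v) \<le> (indicator P x - indicator ?P' x) * M" for x
        using sub M[of x] by (auto simp: indicator_def)
    qed (use iP i' iA[OF sub P'b] iA[OF order_refl Pb(1)] in auto)
    also have "(LINT x|lborel. indicator P x * ((x - q) \<bullet> v) - indicator ?P' x * ((x - q) \<bullet> v)) = ?I - s ^ 3 * ?I"
      using iP i' by (simp add: I' I)
    also have "(LINT x|lborel. (indicator P x - indicator ?P' x) * M) = (?A - s\<^sup>2 * ?A) * M"
    proof -
      have "(LINT x|lborel. (indicator P x - indicator ?P' x) * M) = ((LINT x|lborel. indicator P x) - (LINT x|lborel. indicator ?P' x)) * M"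
        using iA[OF sub P'b] iA[OF order_refl Pb(1)] by simp
      then show ?thesis unfolding A' A[symmetric] .
    qed
    finally have "(1 - s) * ((1 + s + s\<^sup>2) * ?I) \<le> (1 - s) * ((1 + s) * (?A * M))"
      by (simp add: algebra_simps power2_eq_square power3_eq_cube)
    then show ?thesis using s by simp
  qed
  have "(1 + 1 + 1\<^sup>2) * ?I \<le> (1 + 1) * (?A * M)"
  proof (rule tendsto_le)
    show "((\<lambda>s. (1 + s + s\<^sup>2) * ?I) \<longlongrightarrow> (1 + 1 + 1\<^sup>2) * ?I) (at_left 1)" by (intro tendsto_intros)
    show "((\<lambda>s. (1 + s) * (?A * M)) \<longlongrightarrow> (1 + 1) * (?A * M)) (at_left 1)" by (intro tendsto_intros)
    show "\<forall>\<^sub>F s in at_left 1. (1 + s + s\<^sup>2) * ?I \<le> (1 + s) * (?A * M)"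
      using eventually_at_left_real[OF zero_less_one] by eventually_elim (use main in auto)
  qed simp
  then show ?thesis by simp
qed

text \<open>The centroid has distance at least \<open>w / 3\<close> from every supporting line.\<close>

lemma width_ball:
  fixes P :: "(real^2) set"
  assumes P: "open P" "convex P" "bounded P" "P \<noteq> {}" and w: "\<And>v. norm v = 1 \<Longrightarrow> w \<le> width P v"
  obtains c where "ball c (w / 3) \<subseteq> P"
proof -
  let ?A = "measure lebesgue P"
  have A: "?A > 0" by (rule measure_pos_open[OF P(1,3,4)])
  have fin: "P \<in> lmeasurable" using P by (intro lmeasurable_open) auto
  interpret finite_measure "lebesgue_on P" using fin by (rule finite_measure_lebesgue_on)
  have iP: "integrable (lebesgue_on P) (\<lambda>x. x)"
    using P fin by (intro integrable_continuous_bounded) auto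
  define c where "c = (1 / ?A) *\<^sub>R (LINT x|lebesgue_on P. x)"
  have Ac: "?A *\<^sub>R c = (LINT x|lebesgue_on P. x)" using A by (simp add: c_def)
  have key: "c \<bullet> v \<le> (SUP x\<in>P. x \<bullet> v) - w / 3" if v: "norm v = 1" for v
  proof -
    let ?S = "SUP x\<in>P. x \<bullet> v" and ?J = "INF x\<in>P. x \<bullet> v"
    \<comment> \<open>The moment inequality holds for every base point \<open>q\<close>; the infimum
      over \<open>q\<close> then brings in the opposite supporting line.\<close>
    have "3 * (c \<bullet> v) - 2 * ?S \<le> q \<bullet> v" if q: "q \<in> P" for q
    proof -
      have "(LINT x|lebesgue_on P. (x - q) \<bullet> v) = (LINT x|lebesgue_on P. x - q) \<bullet> v"
        using iP by (intro integral_inner_left) auto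
      also have "\<dots> = ?A * ((c - q) \<bullet> v)"
        using iP fin by (simp add: measure_restrict_space inner_diff_left algebra_simps flip: Ac)
      finally have "3 * (?A * ((c - q) \<bullet> v)) \<le> 2 * (?A * (?S - q \<bullet> v))"
        using first_moment_le[OF P(1-3) q, of v "?S - q \<bullet> v"] inner_Sup_Inf(1)[OF P(3)]
        by (simp add: inner_diff_left)
      then have "?A * (3 * ((c - q) \<bullet> v)) \<le> ?A * (2 * (?S - q \<bullet> v))" by (simp add: algebra_simps)
      then have "3 * ((c - q) \<bullet> v) \<le> 2 * (?S - q \<bullet> v)" using A by simp
      then show ?thesis by (simp add: inner_diff_left algebra_simps)
    qed
    then have "3 * (c \<bullet> v) - 2 * ?S \<le> ?J" using P(4) by (intro cINF_greatest) auto
    then show ?thesis using w[OF v] by (simp add: width_def)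
  qed
  have "ball c (w / 3) \<subseteq> P"
  proof
    fix x assume x: "x \<in> ball c (w / 3)"
    show "x \<in> P"
    proof (rule ccontr)
      assume "x \<notin> P"
      \<comment> \<open>A point outside \<open>P\<close> is cut off by a line; its normal
        \<open>v\<close> contradicts \<open>key\<close>, as the point is closer than
        \<open>w / 3\<close> to the centroid.\<close>
      then obtain a b where ab: "a \<noteq> 0" "\<forall>y\<in>P. a \<bullet> y \<le> b" "b \<le> a \<bullet> x"
        using separating_hyperplane_sets[of P "{x}"] P by auto
      define v where "v = (1 / norm a) *\<^sub>R a"
      have v: "norm v = 1" using ab(1) by (simp add: v_def)
      have "y \<bullet> v \<le> x \<bullet> v" if "y \<in> P" for y
        using ab(1) ab(2)[rule_format, OF that] ab(3) by (simp add: v_def inner_commute divide_right_mono)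
      then have "(SUP x\<in>P. x \<bullet> v) \<le> x \<bullet> v" using P(4) by (intro cSUP_least) auto
      then have "w / 3 \<le> (x - c) \<bullet> v" using key[OF v] by (simp add: inner_diff_left)
      also have "\<dots> \<le> norm (x - c) * norm v" by (rule norm_cauchy_schwarz)
      finally show False using x v by (simp add: dist_norm norm_minus_commute)
    qed
  qed
  then show ?thesis using that by blast
qed

section \<open>The Payne-Weinberger inequality\<close>

lemma measure_lebesgue_on_const:
  assumes "P \<in> lmeasurable" shows "(LINT x|lebesgue_on P. c) = measure lebesgue P * (c :: real)"
proof -
  interpret finite_measure "lebesgue_on P" using assms by (rule finite_measure_lebesgue_on)
  show ?thesis using assms by (simp add: measure_restrict_space)
qed

lemma integral_abs_le_const:
  fixes f :: "'a::euclidean_space \<Rightarrow> real"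
  assumes "P \<in> lmeasurable" "integrable (lebesgue_on P) f" "\<And>x. x \<in> P \<Longrightarrow> f x \<le> B"
  shows "(LINT x|lebesgue_on P. f x) \<le> measure lebesgue P * B"
proof -
  interpret finite_measure "lebesgue_on P" using assms(1) by (rule finite_measure_lebesgue_on)
  have "(LINT x|lebesgue_on P. f x) \<le> (LINT x|lebesgue_on P. B)"
    using assms by (intro integral_mono) auto
  then show ?thesis unfolding measure_lebesgue_on_const[OF assms(1)] .
qed

text \<open>With the energy divided by \<open>K^2\<close> the inequality says that an integral is at
  most 0, a claim that can be followed through cuts since the integral is additive over
  pieces.\<close>

definition pw_defect :: "real \<Rightarrow> (real^2 \<Rightarrow> real) \<Rightarrow> (real^2 \<Rightarrow> real^2) \<Rightarrow> real^2 \<Rightarrow> real" where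
  "pw_defect K u G x = (u x)\<^sup>2 - (norm (G x))\<^sup>2 / K\<^sup>2"

text \<open>With the coordinate along \<open>rot2 v\<close> frozen at \<open>c\<close>, the
  integrands depend on \<open>x \<bullet> v\<close> only; integrated over \<open>P\<close> they
  become one-dimensional integrals with the concave chord length as weight.\<close>

lemma pw_strip:
  fixes P :: "(real^2) set"
  assumes u: "C1_grad u G" and P: "open P" "convex P" "bounded P" "P \<noteq> {}" and v: "norm v = 1"
    and D: "D > 0" "\<And>x y. x \<in> P \<Longrightarrow> y \<in> P \<Longrightarrow> (x - y) \<bullet> v \<le> D"
  shows "(pi / D)\<^sup>2 * ((LINT x|lebesgue_on P. (u (frame2 v (x \<bullet> v, c)))\<^sup>2) * measure lebesgue P
      - (LINT x|lebesgue_on P. u (frame2 v (x \<bullet> v, c)))\<^sup>2)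
    \<le> (LINT x|lebesgue_on P. (G (frame2 v (x \<bullet> v, c)) \<bullet> v)\<^sup>2) * measure lebesgue P"
proof -
  define U where "U s = u (frame2 v (s, c))" for s
  define U' where "U' s = G (frame2 v (s, c)) \<bullet> v" for s
  have cG: "continuous_on UNIV G" using u by (simp add: C1_grad_def)
  have cfr: "continuous_on UNIV (\<lambda>s. frame2 v (s, c))" unfolding frame2_def by (intro continuous_intros)
  have U: "(U has_real_derivative U' s) (at s)" for s
  proof -
    have a: "((\<lambda>s. frame2 v (s, c)) has_derivative (\<lambda>h. h *\<^sub>R v)) (at s)"
      unfolding frame2_def by (auto intro!: derivative_eq_intros)
    have b: "(u has_derivative (\<lambda>h. h \<bullet> G (frame2 v (s, c)))) (at (frame2 v (s, c)))"
      using u by (simp add: C1_grad_def)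
    show ?thesis using has_derivative_compose[OF a b]
      by (simp add: has_field_derivative_def U_def[abs_def] U'_def inner_commute mult_commute_abs)
  qed
  have cU': "continuous_on UNIV U'" unfolding U'_def
    by (intro continuous_on_inner continuous_on_compose2[OF cG cfr] continuous_on_const) auto
  have cU: "continuous_on UNIV U" using U by (intro DERIV_continuous_on[of _ _ U']) auto
  let ?J = "(\<lambda>x. x \<bullet> v) ` P"
  define \<alpha> \<beta> where "\<alpha> = Inf ?J" and "\<beta> = Sup ?J"
  have J: "?J = {\<alpha><..<\<beta>}" unfolding \<alpha>_def \<beta>_def by (rule inner_image_interval[OF P v])
  then have ab: "\<alpha> < \<beta>" using P(4) by (metis greaterThanLessThan_empty_iff image_is_empty not_le)
  have bD: "\<beta> - \<alpha> \<le> D"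
  proof (rule ccontr)
    assume "\<not> \<beta> - \<alpha> \<le> D"
    define e where "e = (\<beta> - \<alpha> - D) / 3"
    have e: "e > 0" "3 * e = \<beta> - \<alpha> - D" using \<open>\<not> \<beta> - \<alpha> \<le> D\<close> by (auto simp: e_def)
    have "\<alpha> + e \<in> ?J" "\<beta> - e \<in> ?J" unfolding J using e D(1) by auto
    then obtain x y where "x \<in> P" "y \<in> P" "x \<bullet> v = \<beta> - e" "y \<bullet> v = \<alpha> + e" by force
    with D(2)[of x y] e show False by (simp add: inner_diff_left)
  qed
  obtain B where B: "B > 0" "\<And>x v. x \<in> P \<Longrightarrow> norm v = 1 \<Longrightarrow> \<bar>x \<bullet> v\<bar> \<le> B" using bounded_inner_bounds[OF P(3)] by metis
  have Bv: "- B \<le> x \<bullet> rot2 v \<and> x \<bullet> rot2 v \<le> B" if "x \<in> P" for x using B(2)[OF that, of "rot2 v"] v by auto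
  have lme: "P \<in> lmeasurable" using P by (intro lmeasurable_open) auto
  have conv: "(LINT x|lebesgue_on P. g (x \<bullet> v)) = (LINT s|lborel. g s * chord v P s)" if "continuous_on UNIV g" for g
  proof (rule integral_chord(1)[OF P(1,3) v])
    show "g \<in> borel_measurable borel" using that by (rule borel_measurable_continuous_onI)
    have "continuous_on UNIV (\<lambda>x. g (x \<bullet> v))" by (intro continuous_on_compose2[OF that] continuous_intros) auto
    then show "integrable (lebesgue_on P) (\<lambda>x. g (x \<bullet> v))" using P lme by (intro integrable_continuous_bounded) auto
  qed
  have A: "measure lebesgue P = (LINT s|lborel. chord v P s)"
    using conv[of "\<lambda>_. 1"] measure_lebesgue_on_const[OF lme, of 1] by simp
  have "(pi / D)\<^sup>2 * ((LINT x|lborel. (U x)\<^sup>2 * chord v P x) * (LINT x|lborel. chord v P x) - (LINT x|lborel. U x * chord v P x)\<^sup>2)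
     \<le> (LINT x|lborel. (U' x)\<^sup>2 * chord v P x) * (LINT x|lborel. chord v P x)"
  proof (rule payne_weinberger_concave[OF ab bD])
    show "concave_on {\<alpha><..<\<beta>} (chord v P)" using J by (intro chord_concave P v) auto
    show "chord v P s > 0" if "s \<in> {\<alpha><..<\<beta>}" for s
      using that slice_nonempty_iff[OF v, of P s] J by (intro chord_eq(3) P v) auto
    show "chord v P s = 0" if "s \<notin> {\<alpha><..<\<beta>}" for s
      using that slice_nonempty_iff[OF v, of P s] J by (auto simp: chord_def)
    show "chord v P s \<le> B - (- B)" for s using B(1) Bv by (intro chord_le v) auto
    show "chord v P \<in> borel_measurable borel" by (rule chord_measurable[OF P(1)])
  qed (use U cU' in auto)
  then show ?thesis unfolding A
    using conv[of "\<lambda>s. (U s)\<^sup>2"] conv[of U] conv[of "\<lambda>s. (U' s)\<^sup>2"] cU cU'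
    by (simp add: continuous_on_power U_def U'_def)
qed

text \<open>On a piece narrower than \<open>\<epsilon>\<close>, uniform continuity allows
  \<open>u\<close> and \<open>G\<close> to be read off on a line in direction \<open>v\<close>. The
  error per unit of area is at most \<open>\<delta>\<close>, uniformly over all such pieces, and
  dropping the part of \<open>G\<close> orthogonal to \<open>v\<close> goes in the right
  direction.\<close>

lemma pw_thin:
  assumes u: "C1_grad u G" and \<delta>: "\<delta> > 0" and D: "D > 0"
  shows "\<exists>\<epsilon>>0. \<forall>P v. open P \<and> convex P \<and> P \<noteq> {} \<and> P \<subseteq> cball 0 \<rho> \<and> (\<forall>x\<in>P. \<forall>y\<in>P. norm (x - y) \<le> D) \<and>
       norm v = 1 \<and> width P (rot2 v) < \<epsilon> \<and> (LINT x|lebesgue_on P. u x) = 0 \<longrightarrow>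
     (LINT x|lebesgue_on P. pw_defect (pi / D) u G x) \<le> measure lebesgue P * \<delta>"
proof -
  define K where "K = pi / D"
  have K: "K > 0" using D by (simp add: K_def)
  \<comment> \<open>One unit larger than the disc containing the pieces, so that the projections
    \<open>p x\<close> stay inside; hence \<open>\<epsilon> \<le> 1\<close>.\<close>
  let ?C = "cball 0 (\<rho> + 1) :: (real^2) set"
  have cu: "continuous_on UNIV u" and cG: "continuous_on UNIV G"
    using u C1_grad_continuous by (auto simp: C1_grad_def)
  obtain B1 where B1: "B1 > 0" "\<And>x. x \<in> ?C \<Longrightarrow> norm (u x) \<le> B1" using bounded_continuous_image[OF _ cu, of ?C] by auto
  obtain B2 where B2: "B2 > 0" "\<And>x. x \<in> ?C \<Longrightarrow> norm (G x) \<le> B2" using bounded_continuous_image[OF _ cG, of ?C] by auto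
  define B where "B = max B1 B2"
  have B: "B > 0" "\<And>x. x \<in> ?C \<Longrightarrow> \<bar>u x\<bar> \<le> B" "\<And>x. x \<in> ?C \<Longrightarrow> norm (G x) \<le> B"
    using B1 B2 by (force simp: B_def)+
  \<comment> \<open>Collects the errors: \<open>2 B / K^2\<close> from the gradients,
    \<open>2 B\<close> from the squares of \<open>u\<close>, and 1 for the square of the
    mean.\<close>
  define c where "c = 2 * B / K\<^sup>2 + 1 + 2 * B"
  have c: "c > 0" using B K by (auto simp: c_def intro!: add_pos_pos)
  define \<eta> where "\<eta> = min 1 (\<delta> / c)"
  have \<eta>: "0 < \<eta>" "\<eta> \<le> 1" "\<eta> * c \<le> \<delta>" using c \<delta> by (auto simp: \<eta>_def min_def field_simps)
  have "uniformly_continuous_on ?C u" "uniformly_continuous_on ?C G"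
    by (auto intro!: compact_uniformly_continuous continuous_on_subset[OF cu] continuous_on_subset[OF cG])
  then obtain e1 e2 where e: "e1 > 0" "\<And>x y. x \<in> ?C \<Longrightarrow> y \<in> ?C \<Longrightarrow> dist y x < e1 \<Longrightarrow> dist (u y) (u x) < \<eta>"
    "e2 > 0" "\<And>x y. x \<in> ?C \<Longrightarrow> y \<in> ?C \<Longrightarrow> dist y x < e2 \<Longrightarrow> dist (G y) (G x) < \<eta>"
    unfolding uniformly_continuous_on_def using \<eta>(1) by metis
  define \<epsilon> where "\<epsilon> = min 1 (min e1 e2)"
  show ?thesis
  proof (intro exI[of _ \<epsilon>] conjI allI impI)
    show "\<epsilon> > 0" using e by (simp add: \<epsilon>_def)
    fix P :: "(real^2) set" and v :: "real^2"
    assume "open P \<and> convex P \<and> P \<noteq> {} \<and> P \<subseteq> cball 0 \<rho> \<and> (\<forall>x\<in>P. \<forall>y\<in>P. norm (x - y) \<le> D) \<and>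
       norm v = 1 \<and> width P (rot2 v) < \<epsilon> \<and> (LINT x|lebesgue_on P. u x) = 0"
    then have P: "open P" "convex P" "P \<noteq> {}" "P \<subseteq> cball 0 \<rho>" and diam: "\<And>x y. x \<in> P \<Longrightarrow> y \<in> P \<Longrightarrow> norm (x - y) \<le> D"
      and v: "norm v = 1" and w: "width P (rot2 v) < \<epsilon>" and mean: "(LINT x|lebesgue_on P. u x) = 0" by auto
    have bP: "bounded P" using P(4) bounded_cball bounded_subset by blast
    have lme: "P \<in> lmeasurable" using P bP by (intro lmeasurable_open) auto
    define A where "A = measure lebesgue P"
    have A: "A > 0" unfolding A_def by (rule measure_pos_open[OF P(1) bP P(3)])
    obtain y0 where y0: "y0 \<in> P" using P(3) by blast
    define c0 where "c0 = y0 \<bullet> rot2 v"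
    define p where "p x = frame2 v (x \<bullet> v, c0)" for x
    have cp: "continuous_on UNIV p" unfolding p_def frame2_def by (intro continuous_intros)
    have int: "integrable (lebesgue_on P) f" if "continuous_on UNIV f" for f :: "real^2 \<Rightarrow> real"
      using that bP lme by (intro integrable_continuous_bounded) auto
    have cup: "continuous_on UNIV (\<lambda>x. u (p x))" and cGp: "continuous_on UNIV (\<lambda>x. G (p x) \<bullet> v)"
      by (auto intro!: continuous_on_compose2[OF cu cp] continuous_on_inner continuous_on_compose2[OF cG cp])
    have near: "p x \<in> ?C" "x \<in> ?C" "\<bar>u x - u (p x)\<bar> \<le> \<eta>" "norm (G (p x) - G x) \<le> \<eta>" if x: "x \<in> P" for x
    proof -
      have "p x - x = (c0 - x \<bullet> rot2 v) *\<^sub>R rot2 v"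
        using frame2_decompose[OF v, of x] unfolding p_def frame2_def
        by (simp add: algebra_simps)
      then have "norm (p x - x) = \<bar>c0 - x \<bullet> rot2 v\<bar>" using v by simp
      also have "\<dots> \<le> width P (rot2 v)"
        using inner_Sup_Inf[OF bP x, of "rot2 v"] inner_Sup_Inf[OF bP y0, of "rot2 v"]
        unfolding width_def c0_def by linarith
      finally have d: "norm (p x - x) < \<epsilon>" using w by simp
      show xC: "x \<in> ?C" using x P(4) by (auto simp: subset_iff intro: order_trans[of _ \<rho>])
      have "norm (p x) \<le> norm x + norm (p x - x)" using norm_triangle_ineq[of x "p x - x"] by simp
      then show pC: "p x \<in> ?C" using d x P(4) by (auto simp: \<epsilon>_def subset_iff)
      show "\<bar>u x - u (p x)\<bar> \<le> \<eta>" using e(2)[OF xC pC] d by (auto simp: \<epsilon>_def dist_norm abs_minus_commute)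
      show "norm (G (p x) - G x) \<le> \<eta>" using e(4)[OF xC pC] d by (auto simp: \<epsilon>_def dist_norm)
    qed
    have 1: "K\<^sup>2 * ((LINT x|lebesgue_on P. (u (p x))\<^sup>2) * A - (LINT x|lebesgue_on P. u (p x))\<^sup>2)
      \<le> (LINT x|lebesgue_on P. (G (p x) \<bullet> v)\<^sup>2) * A"
      unfolding A_def K_def p_def
    proof (rule pw_strip[OF u P(1,2) bP P(3) v D])
      fix x y assume "x \<in> P" "y \<in> P"
      then show "(x - y) \<bullet> v \<le> D" using norm_cauchy_schwarz[of "x - y" v] diam[of x y] v by simp
    qed
    have 2: "(LINT x|lebesgue_on P. (u x)\<^sup>2) \<le> (LINT x|lebesgue_on P. (u (p x))\<^sup>2) + A * (2 * B * \<eta>)"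
    proof -
      have "(LINT x|lebesgue_on P. (u x)\<^sup>2 - (u (p x))\<^sup>2) \<le> A * (2 * B * \<eta>)"
        unfolding A_def
      proof (rule integral_abs_le_const[OF lme])
        fix x assume x: "x \<in> P"
        have "(u x)\<^sup>2 - (u (p x))\<^sup>2 \<le> \<bar>(u x + u (p x)) * (u x - u (p x))\<bar>"
          by (simp add: power2_eq_square algebra_simps)
        also have "\<dots> \<le> (2 * B) * \<eta>" unfolding abs_mult
          using near[OF x] B(2)[of x] B(2)[of "p x"] B(1) by (intro mult_mono) auto
        finally show "(u x)\<^sup>2 - (u (p x))\<^sup>2 \<le> 2 * B * \<eta>" .
      qed (intro int continuous_intros cu cup)
      moreover have "(LINT x|lebesgue_on P. (u x)\<^sup>2 - (u (p x))\<^sup>2) = (LINT x|lebesgue_on P. (u x)\<^sup>2) - (LINT x|lebesgue_on P. (u (p x))\<^sup>2)"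
        by (intro Bochner_Integration.integral_diff int continuous_intros cu cup)
      ultimately show ?thesis by simp
    qed
    have 3: "(LINT x|lebesgue_on P. (G (p x) \<bullet> v)\<^sup>2) \<le> (LINT x|lebesgue_on P. (norm (G x))\<^sup>2) + A * (2 * B * \<eta>)"
    proof -
      have "(LINT x|lebesgue_on P. (G (p x) \<bullet> v)\<^sup>2 - (norm (G x))\<^sup>2) \<le> A * (2 * B * \<eta>)"
        unfolding A_def
      proof (rule integral_abs_le_const[OF lme])
        fix x assume x: "x \<in> P"
        have "(G (p x) \<bullet> v)\<^sup>2 \<le> (norm (G (p x)))\<^sup>2"
          using Cauchy_Schwarz_ineq2[of "G (p x)" v] v by (intro abs_le_square_iff[THEN iffD1]) simp
        then have "(G (p x) \<bullet> v)\<^sup>2 - (norm (G x))\<^sup>2 \<le> \<bar>(norm (G (p x)) + norm (G x)) * (norm (G (p x)) - norm (G x))\<bar>"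
          by (simp add: power2_eq_square algebra_simps)
        also have "\<dots> \<le> (2 * B) * \<eta>" unfolding abs_mult
        proof (rule mult_mono)
          show "\<bar>norm (G (p x)) - norm (G x)\<bar> \<le> \<eta>" using near(4)[OF x] norm_triangle_ineq3[of "G (p x)" "G x"] by linarith
        qed (use near[OF x] B(3)[of x] B(3)[of "p x"] B(1) in auto)
        finally show "(G (p x) \<bullet> v)\<^sup>2 - (norm (G x))\<^sup>2 \<le> 2 * B * \<eta>" .
      qed (intro int continuous_intros cG cGp)
      moreover have "(LINT x|lebesgue_on P. (G (p x) \<bullet> v)\<^sup>2 - (norm (G x))\<^sup>2) = (LINT x|lebesgue_on P. (G (p x) \<bullet> v)\<^sup>2) - (LINT x|lebesgue_on P. (norm (G x))\<^sup>2)"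
        by (intro Bochner_Integration.integral_diff int continuous_intros cG cGp)
      ultimately show ?thesis by simp
    qed
    \<comment> \<open>The mean of \<open>u\<close> is 0 on the piece, so that of its projection is
      at most \<open>\<eta>\<close>.\<close>
    have 4: "(LINT x|lebesgue_on P. u (p x))\<^sup>2 \<le> (A * \<eta>)\<^sup>2"
    proof -
      have "(LINT x|lebesgue_on P. u (p x)) = (LINT x|lebesgue_on P. u (p x) - u x)"
        using mean int[OF cup] int[OF cu] by simp
      also have "\<dots> \<le> A * \<eta>" unfolding A_def
        using near(3) by (intro integral_abs_le_const lme int continuous_intros cu cup) (auto simp: abs_le_iff)
      finally have a: "(LINT x|lebesgue_on P. u (p x)) \<le> A * \<eta>" .
      have "- (LINT x|lebesgue_on P. u (p x)) = (LINT x|lebesgue_on P. u x - u (p x))"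
        using mean int[OF cup] int[OF cu] by simp
      also have "\<dots> \<le> A * \<eta>" unfolding A_def
        using near(3) by (intro integral_abs_le_const lme int continuous_intros cu cup) (auto simp: abs_le_iff)
      finally show ?thesis using a A \<eta> by (intro abs_le_square_iff[THEN iffD1]) (simp add: abs_le_iff)
    qed
    let ?u2 = "LINT x|lebesgue_on P. (u x)\<^sup>2" and ?G2 = "LINT x|lebesgue_on P. (norm (G x))\<^sup>2"
    have "K\<^sup>2 * (?u2 - A * (2 * B * \<eta>)) * A \<le> K\<^sup>2 * (LINT x|lebesgue_on P. (u (p x))\<^sup>2) * A"
      using 2 A K by (intro mult_right_mono mult_left_mono) auto
    also have "\<dots> \<le> (LINT x|lebesgue_on P. (G (p x) \<bullet> v)\<^sup>2) * A + K\<^sup>2 * (LINT x|lebesgue_on P. u (p x))\<^sup>2"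
      using 1 by (simp add: algebra_simps)
    also have "\<dots> \<le> (?G2 + A * (2 * B * \<eta>)) * A + K\<^sup>2 * (A * \<eta>)\<^sup>2"
      using 3 4 A K by (intro add_mono mult_right_mono mult_left_mono) auto
    also have "\<dots> = (?G2 + A * (2 * B * \<eta>) + K\<^sup>2 * (A * \<eta>\<^sup>2)) * A" by (simp add: algebra_simps power2_eq_square)
    finally have "K\<^sup>2 * (?u2 - A * (2 * B * \<eta>)) \<le> ?G2 + A * (2 * B * \<eta>) + K\<^sup>2 * (A * \<eta>\<^sup>2)" using A by simp
    then have "?u2 - A * (2 * B * \<eta>) \<le> (?G2 + A * (2 * B * \<eta>) + K\<^sup>2 * (A * \<eta>\<^sup>2)) / K\<^sup>2"
      using K by (simp add: pos_le_divide_eq mult.commute)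
    also have "\<dots> = ?G2 / K\<^sup>2 + A * (2 * B * \<eta>) / K\<^sup>2 + A * \<eta>\<^sup>2" using K by (simp add: add_divide_distrib)
    finally have "?u2 - ?G2 / K\<^sup>2 \<le> A * (\<eta> * (2 * B / K\<^sup>2 + 2 * B) + \<eta> * \<eta>)"
      by (simp add: algebra_simps power2_eq_square)
    also have "\<dots> \<le> A * (\<eta> * c)"
    proof (rule mult_left_mono)
      have "\<eta> * \<eta> \<le> \<eta> * 1" using \<eta> by (intro mult_left_mono) auto
      then show "\<eta> * (2 * B / K\<^sup>2 + 2 * B) + \<eta> * \<eta> \<le> \<eta> * c" by (simp add: c_def algebra_simps)
    qed (use A in simp)
    also have "\<dots> \<le> A * \<delta>" using \<eta> A by (intro mult_left_mono) auto
    finally have fin: "?u2 - ?G2 / K\<^sup>2 \<le> A * \<delta>" .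
    have "(LINT x|lebesgue_on P. pw_defect K u G x) = ?u2 - ?G2 / K\<^sup>2"
      unfolding pw_defect_def
      using K by (subst Bochner_Integration.integral_diff) (auto intro!: int continuous_intros cu cG)
    then show "(LINT x|lebesgue_on P. pw_defect (pi / D) u G x) \<le> measure lebesgue P * \<delta>"
      using fin unfolding K_def A_def by simp
  qed
qed

section \<open>Cutting a convex set in half\<close>

lemma AE_lebesgue_on_negligible:
  assumes "negligible N" "S \<in> sets lebesgue" shows "AE x in lebesgue_on S. x \<notin> N"
proof -
  have "AE x in lebesgue. x \<notin> N" using assms(1) by (intro AE_not_in) (simp add: negligible_iff_null_sets)
  then have "AE x in lebesgue. x \<in> S \<longrightarrow> x \<notin> N" by eventually_elim simp
  then show ?thesis using assms(2) by (simp add: AE_restrict_space_iff)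
qed

lemma integral_lebesgue_on_Int:
  fixes f :: "'a::euclidean_space \<Rightarrow> real"
  assumes "P \<in> sets lebesgue" "H \<in> sets lebesgue"
  shows "(LINT x|lebesgue_on (P \<inter> H). f x) = (LINT x|lebesgue_on P. indicator H x * f x)"
proof -
  have "(LINT x|lebesgue_on P. indicator H x * f x) = (LINT x|lebesgue_on P. (if x \<in> H then f x else 0))"
    by (intro Bochner_Integration.integral_cong) (auto simp: indicator_def)
  also have "\<dots> = (LINT x|lebesgue_on (H \<inter> P). f x)" by (rule Lebesgue_Measure.integral_restrict_Int[OF assms(2,1)])
  finally show ?thesis by (simp add: Int_commute)
qed

lemma integrable_indicator_mult:
  fixes f :: "'a::euclidean_space \<Rightarrow> real"
  assumes "bounded P" "P \<in> sets lebesgue" "open H" "continuous_on UNIV f"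
  shows "integrable (lebesgue_on P) (\<lambda>x. indicator H x * f x)"
proof -
  obtain B where B: "B > 0" "\<And>x. x \<in> P \<Longrightarrow> norm (f x) \<le> B" using bounded_continuous_image assms by metis
  have "(\<lambda>x. indicator H x * f x) \<in> borel_measurable borel"
    using assms(3) borel_measurable_continuous_onI[OF assms(4)]
    by (intro borel_measurable_times borel_measurable_indicator) auto
  then have "(\<lambda>x. indicator H x * f x) \<in> borel_measurable (lebesgue_on P)"
    by (rule borel_measurable_lebesgue_on_borel)
  then show ?thesis
    using assms B by (intro integrable_bounded_lmeasurable[of _ _ B]) (auto simp: bounded_set_imp_lmeasurable indicator_def less_imp_le)
qed

lemma measure_disjoint_le:
  assumes "A \<in> lmeasurable" "B \<in> lmeasurable" "P \<in> lmeasurable" "A \<subseteq> P" "B \<subseteq> P" "A \<inter> B = {}"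
  shows "measure lebesgue A + measure lebesgue B \<le> measure lebesgue P"
proof -
  have "measure lebesgue A + measure lebesgue B = measure lebesgue (A \<union> B)"
    using assms by (simp add: measure_Un3)
  also have "\<dots> \<le> measure lebesgue P"
    using assms by (intro measure_mono_fmeasurable) auto
  finally show ?thesis .
qed

lemma convex_halfspace_open:
  fixes c e :: "'a::euclidean_space"
  shows "open {x. 0 < (x - c) \<bullet> e}" "convex {x. 0 < (x - c) \<bullet> e}"
proof -
  have "{x. 0 < (x - c) \<bullet> e} = {x. e \<bullet> x > e \<bullet> c}" by (auto simp: inner_diff_left inner_commute[of e])
  then show "open {x. 0 < (x - c) \<bullet> e}" "convex {x. 0 < (x - c) \<bullet> e}"
    by (simp_all add: open_halfspace_gt convex_halfspace_gt)
qed

text \<open>The disc of radius \<open>r / 2\<close> that touches the line from the discarded side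
  lies in \<open>ball c r\<close>. Its area is lost in every cut, whatever the direction.\<close>

lemma half_piece:
  fixes P :: "(real^2) set"
  assumes P: "open P" "convex P" "bounded P" and c: "ball c r \<subseteq> P" "r > 0" and e: "norm e = 1"
  shows "P \<inter> {x. 0 < (x - c) \<bullet> e} \<noteq> {}"
    "measure lebesgue (P \<inter> {x. 0 < (x - c) \<bullet> e}) \<le> measure lebesgue P - measure lebesgue (ball (0 :: real^2) (r / 2))"
proof -
  have ee: "e \<bullet> e = 1" using e by (simp add: dot_square_norm)
  have "c + (r / 2) *\<^sub>R e \<in> P" using c e by (intro subsetD[OF c(1)]) (auto simp: dist_norm)
  then show "P \<inter> {x. 0 < (x - c) \<bullet> e} \<noteq> {}" using c(2) ee by (auto intro!: exI[of _ "c + (r / 2) *\<^sub>R e"])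
  let ?B = "ball (c - (r / 2) *\<^sub>R e) (r / 2)"
  have "measure lebesgue (P \<inter> {x. 0 < (x - c) \<bullet> e}) + measure lebesgue ?B \<le> measure lebesgue P"
  proof (rule measure_disjoint_le)
    show "P \<inter> {x. 0 < (x - c) \<bullet> e} \<in> lmeasurable" "P \<in> lmeasurable"
      using P convex_halfspace_open[of c e] by (auto intro!: lmeasurable_open)
    show "?B \<subseteq> P"
    proof
      fix y assume "y \<in> ?B"
      then have "norm (c - (r / 2) *\<^sub>R e - y) < r / 2" by (simp add: dist_norm)
      moreover have "norm (c - y) \<le> norm (c - (r / 2) *\<^sub>R e - y) + norm ((r / 2) *\<^sub>R e)"
        using norm_triangle_ineq[of "c - (r / 2) *\<^sub>R e - y" "(r / 2) *\<^sub>R e"] by (simp add: algebra_simps)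
      ultimately show "y \<in> P" using c e by (intro subsetD[OF c(1)]) (auto simp: dist_norm)
    qed
    show "P \<inter> {x. 0 < (x - c) \<bullet> e} \<inter> ?B = {}"
    proof safe
      fix y assume y: "0 < (y - c) \<bullet> e" "y \<in> ?B"
      have "(y - (c - (r / 2) *\<^sub>R e)) \<bullet> e \<le> norm (y - (c - (r / 2) *\<^sub>R e)) * norm e" by (rule norm_cauchy_schwarz)
      also have "\<dots> < r / 2" using y(2) e by (simp add: dist_norm norm_minus_commute)
      finally show "y \<in> {}" using y(1) ee by (simp add: inner_diff_left)
    qed
  qed auto
  moreover have "measure lebesgue ?B = measure lebesgue (ball (0 :: real^2) (r / 2))"
    using c(2) by (simp add: content_ball)
  ultimately show "measure lebesgue (P \<inter> {x. 0 < (x - c) \<bullet> e}) \<le> measure lebesgue P - measure lebesgue (ball (0 :: real^2) (r / 2))"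
    by simp
qed

text \<open>Rotating a line through \<open>c\<close> by \<open>\<pi>\<close> exchanges the two halves, so some direction splits the integral of
  \<open>u\<close> evenly.\<close>

lemma balanced_cut:
  fixes P :: "(real^2) set" and u h :: "real^2 \<Rightarrow> real"
  assumes P: "open P" "convex P" "bounded P" and c: "ball c r \<subseteq> P" "r > 0"
    and cu: "continuous_on UNIV u" and ch: "continuous_on UNIV h"
    and mean: "(LINT x|lebesgue_on P. u x) = 0" and hP: "measure lebesgue P * \<delta> \<le> (LINT x|lebesgue_on P. h x)"
  obtains P' where "open P'" "convex P'" "P' \<noteq> {}" "P' \<subseteq> P" "(LINT x|lebesgue_on P'. u x) = 0"
    "measure lebesgue P' * \<delta> \<le> (LINT x|lebesgue_on P'. h x)"
    "measure lebesgue P' \<le> measure lebesgue P - measure lebesgue (ball (0 :: real^2) (r / 2))"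
proof -
  define e where "e \<theta> = (vector [cos \<theta>, sin \<theta>] :: real^2)" for \<theta> :: real
  define H where "H \<theta> = {x. 0 < (x - c) \<bullet> e \<theta>}" for \<theta>
  have ne: "norm (e \<theta>) = 1" for \<theta>
    by (simp add: e_def norm_eq_1 inner_real2 flip: power2_eq_square)
  have lme: "P \<in> lmeasurable" "P \<in> sets lebesgue" using P by (auto intro: lmeasurable_open)
  have oH: "open (H \<theta>)" "convex (H \<theta>)" "H \<theta> \<in> sets lebesgue" for \<theta>
    using convex_halfspace_open[of c "e \<theta>"] by (auto simp: H_def)
  have neg: "AE x in lebesgue_on P. (x - c) \<bullet> e \<theta> \<noteq> 0" for \<theta>
  proof -
    have "negligible {x. e \<theta> \<bullet> x = e \<theta> \<bullet> c}" using ne[of \<theta>] by (intro negligible_hyperplane) auto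
    from AE_lebesgue_on_negligible[OF this lme(2)] show ?thesis
      by eventually_elim (auto simp: inner_diff_left inner_commute[of "e \<theta>"])
  qed
  have e_pi: "e (\<theta> + pi) = - e \<theta>" for \<theta> by (simp add: e_def vec_eq_iff forall_2)
  have split: "(LINT x|lebesgue_on P. f x) = (LINT x|lebesgue_on (P \<inter> H \<theta>). f x) + (LINT x|lebesgue_on (P \<inter> H (\<theta> + pi)). f x)"
    if f: "continuous_on UNIV f" for f :: "real^2 \<Rightarrow> real" and \<theta>
  proof -
    have int: "integrable (lebesgue_on P) (\<lambda>x. indicator (H \<theta>) x * f x)" for \<theta>
      by (rule integrable_indicator_mult[OF P(3) lme(2) oH(1) f])
    have "(LINT x|lebesgue_on P. f x) = (LINT x|lebesgue_on P. indicator (H \<theta>) x * f x + indicator (H (\<theta> + pi)) x * f x)"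
    proof (rule integral_cong_AE)
      show "AE x in lebesgue_on P. f x = indicator (H \<theta>) x * f x + indicator (H (\<theta> + pi)) x * f x"
        using neg[of \<theta>] by eventually_elim (auto simp: H_def e_pi indicator_def)
    qed (use int[of \<theta>] int[of "\<theta> + pi"] f in \<open>auto intro: lebesgue_on_measurable_continuous borel_measurable_integrable\<close>)
    also have "\<dots> = (LINT x|lebesgue_on P. indicator (H \<theta>) x * f x) + (LINT x|lebesgue_on P. indicator (H (\<theta> + pi)) x * f x)"
      by (rule Bochner_Integration.integral_add[OF int int])
    finally show ?thesis by (simp only: integral_lebesgue_on_Int[OF lme(2) oH(3)])
  qed
  define g where "g \<theta> = (LINT x|lebesgue_on P. indicator (H \<theta>) x * u x)" for \<theta>
  \<comment> \<open>A point off the line keeps its side under small rotations, and the line itself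
    is a null set; so the indicators converge almost everywhere.\<close>
  have cont: "isCont g \<theta>" for \<theta>
  proof (rule continuous_at_sequentiallyI)
    fix \<theta>' :: "nat \<Rightarrow> real" assume lim: "\<theta>' \<longlonglongrightarrow> \<theta>"
    obtain B where B: "B > 0" "\<And>x. x \<in> P \<Longrightarrow> norm (u x) \<le> B" using bounded_continuous_image[OF P(3) cu] by metis
    interpret finite_measure "lebesgue_on P" using lme(1) by (rule finite_measure_lebesgue_on)
    show "(\<lambda>n. g (\<theta>' n)) \<longlonglongrightarrow> g \<theta>"
      unfolding g_def
    proof (rule integral_dominated_convergence[where w="\<lambda>_. B"])
      show "AE x in lebesgue_on P. (\<lambda>n. indicator (H (\<theta>' n)) x * u x) \<longlonglongrightarrow> indicator (H \<theta>) x * u x"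
        using neg[of \<theta>]
      proof eventually_elim
        fix x assume x: "(x - c) \<bullet> e \<theta> \<noteq> 0"
        have e_inner: "(x - c) \<bullet> e t = (x - c) $ 1 * cos t + (x - c) $ 2 * sin t" for t by (simp add: e_def inner_real2)
        have L: "(\<lambda>n. (x - c) \<bullet> e (\<theta>' n)) \<longlonglongrightarrow> (x - c) \<bullet> e \<theta>"
          unfolding e_inner by (intro tendsto_intros lim)
        have "\<forall>\<^sub>F n in sequentially. indicator (H \<theta>) x * u x = indicator (H (\<theta>' n)) x * u x"
        proof (cases "0 < (x - c) \<bullet> e \<theta>")
          case True
          show ?thesis using order_tendstoD(1)[OF L True] by eventually_elim (use True in \<open>simp add: H_def\<close>)
        next
          case False
          then have "(x - c) \<bullet> e \<theta> < 0" using x by simp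
          from order_tendstoD(2)[OF L this] show ?thesis
            by eventually_elim (use False in \<open>simp add: H_def\<close>)
        qed
        then show "(\<lambda>n. indicator (H (\<theta>' n)) x * u x) \<longlonglongrightarrow> indicator (H \<theta>) x * u x"
          by (rule Lim_transform_eventually[OF tendsto_const])
      qed
      show "AE x in lebesgue_on P. norm (indicator (H (\<theta>' n)) x * u x) \<le> B" for n
        using B by (intro AE_I2) (auto simp: indicator_def less_imp_le)
    qed (use integrable_indicator_mult[OF P(3) lme(2) oH(1) cu] in \<open>auto intro: borel_measurable_integrable\<close>)
  qed
  have geq: "g \<theta> = (LINT x|lebesgue_on (P \<inter> H \<theta>). u x)" for \<theta>
    unfolding g_def integral_lebesgue_on_Int[OF lme(2) oH(3)] ..
  have anti: "g (\<theta> + pi) = - g \<theta>" for \<theta> using split[OF cu, of \<theta>] mean by (simp add: geq)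
  have "\<exists>\<theta>. g \<theta> = 0"
  proof (cases "g 0 \<le> 0")
    case True
    then show ?thesis using IVT[of g 0 0 pi] anti[of 0] cont by auto
  next
    case False
    then show ?thesis using IVT2[of g pi 0 0] anti[of 0] cont by auto
  qed
  then obtain \<theta> where \<theta>: "g \<theta> = 0" by blast
  have sum: "measure lebesgue P = measure lebesgue (P \<inter> H \<theta>) + measure lebesgue (P \<inter> H (\<theta> + pi))"
  proof -
    have l: "P \<inter> H t \<in> lmeasurable" for t using P oH by (intro lmeasurable_open) auto
    show ?thesis using split[of "\<lambda>_. 1" \<theta>]
      unfolding measure_lebesgue_on_const[OF lme(1)] measure_lebesgue_on_const[OF l] by simp
  qed
  \<comment> \<open>Area and integral of \<open>h\<close> are additive over the two halves, so at
    least one half inherits the inequality.\<close>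
  have "\<exists>t. g t = 0 \<and> measure lebesgue (P \<inter> H t) * \<delta> \<le> (LINT x|lebesgue_on (P \<inter> H t). h x)"
  proof (rule ccontr)
    assume "\<not> ?thesis"
    then have n: "\<not> measure lebesgue (P \<inter> H \<theta>) * \<delta> \<le> (LINT x|lebesgue_on (P \<inter> H \<theta>). h x)"
      "\<not> measure lebesgue (P \<inter> H (\<theta> + pi)) * \<delta> \<le> (LINT x|lebesgue_on (P \<inter> H (\<theta> + pi)). h x)"
      using \<theta> anti[of \<theta>] by auto
    then show False using hP unfolding split[OF ch, of \<theta>] sum by (simp add: distrib_right)
  qed
  then obtain t where t: "g t = 0" "measure lebesgue (P \<inter> H t) * \<delta> \<le> (LINT x|lebesgue_on (P \<inter> H t). h x)" by blast
  show thesis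
    by (rule that[of "P \<inter> H t"])
      (use t geq P oH half_piece[OF P c ne[of t]] in \<open>auto simp: H_def intro: convex_Int\<close>)
qed

text \<open>If the inequality failed, repeated cuts would produce convex pieces violating it by a fixed margin
  whose area drops by a fixed amount as long as all their widths are bounded below.\<close>

lemma payne_weinberger_smooth_mean_zero:
  fixes \<Omega> :: "(real^2) set"
  assumes u: "C1_grad u G" and \<Omega>: "open \<Omega>" "convex \<Omega>" "bounded \<Omega>" "\<Omega> \<noteq> {}"
    and D: "D > 0" "\<And>x y. x \<in> \<Omega> \<Longrightarrow> y \<in> \<Omega> \<Longrightarrow> norm (x - y) \<le> D"
    and mean: "(LINT x|lebesgue_on \<Omega>. u x) = 0"
  shows "(LINT x|lebesgue_on \<Omega>. pw_defect (pi / D) u G x) \<le> 0"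
proof (rule ccontr)
  let ?h = "pw_defect (pi / D) u G"
  assume neg: "\<not> ?thesis"
  have cu: "continuous_on UNIV u" and ch: "continuous_on UNIV ?h"
    using u C1_grad_continuous[OF u] D(1) unfolding pw_defect_def by (auto simp: C1_grad_def intro!: continuous_intros)
  have A: "measure lebesgue \<Omega> > 0" by (rule measure_pos_open[OF \<Omega>(1,3,4)])
  \<comment> \<open>The mean defect of \<Omega>. Every piece produced below has at least this mean,
    whereas a thin piece has at most half of it.\<close>
  define \<delta> where "\<delta> = (LINT x|lebesgue_on \<Omega>. ?h x) / measure lebesgue \<Omega>"
  have \<delta>: "\<delta> > 0" using neg A by (simp add: \<delta>_def)
  obtain \<rho> where "\<And>x. x \<in> \<Omega> \<Longrightarrow> norm x \<le> \<rho>" using \<Omega>(3) unfolding bounded_iff by auto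
  then have \<rho>: "\<Omega> \<subseteq> cball 0 \<rho>" by auto
  obtain \<epsilon> where E: "0 < \<epsilon> \<and> (\<forall>P v. open P \<and> convex P \<and> P \<noteq> {} \<and> P \<subseteq> cball 0 \<rho> \<and> (\<forall>x\<in>P. \<forall>y\<in>P. norm (x - y) \<le> D) \<and>
       norm v = 1 \<and> width P (rot2 v) < \<epsilon> \<and> (LINT x|lebesgue_on P. u x) = 0 \<longrightarrow>
     (LINT x|lebesgue_on P. ?h x) \<le> measure lebesgue P * (\<delta> / 2))"
    using pw_thin[OF u half_gt_zero[OF \<delta>] D(1), of \<rho>] by (rule exE)
  note \<epsilon> = E[THEN conjunct1] and thin = E[THEN conjunct2, THEN spec, THEN spec, THEN mp]
  \<comment> \<open>A piece of all widths at least \<open>\<epsilon>\<close> contains a disc of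
    radius \<open>\<epsilon> / 3\<close>; a cut through its centre removes a disc of half that
    radius.\<close>
  define \<kappa> where "\<kappa> = measure lebesgue (ball (0 :: real^2) (\<epsilon> / 3 / 2))"
  have \<kappa>: "\<kappa> > 0" unfolding \<kappa>_def using \<epsilon> by (intro measure_pos_open) auto
  have ex: "\<exists>P. open P \<and> convex P \<and> P \<noteq> {} \<and> P \<subseteq> \<Omega> \<and> (LINT x|lebesgue_on P. u x) = 0 \<and>
      measure lebesgue P * \<delta> \<le> (LINT x|lebesgue_on P. ?h x) \<and> measure lebesgue P \<le> measure lebesgue \<Omega> - real n * \<kappa>" for n
  proof (induction n)
    case 0
    show ?case using \<Omega> mean A by (intro exI[of _ \<Omega>]) (auto simp: \<delta>_def)
  next
    case (Suc n)
    then obtain P where P: "open P" "convex P" "P \<noteq> {}" "P \<subseteq> \<Omega>" "(LINT x|lebesgue_on P. u x) = 0"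
      "measure lebesgue P * \<delta> \<le> (LINT x|lebesgue_on P. ?h x)" "measure lebesgue P \<le> measure lebesgue \<Omega> - real n * \<kappa>" by blast
    have bP: "bounded P" using P(4) \<Omega>(3) bounded_subset by blast
    have Apos: "measure lebesgue P > 0" by (rule measure_pos_open[OF P(1) bP P(3)])
    have "\<epsilon> \<le> width P v" if v: "norm v = 1" for v
    proof (rule ccontr)
      assume "\<not> \<epsilon> \<le> width P v"
      moreover have "rot2 (- rot2 v) = v" by (simp add: vec_eq_iff forall_2)
      ultimately have "width P (rot2 (- rot2 v)) < \<epsilon>" by simp
      moreover have "\<forall>x\<in>P. \<forall>y\<in>P. norm (x - y) \<le> D" using P(4) D(2) by blast
      moreover have "norm (- rot2 v) = 1" using v by simp
      moreover have "P \<subseteq> cball 0 \<rho>" using P(4) \<rho> by blast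
      ultimately have "(LINT x|lebesgue_on P. ?h x) \<le> measure lebesgue P * (\<delta> / 2)"
        using P(1-3,5) by (intro thin[of P "- rot2 v"] conjI)
      then have "measure lebesgue P * \<delta> \<le> measure lebesgue P * (\<delta> / 2)" using P(6) by linarith
      then show False using Apos \<delta> by simp
    qed
    then obtain c where "ball c (\<epsilon> / 3) \<subseteq> P" using width_ball[OF P(1,2) bP P(3)] by blast
    then obtain P' where "open P'" "convex P'" "P' \<noteq> {}" "P' \<subseteq> P" "(LINT x|lebesgue_on P'. u x) = 0"
      "measure lebesgue P' * \<delta> \<le> (LINT x|lebesgue_on P'. ?h x)" "measure lebesgue P' \<le> measure lebesgue P - \<kappa>"
      using balanced_cut[OF P(1,2) bP _ _ cu ch P(5,6), of c "\<epsilon> / 3"] \<epsilon> unfolding \<kappa>_def by auto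
    then show ?case using P by (intro exI[of _ P']) (auto simp: algebra_simps)
  qed
  obtain n where "measure lebesgue \<Omega> < real n * \<kappa>" using reals_Archimedean3[OF \<kappa>] by blast
  moreover obtain P :: "(real^2) set" where "measure lebesgue P \<le> measure lebesgue \<Omega> - real n * \<kappa>"
    using ex[of n] by blast
  ultimately have "measure lebesgue P < 0" by linarith
  then show False using measure_nonneg[of lebesgue P] by linarith
qed

text \<open>Subtracting the mean gives the variance form. It has no side condition, so it applies to
  approximants whose mean is not controlled.\<close>

lemma payne_weinberger_smooth:
  fixes \<Omega> :: "(real^2) set"
  assumes u: "C1_grad u G" and \<Omega>: "open \<Omega>" "convex \<Omega>" "bounded \<Omega>" "\<Omega> \<noteq> {}"
    and D: "D > 0" "\<And>x y. x \<in> \<Omega> \<Longrightarrow> y \<in> \<Omega> \<Longrightarrow> norm (x - y) \<le> D"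
  shows "(pi / D)\<^sup>2 * ((LINT x|lebesgue_on \<Omega>. (u x)\<^sup>2) - (LINT x|lebesgue_on \<Omega>. u x)\<^sup>2 / measure lebesgue \<Omega>)
    \<le> (LINT x|lebesgue_on \<Omega>. (norm (G x))\<^sup>2)"
proof -
  let ?A = "measure lebesgue \<Omega>" and ?K = "pi / D"
  have A: "?A > 0" by (rule measure_pos_open[OF \<Omega>(1,3,4)])
  have lme: "\<Omega> \<in> lmeasurable" "\<Omega> \<in> sets lebesgue" using \<Omega> by (auto intro: lmeasurable_open)
  have cu: "continuous_on UNIV u" and cG: "continuous_on UNIV G"
    using u C1_grad_continuous by (auto simp: C1_grad_def)
  have int: "integrable (lebesgue_on \<Omega>) f" if "continuous_on UNIV f" for f :: "real^2 \<Rightarrow> real"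
    using that \<Omega> lme by (intro integrable_continuous_bounded) auto
  define I where "I = (LINT x|lebesgue_on \<Omega>. u x)"
  define m where "m = I / ?A"
  have mA: "?A * m = I" using A by (simp add: m_def)
  have C: "C1_grad (\<lambda>x. u x + (- m)) (\<lambda>x. G x + 0)" by (rule C1_grad_add[OF u C1_grad_const])
  have mean: "(LINT x|lebesgue_on \<Omega>. u x + (- m)) = 0"
    using mA by (subst Bochner_Integration.integral_add)
      (auto intro: int cu simp: measure_lebesgue_on_const[OF lme(1)] I_def[symmetric] simp del: integral_const lebesgue_integral_const)
  have "(LINT x|lebesgue_on \<Omega>. pw_defect ?K (\<lambda>x. u x + (- m)) (\<lambda>x. G x + 0) x)
      = (LINT x|lebesgue_on \<Omega>. ((u x)\<^sup>2 - 2 * m * u x) + (m\<^sup>2 - (norm (G x))\<^sup>2 / ?K\<^sup>2))"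
    unfolding pw_defect_def by (intro Bochner_Integration.integral_cong) (auto simp: power2_eq_square algebra_simps)
  also have "\<dots> = ((LINT x|lebesgue_on \<Omega>. (u x)\<^sup>2) - 2 * m * I) + (?A * m\<^sup>2 - (LINT x|lebesgue_on \<Omega>. (norm (G x))\<^sup>2) / ?K\<^sup>2)"
  proof -
    have i: "integrable (lebesgue_on \<Omega>) (\<lambda>x. (u x)\<^sup>2)" "integrable (lebesgue_on \<Omega>) (\<lambda>x. 2 * m * u x)"
      "integrable (lebesgue_on \<Omega>) (\<lambda>x. m\<^sup>2)" "integrable (lebesgue_on \<Omega>) (\<lambda>x. (norm (G x))\<^sup>2 / ?K\<^sup>2)"
      using D(1) by (auto intro!: int continuous_intros cu cG)
    show ?thesis
      unfolding Bochner_Integration.integral_add[OF Bochner_Integration.integrable_diff[OF i(1,2)] Bochner_Integration.integrable_diff[OF i(3,4)]]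
        Bochner_Integration.integral_diff[OF i(1,2)] Bochner_Integration.integral_diff[OF i(3,4)] measure_lebesgue_on_const[OF lme(1)] I_def
      by simp
  qed
  also have "\<dots> = (LINT x|lebesgue_on \<Omega>. (u x)\<^sup>2) - I\<^sup>2 / ?A - (LINT x|lebesgue_on \<Omega>. (norm (G x))\<^sup>2) / ?K\<^sup>2"
    using A by (simp add: m_def power2_eq_square)
  finally have "(LINT x|lebesgue_on \<Omega>. (u x)\<^sup>2) - I\<^sup>2 / ?A \<le> (LINT x|lebesgue_on \<Omega>. (norm (G x))\<^sup>2) / ?K\<^sup>2"
    using payne_weinberger_smooth_mean_zero[OF C \<Omega> D mean] by simp
  moreover have "?K\<^sup>2 > 0" using D(1) by simp
  ultimately show ?thesis unfolding I_def[symmetric] by (simp only: pos_le_divide_eq mult.commute)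
qed

section \<open>Mollification\<close>

lemma bump_le_1: "bump a r x \<le> 1"
  by (simp add: bump_def flat_exp_def)

lemma bump_diff: "bump 0 r (x - y) = bump x r y" "bump 0 r (x - y) = bump y r x"
  by (simp_all add: bump_def norm_minus_commute)

lemma bump_C1: "C1_grad (bump a r) (grad (bump a r))"
  by (rule Ck_imp_C1_grad[of 0, OF Ck_bump])

lemma bump_continuous: "continuous_on UNIV (bump a r)"
  by (rule C1_grad_continuous[OF bump_C1])

lemma bump_grad_continuous: "continuous_on UNIV (grad (bump a r))"
  using bump_C1 by (auto simp: C1_grad_def)

lemma bump_grad_support:
  assumes "r > 0" "x \<notin> cball a r" shows "grad (bump a r) x = 0"
  by (rule C1_grad_support[OF bump_C1, of "cball a r"]) (use assms in \<open>auto intro: bump_eq_0\<close>)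

lemma bump_grad_uniform:
  fixes a :: "'a::euclidean_space"
  assumes r: "r > 0" and e: "e > 0"
  obtains d where "d > 0" "\<And>z w. norm (w - z) < d \<Longrightarrow> norm (grad (bump a r) w - grad (bump a r) z) \<le> e"
proof -
  have "uniformly_continuous_on (cball a (r + 1)) (grad (bump a r))"
    by (intro compact_uniformly_continuous continuous_on_subset[OF bump_grad_continuous]) auto
  then obtain d where d: "d > 0" "\<And>x x'. x \<in> cball a (r + 1) \<Longrightarrow> x' \<in> cball a (r + 1) \<Longrightarrow> dist x' x < d \<Longrightarrow> dist (grad (bump a r) x') (grad (bump a r) x) < e"
    unfolding uniformly_continuous_on_def using e by metis
  show thesis
  proof (rule that[of "min d 1"])
    fix z w :: 'a assume zw: "norm (w - z) < min d 1"
    show "norm (grad (bump a r) w - grad (bump a r) z) \<le> e"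
    proof (cases "z \<in> cball a r \<or> w \<in> cball a r")
      case True
      have "dist a z \<le> dist a w + dist w z" "dist a w \<le> dist a z + dist z w" by (rule dist_triangle)+
      then have "z \<in> cball a (r + 1)" "w \<in> cball a (r + 1)"
        using True zw by (auto simp: dist_norm norm_minus_commute)
      then show ?thesis using d(2)[of z w] zw by (simp add: dist_norm less_imp_le)
    next
      case False
      then have "grad (bump a r) w = 0" "grad (bump a r) z = 0" by (auto intro!: bump_grad_support[OF r])
      then show ?thesis using e by simp
    qed
  qed (use d in auto)
qed

lemma bump_integrable: "r > 0 \<Longrightarrow> integrable lborel (bump a r)"
  by (rule integrable_compact_support[OF bump_continuous, of "cball a r"]) (auto intro: bump_eq_0)

text \<open>The type argument records the dimension, which \<open>r\<close> alone does not
  determine.\<close>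

definition bump_mass :: "'a::euclidean_space itself \<Rightarrow> real \<Rightarrow> real" where
  "bump_mass _ r = (LINT x|lborel. bump (0::'a) r x)"

lemma bump_mass_translate:
  "(LINT y|lborel. bump x r y) = bump_mass TYPE('a) r" for x :: "'a::euclidean_space"
proof -
  have "(LINT y|lborel. bump x r y) = (LINT y|lborel. bump 0 r (- x + y))"
    by (simp add: bump_def)
  also have "\<dots> = (LINT y|lborel. bump (0::'a) r y)"
    using integral_lborel_translate[OF borel_measurable_continuous_onI[OF bump_continuous[of "0::'a" r]], of "- x"] by simp
  finally show ?thesis by (simp add: bump_mass_def)
qed

lemma bump_mass_pos: assumes r: "r > 0" shows "bump_mass TYPE('a::euclidean_space) r > 0"
proof -
  let ?c = "exp (- (1 / (r\<^sup>2 - (r / 2)\<^sup>2)))" and ?B = "ball (0::'a) (r / 2)"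
  have "(LINT x|lborel. indicator ?B x * ?c) \<le> (LINT x|lborel. bump (0::'a) r x)"
  proof (rule integral_mono)
    show "integrable lborel (\<lambda>x. indicator ?B x * ?c)" 
      using emeasure_bounded_finite[OF bounded_ball, of "0::'a" "r / 2"]
      by (intro integrable_mult_left integrable_real_indicator) auto
    show "indicator ?B x * ?c \<le> bump 0 r x" for x :: 'a
    proof (cases "x \<in> ?B")
      case True
      then have n: "(norm x)\<^sup>2 \<le> (r / 2)\<^sup>2" by (intro power_mono) auto
      have p: "0 < r\<^sup>2 - (r / 2)\<^sup>2" using r by (simp add: power2_eq_square field_simps)
      have "1 / (r\<^sup>2 - (norm x)\<^sup>2) \<le> 1 / (r\<^sup>2 - (r / 2)\<^sup>2)" using n p by (intro divide_left_mono mult_pos_pos) auto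
      then show ?thesis using True n p by (simp add: bump_def flat_exp_def)
    qed (simp add: bump_nonneg)
  qed (rule bump_integrable[OF r])
  moreover have "(LINT x|lborel. indicator ?B x * ?c) > 0"
    using r content_ball_pos[of "r / 2" "0::'a"] by simp
  ultimately show ?thesis by (simp add: bump_mass_def)
qed

lemma bump_integral_on:
  fixes \<Omega> :: "'a::euclidean_space set"
  assumes "open \<Omega>" "r > 0"
  shows "(LINT y|lebesgue_on \<Omega>. bump x r y) \<le> bump_mass TYPE('a) r"
    "ball x r \<subseteq> \<Omega> \<Longrightarrow> (LINT y|lebesgue_on \<Omega>. bump x r y) = bump_mass TYPE('a) r"
proof -
  have m: "bump x r \<in> borel_measurable borel" by (rule borel_measurable_continuous_onI[OF bump_continuous])
  have b: "\<Omega> \<in> sets borel" using assms(1) by simp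
  have e: "(LINT y|lebesgue_on \<Omega>. bump x r y) = (LINT y|lborel. indicator \<Omega> y * bump x r y)"
    by (rule integral_lebesgue_on_borel[OF b m])
  have i: "integrable lborel (\<lambda>y. indicator \<Omega> y * bump x r y)"
    by (rule Bochner_Integration.integrable_bound[OF bump_integrable[OF assms(2), of x]]) (use m b in \<open>auto simp: indicator_def\<close>)
  show "(LINT y|lebesgue_on \<Omega>. bump x r y) \<le> bump_mass TYPE('a) r"
    unfolding e bump_mass_translate[symmetric, of r x]
    by (rule integral_mono[OF i bump_integrable[OF assms(2)]]) (auto simp: indicator_def bump_nonneg)
  assume "ball x r \<subseteq> \<Omega>"
  then have "indicator \<Omega> y * bump x r y = bump x r y" for y
  proof (cases "y \<in> \<Omega>")
    case False
    then have "y \<notin> ball x r" using \<open>ball x r \<subseteq> \<Omega>\<close> by blast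
    then show ?thesis using bump_eq_0[OF assms(2), of y x] by simp
  qed simp
  then show "(LINT y|lebesgue_on \<Omega>. bump x r y) = bump_mass TYPE('a) r"
    unfolding e bump_mass_translate[symmetric, of r x] by (simp only:)
qed

text \<open>Convolution with the unnormalised kernel of the function that is \<open>u\<close> on
  \<Omega> and 0 elsewhere.\<close>

definition smear :: "'a::euclidean_space set \<Rightarrow> real \<Rightarrow> ('a \<Rightarrow> 'b::euclidean_space) \<Rightarrow> 'a \<Rightarrow> 'b" where
  "smear \<Omega> r u x = (LINT y|lebesgue_on \<Omega>. bump x r y *\<^sub>R u y)"

lemma integrable_smear:
  fixes u :: "'a::euclidean_space \<Rightarrow> 'b::euclidean_space"
  assumes "integrable (lebesgue_on \<Omega>) u"
  shows "integrable (lebesgue_on \<Omega>) (\<lambda>y. bump x r y *\<^sub>R u y)"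
proof (rule Bochner_Integration.integrable_bound[OF assms])
  show "(\<lambda>y. bump x r y *\<^sub>R u y) \<in> borel_measurable (lebesgue_on \<Omega>)"
    using assms lebesgue_on_measurable_continuous[OF bump_continuous[of x r], of \<Omega>] by (intro borel_measurable_scaleR) auto
  have "norm (bump x r y *\<^sub>R u y) \<le> norm (u y)" for y
    using bump_le_1[of x r y] bump_nonneg[of x r y] by (simp add: mult_left_le_one_le)
  then show "AE y in lebesgue_on \<Omega>. norm (bump x r y *\<^sub>R u y) \<le> norm (u y)" by simp
qed

text \<open>Differentiation under the integral: the gradient of the kernel is uniformly continuous,
  so the first-order remainder is small uniformly in \<open>y\<close>, and integrability of
  \<open>u\<close> suffices.\<close>

lemma smear_C1:
  fixes u :: "'a::euclidean_space \<Rightarrow> real"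
  assumes r: "r > 0" and u: "integrable (lebesgue_on \<Omega>) u"
  shows "C1_grad (smear \<Omega> r u) (\<lambda>x. LINT y|lebesgue_on \<Omega>. u y *\<^sub>R grad (bump 0 r) (x - y))"
proof -
  let ?b = "bump (0::'a) r" and ?b' = "grad (bump (0::'a) r)" and ?M = "lebesgue_on \<Omega>"
  let ?N = "LINT y|?M. \<bar>u y\<bar>"
  \<comment> \<open>Dividing by \<open>?N + 1\<close>, because the integral of
    \<open>\<bar>u\<bar>\<close> may be 0.\<close>
  have scale: "e / (?N + 1) > 0" "e / (?N + 1) * ?N < e" if "e > 0" for e
  proof -
    have "e / (N + 1) > 0" "e / (N + 1) * N < e" if "N \<ge> 0" for N
      using that \<open>e > 0\<close> by (auto simp: divide_less_eq intro!: divide_pos_pos)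
    from this[of ?N] show "e / (?N + 1) > 0" "e / (?N + 1) * ?N < e" by simp_all
  qed
  have bm: "(\<lambda>y. ?b' (x - y)) \<in> borel_measurable ?M" for x
    by (intro lebesgue_on_measurable_continuous continuous_on_compose2[OF bump_grad_continuous] continuous_intros) auto
  obtain B where B: "\<And>z. norm (?b' z) \<le> B"
  proof -
    obtain B where "B > 0" "\<And>z. z \<in> cball 0 r \<Longrightarrow> norm (?b' z) \<le> B"
      using bounded_continuous_image[OF bounded_cball bump_grad_continuous] by metis
    then show thesis using that bump_grad_support[OF r] by (metis less_imp_le norm_zero)
  qed
  have iG: "integrable ?M (\<lambda>y. u y *\<^sub>R ?b' (x - y))" for x
  proof (rule Bochner_Integration.integrable_bound)
    show "integrable ?M (\<lambda>y. B * norm (u y))" using u by simp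
    show "(\<lambda>y. u y *\<^sub>R ?b' (x - y)) \<in> borel_measurable ?M" using u bm by (intro borel_measurable_scaleR) auto
    have "norm (u y *\<^sub>R ?b' (x - y)) \<le> norm (B * norm (u y))" for y
      using mult_right_mono[OF B, of "\<bar>u y\<bar>" "x - y"] by (simp add: abs_mult mult.commute)
         (metis abs_ge_self mult.commute mult_right_mono abs_ge_zero order_trans)
    then show "AE y in ?M. norm (u y *\<^sub>R ?b' (x - y)) \<le> norm (B * norm (u y))" by simp
  qed
  have iS: "integrable ?M (\<lambda>y. bump x r y *\<^sub>R u y)" for x by (rule integrable_smear[OF u])
  have int_bound: "norm (LINT y|?M. f y) \<le> e * ?N"
    if "integrable ?M f" "\<And>y. norm (f y) \<le> e * \<bar>u y\<bar>" for f :: "'a \<Rightarrow> 'c::euclidean_space" and e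
  proof -
    have "norm (LINT y|?M. f y) \<le> (LINT y|?M. norm (f y))" by (rule integral_norm_bound)
    also have "\<dots> \<le> (LINT y|?M. e * \<bar>u y\<bar>)" using that u by (intro integral_mono) auto
    finally show ?thesis by simp
  qed
  show ?thesis
    unfolding C1_grad_def
  proof (intro conjI allI)
    fix x
    let ?G = "LINT y|?M. u y *\<^sub>R ?b' (x - y)"
    show "(smear \<Omega> r u has_derivative (\<lambda>h. h \<bullet> ?G)) (at x)"
      unfolding has_derivative_at_alt
    proof (intro conjI allI impI)
      show "bounded_linear (\<lambda>h. h \<bullet> ?G)" by (rule bounded_linear_inner_left)
      fix e :: real assume e: "e > 0"
      define e' where "e' = e / (?N + 1)"
      have e': "e' > 0" "e' * ?N \<le> e" using scale[OF e] by (auto simp: e'_def)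
      obtain d where d: "d > 0" "\<And>z w. norm (w - z) < d \<Longrightarrow> norm (?b' w - ?b' z) \<le> e'"
        using bump_grad_uniform[OF r e'(1)] by metis
      show "\<exists>d>0. \<forall>y. norm (y - x) < d \<longrightarrow> norm (smear \<Omega> r u y - smear \<Omega> r u x - (y - x) \<bullet> ?G) \<le> e * norm (y - x)"
      proof (intro exI[of _ d] conjI allI impI d(1))
        fix x' assume x': "norm (x' - x) < d"
        let ?f = "\<lambda>y. bump x' r y *\<^sub>R u y - bump x r y *\<^sub>R u y - (x' - x) \<bullet> (u y *\<^sub>R ?b' (x - y))"
        have pt: "\<bar>bump x' r y - bump x r y - (x' - x) \<bullet> ?b' (x - y)\<bar> \<le> e' * norm (x' - x)" for y
        proof -
          let ?z = "x - y"
          \<comment> \<open>The kernel minus its linear part at \<open>x - y\<close>: its gradient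
            is at most \<open>e'\<close> on the ball of radius \<open>d\<close>, hence so is its
            Lipschitz constant.\<close>
          have C: "C1_grad (\<lambda>w. ?b w + (- 1) * (w \<bullet> ?b' ?z - 0)) (\<lambda>w. ?b' w + (- 1) *\<^sub>R ?b' ?z)"
            by (rule C1_grad_add[OF bump_C1 C1_grad_cmult[OF C1_grad_inner]])
          have "\<bar>(?b (x' - y) + (- 1) * ((x' - y) \<bullet> ?b' ?z - 0)) - (?b ?z + (- 1) * (?z \<bullet> ?b' ?z - 0))\<bar> \<le> e' * norm ((x' - y) - ?z)"
            by (rule C1_grad_lipschitz[OF C, of "ball ?z d"])
              (use d x' in \<open>auto simp: dist_norm norm_minus_commute\<close>)
          then show ?thesis by (simp add: bump_diff(1) inner_diff_left algebra_simps)
        qed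
        have i: "integrable ?M ?f" using iS iG by (intro Bochner_Integration.integrable_diff integrable_inner_right) auto
        have "smear \<Omega> r u x' - smear \<Omega> r u x - (x' - x) \<bullet> ?G = (LINT y|?M. ?f y)"
        proof -
          have iI: "integrable ?M (\<lambda>y. (x' - x) \<bullet> (u y *\<^sub>R ?b' (x - y)))" using iG by (intro integrable_inner_right) auto
          have "(x' - x) \<bullet> ?G = (LINT y|?M. (x' - x) \<bullet> (u y *\<^sub>R ?b' (x - y)))"
            using iG by (intro integral_inner_right[symmetric]) auto
          then show ?thesis unfolding smear_def
            by (simp only: Bochner_Integration.integral_diff[OF Bochner_Integration.integrable_diff[OF iS iS] iI]
                Bochner_Integration.integral_diff[OF iS iS])
        qed
        moreover have "norm (LINT y|?M. ?f y) \<le> (e' * norm (x' - x)) * ?N"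
        proof (rule int_bound[OF i])
          fix y
          have "?f y = (bump x' r y - bump x r y - (x' - x) \<bullet> ?b' (x - y)) * u y" by (simp add: algebra_simps)
          then show "norm (?f y) \<le> e' * norm (x' - x) * \<bar>u y\<bar>" using mult_right_mono[OF pt, of "\<bar>u y\<bar>" y] by (simp add: abs_mult)
        qed
        moreover have "(e' * norm (x' - x)) * ?N \<le> e * norm (x' - x)"
          using mult_right_mono[OF e'(2), of "norm (x' - x)"] by (simp add: mult_ac)
        ultimately show "norm (smear \<Omega> r u x' - smear \<Omega> r u x - (x' - x) \<bullet> ?G) \<le> e * norm (x' - x)" by simp
      qed
    qed
  next
    show "continuous_on UNIV (\<lambda>x. LINT y|?M. u y *\<^sub>R ?b' (x - y))"
      unfolding continuous_on_iff
    proof (intro ballI allI impI)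
      fix x :: 'a and e :: real assume e: "e > 0"
      define e' where "e' = e / (?N + 1)"
      have e': "e' > 0" "e' * ?N < e" using scale[OF e] by (auto simp: e'_def)
      obtain d where d: "d > 0" "\<And>z w. norm (w - z) < d \<Longrightarrow> norm (?b' w - ?b' z) \<le> e'"
        using bump_grad_uniform[OF r e'(1)] by metis
      have "dist (LINT y|?M. u y *\<^sub>R ?b' (x' - y)) (LINT y|?M. u y *\<^sub>R ?b' (x - y)) < e" if "dist x' x < d" for x'
      proof -
        have "norm (LINT y|?M. u y *\<^sub>R ?b' (x' - y) - u y *\<^sub>R ?b' (x - y)) \<le> e' * ?N"
        proof (rule int_bound)
          fix y
          have "norm (?b' (x' - y) - ?b' (x - y)) \<le> e'" using that by (intro d(2)) (simp add: dist_norm)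
          from mult_right_mono[OF this, of "\<bar>u y\<bar>"]
          show "norm (u y *\<^sub>R ?b' (x' - y) - u y *\<^sub>R ?b' (x - y)) \<le> e' * \<bar>u y\<bar>"
            by (simp flip: scaleR_diff_right add: mult.commute)
        qed (use iG in auto)
        then show ?thesis using e'(2) iG by (simp add: dist_norm)
      qed
      then show "\<exists>d>0. \<forall>x'\<in>UNIV. dist x' x < d \<longrightarrow> dist (LINT y|?M. u y *\<^sub>R ?b' (x' - y)) (LINT y|?M. u y *\<^sub>R ?b' (x - y)) < e"
        using d(1) by blast
    qed
  qed
qed

lemma grad_bump_reflect: "grad (bump x r) y = - grad (bump 0 r) (x - y)"
proof (rule grad_eqI)
  have a: "((\<lambda>y. x - y) has_derivative (\<lambda>h. - h)) (at y)" by (auto intro!: derivative_eq_intros)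
  have b: "(bump 0 r has_derivative (\<lambda>h. h \<bullet> grad (bump 0 r) (x - y))) (at (x - y))"
    using bump_C1[of 0 r] unfolding C1_grad_def by blast
  have "((\<lambda>y. bump 0 r (x - y)) has_derivative (\<lambda>h. - h \<bullet> grad (bump 0 r) (x - y))) (at y)"
    by (rule has_derivative_compose[OF a b])
  then show "(bump x r has_derivative (\<lambda>h. h \<bullet> - grad (bump 0 r) (x - y))) (at y)"
    by (simp add: bump_diff(1))
qed

text \<open>Once its closed disc lies in \<Omega>, the kernel around \<open>x\<close> is itself a
  test function, and the weak gradient moves the derivative from it to \<open>u\<close>. The sign
  from the reflection of the kernel cancels the sign from the integration by parts.\<close>

lemma smear_grad_H1:
  assumes H: "H1_with_grad \<Omega> u g" and r: "r > 0" and x: "cball x r \<subseteq> \<Omega>"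
  shows "(LINT y|lebesgue_on \<Omega>. u y *\<^sub>R grad (bump 0 r) (x - y)) = smear \<Omega> r g x"
proof -
  have "(LINT y|lebesgue_on \<Omega>. u y *\<^sub>R grad (bump x r) y) = - (LINT y|lebesgue_on \<Omega>. bump x r y *\<^sub>R g y)"
    using H bump_test_function[OF r x] unfolding H1_with_grad_def by blast
  then show ?thesis unfolding grad_bump_reflect[of x r] by (simp add: smear_def)
qed

lemma square_integrable_on_imp_integrable:
  fixes u :: "'a::euclidean_space \<Rightarrow> 'b::euclidean_space"
  assumes "u square_integrable_on \<Omega>" "\<Omega> \<in> lmeasurable"
  shows "integrable (lebesgue_on \<Omega>) u"
proof (rule Bochner_Integration.integrable_bound)
  interpret finite_measure "lebesgue_on \<Omega>" using assms(2) by (rule finite_measure_lebesgue_on)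
  show "integrable (lebesgue_on \<Omega>) (\<lambda>x. 1 + (norm (u x))\<^sup>2)" using assms(1) by (simp add: square_integrable_on_def)
  show "u \<in> borel_measurable (lebesgue_on \<Omega>)" using assms(1) by (simp add: square_integrable_on_def)
  have "norm (u x) \<le> norm (1 + (norm (u x))\<^sup>2)" for x
  proof -
    have "n \<le> 1 + n\<^sup>2" for n :: real
      using sum_squares_ge_zero[of "n - 1" n] by (simp add: power2_eq_square algebra_simps)
    from this[of "norm (u x)"] have "norm (u x) \<le> 1 + (norm (u x))\<^sup>2" .
    also have "\<dots> \<le> norm (1 + (norm (u x))\<^sup>2)" by (simp only: real_norm_def abs_ge_self)
    finally show ?thesis .
  qed
  then show "AE x in lebesgue_on \<Omega>. norm (u x) \<le> norm (1 + (norm (u x))\<^sup>2)" by simp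
qed

text \<open>Cauchy-Schwarz for the measure with density \<open>bump x r\<close>, whose mass is at
  most \<open>bump_mass\<close>.\<close>

lemma smear_square_le:
  fixes f :: "'a::euclidean_space \<Rightarrow> 'b::euclidean_space"
  assumes f: "f square_integrable_on \<Omega>" and \<Omega>: "\<Omega> \<in> lmeasurable" "open \<Omega>" and r: "r > 0"
  shows "(norm (smear \<Omega> r f x))\<^sup>2 \<le> bump_mass TYPE('a) r * smear \<Omega> r (\<lambda>y. (norm (f y))\<^sup>2) x"
proof -
  let ?M = "lebesgue_on \<Omega>" and ?C = "bump_mass TYPE('a) r"
  have C: "?C > 0" by (rule bump_mass_pos[OF r])
  have i1: "integrable ?M f" by (rule square_integrable_on_imp_integrable[OF f \<Omega>(1)])
  then have i1': "integrable ?M (\<lambda>y. norm (f y))" by simp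
  have i2: "integrable ?M (\<lambda>y. (norm (f y))\<^sup>2)" using f by (simp add: square_integrable_on_def)
  interpret finite_measure ?M using \<Omega>(1) by (rule finite_measure_lebesgue_on)
  have i0: "integrable ?M (\<lambda>y. bump x r y)" using integrable_smear[of \<Omega> "\<lambda>_. 1::real" x r] by simp
  define P where "P = smear \<Omega> r (\<lambda>y. norm (f y)) x"
  define Q where "Q = smear \<Omega> r (\<lambda>y. (norm (f y))\<^sup>2) x"
  define \<beta> where "\<beta> = (LINT y|?M. bump x r y)"
  have \<beta>: "\<beta> \<le> ?C" unfolding \<beta>_def by (rule bump_integral_on(1)[OF \<Omega>(2) r])
  have le: "norm (smear \<Omega> r f x) \<le> P"
  proof -
    have "norm (smear \<Omega> r f x) \<le> (LINT y|?M. norm (bump x r y *\<^sub>R f y))" unfolding smear_def by (rule integral_norm_bound)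
    then show ?thesis by (simp add: P_def smear_def bump_nonneg)
  qed
  define m where "m = P / ?C"
  have mC: "m * ?C = P" using C by (simp add: m_def)
  have j: "integrable ?M (\<lambda>y. bump x r y * (norm (f y))\<^sup>2)" "integrable ?M (\<lambda>y. bump x r y * norm (f y))"
    using integrable_smear[OF i2, of x r] integrable_smear[OF i1', of x r] by simp_all
  have "0 \<le> (LINT y|?M. bump x r y * (norm (f y) - m)\<^sup>2)"
    by (intro integral_nonneg_AE AE_I2) (simp add: bump_nonneg)
  also have "\<dots> = (LINT y|?M. bump x r y * (norm (f y))\<^sup>2 - 2 * m * (bump x r y * norm (f y)) + m\<^sup>2 * bump x r y)"
    by (intro Bochner_Integration.integral_cong) (auto simp: power2_eq_square algebra_simps)
  also have "\<dots> = Q - 2 * m * P + m\<^sup>2 * \<beta>"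
    using j i0 by (simp add: Q_def P_def smear_def \<beta>_def)
  also have "\<dots> \<le> Q - 2 * m * P + m\<^sup>2 * ?C" using \<beta> by (intro add_left_mono mult_left_mono) auto
  also have "\<dots> = Q - m * P" using mC by (simp add: power2_eq_square algebra_simps flip: mC)
  finally have "m * P \<le> Q" by simp
  then have "P\<^sup>2 \<le> ?C * Q" using C by (simp add: m_def power2_eq_square field_simps)
  moreover have "(norm (smear \<Omega> r f x))\<^sup>2 \<le> P\<^sup>2" using le by (intro power_mono) auto
  ultimately show ?thesis unfolding Q_def by linarith
qed

text \<open>Fubini: integrated over \<open>x\<close>, the kernel has mass at most
  \<open>bump_mass\<close> for each \<open>y\<close>. Together with \<open>smear_square_le\<close>
  this is Young's inequality for convolutions in L2.\<close>

lemma integral_smear_le: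
  fixes F :: "'a::euclidean_space \<Rightarrow> real"
  assumes F: "integrable (lebesgue_on \<Omega>) F" "\<And>y. F y \<ge> 0" and \<Omega>: "\<Omega> \<in> lmeasurable"
    and \<Omega>': "\<Omega>' \<in> lmeasurable" "open \<Omega>'" "bounded \<Omega>'" and r: "r > 0"
  shows "integrable (lebesgue_on \<Omega>') (smear \<Omega> r F)"
    "(LINT x|lebesgue_on \<Omega>'. smear \<Omega> r F x) \<le> bump_mass TYPE('a) r * (LINT y|lebesgue_on \<Omega>. F y)"
proof -
  let ?M = "lebesgue_on \<Omega>" and ?M' = "lebesgue_on \<Omega>'" and ?C = "bump_mass TYPE('a) r"
  interpret M: finite_measure ?M using \<Omega> by (rule finite_measure_lebesgue_on)
  interpret M': finite_measure ?M' using \<Omega>'(1) by (rule finite_measure_lebesgue_on)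
  interpret pair_sigma_finite ?M' ?M ..
  have cs: "continuous_on UNIV (smear \<Omega> r F)" by (rule C1_grad_continuous[OF smear_C1[OF r F(1)]])
  show "integrable ?M' (smear \<Omega> r F)" using \<Omega>' cs by (intro integrable_continuous_bounded) auto
  have idm: "(\<lambda>x. x) \<in> borel_measurable (lebesgue_on S)" for S :: "'a set"
    by (rule lebesgue_on_measurable_continuous) simp
  have m1: "(\<lambda>p. bump 0 r (fst p - snd p)) \<in> borel_measurable (?M' \<Otimes>\<^sub>M ?M)"
  proof -
    have "(\<lambda>p. fst p - snd p) \<in> borel_measurable (?M' \<Otimes>\<^sub>M ?M)"
      by (intro borel_measurable_diff measurable_compose[OF measurable_fst idm] measurable_compose[OF measurable_snd idm])
    then show ?thesis
      by (rule measurable_compose) (rule borel_measurable_continuous_onI[OF bump_continuous])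
  qed
  have m2: "(\<lambda>p. F (snd p)) \<in> borel_measurable (?M' \<Otimes>\<^sub>M ?M)"
    by (rule measurable_compose[OF measurable_snd]) (use F(1) in auto)
  have i: "integrable (?M' \<Otimes>\<^sub>M ?M) (\<lambda>(x, y). bump x r y * F y)"
  proof (rule Fubini_integrable)
    show "(\<lambda>(x, y). bump x r y * F y) \<in> borel_measurable (?M' \<Otimes>\<^sub>M ?M)"
      using borel_measurable_times[OF m1 m2] by (simp add: split_def bump_diff(1))
    have "(LINT y|?M. norm (case (x, y) of (x, y) \<Rightarrow> bump x r y * F y)) = smear \<Omega> r F x" for x
      using F(2) by (simp add: smear_def bump_nonneg abs_mult)
    then show "integrable ?M' (\<lambda>x. LINT y|?M. norm (case (x, y) of (x, y) \<Rightarrow> bump x r y * F y))"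
      using \<open>integrable ?M' (smear \<Omega> r F)\<close> by simp
    show "AE x in ?M'. integrable ?M (\<lambda>y. case (x, y) of (x, y) \<Rightarrow> bump x r y * F y)"
      using integrable_smear[OF F(1)] by simp
  qed
  have "(LINT x|?M'. smear \<Omega> r F x) = (LINT y|?M. LINT x|?M'. bump x r y * F y)"
    unfolding smear_def using Fubini_integral[OF i] by simp
  also have "\<dots> \<le> (LINT y|?M. ?C * F y)"
  proof (rule integral_mono)
    show "integrable ?M (\<lambda>y. LINT x|?M'. bump x r y * F y)" using integrable_snd[OF i] by simp
    show "integrable ?M (\<lambda>y. ?C * F y)" using F by simp
    fix y
    have "(LINT x|?M'. bump x r y) = (LINT x|?M'. bump y r x)" 
      by (intro Bochner_Integration.integral_cong refl) (simp add: bump_def norm_minus_commute)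
    then have "(LINT x|?M'. bump x r y) \<le> ?C" using bump_integral_on(1)[OF \<Omega>'(2) r, of y] by simp
    then show "(LINT x|?M'. bump x r y * F y) \<le> ?C * F y" using F(2)[of y] by (simp add: mult_right_mono)
  qed
  finally show "(LINT x|?M'. smear \<Omega> r F x) \<le> ?C * (LINT y|?M. F y)" by simp
qed

section \<open>Approximation in L2\<close>

lemma square_integrable_diff:
  fixes u v :: "'a::euclidean_space \<Rightarrow> 'b::euclidean_space"
  assumes "u square_integrable_on \<Omega>" "v square_integrable_on \<Omega>"
  shows "(\<lambda>x. u x - v x) square_integrable_on \<Omega>"
  unfolding square_integrable_on_def
proof
  show m: "(\<lambda>x. u x - v x) \<in> borel_measurable (lebesgue_on \<Omega>)" using assms by (auto simp: square_integrable_on_def)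
  show "integrable (lebesgue_on \<Omega>) (\<lambda>x. (norm (u x - v x))\<^sup>2)"
  proof (rule Bochner_Integration.integrable_bound)
    show "integrable (lebesgue_on \<Omega>) (\<lambda>x. 2 * (norm (u x))\<^sup>2 + 2 * (norm (v x))\<^sup>2)" using assms by (simp add: square_integrable_on_def)
    show "(\<lambda>x. (norm (u x - v x))\<^sup>2) \<in> borel_measurable (lebesgue_on \<Omega>)" using m by simp
    have "(norm (u x - v x))\<^sup>2 \<le> 2 * (norm (u x))\<^sup>2 + 2 * (norm (v x))\<^sup>2" for x
    proof -
      have "(norm (u x - v x))\<^sup>2 \<le> (norm (u x) + norm (v x))\<^sup>2" by (intro power_mono norm_triangle_ineq4) simp
      also have "\<dots> \<le> 2 * (norm (u x))\<^sup>2 + 2 * (norm (v x))\<^sup>2"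
        using zero_le_power2[of "norm (u x) - norm (v x)"] by (simp add: power2_eq_square algebra_simps)
      finally show ?thesis .
    qed
    then show "AE x in lebesgue_on \<Omega>. norm ((norm (u x - v x))\<^sup>2) \<le> norm (2 * (norm (u x))\<^sup>2 + 2 * (norm (v x))\<^sup>2)" by simp
  qed
qed

lemma square_integrable_real:
  "u square_integrable_on \<Omega> \<longleftrightarrow> u \<in> borel_measurable (lebesgue_on \<Omega>) \<and> integrable (lebesgue_on \<Omega>) (\<lambda>x. (u x)\<^sup>2)"
  for u :: "'a::euclidean_space \<Rightarrow> real"
  by (simp add: square_integrable_on_def)

lemma integrable_lebesgue_on_subset:
  fixes k :: "'a::euclidean_space \<Rightarrow> 'b::euclidean_space"
  assumes "integrable (lebesgue_on T) k" "S \<subseteq> T" "S \<in> sets lebesgue" "T \<in> sets lebesgue"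
  shows "integrable (lebesgue_on S) k"
proof -
  have "set_integrable lebesgue T k" using assms by (simp add: set_integrable_def integrable_restrict_space)
  then have "set_integrable lebesgue S k" by (rule set_integrable_subset) (use assms in auto)
  then show ?thesis using assms by (simp add: set_integrable_def integrable_restrict_space)
qed

lemma continuous_AE_limit:
  fixes u :: "'a::euclidean_space \<Rightarrow> real"
  assumes "u \<in> borel_measurable (lebesgue_on \<Omega>)" "\<Omega> \<in> sets lebesgue"
  obtains h where "\<And>n. continuous_on UNIV (h n)" "AE x in lebesgue_on \<Omega>. (\<lambda>n. h n x) \<longlonglongrightarrow> u x"
proof -
  have "u measurable_on \<Omega>" using assms by (simp add: measurable_on_iff_borel_measurable)
  then obtain N g where N: "negligible N" "\<And>n. continuous_on UNIV (g n)"
    "\<And>x. x \<notin> N \<Longrightarrow> (\<lambda>n. g n x) \<longlonglongrightarrow> (if x \<in> \<Omega> then u x else 0)"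
    unfolding measurable_on_def by metis
  have "AE x in lebesgue_on \<Omega>. x \<in> \<Omega>" using AE_space[of "lebesgue_on \<Omega>"] by simp
  then have "AE x in lebesgue_on \<Omega>. (\<lambda>n. g n x) \<longlonglongrightarrow> u x"
    using AE_lebesgue_on_negligible[OF N(1) assms(2)] by eventually_elim (use N(3) in force)
  with N(2) show thesis using that by blast
qed

text \<open>Truncation reduces the claim to bounded functions. There, continuous functions
  converging almost everywhere are truncated at the same level, which provides the bound for
  dominated convergence.\<close>

lemma continuous_dense_L2:
  fixes u :: "'a::euclidean_space \<Rightarrow> real"
  assumes u: "u square_integrable_on \<Omega>" and \<Omega>: "\<Omega> \<in> lmeasurable" and \<eta>: "\<eta> > 0"
  obtains h where "continuous_on UNIV h" "(LINT x|lebesgue_on \<Omega>. (u x - h x)\<^sup>2) < \<eta>"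
proof -
  let ?M = "lebesgue_on \<Omega>"
  interpret finite_measure ?M using \<Omega> by (rule finite_measure_lebesgue_on)
  have um: "u \<in> borel_measurable ?M" and ui: "integrable ?M (\<lambda>x. (u x)\<^sup>2)" using u by (auto simp: square_integrable_real)
  define clip where "clip M t = max (- M) (min M t)" for M t :: real
  have clip_cont: "continuous_on UNIV (clip M)" for M unfolding clip_def by (intro continuous_intros)
  have clip_m: "(\<lambda>x. clip M (f x)) \<in> borel_measurable ?M" if "f \<in> borel_measurable ?M" for f M
    using that unfolding clip_def by simp
  have clip_b: "\<bar>clip M t\<bar> \<le> M" if "M \<ge> 0" for M t using that by (auto simp: clip_def)
  have "(\<lambda>n. LINT x|?M. (u x - clip (real n) (u x))\<^sup>2) \<longlonglongrightarrow> (LINT x|?M. 0)"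
  proof (rule integral_dominated_convergence[where w="\<lambda>x. (u x)\<^sup>2"])
    show "AE x in ?M. (\<lambda>n. (u x - clip (real n) (u x))\<^sup>2) \<longlonglongrightarrow> 0"
    proof (rule AE_I2)
      fix x
      obtain N where "\<bar>u x\<bar> \<le> real N" using real_arch_simple by blast
      then have "\<forall>\<^sub>F n in sequentially. 0 = (u x - clip (real n) (u x))\<^sup>2"
        by (intro eventually_sequentiallyI[of N]) (auto simp: clip_def)
      then show "(\<lambda>n. (u x - clip (real n) (u x))\<^sup>2) \<longlonglongrightarrow> 0" by (rule Lim_transform_eventually[OF tendsto_const])
    qed
    show "AE x in ?M. norm ((u x - clip (real n) (u x))\<^sup>2) \<le> (u x)\<^sup>2" for n
    proof (rule AE_I2)
      fix x
      have "\<bar>u x - clip (real n) (u x)\<bar> \<le> \<bar>u x\<bar>" by (auto simp: clip_def)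
      then show "norm ((u x - clip (real n) (u x))\<^sup>2) \<le> (u x)\<^sup>2" by (simp add: abs_le_square_iff)
    qed
  qed (use um ui clip_m in auto)
  then have "\<forall>\<^sub>F n in sequentially. (LINT x|?M. (u x - clip (real n) (u x))\<^sup>2) < \<eta> / 4"
    using \<eta> by (intro order_tendstoD(2)) auto
  then obtain M where "(LINT x|?M. (u x - clip (real M) (u x))\<^sup>2) < \<eta> / 4" by (auto simp: eventually_sequentially)
  define w where "w x = clip (real M) (u x)" for x
  have w1: "(LINT x|?M. (u x - w x)\<^sup>2) < \<eta> / 4" unfolding w_def by fact
  have wm: "w \<in> borel_measurable ?M" unfolding w_def by (rule clip_m[OF um])
  obtain h where h: "\<And>n. continuous_on UNIV (h n)" "AE x in ?M. (\<lambda>n. h n x) \<longlonglongrightarrow> u x"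
    using continuous_AE_limit[OF um] \<Omega> by auto
  have ch: "continuous_on UNIV (\<lambda>x. clip (real M) (h n x))" for n
    by (rule continuous_on_compose2[OF clip_cont h(1)]) auto
  have "(\<lambda>n. LINT x|?M. (w x - clip (real M) (h n x))\<^sup>2) \<longlonglongrightarrow> (LINT x|?M. 0)"
  proof (rule integral_dominated_convergence[where w="\<lambda>x. (2 * real M)\<^sup>2"])
    show "AE x in ?M. (\<lambda>n. (w x - clip (real M) (h n x))\<^sup>2) \<longlonglongrightarrow> 0"
      using h(2)
    proof eventually_elim
      fix x assume "(\<lambda>n. h n x) \<longlonglongrightarrow> u x"
      then have "(\<lambda>n. clip (real M) (h n x)) \<longlonglongrightarrow> w x"
        unfolding w_def clip_def by (intro tendsto_intros)
      then have "(\<lambda>n. (w x - clip (real M) (h n x))\<^sup>2) \<longlonglongrightarrow> (w x - w x)\<^sup>2" by (intro tendsto_intros)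
      then show "(\<lambda>n. (w x - clip (real M) (h n x))\<^sup>2) \<longlonglongrightarrow> 0" by simp
    qed
    show "AE x in ?M. norm ((w x - clip (real M) (h n x))\<^sup>2) \<le> (2 * real M)\<^sup>2" for n
    proof (rule AE_I2)
      fix x
      have "\<bar>w x - clip (real M) (h n x)\<bar> \<le> 2 * real M"
        using clip_b[of "real M" "u x"] clip_b[of "real M" "h n x"] by (simp add: w_def)
      then show "norm ((w x - clip (real M) (h n x))\<^sup>2) \<le> (2 * real M)\<^sup>2"
        using power_mono[of "\<bar>w x - clip (real M) (h n x)\<bar>" "2 * real M" 2] by simp
    qed
  qed (use wm lebesgue_on_measurable_continuous[OF ch] in auto)
  then have "\<forall>\<^sub>F n in sequentially. (LINT x|?M. (w x - clip (real M) (h n x))\<^sup>2) < \<eta> / 4"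
    using \<eta> by (intro order_tendstoD(2)) auto
  then obtain n where n: "(LINT x|?M. (w x - clip (real M) (h n x))\<^sup>2) < \<eta> / 4" by (auto simp: eventually_sequentially)
  define k where "k x = clip (real M) (h n x)" for x
  have bsq: "f square_integrable_on \<Omega>" if "f \<in> borel_measurable ?M" "\<And>x. \<bar>f x\<bar> \<le> real M" for f :: "'a \<Rightarrow> real"
  proof -
    have "(f x)\<^sup>2 \<le> (real M)\<^sup>2" for x using power_mono[OF that(2), of x 2] by simp
    then show ?thesis using that(1) by (auto simp: square_integrable_real intro!: integrable_const_bound[of _ "(real M)\<^sup>2"])
  qed
  have ws: "w square_integrable_on \<Omega>" by (rule bsq[OF wm]) (simp add: w_def clip_b)
  have ks: "k square_integrable_on \<Omega>" unfolding k_def by (rule bsq) (auto simp: clip_b lebesgue_on_measurable_continuous[OF ch])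
  have i: "integrable ?M (\<lambda>x. (u x - w x)\<^sup>2)" "integrable ?M (\<lambda>x. (w x - k x)\<^sup>2)" "integrable ?M (\<lambda>x. (u x - k x)\<^sup>2)"
    using square_integrable_diff[OF u ws] square_integrable_diff[OF ws ks] square_integrable_diff[OF u ks]
    by (auto simp: square_integrable_real)
  have "(LINT x|?M. (u x - k x)\<^sup>2) \<le> (LINT x|?M. 2 * (u x - w x)\<^sup>2 + 2 * (w x - k x)\<^sup>2)"
  proof (rule integral_mono[OF i(3)])
    show "(u x - k x)\<^sup>2 \<le> 2 * (u x - w x)\<^sup>2 + 2 * (w x - k x)\<^sup>2" for x
      using zero_le_power2[of "(u x - w x) - (w x - k x)"] by (simp add: power2_eq_square algebra_simps)
  qed (use i in auto)
  also have "\<dots> = 2 * (LINT x|?M. (u x - w x)\<^sup>2) + 2 * (LINT x|?M. (w x - k x)\<^sup>2)" using i by simp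
  also have "\<dots> < \<eta>" using w1 n unfolding k_def by linarith
  finally have "(LINT x|?M. (u x - k x)\<^sup>2) < \<eta>" .
  moreover have "continuous_on UNIV k" unfolding k_def by (rule ch)
  ultimately show thesis using that by blast
qed

text \<open>Smoothing by \<open>smear\<close> divided by \<open>bump_mass\<close>: the gradient energy does not increase.\<close>

lemma H1_smooth_approximation:
  fixes \<Omega> :: "'a::euclidean_space set"
  assumes H: "H1_with_grad \<Omega> u g" and \<Omega>: "open \<Omega>" "bounded \<Omega>"
    and \<Omega>': "open \<Omega>'" "\<Omega>' \<subseteq> \<Omega>" and r0: "r0 > 0" "\<And>x. x \<in> \<Omega>' \<Longrightarrow> cball x r0 \<subseteq> \<Omega>" and \<eta>: "\<eta> > 0"
  obtains w W where "C1_grad w W" "(LINT x|lebesgue_on \<Omega>'. (u x - w x)\<^sup>2) < \<eta>"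
    "(LINT x|lebesgue_on \<Omega>'. (norm (W x))\<^sup>2) \<le> (LINT x|lebesgue_on \<Omega>. (norm (g x))\<^sup>2)"
proof -
  let ?M = "lebesgue_on \<Omega>" and ?M' = "lebesgue_on \<Omega>'"
  have b': "bounded \<Omega>'" using \<Omega>(2) \<Omega>'(2) bounded_subset by blast
  have lm: "\<Omega> \<in> lmeasurable" "\<Omega>' \<in> lmeasurable" using \<Omega> \<Omega>' b' by (auto intro: lmeasurable_open)
  have us: "u square_integrable_on \<Omega>" and gs: "g square_integrable_on \<Omega>" using H by (auto simp: H1_with_grad_def)
  \<comment> \<open>The final estimate weighs the errors by 4, 4 and 2, so that sixteenths add up to
    10/16 of \<open>\<eta>\<close>.\<close>
  obtain h where h: "continuous_on UNIV h" "(LINT x|?M. (u x - h x)\<^sup>2) < \<eta> / 16"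
    using continuous_dense_L2[OF us lm(1), of "\<eta> / 16"] \<eta> by auto
  define A where "A = measure lebesgue \<Omega>'"
  have A: "A \<ge> 0" by (simp add: A_def)
  define e where "e = sqrt (\<eta> / (16 * (A + 1)))"
  have e: "e > 0" "A * e\<^sup>2 \<le> \<eta> / 16"
    using \<eta> A by (auto simp: e_def field_simps)
  obtain \<rho> where "\<And>x. x \<in> \<Omega> \<Longrightarrow> norm x \<le> \<rho>" using \<Omega>(2) unfolding bounded_iff by auto
  then have \<rho>: "\<Omega> \<subseteq> cball 0 \<rho>" by auto
  have "uniformly_continuous_on (cball 0 \<rho>) h"
    by (intro compact_uniformly_continuous continuous_on_subset[OF h(1)]) auto
  then obtain d where d: "d > 0" "\<And>x y. x \<in> cball 0 \<rho> \<Longrightarrow> y \<in> cball 0 \<rho> \<Longrightarrow> dist y x < d \<Longrightarrow> dist (h y) (h x) < e"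
    unfolding uniformly_continuous_on_def using e(1) by metis
  \<comment> \<open>\<open>r0\<close> keeps the kernel inside \<Omega>, and \<open>d\<close>
    controls the oscillation of \<open>h\<close> on its support.\<close>
  define r where "r = min r0 (d / 2)"
  have r: "r > 0" "r \<le> r0" "r < d" using r0 d by (auto simp: r_def)
  define C where "C = bump_mass TYPE('a) r"
  have C: "C > 0" unfolding C_def by (rule bump_mass_pos[OF r(1)])
  have ball: "cball x r \<subseteq> \<Omega>" if "x \<in> \<Omega>'" for x using r0(2)[OF that] r(2) by (meson order_trans subset_cball)
  define w where "w x = (1 / C) * smear \<Omega> r u x" for x
  define W where "W x = (1 / C) *\<^sub>R (LINT y|?M. u y *\<^sub>R grad (bump 0 r) (x - y))" for x
  have iu: "integrable ?M u" by (rule square_integrable_on_imp_integrable[OF us lm(1)])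
  have C1: "C1_grad w W" unfolding w_def W_def by (rule C1_grad_cmult[OF smear_C1[OF r(1) iu]])
  have cw: "continuous_on UNIV w" "continuous_on UNIV W" using C1 C1_grad_continuous by (auto simp: C1_grad_def)
  have int': "integrable ?M' f" if "continuous_on UNIV f" for f :: "'a \<Rightarrow> real"
    using that b' lm by (intro integrable_continuous_bounded) auto
  have young: "(norm ((1 / C) *\<^sub>R smear \<Omega> r f x))\<^sup>2 \<le> (1 / C) * smear \<Omega> r (\<lambda>y. (norm (f y))\<^sup>2) x"
    if "f square_integrable_on \<Omega>" for f :: "'a \<Rightarrow> 'c::euclidean_space" and x
  proof -
    have "(norm ((1 / C) *\<^sub>R smear \<Omega> r f x))\<^sup>2 = (1 / C)\<^sup>2 * (norm (smear \<Omega> r f x))\<^sup>2"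
      using C by (simp add: power_mult_distrib power_divide)
    also have "\<dots> \<le> (1 / C)\<^sup>2 * (C * smear \<Omega> r (\<lambda>y. (norm (f y))\<^sup>2) x)"
      unfolding C_def by (intro mult_left_mono smear_square_le[OF that lm(1) \<Omega>(1) r(1)]) simp
    also have "\<dots> = (1 / C) * smear \<Omega> r (\<lambda>y. (norm (f y))\<^sup>2) x" using C by (simp add: power2_eq_square)
    finally show ?thesis .
  qed
  have young_int: "(LINT x|?M'. (1 / C) * smear \<Omega> r (\<lambda>y. (norm (f y))\<^sup>2) x) \<le> (LINT x|?M. (norm (f x))\<^sup>2)"
    "integrable ?M' (\<lambda>x. (1 / C) * smear \<Omega> r (\<lambda>y. (norm (f y))\<^sup>2) x)"
    if "f square_integrable_on \<Omega>" for f :: "'a \<Rightarrow> 'c::euclidean_space"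
  proof -
    have i: "integrable ?M (\<lambda>y. (norm (f y))\<^sup>2)" using that by (simp add: square_integrable_on_def)
    note * = integral_smear_le[OF i _ lm(1) lm(2) \<Omega>'(1) b' r(1)]
    show "integrable ?M' (\<lambda>x. (1 / C) * smear \<Omega> r (\<lambda>y. (norm (f y))\<^sup>2) x)" using *(1) by simp
    have "(1 / C) * (LINT x|?M'. smear \<Omega> r (\<lambda>y. (norm (f y))\<^sup>2) x) \<le> (1 / C) * (C * (LINT x|?M. (norm (f x))\<^sup>2))"
      using C *(2) by (intro mult_left_mono) (auto simp: C_def)
    then show "(LINT x|?M'. (1 / C) * smear \<Omega> r (\<lambda>y. (norm (f y))\<^sup>2) x) \<le> (LINT x|?M. (norm (f x))\<^sup>2)"
      using C by simp
  qed
  have E: "(LINT x|?M'. (norm (W x))\<^sup>2) \<le> (LINT x|?M. (norm (g x))\<^sup>2)"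
  proof -
    have "(LINT x|?M'. (norm (W x))\<^sup>2) \<le> (LINT x|?M'. (1 / C) * smear \<Omega> r (\<lambda>y. (norm (g y))\<^sup>2) x)"
    proof (rule integral_mono_AE)
      show "integrable ?M' (\<lambda>x. (norm (W x))\<^sup>2)" by (intro int' continuous_intros cw)
      have "(norm (W x))\<^sup>2 \<le> (1 / C) * smear \<Omega> r (\<lambda>y. (norm (g y))\<^sup>2) x" if "x \<in> \<Omega>'" for x
        using young[OF gs, of x] unfolding W_def smear_grad_H1[OF H r(1) ball[OF that]] .
      then show "AE x in ?M'. (norm (W x))\<^sup>2 \<le> (1 / C) * smear \<Omega> r (\<lambda>y. (norm (g y))\<^sup>2) x" by (intro AE_I2) simp
    qed (rule young_int(2)[OF gs])
    with young_int(1)[OF gs] show ?thesis by linarith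
  qed
  define f where "f x = u x - h x" for x
  have hs: "h square_integrable_on \<Omega>" using \<Omega> lm by (intro square_integrable_continuous h) auto
  have fs: "f square_integrable_on \<Omega>" unfolding f_def by (rule square_integrable_diff[OF us hs])
  have ih: "integrable ?M h" by (rule square_integrable_on_imp_integrable[OF hs lm(1)])
  have main: "(u x - w x)\<^sup>2 \<le> 4 * (f x)\<^sup>2 + 4 * ((1 / C) * smear \<Omega> r (\<lambda>y. (norm (f y))\<^sup>2) x) + 2 * e\<^sup>2" if x: "x \<in> \<Omega>'" for x
  proof -
    \<comment> \<open>Decomposes \<open>u - w\<close> into \<open>f\<close>, the mollified
      \<open>f\<close>, and the mollification error of the continuous function
      \<open>h\<close>.\<close>
    define a where "a = (1 / C) * smear \<Omega> r f x"
    define b where "b = (1 / C) * smear \<Omega> r h x - h x"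
    have "smear \<Omega> r u x = smear \<Omega> r f x + smear \<Omega> r h x"
    proof -
      have if': "integrable ?M f" unfolding f_def using iu ih by simp
      have "smear \<Omega> r u x = (LINT y|?M. bump x r y *\<^sub>R f y + bump x r y *\<^sub>R h y)"
        unfolding smear_def by (intro Bochner_Integration.integral_cong) (auto simp: f_def algebra_simps)
      then show ?thesis unfolding smear_def using integrable_smear[OF if', of x r] integrable_smear[OF ih, of x r] by simp
    qed
    then have dec: "u x - w x = f x - a - b" by (simp add: w_def a_def b_def f_def algebra_simps)
    have a2: "a\<^sup>2 \<le> (1 / C) * smear \<Omega> r (\<lambda>y. (norm (f y))\<^sup>2) x"
      using young[OF fs, of x] by (simp only: real_norm_def power2_abs real_scaleR_def a_def)
    have "\<bar>b\<bar> \<le> e"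
    proof -
      have ball': "ball x r \<subseteq> \<Omega>" using ball[OF x] ball_subset_cball by blast
      have Cx: "(LINT y|?M. bump x r y) = C" unfolding C_def by (rule bump_integral_on(2)[OF \<Omega>(1) r(1) ball'])
      have ib: "integrable ?M (bump x r)"
        using \<Omega> lm by (intro integrable_continuous_bounded bump_continuous) auto
      have "C * b = (LINT y|?M. bump x r y * h y - h x * bump x r y)"
        using integrable_smear[OF ih, of x r] ib C by (simp add: b_def smear_def Cx right_diff_distrib)
      moreover have "norm (LINT y|?M. bump x r y * h y - h x * bump x r y) \<le> (LINT y|?M. bump x r y * e)"
      proof (rule Bochner_Integration.integral_norm_bound_integral)
        show "integrable ?M (\<lambda>y. bump x r y * h y - h x * bump x r y)" using integrable_smear[OF ih, of x r] ib by simp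
        fix y
        have "\<bar>h y - h x\<bar> \<le> e" if "y \<in> ball x r"
          using d(2)[of x y] that ball' \<rho> \<Omega>'(2) x r(3) by (force simp: dist_real_def dist_commute)
        then have "bump x r y * \<bar>h y - h x\<bar> \<le> bump x r y * e"
          using bump_nonneg[of x r y] bump_eq_0[OF r(1), of y x] by (cases "y \<in> ball x r") (auto intro: mult_left_mono)
        moreover have "bump x r y * h y - h x * bump x r y = bump x r y * (h y - h x)" by (simp add: algebra_simps)
        ultimately show "norm (bump x r y * h y - h x * bump x r y) \<le> bump x r y * e"
          using bump_nonneg[of x r y] by (simp add: abs_mult)
      qed (use ib in simp)
      ultimately have "\<bar>C * b\<bar> \<le> C * e" using Cx by simp
      then show ?thesis using C by (simp add: abs_mult)
    qed
    then have b2: "b\<^sup>2 \<le> e\<^sup>2" using e(1) power_mono[of "\<bar>b\<bar>" e 2] by simp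
    have "(f x - a - b)\<^sup>2 \<le> 4 * (f x)\<^sup>2 + 4 * a\<^sup>2 + 2 * b\<^sup>2"
    proof -
      have "(p - a - b)\<^sup>2 \<le> 4 * p\<^sup>2 + 4 * a\<^sup>2 + 2 * b\<^sup>2" for p
      proof -
        have "4 * p\<^sup>2 + 4 * a\<^sup>2 + 2 * b\<^sup>2 - (p - a - b)\<^sup>2 = (p - a + b)\<^sup>2 + 2 * (p + a)\<^sup>2"
          by (simp add: power2_eq_square algebra_simps)
        then show ?thesis using zero_le_power2[of "p - a + b"] zero_le_power2[of "p + a"] by linarith
      qed
      then show ?thesis .
    qed
    also have "\<dots> \<le> 4 * (f x)\<^sup>2 + 4 * ((1 / C) * smear \<Omega> r (\<lambda>y. (norm (f y))\<^sup>2) x) + 2 * e\<^sup>2"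
      by (intro add_mono mult_left_mono a2 b2 order_refl) auto
    finally show ?thesis unfolding dec .
  qed
  have if2: "integrable ?M (\<lambda>x. (f x)\<^sup>2)" by (rule square_integrable_real[THEN iffD1, OF fs, THEN conjunct2])
  have ls: "\<Omega>' \<in> sets lebesgue" "\<Omega> \<in> sets lebesgue" using lm by auto
  have restr: "integrable ?M' k" if "integrable ?M k" for k :: "'a \<Rightarrow> real"
    by (rule integrable_lebesgue_on_subset[OF that \<Omega>'(2) ls])
  have if2': "integrable ?M' (\<lambda>x. (f x)\<^sup>2)" by (rule restr[OF if2])
  have fle: "(LINT x|?M'. (f x)\<^sup>2) \<le> (LINT x|?M. (f x)\<^sup>2)"
    by (rule integral_mono_lebesgue_on_AE[OF if2 _ _ \<Omega>'(2) ls]) auto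
  have ws: "w square_integrable_on \<Omega>" by (rule square_integrable_continuous[OF \<Omega>(2) ls(2) cw(1)])
  have iu2': "integrable ?M' (\<lambda>x. (u x - w x)\<^sup>2)"
    by (rule restr[OF square_integrable_real[THEN iffD1, OF square_integrable_diff[OF us ws], THEN conjunct2]])
  interpret finite_measure ?M' using lm(2) by (rule finite_measure_lebesgue_on)
  have yi: "integrable ?M' (\<lambda>x. 4 * ((1 / C) * smear \<Omega> r (\<lambda>y. (norm (f y))\<^sup>2) x))"
    by (rule integrable_mult_right[OF young_int(2)[OF fs]])
  have ff: "integrable ?M' (\<lambda>x. 4 * (f x)\<^sup>2)" using if2' by simp
  have "(LINT x|?M'. (u x - w x)\<^sup>2) \<le> (LINT x|?M'. 4 * (f x)\<^sup>2 + 4 * ((1 / C) * smear \<Omega> r (\<lambda>y. (norm (f y))\<^sup>2) x) + 2 * e\<^sup>2)"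
    using main ff yi by (intro integral_mono_AE iu2' Bochner_Integration.integrable_add) auto
  also have "\<dots> = 4 * (LINT x|?M'. (f x)\<^sup>2) + 4 * (LINT x|?M'. (1 / C) * smear \<Omega> r (\<lambda>y. (norm (f y))\<^sup>2) x) + A * (2 * e\<^sup>2)"
    unfolding A_def measure_lebesgue_on_const[OF lm(2), symmetric]
    using ff yi by (simp only: Bochner_Integration.integral_add Bochner_Integration.integrable_add integrable_const
        integral_mult_right_zero)
  also have "\<dots> < 4 * (\<eta> / 16) + 4 * (\<eta> / 16) + 2 * (\<eta> / 16)"
    using h(2) fle young_int(1)[OF fs] e(2) \<eta> by (simp add: f_def)
  finally have "(LINT x|?M'. (u x - w x)\<^sup>2) < \<eta>" using \<eta> by simp
  with C1 E show thesis using that by blast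
qed

section \<open>From smooth functions to Sobolev functions\<close>

lemma payne_weinberger_H1_interior:
  fixes \<Omega> :: "(real^2) set"
  assumes H: "H1_with_grad \<Omega> u g" and \<Omega>: "open \<Omega>" "bounded \<Omega>"
    and \<Omega>': "open \<Omega>'" "convex \<Omega>'" "\<Omega>' \<noteq> {}" "\<Omega>' \<subseteq> \<Omega>" and r0: "r0 > 0" "\<And>x. x \<in> \<Omega>' \<Longrightarrow> cball x r0 \<subseteq> \<Omega>"
    and D: "D > 0" "\<And>x y. x \<in> \<Omega> \<Longrightarrow> y \<in> \<Omega> \<Longrightarrow> norm (x - y) \<le> D"
  shows "(pi / D)\<^sup>2 * ((LINT x|lebesgue_on \<Omega>'. (u x)\<^sup>2) - (LINT x|lebesgue_on \<Omega>'. u x)\<^sup>2 / measure lebesgue \<Omega>')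
    \<le> (LINT x|lebesgue_on \<Omega>. (norm (g x))\<^sup>2)"
proof -
  let ?M' = "lebesgue_on \<Omega>'" and ?A = "measure lebesgue \<Omega>'"
  define K where "K = pi / D"
  have K: "K > 0" using D by (simp add: K_def)
  define E where "E = (LINT x|lebesgue_on \<Omega>. (norm (g x))\<^sup>2)"
  have b': "bounded \<Omega>'" using \<Omega>(2) \<Omega>'(4) bounded_subset by blast
  have lm: "\<Omega>' \<in> lmeasurable" using \<Omega>' b' by (auto intro: lmeasurable_open)
  have ls: "\<Omega>' \<in> sets lebesgue" "\<Omega> \<in> sets lebesgue" using \<Omega> \<Omega>' by auto
  have lm\<Omega>: "\<Omega> \<in> lmeasurable" using \<Omega> by (auto intro: lmeasurable_open)
  interpret finite_measure ?M' using lm by (rule finite_measure_lebesgue_on)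
  have A: "?A > 0" by (rule measure_pos_open[OF \<Omega>'(1) b' \<Omega>'(3)])
  have us: "u square_integrable_on \<Omega>" using H by (simp add: H1_with_grad_def)
  have iu: "integrable ?M' u"
    by (rule integrable_lebesgue_on_subset[OF square_integrable_on_imp_integrable[OF us lm\<Omega>] \<Omega>'(4) ls])
  have iu2: "integrable ?M' (\<lambda>x. (u x)\<^sup>2)"
    by (rule integrable_lebesgue_on_subset[OF square_integrable_real[THEN iffD1, OF us, THEN conjunct2] \<Omega>'(4) ls])
  have expand: "(LINT x|?M'. (f x - m)\<^sup>2) = (LINT x|?M'. (f x)\<^sup>2) - 2 * m * (LINT x|?M'. f x) + ?A * m\<^sup>2"
    and expand_int: "integrable ?M' (\<lambda>x. (f x - m)\<^sup>2)"
    if f: "integrable ?M' f" "integrable ?M' (\<lambda>x. (f x)\<^sup>2)" for f :: "real^2 \<Rightarrow> real" and m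
  proof -
    have eq: "(\<lambda>x. (f x - m)\<^sup>2) = (\<lambda>x. (f x)\<^sup>2 - 2 * m * f x + m\<^sup>2)" by (auto simp: power2_eq_square algebra_simps)
    have i: "integrable ?M' (\<lambda>x. 2 * m * f x)" "integrable ?M' (\<lambda>x. m\<^sup>2)" using f by auto
    show "integrable ?M' (\<lambda>x. (f x - m)\<^sup>2)" unfolding eq using f i by (intro Bochner_Integration.integrable_add Bochner_Integration.integrable_diff)
    show "(LINT x|?M'. (f x - m)\<^sup>2) = (LINT x|?M'. (f x)\<^sup>2) - 2 * m * (LINT x|?M'. f x) + ?A * m\<^sup>2"
      unfolding eq Bochner_Integration.integral_add[OF Bochner_Integration.integrable_diff[OF f(2) i(1)] i(2)]
        Bochner_Integration.integral_diff[OF f(2) i(1)] measure_lebesgue_on_const[OF lm] by simp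
  qed
  define V where "V = (LINT x|?M'. (u x)\<^sup>2) - (LINT x|?M'. u x)\<^sup>2 / ?A"
  \<comment> \<open>\<open>\<tau>\<close> is the parameter in Young's inequality that separates
    \<open>w - m\<close> from the approximation error \<open>u - w\<close>; it tends to 0 at the
    end.\<close>
  have main: "K\<^sup>2 * V \<le> (1 + \<tau>) * E + \<tau>" if \<tau>: "\<tau> > 0" for \<tau>
  proof -
    \<comment> \<open>Chosen so that the approximation error contributes exactly
      \<open>\<tau>\<close> after all factors.\<close>
    define \<eta> where "\<eta> = \<tau> / (K\<^sup>2 * (1 + 1 / \<tau>))"
    have p: "K\<^sup>2 * (1 + 1 / \<tau>) > 0" using K \<tau> by (intro mult_pos_pos add_pos_pos) auto
    have \<eta>: "\<eta> > 0" "K\<^sup>2 * ((1 + 1 / \<tau>) * \<eta>) = \<tau>"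
    proof -
      have "c * (\<tau> / c) = \<tau>" if "c > 0" for c :: real using that by simp
      from this[OF p] show "K\<^sup>2 * ((1 + 1 / \<tau>) * \<eta>) = \<tau>" by (simp only: \<eta>_def mult.assoc[symmetric])
      show "\<eta> > 0" unfolding \<eta>_def by (rule divide_pos_pos[OF \<tau> p])
    qed
    obtain w W where C: "C1_grad w W" and w: "(LINT x|?M'. (u x - w x)\<^sup>2) < \<eta>"
      and W: "(LINT x|?M'. (norm (W x))\<^sup>2) \<le> E"
      using H1_smooth_approximation[OF H \<Omega> \<Omega>'(1,4) r0 \<eta>(1)] unfolding E_def by blast
    have cw: "continuous_on UNIV w" by (rule C1_grad_continuous[OF C])
    have iw: "integrable ?M' w" "integrable ?M' (\<lambda>x. (w x)\<^sup>2)"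
      by (rule integrable_continuous_bounded[OF b' ls(1)], intro continuous_intros cw)+
    have iuw: "integrable ?M' (\<lambda>x. (u x - w x)\<^sup>2)"
    proof -
      have "w square_integrable_on \<Omega>'" by (rule square_integrable_continuous[OF b' ls(1) cw])
      moreover have "u square_integrable_on \<Omega>'" using iu iu2 by (simp add: square_integrable_real)
      ultimately show ?thesis by (intro square_integrable_real[THEN iffD1, THEN conjunct2] square_integrable_diff)
    qed
    define m where "m = (LINT x|?M'. w x) / ?A"
    \<comment> \<open>The mean of \<open>u\<close> minimises the quadratic deviation, so the mean
      \<open>m\<close> of \<open>w\<close> may take its place.\<close>
    have "V \<le> (LINT x|?M'. (u x - m)\<^sup>2)"
    proof -
      have "(LINT x|?M'. (u x - m)\<^sup>2) - V = ((LINT x|?M'. u x) - ?A * m)\<^sup>2 / ?A"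
        unfolding expand[OF iu iu2] V_def using A by (simp add: power2_eq_square field_simps)
      moreover have "\<dots> \<ge> 0" using A by simp
      ultimately show ?thesis by linarith
    qed
    also have "\<dots> \<le> (LINT x|?M'. (1 + \<tau>) * (w x - m)\<^sup>2 + (1 + 1 / \<tau>) * (u x - w x)\<^sup>2)"
    proof (rule integral_mono[OF expand_int[OF iu iu2]])
      show "integrable ?M' (\<lambda>x. (1 + \<tau>) * (w x - m)\<^sup>2 + (1 + 1 / \<tau>) * (u x - w x)\<^sup>2)"
        using expand_int[OF iw] iuw by simp
      show "(u x - m)\<^sup>2 \<le> (1 + \<tau>) * (w x - m)\<^sup>2 + (1 + 1 / \<tau>) * (u x - w x)\<^sup>2" for x
      proof -
        have "(p + q)\<^sup>2 \<le> (1 + \<tau>) * p\<^sup>2 + (1 + 1 / \<tau>) * q\<^sup>2" for p q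
        proof -
          have "(1 + \<tau>) * p\<^sup>2 + (1 + 1 / \<tau>) * q\<^sup>2 - (p + q)\<^sup>2 = (\<tau> * p - q)\<^sup>2 / \<tau>"
            using \<tau> by (simp add: power2_eq_square field_simps)
          moreover have "\<dots> \<ge> 0" using \<tau> by simp
          ultimately show ?thesis by linarith
        qed
        from this[of "w x - m" "u x - w x"] show ?thesis by simp
      qed
    qed
    also have "\<dots> = (1 + \<tau>) * (LINT x|?M'. (w x - m)\<^sup>2) + (1 + 1 / \<tau>) * (LINT x|?M'. (u x - w x)\<^sup>2)"
      using expand_int[OF iw] iuw by simp
    also have "(LINT x|?M'. (w x - m)\<^sup>2) = (LINT x|?M'. (w x)\<^sup>2) - (LINT x|?M'. w x)\<^sup>2 / ?A"
      unfolding expand[OF iw] using A by (simp add: m_def power2_eq_square field_simps)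
    finally have "K\<^sup>2 * V \<le> K\<^sup>2 * ((1 + \<tau>) * ((LINT x|?M'. (w x)\<^sup>2) - (LINT x|?M'. w x)\<^sup>2 / ?A) + (1 + 1 / \<tau>) * (LINT x|?M'. (u x - w x)\<^sup>2))"
      by (intro mult_left_mono) auto
    also have "\<dots> = (1 + \<tau>) * (K\<^sup>2 * ((LINT x|?M'. (w x)\<^sup>2) - (LINT x|?M'. w x)\<^sup>2 / ?A)) + K\<^sup>2 * ((1 + 1 / \<tau>) * (LINT x|?M'. (u x - w x)\<^sup>2))"
      by (simp only: distrib_left mult.left_commute)
    also have "\<dots> \<le> (1 + \<tau>) * E + K\<^sup>2 * ((1 + 1 / \<tau>) * \<eta>)"
    proof (intro add_mono mult_left_mono)
      have "K\<^sup>2 * ((LINT x|?M'. (w x)\<^sup>2) - (LINT x|?M'. w x)\<^sup>2 / ?A) \<le> (LINT x|?M'. (norm (W x))\<^sup>2)"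
        unfolding K_def
        by (rule payne_weinberger_smooth[OF C \<Omega>'(1,2) b' \<Omega>'(3) D(1)]) (use D(2) \<Omega>'(4) in blast)
      then show "K\<^sup>2 * ((LINT x|?M'. (w x)\<^sup>2) - (LINT x|?M'. w x)\<^sup>2 / ?A) \<le> E" using W by linarith
    qed (use \<tau> w K in auto)
    finally show ?thesis unfolding \<eta>(2) .
  qed
  have "K\<^sup>2 * V \<le> (1 + 0) * E + 0"
  proof (rule tendsto_lowerbound)
    show "((\<lambda>\<tau>. (1 + \<tau>) * E + \<tau>) \<longlongrightarrow> (1 + 0) * E + 0) (at_right 0)" by (intro tendsto_intros)
    show "\<forall>\<^sub>F \<tau> in at_right 0. K\<^sup>2 * V \<le> (1 + \<tau>) * E + \<tau>"
      using eventually_at_right_less[of "0::real"] by eventually_elim (use main in auto)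
  qed simp
  then show ?thesis unfolding K_def V_def E_def by simp
qed

text \<open>Copies of \<Omega> shrunken towards an inner point keep a positive distance from the
  complement, as mollification requires. They exhaust \<Omega>, so the integrals converge.\<close>

lemma payne_weinberger_H1:
  fixes \<Omega> :: "(real^2) set"
  assumes H: "H1_with_grad \<Omega> u g" and \<Omega>: "open \<Omega>" "convex \<Omega>" "bounded \<Omega>" "\<Omega> \<noteq> {}"
    and D: "D > 0" "\<And>x y. x \<in> \<Omega> \<Longrightarrow> y \<in> \<Omega> \<Longrightarrow> norm (x - y) \<le> D"
    and mean: "(LINT x|lebesgue_on \<Omega>. u x) = 0"
  shows "(pi / D)\<^sup>2 * (LINT x|lebesgue_on \<Omega>. (u x)\<^sup>2) \<le> (LINT x|lebesgue_on \<Omega>. (norm (g x))\<^sup>2)"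
proof -
  let ?M = "lebesgue_on \<Omega>"
  obtain c r where c: "r > 0" "ball c r \<subseteq> \<Omega>" using \<Omega>(1,4) by (meson all_not_in_conv openE)
  define s where "s n = 1 - 1 / (real n + 2)" for n
  have s: "0 < s n" "s n < 1" for n by (auto simp: s_def field_simps)
  have "filterlim (\<lambda>n. 2 + real n) at_top sequentially"
    by (rule filterlim_tendsto_add_at_top[OF tendsto_const filterlim_real_sequentially])
  then have "(\<lambda>n. 1 / (real n + 2)) \<longlonglongrightarrow> 0"
    by (intro tendsto_divide_0[OF tendsto_const] filterlim_at_top_imp_at_infinity) (simp add: add.commute)
  from tendsto_diff[OF tendsto_const[of 1] this] have s1: "s \<longlonglongrightarrow> 1" unfolding s_def by simp
  define S where "S n = (\<lambda>y. c + (1 / s n) *\<^sub>R (y - c)) -` \<Omega>" for n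
  have S_alt: "S n = (\<lambda>x. c + s n *\<^sub>R (x - c)) ` \<Omega>" for n
    using s(1)[of n] by (force simp: S_def image_iff)
  have oS: "open (S n)" for n unfolding S_def using \<Omega>(1) by (intro open_vimage continuous_intros)
  have cS: "convex (S n)" for n
  proof -
    have "(\<lambda>x. c + s n *\<^sub>R (x - c)) ` \<Omega> = (\<lambda>x. (c - s n *\<^sub>R c) + x) ` ((\<lambda>x. s n *\<^sub>R x) ` \<Omega>)"
      by (auto simp: image_image algebra_simps)
    then show ?thesis unfolding S_alt using convex_translation[OF convex_scaling[OF \<Omega>(2)]] by metis
  qed
  have neS: "S n \<noteq> {}" for n unfolding S_alt using \<Omega>(4) by auto
  \<comment> \<open>A small displacement \<open>z - x\<close> is absorbed by the disc around
    \<open>c\<close>: scaled up by \<open>1 / (1 - s n)\<close> it still leads from \<open>c\<close>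
    to a point \<open>p\<close> of \<Omega>, and \<open>z\<close> lies between \<open>y\<close> and
    \<open>p\<close>.\<close>
  have ball: "cball x ((1 - s n) * r / 2) \<subseteq> \<Omega>" if "x \<in> S n" for x n
  proof
    fix z assume z: "z \<in> cball x ((1 - s n) * r / 2)"
    obtain y where y: "y \<in> \<Omega>" "x = c + s n *\<^sub>R (y - c)" using \<open>x \<in> S n\<close> unfolding S_alt by auto
    define p where "p = c + (1 / (1 - s n)) *\<^sub>R (z - x)"
    have "norm (z - x) \<le> (1 - s n) * r / 2" using z by (simp add: dist_norm norm_minus_commute)
    also have "\<dots> < (1 - s n) * r" using s(2)[of n] c(1) by simp
    finally have "norm (z - x) / (1 - s n) < r" using s(2)[of n] by (simp add: field_simps)
    then have "p \<in> \<Omega>" using s(2)[of n] by (intro subsetD[OF c(2)]) (simp add: p_def dist_norm)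
    have "(1 - s n) *\<^sub>R (p - c) = z - x" using s(2)[of n] by (simp add: p_def)
    then have "z = s n *\<^sub>R y + (1 - s n) *\<^sub>R p" unfolding y(2) by (simp add: algebra_simps)
    then show "z \<in> \<Omega>" using convexD[OF \<Omega>(2) y(1) \<open>p \<in> \<Omega>\<close>, of "s n" "1 - s n"] s[of n] by simp
  qed
  have margin: "(1 - s n) * r / 2 > 0" for n using s(2)[of n] c(1) by simp
  have subS: "S n \<subseteq> \<Omega>" for n using ball margin by (meson centre_in_cball less_imp_le subset_iff)
  have lm: "\<Omega> \<in> lmeasurable" using \<Omega> by (auto intro: lmeasurable_open)
  have ls: "\<Omega> \<in> sets lebesgue" "S n \<in> sets lebesgue" for n using \<Omega>(1) oS by auto
  have us: "u square_integrable_on \<Omega>" using H by (simp add: H1_with_grad_def)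
  have lim: "(\<lambda>n. LINT x|lebesgue_on (S n). f x) \<longlonglongrightarrow> (LINT x|?M. f x)" if f: "integrable ?M f" for f :: "real^2 \<Rightarrow> real"
  proof -
    have "\<Omega> \<inter> S n = S n" for n using subS by blast
    then have eq: "(LINT x|lebesgue_on (S n). f x) = (LINT x|?M. indicator (S n) x * f x)" for n
      using integral_lebesgue_on_Int[OF ls(1) ls(2)[of n], of f] by simp
    show ?thesis unfolding eq
    proof (rule integral_dominated_convergence[where w="\<lambda>x. norm (f x)"])
      show "AE x in ?M. (\<lambda>n. indicator (S n) x * f x) \<longlonglongrightarrow> f x"
      proof (rule AE_I2)
        fix x assume "x \<in> space ?M"
        then have x: "x \<in> \<Omega>" by simp
        have "(\<lambda>n. c + (1 / s n) *\<^sub>R (x - c)) \<longlonglongrightarrow> c + (1 / 1) *\<^sub>R (x - c)"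
          by (intro tendsto_intros s1) simp
        then have "\<forall>\<^sub>F n in sequentially. c + (1 / s n) *\<^sub>R (x - c) \<in> \<Omega>"
          using \<Omega>(1) x by (intro topological_tendstoD) auto
        then have "\<forall>\<^sub>F n in sequentially. f x = indicator (S n) x * f x"
          by eventually_elim (simp add: S_def)
        then show "(\<lambda>n. indicator (S n) x * f x) \<longlonglongrightarrow> f x" by (rule Lim_transform_eventually[OF tendsto_const])
      qed
      show "(\<lambda>x. indicator (S n) x * f x) \<in> borel_measurable ?M" for n
      proof -
        have "(indicator (S n) :: real^2 \<Rightarrow> real) \<in> borel_measurable ?M"
          using oS by (intro borel_measurable_lebesgue_on_borel borel_measurable_indicator) auto
        then show ?thesis using f by (intro borel_measurable_times) auto
      qed
      show "AE x in ?M. norm (indicator (S n) x * f x) \<le> norm (f x)" for n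
        by (intro AE_I2) (auto simp: indicator_def)
    qed (use f in auto)
  qed
  interpret finite_measure ?M using lm by (rule finite_measure_lebesgue_on)
  have lmS: "S n \<in> lmeasurable" for n
    using oS subS \<Omega>(3) by (intro lmeasurable_open) (auto intro: bounded_subset)
  have A: "measure lebesgue \<Omega> > 0" by (rule measure_pos_open[OF \<Omega>(1,3,4)])
  have A_lim: "(\<lambda>n. measure lebesgue (S n)) \<longlonglongrightarrow> measure lebesgue \<Omega>"
    using lim[of "\<lambda>_. 1"] unfolding measure_lebesgue_on_const[OF lm] measure_lebesgue_on_const[OF lmS] by simp
  have "(pi / D)\<^sup>2 * ((LINT x|?M. (u x)\<^sup>2) - (LINT x|?M. u x)\<^sup>2 / measure lebesgue \<Omega>) \<le> (LINT x|?M. (norm (g x))\<^sup>2)"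
  proof (rule LIMSEQ_le_const2)
    show "(\<lambda>n. (pi / D)\<^sup>2 * ((LINT x|lebesgue_on (S n). (u x)\<^sup>2) - (LINT x|lebesgue_on (S n). u x)\<^sup>2 / measure lebesgue (S n)))
       \<longlonglongrightarrow> (pi / D)\<^sup>2 * ((LINT x|?M. (u x)\<^sup>2) - (LINT x|?M. u x)\<^sup>2 / measure lebesgue \<Omega>)"
      using A by (intro tendsto_intros lim A_lim square_integrable_on_imp_integrable[OF us lm]
          square_integrable_real[THEN iffD1, OF us, THEN conjunct2]) simp
    show "\<exists>N. \<forall>n\<ge>N. (pi / D)\<^sup>2 * ((LINT x|lebesgue_on (S n). (u x)\<^sup>2) - (LINT x|lebesgue_on (S n). u x)\<^sup>2 / measure lebesgue (S n))
       \<le> (LINT x|?M. (norm (g x))\<^sup>2)"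
      by (intro exI allI impI payne_weinberger_H1_interior[OF H \<Omega>(1,3) oS cS neS subS margin ball D])
  qed
  then show ?thesis unfolding mean by simp
qed

section \<open>Weak convergence and completeness in the space of square integrable functions\<close>

text \<open>First variation: a quadratic in \<open>t\<close> that is minimal at 0 has no linear
  term.\<close>

lemma quadratic_nonneg_linear_zero:
  fixes X Y :: real
  assumes "\<And>t. 0 \<le> t * X + t\<^sup>2 * Y" shows "X = 0"
proof (rule ccontr)
  assume X: "X \<noteq> 0"
  \<comment> \<open>The denominator is positive whatever the sign of \<open>Y\<close>, and large
    enough for the linear term to win.\<close>
  define t where "t = - X / (\<bar>Y\<bar> + 1)"
  have "t\<^sup>2 * Y \<le> t\<^sup>2 * \<bar>Y\<bar>" by (intro mult_left_mono) auto
  moreover have "t * X + t\<^sup>2 * \<bar>Y\<bar> = - X\<^sup>2 / (\<bar>Y\<bar> + 1)\<^sup>2"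
    unfolding t_def by (simp add: power2_eq_square divide_simps) (simp add: algebra_simps add_pos_nonneg)
  moreover have "\<dots> < 0" using X by (simp add: divide_neg_pos)
  ultimately show False using assms[of t] by linarith
qed

lemma integral_Cauchy_Schwarz:
  fixes a b :: "'a \<Rightarrow> real"
  assumes "integrable M (\<lambda>x. (a x)\<^sup>2)" "integrable M (\<lambda>x. (b x)\<^sup>2)" "integrable M (\<lambda>x. a x * b x)"
  shows "(LINT x|M. a x * b x)\<^sup>2 \<le> (LINT x|M. (a x)\<^sup>2) * (LINT x|M. (b x)\<^sup>2)"
proof -
  let ?A = "LINT x|M. (a x)\<^sup>2" and ?B = "LINT x|M. (b x)\<^sup>2" and ?X = "LINT x|M. a x * b x"
  have q: "0 \<le> ?A - 2 * t * ?X + t\<^sup>2 * ?B" for t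
  proof -
    have "0 \<le> (LINT x|M. (a x - t * b x)\<^sup>2)" by simp
    also have "(\<lambda>x. (a x - t * b x)\<^sup>2) = (\<lambda>x. (a x)\<^sup>2 - 2 * t * (a x * b x) + t\<^sup>2 * (b x)\<^sup>2)"
      by (auto simp: power2_eq_square algebra_simps)
    also have "(LINT x|M. (a x)\<^sup>2 - 2 * t * (a x * b x) + t\<^sup>2 * (b x)\<^sup>2) = ?A - 2 * t * ?X + t\<^sup>2 * ?B"
      using assms by simp
    finally show ?thesis .
  qed
  show ?thesis
  proof (cases "?B = 0")
    case True
    have "?X = 0"
    proof (rule ccontr)
      assume "?X \<noteq> 0"
      then show False using q[of "(?A + 1) / (2 * ?X)"] True by simp
    qed
    then show ?thesis using True by simp
  next
    case False
    then have "?B > 0" by (simp add: less_le)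
    then show ?thesis using q[of "?X / ?B"] by (simp add: power2_eq_square field_simps)
  qed
qed

lemma square_integrable_add:
  fixes u v :: "'a::euclidean_space \<Rightarrow> 'b::euclidean_space"
  assumes "u square_integrable_on \<Omega>" "v square_integrable_on \<Omega>"
  shows "(\<lambda>x. u x + v x) square_integrable_on \<Omega>"
proof -
  have "(\<lambda>x. - v x) square_integrable_on \<Omega>" using assms(2) by (simp add: square_integrable_on_def)
  from square_integrable_diff[OF assms(1) this] show ?thesis by simp
qed

lemma square_integrable_inner:
  fixes u v :: "'a::euclidean_space \<Rightarrow> 'b::euclidean_space"
  assumes "u square_integrable_on \<Omega>" "v square_integrable_on \<Omega>"
  shows "integrable (lebesgue_on \<Omega>) (\<lambda>x. u x \<bullet> v x)"
proof (rule Bochner_Integration.integrable_bound)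
  show "integrable (lebesgue_on \<Omega>) (\<lambda>x. (norm (u x))\<^sup>2 + (norm (v x))\<^sup>2)" using assms by (simp add: square_integrable_on_def)
  show "(\<lambda>x. u x \<bullet> v x) \<in> borel_measurable (lebesgue_on \<Omega>)"
    using assms by (intro borel_measurable_inner) (auto simp: square_integrable_on_def)
  have "\<bar>u x \<bullet> v x\<bar> \<le> (norm (u x))\<^sup>2 + (norm (v x))\<^sup>2" for x
  proof -
    have "p * q \<le> p\<^sup>2 + q\<^sup>2" for p q :: real
    proof -
      have "0 \<le> (p - q)\<^sup>2 + p\<^sup>2 + q\<^sup>2" by simp
      then show ?thesis by (simp add: power2_eq_square algebra_simps)
    qed
    then show ?thesis using Cauchy_Schwarz_ineq2[of "u x" "v x"] order_trans by blast
  qed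
  then show "AE x in lebesgue_on \<Omega>. norm (u x \<bullet> v x) \<le> norm ((norm (u x))\<^sup>2 + (norm (v x))\<^sup>2)" by simp
qed

lemma norm_add_square:
  fixes a b :: "'b::real_inner"
  shows "(norm (a + t *\<^sub>R b))\<^sup>2 = (norm a)\<^sup>2 + 2 * t * (a \<bullet> b) + t\<^sup>2 * (norm b)\<^sup>2"
  by (simp only: power2_norm_eq_inner) (simp add: inner_add_left inner_add_right inner_commute power2_eq_square algebra_simps)

lemma integral_norm_add_square:
  fixes u v :: "'a::euclidean_space \<Rightarrow> 'b::euclidean_space"
  assumes "u square_integrable_on \<Omega>" "v square_integrable_on \<Omega>"
  shows "(LINT x|lebesgue_on \<Omega>. (norm (u x + t *\<^sub>R v x))\<^sup>2) = (LINT x|lebesgue_on \<Omega>. (norm (u x))\<^sup>2)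
     + 2 * t * (LINT x|lebesgue_on \<Omega>. u x \<bullet> v x) + t\<^sup>2 * (LINT x|lebesgue_on \<Omega>. (norm (v x))\<^sup>2)"
  unfolding norm_add_square using assms square_integrable_inner[OF assms] by (simp add: square_integrable_on_def)

lemma integral_inner_square_le:
  fixes u v :: "'a::euclidean_space \<Rightarrow> 'b::euclidean_space"
  assumes "u square_integrable_on \<Omega>" "v square_integrable_on \<Omega>"
  shows "\<bar>LINT x|lebesgue_on \<Omega>. u x \<bullet> v x\<bar> \<le> sqrt (LINT x|lebesgue_on \<Omega>. (norm (u x))\<^sup>2) * sqrt (LINT x|lebesgue_on \<Omega>. (norm (v x))\<^sup>2)"
proof -
  let ?M = "lebesgue_on \<Omega>"
  have n: "integrable ?M (\<lambda>x. norm (u x) * norm (v x))"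
  proof -
    have "(\<lambda>x. norm (u x)) square_integrable_on \<Omega>" "(\<lambda>x. norm (v x)) square_integrable_on \<Omega>"
      using assms by (auto simp: square_integrable_on_def)
    from square_integrable_inner[OF this] show ?thesis by simp
  qed
  have "\<bar>LINT x|?M. u x \<bullet> v x\<bar> \<le> (LINT x|?M. \<bar>u x \<bullet> v x\<bar>)" by (rule integral_abs_bound)
  also have "\<dots> \<le> (LINT x|?M. norm (u x) * norm (v x))"
    using n square_integrable_inner[OF assms] by (intro integral_mono) (auto simp: Cauchy_Schwarz_ineq2)
  also have "\<dots> \<le> sqrt ((LINT x|?M. (norm (u x))\<^sup>2) * (LINT x|?M. (norm (v x))\<^sup>2))"
    using integral_Cauchy_Schwarz[of ?M "\<lambda>x. norm (u x)" "\<lambda>x. norm (v x)"] assms n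
    by (intro real_le_rsqrt) (simp add: square_integrable_on_def)
  finally show ?thesis by (simp add: real_sqrt_mult)
qed

lemma L2_inner_tendsto:
  fixes u v :: "'a::euclidean_space \<Rightarrow> 'b::euclidean_space"
  assumes u: "u square_integrable_on \<Omega>" and v: "v square_integrable_on \<Omega>" and f: "\<And>n. f n square_integrable_on \<Omega>"
    and lim: "(\<lambda>n. LINT x|lebesgue_on \<Omega>. (norm (u x - f n x))\<^sup>2) \<longlonglongrightarrow> 0"
  shows "(\<lambda>n. LINT x|lebesgue_on \<Omega>. f n x \<bullet> v x) \<longlonglongrightarrow> (LINT x|lebesgue_on \<Omega>. u x \<bullet> v x)"
proof (rule LIM_zero_cancel, rule Lim_null_comparison)
  let ?M = "lebesgue_on \<Omega>"
  have eq: "(LINT x|?M. f n x \<bullet> v x) - (LINT x|?M. u x \<bullet> v x) = - (LINT x|?M. (u x - f n x) \<bullet> v x)" for n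
    using square_integrable_inner[OF f v, of n] square_integrable_inner[OF u v] by (simp add: inner_diff_left)
  show "\<forall>\<^sub>F n in sequentially. norm ((LINT x|?M. f n x \<bullet> v x) - (LINT x|?M. u x \<bullet> v x))
     \<le> sqrt (LINT x|?M. (norm (u x - f n x))\<^sup>2) * sqrt (LINT x|?M. (norm (v x))\<^sup>2)"
    unfolding eq using integral_inner_square_le[OF square_integrable_diff[OF u f] v] by (intro always_eventually) simp
  show "(\<lambda>n. sqrt (LINT x|?M. (norm (u x - f n x))\<^sup>2) * sqrt (LINT x|?M. (norm (v x))\<^sup>2)) \<longlonglongrightarrow> 0"
    using tendsto_mult[OF tendsto_real_sqrt[OF lim] tendsto_const[of "sqrt (LINT x|?M. (norm (v x))\<^sup>2)"]] by simp
qed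

lemma L2_norm_tendsto:
  fixes u :: "'a::euclidean_space \<Rightarrow> 'b::euclidean_space"
  assumes u: "u square_integrable_on \<Omega>" and f: "\<And>n. f n square_integrable_on \<Omega>"
    and lim: "(\<lambda>n. LINT x|lebesgue_on \<Omega>. (norm (u x - f n x))\<^sup>2) \<longlonglongrightarrow> 0"
  shows "(\<lambda>n. LINT x|lebesgue_on \<Omega>. (norm (f n x))\<^sup>2) \<longlonglongrightarrow> (LINT x|lebesgue_on \<Omega>. (norm (u x))\<^sup>2)"
proof -
  let ?M = "lebesgue_on \<Omega>"
  have eq: "(LINT x|?M. (norm (f n x))\<^sup>2) = 2 * (LINT x|?M. f n x \<bullet> u x) - (LINT x|?M. (norm (u x))\<^sup>2) + (LINT x|?M. (norm (u x - f n x))\<^sup>2)" for n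
    using integral_norm_add_square[OF u f, of "-1" n] by (simp add: inner_commute)
  have "(\<lambda>n. 2 * (LINT x|?M. f n x \<bullet> u x) - (LINT x|?M. (norm (u x))\<^sup>2) + (LINT x|?M. (norm (u x - f n x))\<^sup>2))
     \<longlonglongrightarrow> 2 * (LINT x|?M. u x \<bullet> u x) - (LINT x|?M. (norm (u x))\<^sup>2) + 0"
    by (intro tendsto_intros L2_inner_tendsto[OF u u f lim] lim)
  then show ?thesis unfolding eq by (simp add: power2_norm_eq_inner)
qed

text \<open>Riesz-Fischer: along a subsequence with squared steps below \<open>4^-k\<close> the
  functions converge almost everywhere, and Fatou's lemma bounds the distance of the limit to all
  late members of the whole sequence.\<close>

lemma L2_complete:
  fixes f :: "nat \<Rightarrow> 'a::euclidean_space \<Rightarrow> 'b::euclidean_space"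
  assumes \<Omega>: "\<Omega> \<in> lmeasurable" and f: "\<And>n. f n square_integrable_on \<Omega>"
    and Cauchy: "\<And>e. e > 0 \<Longrightarrow> \<exists>N. \<forall>m\<ge>N. \<forall>n\<ge>N. (LINT x|lebesgue_on \<Omega>. (norm (f m x - f n x))\<^sup>2) < e"
  obtains u where "u square_integrable_on \<Omega>" "(\<lambda>n. LINT x|lebesgue_on \<Omega>. (norm (u x - f n x))\<^sup>2) \<longlonglongrightarrow> 0"
proof -
  let ?M = "lebesgue_on \<Omega>"
  interpret finite_measure ?M using \<Omega> by (rule finite_measure_lebesgue_on)
  have fm: "f n \<in> borel_measurable ?M" for n using f by (simp add: square_integrable_on_def)
  have fd: "integrable ?M (\<lambda>x. (norm (f m x - f n x))\<^sup>2)" for m n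
    using square_integrable_diff[OF f f] by (simp add: square_integrable_on_def)
  have "\<exists>r :: nat \<Rightarrow> nat. \<forall>k. (\<forall>m\<ge>r k. \<forall>n\<ge>r k. (LINT x|?M. (norm (f m x - f n x))\<^sup>2) < (1/4) ^ k) \<and> r k < r (Suc k)"
  proof (rule dependent_nat_choice)
    show "\<exists>N. \<forall>m\<ge>N. \<forall>n\<ge>N. (LINT x|?M. (norm (f m x - f n x))\<^sup>2) < (1/4) ^ 0" using Cauchy[of 1] by simp
    fix N k
    obtain N' where "\<forall>m\<ge>N'. \<forall>n\<ge>N'. (LINT x|?M. (norm (f m x - f n x))\<^sup>2) < (1/4) ^ Suc k"
      using Cauchy[of "(1/4) ^ Suc k"] by auto
    then show "\<exists>y. (\<forall>m\<ge>y. \<forall>n\<ge>y. (LINT x|?M. (norm (f m x - f n x))\<^sup>2) < (1/4) ^ Suc k) \<and> N < y"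
      by (intro exI[of _ "max N' (Suc N)"]) auto
  qed
  then obtain r where r: "\<And>k m n. m \<ge> r k \<Longrightarrow> n \<ge> r k \<Longrightarrow> (LINT x|?M. (norm (f m x - f n x))\<^sup>2) < (1/4) ^ k"
    "\<And>k. r k < r (Suc k)" by blast
  have rmono: "strict_mono r" using r(2) by (simp add: strict_mono_Suc_iff)
  define d where "d k x = norm (f (r (Suc k)) x - f (r k) x)" for k x
  have di: "integrable ?M (\<lambda>x. (d k x)\<^sup>2)" for k unfolding d_def by (rule fd)
  have dsmall: "(LINT x|?M. (d k x)\<^sup>2) \<le> (1/4) ^ k" for k
    unfolding d_def using r(1)[of k "r (Suc k)" "r k"] r(2)[of k] by simp
  have AE_sum: "AE x in ?M. summable (\<lambda>k. d k x)"
  proof -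
    have "(\<integral>\<^sup>+x. (\<Sum>k. ennreal (2 ^ k * (d k x)\<^sup>2)) \<partial>?M) = (\<Sum>k. \<integral>\<^sup>+x. ennreal (2 ^ k * (d k x)\<^sup>2) \<partial>?M)"
      using di by (intro nn_integral_suminf) auto
    also have "\<dots> = (\<Sum>k. ennreal (2 ^ k * (LINT x|?M. (d k x)\<^sup>2)))"
      using di by (subst nn_integral_eq_integral) auto
    also have "\<dots> \<le> (\<Sum>k. ennreal ((1/2) ^ k))"
    proof (intro suminf_le ennreal_leI)
      fix k
      have "2 ^ k * (LINT x|?M. (d k x)\<^sup>2) \<le> 2 ^ k * (1/4) ^ k" using dsmall by (intro mult_left_mono) auto
      then show "2 ^ k * (LINT x|?M. (d k x)\<^sup>2) \<le> (1/2) ^ k" by (simp flip: power_mult_distrib)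
    qed auto
    also have "\<dots> = ennreal (\<Sum>k. (1/2) ^ k)" by (intro suminf_ennreal2) (auto simp: summable_geometric)
    also have "\<dots> < \<infinity>" by simp
    finally have "(\<integral>\<^sup>+x. (\<Sum>k. ennreal (2 ^ k * (d k x)\<^sup>2)) \<partial>?M) \<noteq> \<infinity>" by simp
    then have "AE x in ?M. (\<Sum>k. ennreal (2 ^ k * (d k x)\<^sup>2)) \<noteq> \<infinity>"
      using di by (intro nn_integral_PInf_AE) auto
    then show ?thesis
    proof eventually_elim
      fix x assume "(\<Sum>k. ennreal (2 ^ k * (d k x)\<^sup>2)) \<noteq> \<infinity>"
      then have s: "summable (\<lambda>k. 2 ^ k * (d k x)\<^sup>2)" by (intro summable_suminf_not_top) auto
      have "summable (\<lambda>k. (1/2) ^ k + 2 ^ k * (d k x)\<^sup>2)" by (intro summable_add s summable_geometric) simp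
      then show "summable (\<lambda>k. d k x)"
      proof (rule summable_comparison_test')
        fix k
        \<comment> \<open>Leads to the summable majorant \<open>d_k \<le> 2^-k + 2^k d_k^2\<close>;
          the weights \<open>2^k\<close> are still compatible with squared steps of size
          \<open>4^-k\<close>.\<close>
        have "c * y \<le> 1 + (c * y)\<^sup>2" for c y :: real
        proof -
          have "1 + (c * y)\<^sup>2 - c * y = (c * y - 1/2)\<^sup>2 + 3/4" by (simp add: power2_eq_square algebra_simps)
          then show ?thesis using zero_le_power2[of "c * y - 1/2"] by linarith
        qed
        from this[of "2 ^ k" "d k x"] have "(1/2) ^ k * (2 ^ k * d k x) \<le> (1/2) ^ k * (1 + (2 ^ k * d k x)\<^sup>2)"
          by (intro mult_left_mono) auto
        also have "(1/2) ^ k * (2 ^ k * d k x) = d k x" by (simp flip: mult.assoc power_mult_distrib)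
        also have "(1/2) ^ k * (1 + (2 ^ k * d k x)\<^sup>2) = (1/2) ^ k + 2 ^ k * (d k x)\<^sup>2"
          by (simp add: distrib_left power2_eq_square power_divide)
        finally show "norm (d k x) \<le> (1/2) ^ k + 2 ^ k * (d k x)\<^sup>2" by (simp add: d_def)
      qed
    qed
  qed
  define u where "u x = lim (\<lambda>k. f (r k) x)" for x
  have um: "u \<in> borel_measurable ?M" unfolding u_def by (rule borel_measurable_lim_metric) (rule fm)
  have AE_lim: "AE x in ?M. (\<lambda>k. f (r k) x) \<longlonglongrightarrow> u x"
    using AE_sum
  proof eventually_elim
    fix x assume "summable (\<lambda>k. d k x)"
    then have "summable (\<lambda>k. f (r (Suc k)) x - f (r k) x)" unfolding d_def by (rule summable_norm_cancel)
    then have "convergent (\<lambda>n. \<Sum>k<n. f (r (Suc k)) x - f (r k) x)" by (simp add: summable_iff_convergent)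
    then have "convergent (\<lambda>n. f (r n) x - f (r 0) x)" by (simp only: sum_lessThan_telescope[of "\<lambda>k. f (r k) x"])
    then have "convergent (\<lambda>n. f (r 0) x + (f (r n) x - f (r 0) x))" by (intro convergent_add convergent_const)
    then have "convergent (\<lambda>n. f (r n) x)" by simp
    then show "(\<lambda>k. f (r k) x) \<longlonglongrightarrow> u x" unfolding u_def by (simp add: convergent_LIMSEQ_iff)
  qed
  have key: "(\<integral>\<^sup>+x. ennreal ((norm (u x - f n x))\<^sup>2) \<partial>?M) \<le> ennreal ((1/4) ^ k)" if n: "n \<ge> r k" for n k
  proof -
    have "(\<integral>\<^sup>+x. ennreal ((norm (u x - f n x))\<^sup>2) \<partial>?M) = (\<integral>\<^sup>+x. liminf (\<lambda>j. ennreal ((norm (f (r j) x - f n x))\<^sup>2)) \<partial>?M)"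
    proof (rule nn_integral_cong_AE)
      show "AE x in ?M. ennreal ((norm (u x - f n x))\<^sup>2) = liminf (\<lambda>j. ennreal ((norm (f (r j) x - f n x))\<^sup>2))"
        using AE_lim
      proof eventually_elim
        fix x assume "(\<lambda>k. f (r k) x) \<longlonglongrightarrow> u x"
        then have "(\<lambda>j. ennreal ((norm (f (r j) x - f n x))\<^sup>2)) \<longlonglongrightarrow> ennreal ((norm (u x - f n x))\<^sup>2)"
          by (intro tendsto_ennrealI tendsto_intros)
        then show "ennreal ((norm (u x - f n x))\<^sup>2) = liminf (\<lambda>j. ennreal ((norm (f (r j) x - f n x))\<^sup>2))"
          by (intro lim_imp_Liminf[symmetric]) auto
      qed
    qed
    also have "\<dots> \<le> liminf (\<lambda>j. \<integral>\<^sup>+x. ennreal ((norm (f (r j) x - f n x))\<^sup>2) \<partial>?M)"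
      using fm by (intro nn_integral_liminf) auto
    also have "\<dots> \<le> limsup (\<lambda>j. \<integral>\<^sup>+x. ennreal ((norm (f (r j) x - f n x))\<^sup>2) \<partial>?M)"
      by (rule Liminf_le_Limsup) simp
    also have "\<dots> \<le> ennreal ((1/4) ^ k)"
    proof (rule Limsup_bounded, rule eventually_sequentiallyI[of k])
      fix j assume "j \<ge> k"
      then have "r j \<ge> r k" using rmono by (simp add: strict_mono_less_eq)
      then have "(LINT x|?M. (norm (f (r j) x - f n x))\<^sup>2) \<le> (1/4) ^ k" using r(1)[of k "r j" n] n by simp
      then show "(\<integral>\<^sup>+x. ennreal ((norm (f (r j) x - f n x))\<^sup>2) \<partial>?M) \<le> ennreal ((1/4) ^ k)"
        using fd by (subst nn_integral_eq_integral) (auto intro: ennreal_leI)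
    qed
    finally show ?thesis .
  qed
  have ui: "integrable ?M (\<lambda>x. (norm (u x - f n x))\<^sup>2)" if "n \<ge> r k" for n k
  proof (rule integrableI_bounded)
    show "(\<lambda>x. (norm (u x - f n x))\<^sup>2) \<in> borel_measurable ?M" using um fm by simp
    have "(\<integral>\<^sup>+x. ennreal (norm ((norm (u x - f n x))\<^sup>2)) \<partial>?M) \<le> ennreal ((1/4) ^ k)" using key[OF that] by simp
    also have "\<dots> < \<infinity>" by simp
    finally show "(\<integral>\<^sup>+x. ennreal (norm ((norm (u x - f n x))\<^sup>2)) \<partial>?M) < \<infinity>" .
  qed
  have us: "u square_integrable_on \<Omega>"
  proof -
    have "(\<lambda>x. u x - f (r 0) x) square_integrable_on \<Omega>"
      using ui[of 0 "r 0"] um fm by (simp add: square_integrable_on_def)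
    from square_integrable_add[OF this f[of "r 0"]] show ?thesis by simp
  qed
  have "(\<lambda>n. LINT x|?M. (norm (u x - f n x))\<^sup>2) \<longlonglongrightarrow> 0"
  proof (rule LIMSEQ_I)
    fix e :: real assume "e > 0"
    then obtain k where k: "(1/4 :: real) ^ k < e" using real_arch_pow_inv[of e "1/4"] by auto
    have "norm ((LINT x|?M. (norm (u x - f n x))\<^sup>2) - 0) < e" if "n \<ge> r k" for n
    proof -
      have "ennreal (LINT x|?M. (norm (u x - f n x))\<^sup>2) \<le> ennreal ((1/4) ^ k)"
        using key[OF that] nn_integral_eq_integral[OF ui[OF that]] by simp
      then show ?thesis using k by (simp add: ennreal_le_iff)
    qed
    then show "\<exists>no. \<forall>n\<ge>no. norm ((LINT x|?M. (norm (u x - f n x))\<^sup>2) - 0) < e" by blast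
  qed
  with us show thesis using that by blast
qed

section \<open>Rellich compactness\<close>

lemma test_function_C1: "\<phi> \<in> test_functions \<Omega> \<Longrightarrow> C1_grad \<phi> (grad \<phi>)"
  by (rule Ck_imp_C1_grad[of 0]) (auto simp: test_functions_def simp del: Ck.simps)

text \<open>Replaces weak convergence in the proof of Rellich's theorem: up to an error of order
  \<open>\<epsilon>\<close>, finitely many averages control the \<open>L\<^sup>2\<close> norm of a sequence bounded in \<open>H\<^sup>1\<close>.\<close>

definition averages_control :: "real \<Rightarrow> (real^2) set \<Rightarrow> bool" where
  "averages_control \<epsilon> P \<longleftrightarrow> (\<exists>L. (\<forall>(c, S)\<in>set L. 0 \<le> c \<and> S \<in> sets lebesgue \<and> S \<subseteq> P) \<and>
     (\<forall>u G. C1_grad u G \<longrightarrow> (LINT x|lebesgue_on P. (u x)\<^sup>2) \<le> \<epsilon> * (LINT x|lebesgue_on P. (norm (G x))\<^sup>2)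
        + (\<Sum>(c, S)\<leftarrow>L. c * (LINT x|lebesgue_on S. u x)\<^sup>2)))"

text \<open>The variance form of Payne-Weinberger: one average, over \<open>P\<close> itself, is
  enough.\<close>

lemma averages_control_small:
  assumes P: "open P" "convex P" "bounded P" "P \<noteq> {}" and D: "D > 0" "\<And>x y. x \<in> P \<Longrightarrow> y \<in> P \<Longrightarrow> norm (x - y) \<le> D"
  shows "averages_control ((D / pi)\<^sup>2) P"
  unfolding averages_control_def
proof (intro exI[of _ "[(1 / measure lebesgue P, P)]"] conjI allI impI)
  show "\<forall>(c, S)\<in>set [(1 / measure lebesgue P, P)]. 0 \<le> c \<and> S \<in> sets lebesgue \<and> S \<subseteq> P" using P(1) by auto
  fix u :: "real^2 \<Rightarrow> real" and G assume "C1_grad u G"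
  from payne_weinberger_smooth[OF this P D]
  have *: "(pi / D)\<^sup>2 * ((LINT x|lebesgue_on P. (u x)\<^sup>2) - (LINT x|lebesgue_on P. u x)\<^sup>2 / measure lebesgue P)
    \<le> (LINT x|lebesgue_on P. (norm (G x))\<^sup>2)" .
  have "y \<le> (D / pi)\<^sup>2 * E" if "(pi / D)\<^sup>2 * y \<le> E" for y E :: real
  proof -
    have "(D / pi)\<^sup>2 * ((pi / D)\<^sup>2 * y) \<le> (D / pi)\<^sup>2 * E" using that by (intro mult_left_mono) auto
    moreover have "(D / pi)\<^sup>2 * ((pi / D)\<^sup>2 * y) = y" using D(1) by (simp add: power_divide)
    ultimately show ?thesis by simp
  qed
  from this[OF *] show "(LINT x|lebesgue_on P. (u x)\<^sup>2) \<le> (D / pi)\<^sup>2 * (LINT x|lebesgue_on P. (norm (G x))\<^sup>2)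
        + (\<Sum>(c, S)\<leftarrow>[(1 / measure lebesgue P, P)]. c * (LINT x|lebesgue_on S. u x)\<^sup>2)" by simp
qed

text \<open>The common boundary is a null set, so the integrals split and the lists of averages are
  joined, while \<open>\<epsilon>\<close> does not grow.\<close>

lemma averages_control_Un:
  assumes A: "averages_control \<epsilon> A" "open A" and B: "averages_control \<epsilon> B" "open B"
    and AB: "A \<inter> B = {}" and P: "open P" "bounded P" "A \<subseteq> P" "B \<subseteq> P" "negligible (P - (A \<union> B))"
  shows "averages_control \<epsilon> P"
proof -
  obtain L where L: "\<forall>(c, S)\<in>set L. 0 \<le> c \<and> S \<in> sets lebesgue \<and> S \<subseteq> A"
    "\<And>u G. C1_grad u G \<Longrightarrow> (LINT x|lebesgue_on A. (u x)\<^sup>2) \<le> \<epsilon> * (LINT x|lebesgue_on A. (norm (G x))\<^sup>2)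
        + (\<Sum>(c, S)\<leftarrow>L. c * (LINT x|lebesgue_on S. u x)\<^sup>2)" using A(1) unfolding averages_control_def by auto
  obtain L' where L': "\<forall>(c, S)\<in>set L'. 0 \<le> c \<and> S \<in> sets lebesgue \<and> S \<subseteq> B"
    "\<And>u G. C1_grad u G \<Longrightarrow> (LINT x|lebesgue_on B. (u x)\<^sup>2) \<le> \<epsilon> * (LINT x|lebesgue_on B. (norm (G x))\<^sup>2)
        + (\<Sum>(c, S)\<leftarrow>L'. c * (LINT x|lebesgue_on S. u x)\<^sup>2)" using B(1) unfolding averages_control_def by auto
  have ls: "P \<in> sets lebesgue" "A \<in> sets lebesgue" "B \<in> sets lebesgue" using A B P by auto
  have split: "(LINT x|lebesgue_on P. f x) = (LINT x|lebesgue_on A. f x) + (LINT x|lebesgue_on B. f x)"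
    if f: "continuous_on UNIV f" for f :: "real^2 \<Rightarrow> real"
  proof -
    have i: "integrable (lebesgue_on P) (\<lambda>x. indicator A x * f x)" "integrable (lebesgue_on P) (\<lambda>x. indicator B x * f x)"
      using A(2) B(2) by (auto intro!: integrable_indicator_mult[OF P(2) ls(1) _ f])
    have "(LINT x|lebesgue_on P. f x) = (LINT x|lebesgue_on P. indicator A x * f x + indicator B x * f x)"
    proof (rule integral_cong_AE)
      have "AE x in lebesgue_on P. x \<in> P" using AE_space[of "lebesgue_on P"] by simp
      then show "AE x in lebesgue_on P. f x = indicator A x * f x + indicator B x * f x"
        using AE_lebesgue_on_negligible[OF P(5) ls(1)] by eventually_elim (use AB in \<open>auto simp: indicator_def\<close>)
    qed (use i f in \<open>auto intro: lebesgue_on_measurable_continuous borel_measurable_integrable\<close>)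
    also have "\<dots> = (LINT x|lebesgue_on P. indicator A x * f x) + (LINT x|lebesgue_on P. indicator B x * f x)"
      by (rule Bochner_Integration.integral_add[OF i])
    also have "\<dots> = (LINT x|lebesgue_on (P \<inter> A). f x) + (LINT x|lebesgue_on (P \<inter> B). f x)"
      by (simp only: integral_lebesgue_on_Int[OF ls(1,2)] integral_lebesgue_on_Int[OF ls(1,3)])
    also have "P \<inter> A = A" using P(3) by blast
    also have "P \<inter> B = B" using P(4) by blast
    finally show ?thesis .
  qed
  show ?thesis unfolding averages_control_def
  proof (intro exI[of _ "L @ L'"] conjI allI impI)
    show "\<forall>(c, S)\<in>set (L @ L'). 0 \<le> c \<and> S \<in> sets lebesgue \<and> S \<subseteq> P"
    proof
      fix p assume "p \<in> set (L @ L')"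
      then consider "p \<in> set L" | "p \<in> set L'" by auto
      then show "case p of (c, S) \<Rightarrow> 0 \<le> c \<and> S \<in> sets lebesgue \<and> S \<subseteq> P"
        by cases (use bspec[OF L(1), of p] bspec[OF L'(1), of p] P(3,4) in \<open>auto simp: case_prod_beta\<close>)
    qed
    fix u :: "real^2 \<Rightarrow> real" and G assume u: "C1_grad u G"
    have c: "continuous_on UNIV (\<lambda>x. (u x)\<^sup>2)" "continuous_on UNIV (\<lambda>x. (norm (G x))\<^sup>2)"
      using u C1_grad_continuous[OF u] by (auto simp: C1_grad_def intro!: continuous_intros)
    show "(LINT x|lebesgue_on P. (u x)\<^sup>2) \<le> \<epsilon> * (LINT x|lebesgue_on P. (norm (G x))\<^sup>2)
        + (\<Sum>(c, S)\<leftarrow>L @ L'. c * (LINT x|lebesgue_on S. u x)\<^sup>2)"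
      unfolding split[OF c(1)] split[OF c(2)] using add_mono[OF L(2)[OF u] L'(2)[OF u]] by (simp add: distrib_left)
  qed
qed

section \<open>Dissection of a large square\<close>

definition rect :: "real \<Rightarrow> real \<Rightarrow> real \<Rightarrow> real \<Rightarrow> (real^2) set" where
  "rect a b c d = {x. a < x $ 1 \<and> x $ 1 < b \<and> c < x $ 2 \<and> x $ 2 < d}"

lemma rect_eq_box: "rect a b c d = box (vector [a, c]) (vector [b, d])"
  by (auto simp: rect_def mem_box_cart forall_2)

lemma rect_open_convex: "open (rect a b c d)" "convex (rect a b c d)" "bounded (rect a b c d)"
  by (simp_all add: rect_eq_box convex_box bounded_box open_box)

lemma negligible_coordinate: "negligible {x :: real^2. x $ k = c}"
proof -
  have "negligible {x :: real^2. axis k 1 \<bullet> x = c}" by (intro negligible_hyperplane) (simp add: axis_eq_0_iff)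
  then show ?thesis by (simp add: inner_axis' )
qed

lemma averages_control_rect_split1:
  assumes "averages_control \<epsilon> (rect a m c d)" "averages_control \<epsilon> (rect m b c d)" "a \<le> m" "m \<le> b"
  shows "averages_control \<epsilon> (rect a b c d)"
proof (rule averages_control_Un[OF assms(1) _ assms(2)])
  show "negligible (rect a b c d - (rect a m c d \<union> rect m b c d))"
    by (rule negligible_subset[OF negligible_coordinate[of 1 m]]) (auto simp: rect_def)
qed (use assms(3,4) rect_open_convex in \<open>auto simp: rect_def\<close>)

lemma averages_control_rect_split2:
  assumes "averages_control \<epsilon> (rect a b c m)" "averages_control \<epsilon> (rect a b m d)" "c \<le> m" "m \<le> d"
  shows "averages_control \<epsilon> (rect a b c d)"
proof (rule averages_control_Un[OF assms(1) _ assms(2)])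
  show "negligible (rect a b c d - (rect a b c m \<union> rect a b m d))"
    by (rule negligible_subset[OF negligible_coordinate[of 2 m]]) (auto simp: rect_def)
qed (use assms(3,4) rect_open_convex in \<open>auto simp: rect_def\<close>)

text \<open>Repeated halving of both sides produces squares of side \<open>h\<close>;
  \<open>2 h\<close>, the sum of the two side lengths, bounds their diameter.\<close>

lemma averages_control_square:
  assumes "h > 0" shows "averages_control ((2 * h / pi)\<^sup>2) (rect a (a + 2 ^ n * h) c (c + 2 ^ n * h))"
proof (induction n arbitrary: a c)
  case 0
  have "averages_control ((2 * h / pi)\<^sup>2) (rect a (a + h) c (c + h))"
  proof (rule averages_control_small[OF rect_open_convex])
    have "(vector [a + h / 2, c + h / 2] :: real^2) \<in> rect a (a + h) c (c + h)" using assms by (simp add: rect_def)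
    then show "rect a (a + h) c (c + h) \<noteq> {}" by blast
    show "0 < 2 * h" using assms by simp
    fix x y :: "real^2" assume "x \<in> rect a (a + h) c (c + h)" "y \<in> rect a (a + h) c (c + h)"
    then have "\<bar>(x - y) $ 1\<bar> \<le> h" "\<bar>(x - y) $ 2\<bar> \<le> h" by (auto simp: rect_def abs_le_iff)
    moreover have "norm (x - y) \<le> \<bar>(x - y) $ 1\<bar> + \<bar>(x - y) $ 2\<bar>"
      using norm_le_l1_cart[of "x - y"] by (simp add: sum_2)
    ultimately show "norm (x - y) \<le> 2 * h" by linarith
  qed
  then show ?case by simp
next
  case (Suc n)
  let ?s = "2 ^ n * h"
  have s: "?s \<ge> 0" using assms by simp
  have e: "a + 2 ^ Suc n * h = (a + ?s) + ?s" for a by simp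
  have r: "averages_control ((2 * h / pi)\<^sup>2) (rect a (a + ?s) c ((c + ?s) + ?s))" for a c
    by (rule averages_control_rect_split2[OF Suc.IH Suc.IH]) (use assms in auto)
  show ?case unfolding e
    by (rule averages_control_rect_split1[OF r r]) (use assms in auto)
qed

lemma averages_control_big_square:
  assumes "\<epsilon> > 0" "H > 0" obtains \<epsilon>' where "\<epsilon>' \<le> \<epsilon>" "\<epsilon>' \<ge> 0" "averages_control \<epsilon>' (rect a (a + H) c (c + H))"
proof -
  obtain n where n: "(1/2 :: real) ^ n < sqrt \<epsilon> / H" using real_arch_pow_inv[of "sqrt \<epsilon> / H" "1/2"] assms by auto
  define h where "h = H / 2 ^ n"
  have h: "h > 0" "2 ^ n * h = H" using assms by (auto simp: h_def)
  have "h < sqrt \<epsilon>" using n assms by (simp add: h_def field_simps power_divide)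
  moreover have "h * 2 \<le> h * pi" using h pi_gt3 by (intro mult_left_mono) auto
  then have "2 * h / pi \<le> h" by (simp add: divide_le_eq mult.commute)
  ultimately have "2 * h / pi \<le> sqrt \<epsilon>" by linarith
  then have "(2 * h / pi)\<^sup>2 \<le> (sqrt \<epsilon>)\<^sup>2" using h by (intro power_mono) auto
  then show thesis using averages_control_square[OF h(1), of a n c] assms(1) that unfolding h(2) by auto
qed

section \<open>Compactness of sequences of test functions\<close>

lemma convergent_subsequence_list:
  fixes X :: "'i \<Rightarrow> nat \<Rightarrow> real"
  assumes "\<And>i n. i \<in> set L \<Longrightarrow> \<bar>X i n\<bar> \<le> B i"
  shows "\<exists>r :: nat \<Rightarrow> nat. strict_mono r \<and> (\<forall>i\<in>set L. convergent (\<lambda>n. X i (r n)))"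
  using assms
proof (induction L)
  case Nil
  show ?case by (auto intro: strict_mono_id)
next
  case (Cons i L)
  then obtain r where r: "strict_mono r" "\<forall>i\<in>set L. convergent (\<lambda>n. X i (r n))" by auto
  have "bounded (range (\<lambda>n. X i (r n)))" using Cons.prems[of i] by (auto simp: bounded_iff)
  then obtain l q where q: "strict_mono q" "((\<lambda>n. X i (r n)) \<circ> q) \<longlonglongrightarrow> l"
    using bounded_imp_convergent_subsequence by blast
  have "convergent (\<lambda>n. X j (r (q n)))" if "j \<in> set L" for j
  proof -
    have "convergent ((\<lambda>n. X j (r n)) \<circ> q)" using r(2) that q(1) by (intro convergent_subseq_convergent) auto
    then show ?thesis by (simp add: o_def)
  qed
  moreover have "convergent (\<lambda>n. X i (r (q n)))" using q(2) by (auto simp: convergent_def o_def)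
  ultimately show ?case using strict_mono_o[OF r(1) q(1)]
    by (intro exI[of _ "r \<circ> q"]) (auto simp: o_def)
qed

lemma test_function_square_integrable:
  fixes \<Omega> :: "'a::euclidean_space set"
  assumes "\<phi> \<in> test_functions \<Omega>" "bounded P" "P \<in> sets lebesgue"
  shows "\<phi> square_integrable_on P" "grad \<phi> square_integrable_on P"
proof -
  have "continuous_on UNIV \<phi>" "continuous_on UNIV (grad \<phi>)" using C1_grad_continuous test_function_C1[OF assms(1)] by (auto simp: C1_grad_def)
  then show "\<phi> square_integrable_on P" "grad \<phi> square_integrable_on P"
    using square_integrable_continuous[OF assms(2,3)] by auto
qed

text \<open>Extension by zero: the shape of \<Omega> becomes irrelevant, and it suffices to dissect
  one large square around it.\<close>

lemma test_function_integral_extend: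
  fixes \<Omega> :: "'a::euclidean_space set"
  assumes "\<phi> \<in> test_functions \<Omega>" "\<Omega> \<subseteq> P" "\<Omega> \<in> sets lebesgue" "P \<in> sets lebesgue"
  shows "(LINT x|lebesgue_on P. (\<phi> x)\<^sup>2) = (LINT x|lebesgue_on \<Omega>. (\<phi> x)\<^sup>2)"
    "(LINT x|lebesgue_on P. (norm (grad \<phi> x))\<^sup>2) = (LINT x|lebesgue_on \<Omega>. (norm (grad \<phi> x))\<^sup>2)"
proof -
  obtain K where K: "K \<subseteq> \<Omega>" "\<And>x. x \<notin> K \<Longrightarrow> \<phi> x = 0" "\<And>x. x \<notin> K \<Longrightarrow> grad \<phi> x = 0" using test_functionsE[OF assms(1)] by metis
  have *: "(LINT x|lebesgue_on P. f x) = (LINT x|lebesgue_on \<Omega>. f x)" if "\<And>x. x \<notin> K \<Longrightarrow> f x = 0" for f :: "'a \<Rightarrow> real"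
  proof -
    have "(if x \<in> \<Omega> then f x else 0) = f x" for x using that[of x] K(1) by auto
    then have "(LINT x|lebesgue_on P. f x) = (LINT x|lebesgue_on (\<Omega> \<inter> P). f x)"
      using Lebesgue_Measure.integral_restrict_Int[OF assms(3,4), of f] by simp
    then show ?thesis using assms(2) by (simp add: Int_absorb2)
  qed
  show "(LINT x|lebesgue_on P. (\<phi> x)\<^sup>2) = (LINT x|lebesgue_on \<Omega>. (\<phi> x)\<^sup>2)"
    "(LINT x|lebesgue_on P. (norm (grad \<phi> x))\<^sup>2) = (LINT x|lebesgue_on \<Omega>. (norm (grad \<phi> x))\<^sup>2)"
    using K(2,3) by (auto intro!: *)
qed

text \<open>For each level \<open>1 / (j + 1)\<close> finitely many bounded sequences of averages
  have to converge; a diagonal subsequence serves all levels. Along it the averages of differences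
  tend to 0, and only the small multiple of the energy remains.\<close>

lemma test_function_rellich:
  fixes \<Omega> :: "(real^2) set"
  assumes \<Omega>: "open \<Omega>" "bounded \<Omega>" and \<phi>: "\<And>n. \<phi> n \<in> test_functions \<Omega>"
    and N: "\<And>n. (LINT x|lebesgue_on \<Omega>. (\<phi> n x)\<^sup>2) \<le> A" and E: "\<And>n. (LINT x|lebesgue_on \<Omega>. (norm (grad (\<phi> n) x))\<^sup>2) \<le> B"
  obtains r :: "nat \<Rightarrow> nat" where "strict_mono r"
    "\<forall>e>0. \<exists>N. \<forall>m\<ge>N. \<forall>n\<ge>N. (LINT x|lebesgue_on \<Omega>. (\<phi> (r m) x - \<phi> (r n) x)\<^sup>2) < e"
proof -
  obtain \<rho> where \<rho>: "\<And>x. x \<in> \<Omega> \<Longrightarrow> norm x \<le> \<rho>" using \<Omega>(2) unfolding bounded_iff by auto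
  define H where "H = 2 * (\<bar>\<rho>\<bar> + 1)"
  define Q where "Q = rect (- (\<bar>\<rho>\<bar> + 1)) (- (\<bar>\<rho>\<bar> + 1) + H) (- (\<bar>\<rho>\<bar> + 1)) (- (\<bar>\<rho>\<bar> + 1) + H)"
  have H: "H > 0" by (simp add: H_def add_nonneg_pos)
  have sub: "\<Omega> \<subseteq> Q"
  proof
    fix x assume "x \<in> \<Omega>"
    then have "\<bar>x $ 1\<bar> \<le> \<bar>\<rho>\<bar>" "\<bar>x $ 2\<bar> \<le> \<bar>\<rho>\<bar>"
      using \<rho>[of x] component_le_norm_cart[of x 1] component_le_norm_cart[of x 2] by linarith+
    then show "x \<in> Q" by (auto simp: Q_def rect_def H_def abs_le_iff)
  qed
  have Q: "open Q" "bounded Q" unfolding Q_def by (auto simp: rect_open_convex)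
  have ls: "\<Omega> \<in> sets lebesgue" "Q \<in> sets lebesgue" using \<Omega> Q by auto
  note ext = test_function_integral_extend[OF _ sub ls]
  have "\<forall>j. \<exists>\<epsilon>'. \<epsilon>' \<le> 1 / real (Suc j) \<and> \<epsilon>' \<ge> 0 \<and> averages_control \<epsilon>' Q"
    unfolding Q_def using averages_control_big_square[OF _ H] by (metis of_nat_0_less_iff zero_less_Suc zero_less_divide_1_iff)
  then obtain \<epsilon>' where \<epsilon>': "\<And>j. \<epsilon>' j \<le> 1 / real (Suc j)" "\<And>j. 0 \<le> \<epsilon>' j" "\<And>j. averages_control (\<epsilon>' j) Q" by metis
  then have "\<forall>j. \<exists>L. (\<forall>(c, S)\<in>set L. 0 \<le> c \<and> S \<in> sets lebesgue \<and> S \<subseteq> Q) \<and>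
     (\<forall>u G. C1_grad u G \<longrightarrow> (LINT x|lebesgue_on Q. (u x)\<^sup>2) \<le> \<epsilon>' j * (LINT x|lebesgue_on Q. (norm (G x))\<^sup>2)
        + (\<Sum>(c, S)\<leftarrow>L. c * (LINT x|lebesgue_on S. u x)\<^sup>2))" unfolding averages_control_def by blast
  from choice[OF this] obtain L where LL: "\<forall>j. (\<forall>(c, S)\<in>set (L j). 0 \<le> c \<and> S \<in> sets lebesgue \<and> S \<subseteq> Q) \<and>
     (\<forall>u G. C1_grad u G \<longrightarrow> (LINT x|lebesgue_on Q. (u x)\<^sup>2) \<le> \<epsilon>' j * (LINT x|lebesgue_on Q. (norm (G x))\<^sup>2)
        + (\<Sum>(c, S)\<leftarrow>L j. c * (LINT x|lebesgue_on S. u x)\<^sup>2))" by (rule exE)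
  note L = LL[THEN spec, THEN conjunct1] LL[THEN spec, THEN conjunct2, THEN spec, THEN spec, THEN mp]
  define X where "X p n = (LINT x|lebesgue_on (snd p). \<phi> n x)" for p :: "real \<times> (real^2) set" and n
  have sq: "\<phi> n square_integrable_on S" if "S \<subseteq> Q" "S \<in> sets lebesgue" for n S
    by (rule test_function_square_integrable[OF \<phi> bounded_subset[OF Q(2) that(1)] that(2)])
  have lmS: "S \<in> lmeasurable" if "S \<subseteq> Q" "S \<in> sets lebesgue" for S
    using bounded_subset[OF Q(2) that(1)] that(2) by (rule bounded_set_imp_lmeasurable)
  have int: "integrable (lebesgue_on S) (\<phi> n)" if "S \<subseteq> Q" "S \<in> sets lebesgue" for n S
    by (rule square_integrable_on_imp_integrable[OF sq[OF that] lmS[OF that]])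
  have Xb: "\<bar>X p n\<bar> \<le> sqrt (measure lebesgue Q * \<bar>A\<bar>)" if p: "p \<in> set (L j)" for p n j
  proof -
    have S: "snd p \<subseteq> Q" "snd p \<in> sets lebesgue" using L(1)[of j] p by (auto simp: case_prod_beta)
    have one: "(\<lambda>_. 1 :: real) square_integrable_on snd p"
      by (rule square_integrable_continuous[OF bounded_subset[OF Q(2) S(1)] S(2)]) simp
    have "(X p n)\<^sup>2 \<le> (LINT x|lebesgue_on (snd p). (\<phi> n x)\<^sup>2) * (LINT x|lebesgue_on (snd p). 1\<^sup>2)"
      unfolding X_def using integral_Cauchy_Schwarz[of "lebesgue_on (snd p)" "\<phi> n" "\<lambda>_. 1"] sq[OF S, of n] one int[OF S, of n]
      by (simp add: square_integrable_real)
    also have "\<dots> \<le> \<bar>A\<bar> * measure lebesgue Q"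
    proof (rule mult_mono)
      have "(LINT x|lebesgue_on (snd p). (\<phi> n x)\<^sup>2) \<le> (LINT x|lebesgue_on Q. (\<phi> n x)\<^sup>2)"
        by (rule integral_mono_lebesgue_on_AE[OF _ _ _ S(1) S(2) ls(2)])
          (use sq[OF order_refl ls(2), of n] in \<open>auto simp: square_integrable_real\<close>)
      also have "\<dots> \<le> \<bar>A\<bar>" using N[of n] by (simp add: ext(1)[OF \<phi>])
      finally show "(LINT x|lebesgue_on (snd p). (\<phi> n x)\<^sup>2) \<le> \<bar>A\<bar>" .
      have "measure lebesgue (snd p) \<le> measure lebesgue Q"
        using S lmS[OF order_refl ls(2)] by (intro measure_mono_fmeasurable)
      then show "(LINT x|lebesgue_on (snd p). 1\<^sup>2) \<le> measure lebesgue Q"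
        unfolding measure_lebesgue_on_const[OF lmS[OF S]] by simp
    qed auto
    finally show ?thesis by (intro real_le_rsqrt) (simp add: mult.commute)
  qed
  interpret subseqs "\<lambda>j s. \<forall>p\<in>set (L j). convergent (\<lambda>n. X p (s n))"
  proof
    fix j and s :: "nat \<Rightarrow> nat"
    show "\<exists>r'. strict_mono r' \<and> (\<forall>p\<in>set (L j). convergent (\<lambda>n. X p ((s \<circ> r') n)))"
      using convergent_subsequence_list[of "L j" "\<lambda>p n. X p (s n)" "\<lambda>_. sqrt (measure lebesgue Q * \<bar>A\<bar>)"] Xb by auto
  qed
  have conv: "convergent (\<lambda>n. X p (diagseq n))" if "p \<in> set (L j)" for p j
  proof -
    \<comment> \<open>Convergence survives the passage to a further subsequence, so it holds along a
      tail of the diagonal sequence and then along all of it.\<close>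
    have stable: "\<forall>p\<in>set (L n). convergent (\<lambda>k. X p ((s \<circ> r) k))"
      if "strict_mono r" "\<forall>p\<in>set (L n). convergent (\<lambda>k. X p (s k))" for r s n
      using convergent_subseq_convergent[OF _ that(1)] that(2) by (auto simp: o_def)
    have "\<forall>p\<in>set (L j). convergent (\<lambda>n. X p ((diagseq \<circ> (+) (Suc j)) n))"
      by (rule diagseq_holds[OF stable])
    then have "convergent (\<lambda>n. X p (diagseq (n + Suc j)))" using that by (simp add: o_def add.commute)
    then obtain l where "(\<lambda>n. X p (diagseq (n + Suc j))) \<longlonglongrightarrow> l" unfolding convergent_def by blast
    from LIMSEQ_offset[OF this] show ?thesis by (rule convergentI)
  qed
  show thesis
  proof (rule that[of diagseq], rule subseq_diagseq, intro allI impI)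
    fix e :: real assume e: "e > 0"
    let ?B = "\<bar>B\<bar> + 1"
    \<comment> \<open>The energy of a difference is at most \<open>4 * ?B\<close>, so at this level
      it contributes at most \<open>e / 2\<close>.\<close>
    obtain j where j: "1 / real (Suc j) < e / (8 * ?B)"
      using nat_approx_posE[of "e / (8 * ?B)"] e by auto
    have "\<exists>N. \<forall>m\<ge>N. \<forall>n\<ge>N. (\<Sum>(c, S)\<leftarrow>K. c * (X (c, S) (diagseq m) - X (c, S) (diagseq n))\<^sup>2) < d"
      if "set K \<subseteq> set (L j)" "d > 0" for K d
      using that
    proof (induction K arbitrary: d)
      case (Cons p K)
      obtain c S where p: "p = (c, S)" by (cases p)
      have c: "c \<ge> 0" using L(1)[of j] Cons.prems(1) p by auto
      obtain N1 where N1: "\<forall>m\<ge>N1. \<forall>n\<ge>N1. (\<Sum>(c, S)\<leftarrow>K. c * (X (c, S) (diagseq m) - X (c, S) (diagseq n))\<^sup>2) < d / 2"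
        using Cons.IH[of "d / 2"] Cons.prems by auto
      have "Cauchy (\<lambda>n. X p (diagseq n))" using conv[of p j] Cons.prems(1) by (auto intro: convergent_Cauchy)
      then obtain N2 where N2: "\<forall>m\<ge>N2. \<forall>n\<ge>N2. norm (X p (diagseq m) - X p (diagseq n)) < sqrt (d / (2 * (c + 1)))"
        using Cons.prems(2) c unfolding Cauchy_iff by (metis (no_types, lifting) add_nonneg_pos divide_pos_pos mult_pos_pos real_sqrt_gt_zero zero_less_numeral zero_less_one)
      have "(\<Sum>(c, S)\<leftarrow>p # K. c * (X (c, S) (diagseq m) - X (c, S) (diagseq n))\<^sup>2) < d" if "m \<ge> max N1 N2" "n \<ge> max N1 N2" for m n
      proof -
        have "\<bar>X p (diagseq m) - X p (diagseq n)\<bar> < sqrt (d / (2 * (c + 1)))" using N2 that by auto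
        then have "\<bar>X p (diagseq m) - X p (diagseq n)\<bar>\<^sup>2 \<le> (sqrt (d / (2 * (c + 1))))\<^sup>2" by (intro power_mono) auto
        then have "(X p (diagseq m) - X p (diagseq n))\<^sup>2 \<le> d / (2 * (c + 1))" using Cons.prems(2) c by simp
        then have "c * (X p (diagseq m) - X p (diagseq n))\<^sup>2 \<le> c * (d / (2 * (c + 1)))" using c by (intro mult_left_mono)
        also have "\<dots> \<le> d / 2" using c Cons.prems(2) by (simp add: field_simps)
        finally show ?thesis using N1[rule_format, of m n] that by (simp add: p)
      qed
      then show ?case by blast
    qed auto
    from this[of "L j" "e / 2"] e obtain N0 where
      N0: "\<And>m n. m \<ge> N0 \<Longrightarrow> n \<ge> N0 \<Longrightarrow> (\<Sum>(c, S)\<leftarrow>L j. c * (X (c, S) (diagseq m) - X (c, S) (diagseq n))\<^sup>2) < e / 2" by auto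
    have "(LINT x|lebesgue_on \<Omega>. (\<phi> (diagseq m) x - \<phi> (diagseq n) x)\<^sup>2) < e" if mn: "m \<ge> N0" "n \<ge> N0" for m n
    proof -
      let ?f = "\<phi> (diagseq m)" and ?g = "\<phi> (diagseq n)"
      define \<psi> where "\<psi> x = 1 * ?f x + (- 1) * ?g x" for x
      have \<psi>: "\<psi> \<in> test_functions \<Omega>" unfolding \<psi>_def by (rule test_functions_lin[OF \<phi> \<phi>])
      note C = test_function_C1[OF \<psi>]
      have g\<psi>: "grad \<psi> x = grad ?f x - grad ?g x" for x
      proof -
        have "C1_grad (\<lambda>x. 1 * ?f x + (- 1) * ?g x) (\<lambda>x. 1 *\<^sub>R grad ?f x + (- 1) *\<^sub>R grad ?g x)"
          by (intro C1_grad_add C1_grad_cmult test_function_C1[OF \<phi>])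
        from C1_grad_imp_grad[OF this] show ?thesis by (simp add: \<psi>_def[abs_def])
      qed
      have Ebd: "(LINT x|lebesgue_on Q. (norm (grad \<psi> x))\<^sup>2) \<le> 4 * ?B"
      proof -
        have s: "grad ?f square_integrable_on Q" "grad ?g square_integrable_on Q"
          using test_function_square_integrable(2)[OF \<phi> Q(2) ls(2)] by auto
        have "(LINT x|lebesgue_on Q. (norm (grad \<psi> x))\<^sup>2) \<le> (LINT x|lebesgue_on Q. 2 * (norm (grad ?f x))\<^sup>2 + 2 * (norm (grad ?g x))\<^sup>2)"
        proof (rule integral_mono)
          show "integrable (lebesgue_on Q) (\<lambda>x. (norm (grad \<psi> x))\<^sup>2)" using test_function_square_integrable(2)[OF \<psi> Q(2) ls(2)] by (simp add: square_integrable_on_def)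
          show "integrable (lebesgue_on Q) (\<lambda>x. 2 * (norm (grad ?f x))\<^sup>2 + 2 * (norm (grad ?g x))\<^sup>2)" using s by (simp add: square_integrable_on_def)
          show "(norm (grad \<psi> x))\<^sup>2 \<le> 2 * (norm (grad ?f x))\<^sup>2 + 2 * (norm (grad ?g x))\<^sup>2" for x
          proof -
            have "(norm (a - b))\<^sup>2 + (norm (a + b))\<^sup>2 = 2 * (norm a)\<^sup>2 + 2 * (norm b)\<^sup>2" for a b :: "real^2"
              using norm_add_square[of a 1 b] norm_add_square[of a "-1" b] by simp
            from this[of "grad ?f x" "grad ?g x"] show ?thesis unfolding g\<psi> using zero_le_power2[of "norm (grad ?f x + grad ?g x)"] by linarith
          qed
        qed
        also have "\<dots> = 2 * (LINT x|lebesgue_on Q. (norm (grad ?f x))\<^sup>2) + 2 * (LINT x|lebesgue_on Q. (norm (grad ?g x))\<^sup>2)"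
          using s by (simp add: square_integrable_on_def)
        also have "\<dots> \<le> 4 * ?B" using E[of "diagseq m"] E[of "diagseq n"] by (simp add: ext(2)[OF \<phi>])
        finally show ?thesis .
      qed
      have avg: "(LINT x|lebesgue_on S. \<psi> x) = X (c, S) (diagseq m) - X (c, S) (diagseq n)" if "(c, S) \<in> set (L j)" for c S
      proof -
        have S: "S \<subseteq> Q" "S \<in> sets lebesgue" using L(1)[of j] that by auto
        show ?thesis unfolding \<psi>_def X_def using int[OF S] by simp
      qed
      have "(LINT x|lebesgue_on \<Omega>. (\<phi> (diagseq m) x - \<phi> (diagseq n) x)\<^sup>2) = (LINT x|lebesgue_on Q. (\<psi> x)\<^sup>2)"
        unfolding ext(1)[OF \<psi>] by (simp add: \<psi>_def)
      also have "\<dots> \<le> \<epsilon>' j * (LINT x|lebesgue_on Q. (norm (grad \<psi> x))\<^sup>2) + (\<Sum>(c, S)\<leftarrow>L j. c * (LINT x|lebesgue_on S. \<psi> x)\<^sup>2)"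
        by (rule L(2)[OF C])
      also have "(\<Sum>(c, S)\<leftarrow>L j. c * (LINT x|lebesgue_on S. \<psi> x)\<^sup>2) = (\<Sum>(c, S)\<leftarrow>L j. c * (X (c, S) (diagseq m) - X (c, S) (diagseq n))\<^sup>2)"
        by (intro arg_cong[of _ _ sum_list] map_cong refl) (auto simp: avg)
      also have "\<epsilon>' j * (LINT x|lebesgue_on Q. (norm (grad \<psi> x))\<^sup>2) \<le> (1 / real (Suc j)) * (4 * ?B)"
        using \<epsilon>'[of j] Ebd by (intro mult_mono) auto
      also have "\<dots> \<le> e / (8 * ?B) * (4 * ?B)" using j by (intro mult_right_mono) auto
      also have "\<dots> = e / 2" by (simp add: field_simps add_nonneg_eq_0_iff)
      finally show ?thesis using N0[OF mn] by linarith
    qed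
    then show "\<exists>N. \<forall>m\<ge>N. \<forall>n\<ge>N. (LINT x|lebesgue_on \<Omega>. (\<phi> (diagseq m) x - \<phi> (diagseq n) x)\<^sup>2) < e" by blast
  qed
qed

section \<open>Variational characterization of the first Dirichlet eigenvalue\<close>

lemma square_integrable_scaleR_product:
  fixes b :: "'a::euclidean_space \<Rightarrow> 'b::euclidean_space"
  assumes "a square_integrable_on \<Omega>" "b square_integrable_on \<Omega>"
  shows "integrable (lebesgue_on \<Omega>) (\<lambda>x. (a x :: real) *\<^sub>R b x)"
proof (rule Bochner_Integration.integrable_bound)
  have "(\<lambda>x. norm (b x)) square_integrable_on \<Omega>" using assms(2) by (auto simp: square_integrable_on_def)
  from square_integrable_inner[OF assms(1) this] show "integrable (lebesgue_on \<Omega>) (\<lambda>x. a x * norm (b x))" by simp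
  show "(\<lambda>x. a x *\<^sub>R b x) \<in> borel_measurable (lebesgue_on \<Omega>)"
    using assms by (intro borel_measurable_scaleR) (auto simp: square_integrable_on_def)
qed (simp add: abs_mult)

lemma test_function_scale:
  assumes "\<phi> \<in> test_functions \<Omega>"
  shows "(\<lambda>x. c * \<phi> x) \<in> test_functions \<Omega>" "grad (\<lambda>x. c * \<phi> x) x = c *\<^sub>R grad \<phi> x"
proof -
  show "(\<lambda>x. c * \<phi> x) \<in> test_functions \<Omega>" using test_functions_lin[OF assms assms, of c 0] by simp
  show "grad (\<lambda>x. c * \<phi> x) x = c *\<^sub>R grad \<phi> x"
    by (simp add: C1_grad_imp_grad[OF C1_grad_cmult[OF test_function_C1[OF assms]]])
qed

lemma test_function_add_scale:
  assumes "\<phi> \<in> test_functions \<Omega>" "\<psi> \<in> test_functions \<Omega>"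
  shows "(\<lambda>x. \<phi> x + t * \<psi> x) \<in> test_functions \<Omega>" "grad (\<lambda>x. \<phi> x + t * \<psi> x) x = grad \<phi> x + t *\<^sub>R grad \<psi> x"
proof -
  show "(\<lambda>x. \<phi> x + t * \<psi> x) \<in> test_functions \<Omega>" using test_functions_lin[OF assms, of 1 t] by simp
  show "grad (\<lambda>x. \<phi> x + t * \<psi> x) x = grad \<phi> x + t *\<^sub>R grad \<psi> x"
    by (simp add: C1_grad_imp_grad[OF C1_grad_add[OF test_function_C1[OF assms(1)] C1_grad_cmult[OF test_function_C1[OF assms(2)]]]])
qed

section \<open>Rayleigh quotients\<close>

definition mass :: "'a::euclidean_space set \<Rightarrow> ('a \<Rightarrow> real) \<Rightarrow> real" where
  "mass \<Omega> \<phi> = (LINT x|lebesgue_on \<Omega>. (\<phi> x)\<^sup>2)"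

definition energy :: "'a::euclidean_space set \<Rightarrow> ('a \<Rightarrow> real) \<Rightarrow> real" where
  "energy \<Omega> \<phi> = (LINT x|lebesgue_on \<Omega>. (norm (grad \<phi> x))\<^sup>2)"

lemma mass_energy_nonneg: "mass \<Omega> \<phi> \<ge> 0" "energy \<Omega> \<phi> \<ge> 0"
  by (simp_all add: mass_def energy_def)

lemma mass_energy_scale:
  assumes "\<phi> \<in> test_functions \<Omega>"
  shows "mass \<Omega> (\<lambda>x. c * \<phi> x) = c\<^sup>2 * mass \<Omega> \<phi>" "energy \<Omega> (\<lambda>x. c * \<phi> x) = c\<^sup>2 * energy \<Omega> \<phi>"
  by (simp_all add: mass_def energy_def test_function_scale[OF assms] power_mult_distrib)

lemma mass_energy_add_scale:
  assumes "\<phi> \<in> test_functions \<Omega>" "\<psi> \<in> test_functions \<Omega>" "bounded \<Omega>" "\<Omega> \<in> sets lebesgue"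
  shows "mass \<Omega> (\<lambda>x. \<phi> x + t * \<psi> x) = mass \<Omega> \<phi> + 2 * t * (LINT x|lebesgue_on \<Omega>. \<phi> x * \<psi> x) + t\<^sup>2 * mass \<Omega> \<psi>"
    "energy \<Omega> (\<lambda>x. \<phi> x + t * \<psi> x) = energy \<Omega> \<phi> + 2 * t * (LINT x|lebesgue_on \<Omega>. grad \<phi> x \<bullet> grad \<psi> x) + t\<^sup>2 * energy \<Omega> \<psi>"
  using integral_norm_add_square[OF test_function_square_integrable(1)[OF assms(1,3,4)] test_function_square_integrable(1)[OF assms(2,3,4)], of t]
    integral_norm_add_square[OF test_function_square_integrable(2)[OF assms(1,3,4)] test_function_square_integrable(2)[OF assms(2,3,4)], of t]
  by (simp_all add: mass_def energy_def test_function_add_scale[OF assms(1,2)])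

lemma mass_positive_exists:
  fixes \<Omega> :: "'a::euclidean_space set"
  assumes "open \<Omega>" "bounded \<Omega>" "\<Omega> \<noteq> {}"
  obtains \<phi> where "\<phi> \<in> test_functions \<Omega>" "mass \<Omega> \<phi> > 0"
proof -
  obtain a r where r: "r > 0" "cball a r \<subseteq> \<Omega>" using assms by (meson all_not_in_conv open_contains_cball)
  have T: "bump a r \<in> test_functions \<Omega>" by (rule bump_test_function[OF r])
  have ls: "\<Omega> \<in> sets lebesgue" using assms by auto
  have sq: "bump a r square_integrable_on \<Omega>" "(\<lambda>_. 1 :: real) square_integrable_on \<Omega>"
    using test_function_square_integrable(1)[OF T assms(2) ls] square_integrable_continuous[OF assms(2) ls, of "\<lambda>_. 1 :: real"] by auto
  have "(LINT x|lebesgue_on \<Omega>. bump a r x) = bump_mass TYPE('a) r"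
    using r ball_subset_cball by (intro bump_integral_on(2) assms) blast+
  then have p: "(LINT x|lebesgue_on \<Omega>. bump a r x) > 0" using bump_mass_pos[OF r(1)] by simp
  have "(LINT x|lebesgue_on \<Omega>. bump a r x * 1)\<^sup>2 \<le> (LINT x|lebesgue_on \<Omega>. (bump a r x)\<^sup>2) * (LINT x|lebesgue_on \<Omega>. 1\<^sup>2)"
    using sq square_integrable_inner[OF sq] by (intro integral_Cauchy_Schwarz) (auto simp: square_integrable_real)
  then have "mass \<Omega> (bump a r) \<noteq> 0" using p by (auto simp: mass_def)
  then have "mass \<Omega> (bump a r) > 0" using mass_energy_nonneg(1)[of \<Omega> "bump a r"] by linarith
  with T show thesis using that by blast
qed

text \<open>Only test functions compete, whose gradients are classical; \<open>lambda1_eq\<close>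
  identifies the value with the first eigenvalue.\<close>

definition dirichlet_inf :: "'a::euclidean_space set \<Rightarrow> real" where
  "dirichlet_inf \<Omega> = Inf {energy \<Omega> \<phi> / mass \<Omega> \<phi> | \<phi>. \<phi> \<in> test_functions \<Omega> \<and> mass \<Omega> \<phi> > 0}"

lemma dirichlet_inf_le:
  assumes "\<phi> \<in> test_functions \<Omega>"
  shows "dirichlet_inf \<Omega> * mass \<Omega> \<phi> \<le> energy \<Omega> \<phi>"
proof (cases "mass \<Omega> \<phi> > 0")
  case True
  have "bdd_below {energy \<Omega> \<phi> / mass \<Omega> \<phi> | \<phi>. \<phi> \<in> test_functions \<Omega> \<and> mass \<Omega> \<phi> > 0}"
    by (rule bdd_belowI[of _ 0]) (auto simp: mass_energy_nonneg)
  then have "dirichlet_inf \<Omega> \<le> energy \<Omega> \<phi> / mass \<Omega> \<phi>"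
    unfolding dirichlet_inf_def using assms True by (intro cInf_lower) auto
  then show ?thesis using True by (simp add: pos_le_divide_eq)
next
  case False
  then have "mass \<Omega> \<phi> = 0" using mass_energy_nonneg(1)[of \<Omega> \<phi>] by linarith
  then show ?thesis by (simp add: mass_energy_nonneg)
qed

lemma dirichlet_inf_greatest:
  fixes \<Omega> :: "'a::euclidean_space set"
  assumes "open \<Omega>" "bounded \<Omega>" "\<Omega> \<noteq> {}" "\<And>\<phi>. \<phi> \<in> test_functions \<Omega> \<Longrightarrow> c * mass \<Omega> \<phi> \<le> energy \<Omega> \<phi>"
  shows "c \<le> dirichlet_inf \<Omega>"
  unfolding dirichlet_inf_def
proof (rule cInf_greatest)
  obtain \<phi> where "\<phi> \<in> test_functions \<Omega>" "mass \<Omega> \<phi> > 0" using mass_positive_exists[OF assms(1-3)] by blast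
  then show "{energy \<Omega> \<phi> / mass \<Omega> \<phi> | \<phi>. \<phi> \<in> test_functions \<Omega> \<and> mass \<Omega> \<phi> > 0} \<noteq> {}" by blast
qed (use assms(4) in \<open>auto simp: pos_le_divide_eq\<close>)

lemma dirichlet_minimizing:
  fixes \<Omega> :: "'a::euclidean_space set"
  assumes "open \<Omega>" "bounded \<Omega>" "\<Omega> \<noteq> {}" "e > 0"
  shows "\<exists>\<phi>\<in>test_functions \<Omega>. mass \<Omega> \<phi> = 1 \<and> energy \<Omega> \<phi> < dirichlet_inf \<Omega> + e"
proof -
  let ?S = "{energy \<Omega> \<phi> / mass \<Omega> \<phi> | \<phi>. \<phi> \<in> test_functions \<Omega> \<and> mass \<Omega> \<phi> > 0}"
  have ne: "?S \<noteq> {}" using mass_positive_exists[OF assms(1-3)] by blast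
  have "Inf ?S < dirichlet_inf \<Omega> + e" using assms(4) by (simp add: dirichlet_inf_def)
  then obtain q where "q \<in> ?S" "q < dirichlet_inf \<Omega> + e" using cInf_lessD[OF ne] by blast
  then obtain \<phi> where \<phi>: "\<phi> \<in> test_functions \<Omega>" "mass \<Omega> \<phi> > 0" "energy \<Omega> \<phi> / mass \<Omega> \<phi> < dirichlet_inf \<Omega> + e" by blast
  let ?c = "1 / sqrt (mass \<Omega> \<phi>)"
  have "?c\<^sup>2 = 1 / mass \<Omega> \<phi>" using \<phi>(2) by (simp add: power_divide)
  then have "mass \<Omega> (\<lambda>x. ?c * \<phi> x) = 1 \<and> energy \<Omega> (\<lambda>x. ?c * \<phi> x) < dirichlet_inf \<Omega> + e"
    unfolding mass_energy_scale[OF \<phi>(1)] using \<phi>(2,3) by simp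
  then show ?thesis using test_function_scale(1)[OF \<phi>(1), of ?c] by blast
qed

text \<open>An eigenfunction is tested with its own approximants: in the limit its energy is
  \<open>l\<close> times its mass, while the Rayleigh inequality for the approximants passes to the
  same limit.\<close>

lemma dirichlet_eigenvalue_ge:
  fixes \<Omega> :: "(real^2) set"
  assumes \<Omega>: "open \<Omega>" "bounded \<Omega>" and l: "dirichlet_eigenvalue \<Omega> l"
  shows "dirichlet_inf \<Omega> \<le> l"
proof -
  let ?M = "lebesgue_on \<Omega>"
  have ls: "\<Omega> \<in> sets lebesgue" using \<Omega> by auto
  obtain u g where H: "H10_with_grad \<Omega> u g" and nz: "nonzero_on \<Omega> u"
    and eq: "\<And>\<phi>. \<phi> \<in> test_functions \<Omega> \<Longrightarrow> (LINT x|?M. g x \<bullet> grad \<phi> x) = l * (LINT x|?M. u x * \<phi> x)"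
    using l unfolding dirichlet_eigenvalue_def by blast
  have us: "u square_integrable_on \<Omega>" and gs: "g square_integrable_on \<Omega>"
    using H by (auto simp: H10_with_grad_def H1_with_grad_def)
  obtain \<phi> :: "nat \<Rightarrow> real^2 \<Rightarrow> real" where \<phi>: "\<And>n. \<phi> n \<in> test_functions \<Omega>"
    and l1: "(\<lambda>n. LINT x|?M. (u x - \<phi> n x)\<^sup>2) \<longlonglongrightarrow> 0" and l2: "(\<lambda>n. LINT x|?M. (norm (g x - grad (\<phi> n) x))\<^sup>2) \<longlonglongrightarrow> 0"
    using H unfolding H10_with_grad_def by blast
  have l1': "(\<lambda>n. LINT x|?M. (norm (u x - \<phi> n x))\<^sup>2) \<longlonglongrightarrow> 0" using l1 by simp
  note sq = test_function_square_integrable[OF \<phi> \<Omega>(2) ls]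
  define U where "U = (LINT x|?M. (u x)\<^sup>2)"
  define G where "G = (LINT x|?M. (norm (g x))\<^sup>2)"
  have NU: "(\<lambda>n. mass \<Omega> (\<phi> n)) \<longlonglongrightarrow> U" using L2_norm_tendsto[OF us sq(1) l1'] by (simp add: mass_def U_def)
  have EG: "(\<lambda>n. energy \<Omega> (\<phi> n)) \<longlonglongrightarrow> G" using L2_norm_tendsto[OF gs sq(2) l2] by (simp add: energy_def G_def)
  have "(\<lambda>n. LINT x|?M. grad (\<phi> n) x \<bullet> g x) \<longlonglongrightarrow> (LINT x|?M. g x \<bullet> g x)" by (rule L2_inner_tendsto[OF gs gs sq(2) l2])
  then have a: "(\<lambda>n. l * (LINT x|?M. u x * \<phi> n x)) \<longlonglongrightarrow> G"
    by (simp add: G_def power2_norm_eq_inner inner_commute flip: eq[OF \<phi>])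
  have "(\<lambda>n. LINT x|?M. \<phi> n x \<bullet> u x) \<longlonglongrightarrow> (LINT x|?M. u x \<bullet> u x)" by (rule L2_inner_tendsto[OF us us sq(1) l1'])
  then have "(\<lambda>n. LINT x|?M. u x * \<phi> n x) \<longlonglongrightarrow> U" by (simp add: U_def power2_eq_square mult.commute)
  then have "(\<lambda>n. l * (LINT x|?M. u x * \<phi> n x)) \<longlonglongrightarrow> l * U" by (intro tendsto_intros)
  with a have GlU: "G = l * U" by (rule LIMSEQ_unique)
  have "dirichlet_inf \<Omega> * U \<le> G"
    by (rule LIMSEQ_le[OF tendsto_mult[OF tendsto_const NU] EG]) (use dirichlet_inf_le[OF \<phi>] in blast)
  moreover have "U > 0"
  proof -
    have "U \<noteq> 0"
    proof
      assume "U = 0"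
      then have "AE x in ?M. (u x)\<^sup>2 = 0"
        using us unfolding U_def by (subst (asm) integral_nonneg_eq_0_iff_AE) (auto simp: square_integrable_real)
      then show False using nz by (simp add: nonzero_on_def)
    qed
    moreover have "U \<ge> 0" by (simp add: U_def)
    ultimately show ?thesis by simp
  qed
  ultimately show ?thesis unfolding GlU by simp
qed

text \<open>Direct method. Compactness makes a minimising sequence Cauchy in L2, minimality makes
  the gradients Cauchy as well, and first variation turns the limit into a weak solution.\<close>

lemma dirichlet_eigenvalue_exists:
  fixes \<Omega> :: "(real^2) set"
  assumes \<Omega>: "open \<Omega>" "bounded \<Omega>" "\<Omega> \<noteq> {}"
  shows "dirichlet_eigenvalue \<Omega> (dirichlet_inf \<Omega>)"
proof -
  let ?M = "lebesgue_on \<Omega>" and ?l = "dirichlet_inf \<Omega>"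
  have ls: "\<Omega> \<in> sets lebesgue" using \<Omega> by auto
  have lm: "\<Omega> \<in> lmeasurable" using \<Omega> by (auto intro: lmeasurable_open)
  have "\<forall>n. \<exists>\<phi>. \<phi> \<in> test_functions \<Omega> \<and> mass \<Omega> \<phi> = 1 \<and> energy \<Omega> \<phi> < ?l + 1 / real (Suc n)"
    using dirichlet_minimizing[OF \<Omega>] by (metis of_nat_0_less_iff zero_less_Suc zero_less_divide_1_iff)
  from choice[OF this] obtain \<phi> where \<phi>all: "\<forall>n. \<phi> n \<in> test_functions \<Omega> \<and> mass \<Omega> (\<phi> n) = 1 \<and> energy \<Omega> (\<phi> n) < ?l + 1 / real (Suc n)"
    by (rule exE)
  then have \<phi>: "\<phi> n \<in> test_functions \<Omega>" "mass \<Omega> (\<phi> n) = 1" "energy \<Omega> (\<phi> n) < ?l + 1 / real (Suc n)" for n by auto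
  have "1 / real (Suc n) \<le> 1" for n by simp
  then have En: "energy \<Omega> (\<phi> n) \<le> ?l + 1" for n using \<phi>(3)[of n] by (meson add_left_mono less_imp_le order_trans)
  obtain r :: "nat \<Rightarrow> nat" where r: "strict_mono r"
    "\<forall>e>0. \<exists>N. \<forall>m\<ge>N. \<forall>n\<ge>N. (LINT x|?M. (\<phi> (r m) x - \<phi> (r n) x)\<^sup>2) < e"
  proof (rule test_function_rellich[OF \<Omega>(1,2), where \<phi>=\<phi> and A=1 and B="?l + 1"])
    show "\<phi> n \<in> test_functions \<Omega>" for n by (rule \<phi>(1))
    show "(LINT x|?M. (\<phi> n x)\<^sup>2) \<le> 1" for n using \<phi>(2)[of n] by (simp add: mass_def)
    show "(LINT x|?M. (norm (grad (\<phi> n) x))\<^sup>2) \<le> ?l + 1" for n using En[of n] by (simp add: energy_def)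
  qed
  define f where "f n = \<phi> (r n)" for n
  have f: "f n \<in> test_functions \<Omega>" "mass \<Omega> (f n) = 1" for n by (auto simp: f_def \<phi>)
  note sq = test_function_square_integrable[OF f(1) \<Omega>(2) ls]
  have El: "(\<lambda>n. energy \<Omega> (f n)) \<longlonglongrightarrow> ?l"
  proof (rule real_tendsto_sandwich)
    show "\<forall>\<^sub>F n in sequentially. ?l \<le> energy \<Omega> (f n)"
      using dirichlet_inf_le[OF f(1)] f(2) by (intro always_eventually) simp
    show "\<forall>\<^sub>F n in sequentially. energy \<Omega> (f n) \<le> ?l + 1 / real (Suc n)"
    proof (intro always_eventually allI)
      fix n
      have "n \<le> r n" using r(1) by (rule seq_suble)
      then have "1 / real (Suc (r n)) \<le> 1 / real (Suc n)" by (intro divide_left_mono) auto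
      then show "energy \<Omega> (f n) \<le> ?l + 1 / real (Suc n)" using \<phi>(3)[of "r n"] by (simp add: f_def)
    qed
    show "(\<lambda>n. ?l + 1 / real (Suc n)) \<longlonglongrightarrow> ?l"
      using tendsto_add[OF tendsto_const[of ?l] LIMSEQ_inverse_real_of_nat] by (simp add: inverse_eq_divide)
  qed simp
  have massd: "(LINT x|?M. (f m x - f n x)\<^sup>2) = mass \<Omega> (\<lambda>x. f m x + (- 1) * f n x)" for m n
    by (simp add: mass_def)
  have graddiff: "(LINT x|?M. (norm (grad (f m) x - grad (f n) x))\<^sup>2) = energy \<Omega> (\<lambda>x. f m x + (- 1) * f n x)" for m n
    unfolding energy_def test_function_add_scale(2)[OF f(1) f(1)] by simp
  \<comment> \<open>Parallelogram identity for the energy; the sum \<open>f m + f n\<close> has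
    energy at least \<open>?l\<close> times its mass, which is 4 minus the mass of the
    difference.\<close>
  have par: "(LINT x|?M. (norm (grad (f m) x - grad (f n) x))\<^sup>2)
      \<le> 2 * (energy \<Omega> (f m) - ?l) + 2 * (energy \<Omega> (f n) - ?l) + ?l * (LINT x|?M. (f m x - f n x)\<^sup>2)" for m n
  proof -
    note ms = mass_energy_add_scale[OF f(1)[of m] f(1)[of n] \<Omega>(2) ls]
    have "?l * mass \<Omega> (\<lambda>x. f m x + 1 * f n x) \<le> energy \<Omega> (\<lambda>x. f m x + 1 * f n x)"
      by (intro dirichlet_inf_le test_function_add_scale(1) f)
    then show ?thesis unfolding massd graddiff ms f(2) by (simp add: algebra_simps)
  qed
  obtain u where us: "u square_integrable_on \<Omega>" and ul: "(\<lambda>n. LINT x|?M. (norm (u x - f n x))\<^sup>2) \<longlonglongrightarrow> 0"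
  proof (rule L2_complete[OF lm sq(1)])
    show "\<exists>N. \<forall>m\<ge>N. \<forall>n\<ge>N. (LINT x|?M. (norm (f m x - f n x))\<^sup>2) < e" if "e > 0" for e
      using r(2) that by (simp add: f_def)
  qed
  obtain g where gs: "g square_integrable_on \<Omega>" and gl: "(\<lambda>n. LINT x|?M. (norm (g x - grad (f n) x))\<^sup>2) \<longlonglongrightarrow> 0"
  proof (rule L2_complete[OF lm sq(2)])
    fix e :: real assume e: "e > 0"
    \<comment> \<open>Budget: \<open>e / 8\<close> from the L2 distance and \<open>2 e / 8\<close>
      from each of the two energies.\<close>
    define e' where "e' = e / (8 * (\<bar>?l\<bar> + 1))"
    have e': "e' > 0" using e by (simp add: e'_def)
    have e'2: "\<bar>?l\<bar> * e' \<le> e / 8" using e by (simp add: e'_def field_simps)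
    obtain N1 where N1: "\<forall>m\<ge>N1. \<forall>n\<ge>N1. (LINT x|?M. (f m x - f n x)\<^sup>2) < e'" using r(2) e' by (auto simp: f_def)
    have "\<forall>\<^sub>F n in sequentially. energy \<Omega> (f n) < ?l + e / 8" using El e by (intro order_tendstoD(2)) auto
    then obtain N2 where N2: "\<forall>n\<ge>N2. energy \<Omega> (f n) < ?l + e / 8" by (auto simp: eventually_sequentially)
    have arith: "G < e" if "p \<le> e / 8" "a < l + e / 8" "b < l + e / 8" "G \<le> 2 * (a - l) + 2 * (b - l) + p" "0 < e"
      for p a b l G :: real
    proof -
      have "2 * (a - l) \<le> 2 * (e / 8)" "2 * (b - l) \<le> 2 * (e / 8)"
        by (rule mult_left_mono; use that in simp)+
      then have "2 * (a - l) + 2 * (b - l) + p \<le> 2 * (e / 8) + 2 * (e / 8) + e / 8"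
        by (intro add_mono that(1))
      also have "\<dots> < e" using that(5) by simp
      finally show ?thesis using that(4) by (rule le_less_trans[rotated])
    qed
    have "(LINT x|?M. (norm (grad (f m) x - grad (f n) x))\<^sup>2) < e" if "m \<ge> max N1 N2" "n \<ge> max N1 N2" for m n
    proof -
      have "?l * (LINT x|?M. (f m x - f n x)\<^sup>2) \<le> \<bar>?l\<bar> * e'"
        using N1[rule_format, of m n] that by (intro mult_mono) auto
      from order_trans[OF this e'2] have "?l * (LINT x|?M. (f m x - f n x)\<^sup>2) \<le> e / 8" .
      moreover have "energy \<Omega> (f m) < ?l + e / 8" "energy \<Omega> (f n) < ?l + e / 8" using N2 that by auto
      ultimately show ?thesis using par[of m n] e by (rule arith)
    qed
    then show "\<exists>N. \<forall>m\<ge>N. \<forall>n\<ge>N. (LINT x|?M. (norm (grad (f m) x - grad (f n) x))\<^sup>2) < e" by blast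
  qed
  have H1: "H1_with_grad \<Omega> u g"
    unfolding H1_with_grad_def
  proof (intro conjI ballI us gs)
    fix \<psi> assume \<psi>: "\<psi> \<in> test_functions \<Omega>"
    note \<psi>s = test_function_square_integrable[OF \<psi> \<Omega>(2) ls]
    have c\<psi>: "continuous_on UNIV \<psi>" "continuous_on UNIV (grad \<psi>)"
      using test_function_C1[OF \<psi>] C1_grad_continuous by (auto simp: C1_grad_def)
    \<comment> \<open>Tested against a fixed vector, both sides become L2 scalar products, which
      converge.\<close>
    have "(LINT x|?M. u x *\<^sub>R grad \<psi> x) \<bullet> v = - (LINT x|?M. \<psi> x *\<^sub>R g x) \<bullet> v" for v
    proof -
      have s1: "(\<lambda>x. grad \<psi> x \<bullet> v) square_integrable_on \<Omega>" and s2: "(\<lambda>x. \<psi> x *\<^sub>R v) square_integrable_on \<Omega>"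
        using c\<psi> by (auto intro!: square_integrable_continuous[OF \<Omega>(2) ls] continuous_intros)
      have A: "(LINT x|?M. a x *\<^sub>R grad \<psi> x) \<bullet> v = (LINT x|?M. a x \<bullet> (grad \<psi> x \<bullet> v))" if "a square_integrable_on \<Omega>" for a :: "real^2 \<Rightarrow> real"
        using integral_inner_left[of v ?M "\<lambda>x. a x *\<^sub>R grad \<psi> x"] square_integrable_scaleR_product[OF that \<psi>s(2)] by simp
      have B: "(LINT x|?M. \<psi> x *\<^sub>R b x) \<bullet> v = (LINT x|?M. b x \<bullet> (\<psi> x *\<^sub>R v))" if "b square_integrable_on \<Omega>" for b :: "real^2 \<Rightarrow> real^2"
        using integral_inner_left[of v ?M "\<lambda>x. \<psi> x *\<^sub>R b x"] square_integrable_scaleR_product[OF \<psi>s(1) that] by simp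
      have "(\<lambda>n. (LINT x|?M. f n x \<bullet> (grad \<psi> x \<bullet> v))) \<longlonglongrightarrow> (LINT x|?M. u x \<bullet> (grad \<psi> x \<bullet> v))"
        by (rule L2_inner_tendsto[OF us s1 sq(1) ul])
      moreover have "(\<lambda>n. - (LINT x|?M. grad (f n) x \<bullet> (\<psi> x *\<^sub>R v))) \<longlonglongrightarrow> - (LINT x|?M. g x \<bullet> (\<psi> x *\<^sub>R v))"
        by (rule tendsto_minus[OF L2_inner_tendsto[OF gs s2 sq(2) gl]])
      moreover have "(LINT x|?M. f n x \<bullet> (grad \<psi> x \<bullet> v)) = - (LINT x|?M. grad (f n) x \<bullet> (\<psi> x *\<^sub>R v))" for n
        using C1_grad_integration_by_parts[OF test_function_C1[OF f(1)[of n]] ls \<psi>]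
        unfolding A[OF sq(1), symmetric] B[OF sq(2), symmetric] by simp
      ultimately have "(LINT x|?M. u x \<bullet> (grad \<psi> x \<bullet> v)) = - (LINT x|?M. g x \<bullet> (\<psi> x *\<^sub>R v))"
        using LIMSEQ_unique by simp
      then show ?thesis unfolding A[OF us, symmetric] B[OF gs, symmetric] by simp
    qed
    then have "\<forall>v. (LINT x|?M. u x *\<^sub>R grad \<psi> x) \<bullet> v = - (LINT x|?M. \<psi> x *\<^sub>R g x) \<bullet> v" ..
    then show "(LINT x|?M. u x *\<^sub>R grad \<psi> x) = - (LINT x|?M. \<psi> x *\<^sub>R g x)"
      by (rule vector_eq_rdot[THEN iffD1])
  qed
  have H10: "H10_with_grad \<Omega> u g"
    unfolding H10_with_grad_def using H1 f(1) ul gl by (intro conjI exI[of _ f]) auto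
  have U1: "(LINT x|?M. (u x)\<^sup>2) = 1"
  proof -
    have "(\<lambda>n. mass \<Omega> (f n)) \<longlonglongrightarrow> (LINT x|?M. (u x)\<^sup>2)" using L2_norm_tendsto[OF us sq(1) ul] by (simp add: mass_def)
    then show ?thesis using f(2) by (simp add: LIMSEQ_const_iff)
  qed
  have nz: "nonzero_on \<Omega> u"
    unfolding nonzero_on_def
  proof
    assume "AE x in ?M. u x = 0"
    then have "(LINT x|?M. (u x)\<^sup>2) = 0" by (intro integral_eq_zero_AE) (auto elim: eventually_mono)
    then show False using U1 by simp
  qed
  have "(LINT x|?M. g x \<bullet> grad \<psi> x) = ?l * (LINT x|?M. u x * \<psi> x)" if \<psi>: "\<psi> \<in> test_functions \<Omega>" for \<psi>
  proof -
    note \<psi>s = test_function_square_integrable[OF \<psi> \<Omega>(2) ls]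
    define X where "X = (LINT x|?M. g x \<bullet> grad \<psi> x) - ?l * (LINT x|?M. u x * \<psi> x)"
    have L1: "(\<lambda>n. LINT x|?M. grad (f n) x \<bullet> grad \<psi> x) \<longlonglongrightarrow> (LINT x|?M. g x \<bullet> grad \<psi> x)"
      by (rule L2_inner_tendsto[OF gs \<psi>s(2) sq(2) gl])
    have L2: "(\<lambda>n. LINT x|?M. f n x * \<psi> x) \<longlonglongrightarrow> (LINT x|?M. u x * \<psi> x)"
      using L2_inner_tendsto[OF us \<psi>s(1) sq(1) ul] by simp
    \<comment> \<open>The Rayleigh inequality for \<open>f n + t \<psi>\<close> becomes, as
      \<open>n\<close> grows, a quadratic in \<open>t\<close> that vanishes at 0.\<close>
    have "0 \<le> t * (2 * X) + t\<^sup>2 * (energy \<Omega> \<psi> - ?l * mass \<Omega> \<psi>)" for t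
    proof -
      have "?l * (1 + 2 * t * (LINT x|?M. f n x * \<psi> x) + t\<^sup>2 * mass \<Omega> \<psi>)
          \<le> energy \<Omega> (f n) + 2 * t * (LINT x|?M. grad (f n) x \<bullet> grad \<psi> x) + t\<^sup>2 * energy \<Omega> \<psi>" for n
        using dirichlet_inf_le[OF test_function_add_scale(1)[OF f(1)[of n] \<psi>], of t]
        unfolding mass_energy_add_scale[OF f(1)[of n] \<psi> \<Omega>(2) ls] f(2) .
      then have "?l * (1 + 2 * t * (LINT x|?M. u x * \<psi> x) + t\<^sup>2 * mass \<Omega> \<psi>)
          \<le> ?l + 2 * t * (LINT x|?M. g x \<bullet> grad \<psi> x) + t\<^sup>2 * energy \<Omega> \<psi>"
        by (intro LIMSEQ_le[of "\<lambda>n. ?l * (1 + 2 * t * (LINT x|?M. f n x * \<psi> x) + t\<^sup>2 * mass \<Omega> \<psi>)" _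
            "\<lambda>n. energy \<Omega> (f n) + 2 * t * (LINT x|?M. grad (f n) x \<bullet> grad \<psi> x) + t\<^sup>2 * energy \<Omega> \<psi>"] tendsto_intros L1 L2 El) blast
      then show ?thesis by (simp add: X_def algebra_simps)
    qed
    then have "2 * X = 0" by (rule quadratic_nonneg_linear_zero)
    then show ?thesis by (simp add: X_def)
  qed
  with H10 nz show ?thesis unfolding dirichlet_eigenvalue_def by blast
qed

text \<open>\<open>LEAST\<close> is meaningful here: the Rayleigh infimum is an eigenvalue, and no
  eigenvalue lies below it.\<close>

lemma lambda1_eq:
  fixes \<Omega> :: "(real^2) set"
  assumes "open \<Omega>" "bounded \<Omega>" "\<Omega> \<noteq> {}"
  shows "lambda1 \<Omega> = dirichlet_inf \<Omega>"
  unfolding lambda1_def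
  using dirichlet_eigenvalue_exists[OF assms] dirichlet_eigenvalue_ge[OF assms(1,2)] by (intro Least_equality)

section \<open>The lower bound\<close>

lemma inner_strict_bounds:
  fixes P :: "(real^2) set"
  assumes P: "open P" "bounded P" and v: "norm v = 1" and x: "x \<in> P"
  shows "x \<bullet> v < (SUP x\<in>P. x \<bullet> v)" "(INF x\<in>P. x \<bullet> v) < x \<bullet> v"
proof -
  have vv: "v \<bullet> v = 1" using v by (simp add: dot_square_norm)
  obtain e where e: "e > 0" "ball x e \<subseteq> P" using P(1) x open_contains_ball by blast
  have "x + (e / 2) *\<^sub>R v \<in> P" "x - (e / 2) *\<^sub>R v \<in> P" using e v by (auto intro!: subsetD[OF e(2)] simp: dist_norm)
  from inner_Sup_Inf(1)[OF P(2) this(1), of v] inner_Sup_Inf(2)[OF P(2) this(2), of v]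
  show "x \<bullet> v < (SUP x\<in>P. x \<bullet> v)" "(INF x\<in>P. x \<bullet> v) < x \<bullet> v"
    using e(1) by (simp_all add: inner_add_left inner_diff_left vv)
qed

lemma width_le:
  fixes P :: "(real^2) set"
  assumes "P \<noteq> {}" "\<And>x y. x \<in> P \<Longrightarrow> y \<in> P \<Longrightarrow> (x - y) \<bullet> v \<le> D"
  shows "width P v \<le> D"
proof -
  have "x \<bullet> v - D \<le> (INF y\<in>P. y \<bullet> v)" if "x \<in> P" for x
    using assms(1) assms(2)[OF that] by (intro cINF_greatest) (auto simp: inner_diff_left algebra_simps)
  then have "(SUP x\<in>P. x \<bullet> v) \<le> (INF y\<in>P. y \<bullet> v) + D"
    using assms(1) by (intro cSUP_least) (auto simp: algebra_simps)
  then show ?thesis by (simp add: width_def)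
qed

lemma width_pos:
  fixes P :: "(real^2) set"
  assumes "open P" "bounded P" "P \<noteq> {}" "norm v = 1" shows "width P v > 0"
proof -
  obtain x where "x \<in> P" using assms(3) by blast
  from inner_strict_bounds[OF assms(1,2,4) this] show ?thesis by (simp add: width_def)
qed

text \<open>On every line in direction \<open>rot2 v\<close> the test function vanishes off an
  interval of length \<open>width \<Omega> (rot2 v)\<close>, the same for all lines; Fubini adds up
  the one-dimensional inequalities.\<close>

lemma wirtinger_slices:
  fixes \<Omega> :: "(real^2) set"
  assumes \<Omega>: "open \<Omega>" "bounded \<Omega>" "\<Omega> \<noteq> {}" and v: "norm v = 1" and \<phi>: "\<phi> \<in> test_functions \<Omega>"
  shows "(pi / width \<Omega> (rot2 v))\<^sup>2 * mass \<Omega> \<phi> \<le> (LINT x|lebesgue_on \<Omega>. (grad \<phi> x \<bullet> rot2 v)\<^sup>2)"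
proof -
  let ?e = "rot2 v"
  define a b where "a = (INF x\<in>\<Omega>. x \<bullet> ?e)" and "b = (SUP x\<in>\<Omega>. x \<bullet> ?e)"
  have ne: "norm ?e = 1" using v by simp
  have st: "a < x \<bullet> ?e" "x \<bullet> ?e < b" if "x \<in> \<Omega>" for x
    unfolding a_def b_def using inner_strict_bounds[OF \<Omega>(1,2) ne that] by auto
  have w: "width \<Omega> ?e = b - a" by (simp add: width_def a_def b_def)
  then have ab: "a < b" using width_pos[OF \<Omega> ne] by simp
  have ls: "\<Omega> \<in> sets lebesgue" using \<Omega> by auto
  obtain K where K: "compact K" "K \<subseteq> \<Omega>" "\<And>x. x \<notin> K \<Longrightarrow> \<phi> x = 0" "\<And>x. x \<notin> K \<Longrightarrow> grad \<phi> x = 0"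
    and C: "C1_grad \<phi> (grad \<phi>)" using test_functionsE[OF \<phi>] by metis
  have c: "continuous_on UNIV \<phi>" "continuous_on UNIV (grad \<phi>)" using C C1_grad_continuous by (auto simp: C1_grad_def)
  have c2: "continuous_on UNIV (\<lambda>x. (\<phi> x)\<^sup>2)" "continuous_on UNIV (\<lambda>x. (grad \<phi> x \<bullet> ?e)\<^sup>2)" by (intro continuous_intros c)+
  have z: "(\<phi> x)\<^sup>2 = 0" "(grad \<phi> x \<bullet> ?e)\<^sup>2 = 0" if "x \<notin> K" for x using K(3,4)[OF that] by auto
  have eq: "(LINT x|lebesgue_on \<Omega>. (\<phi> x)\<^sup>2) = (LINT x|lborel. (\<phi> x)\<^sup>2)"
    "(LINT x|lebesgue_on \<Omega>. (grad \<phi> x \<bullet> ?e)\<^sup>2) = (LINT x|lborel. (grad \<phi> x \<bullet> ?e)\<^sup>2)"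
    by (rule integral_lebesgue_on_support[OF ls _ borel_measurable_continuous_onI[OF c2(1)]], use z K(2) in blast)
       (rule integral_lebesgue_on_support[OF ls _ borel_measurable_continuous_onI[OF c2(2)]], use z K(2) in blast)
  have i: "integrable lborel (\<lambda>x. (\<phi> x)\<^sup>2)" "integrable lborel (\<lambda>x. (grad \<phi> x \<bullet> ?e)\<^sup>2)"
    by (rule integrable_compact_support[OF c2(1) K(1) z(1)], assumption)
       (rule integrable_compact_support[OF c2(2) K(1) z(2)], assumption)
  have inner: "(pi / (b - a))\<^sup>2 * (LINT t|lborel. (\<phi> (frame2 v (s, t)))\<^sup>2) \<le> (LINT t|lborel. (grad \<phi> (frame2 v (s, t)) \<bullet> ?e)\<^sup>2)" for s
  proof -
    define u where "u t = \<phi> (frame2 v (s, t))" for t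
    define u' where "u' t = grad \<phi> (frame2 v (s, t)) \<bullet> ?e" for t
    have cf: "continuous_on UNIV (\<lambda>t. frame2 v (s, t))" unfolding frame2_def by (intro continuous_intros)
    have u: "(u has_real_derivative u' t) (at t)" for t
    proof -
      have A: "((\<lambda>t. frame2 v (s, t)) has_derivative (\<lambda>h. h *\<^sub>R ?e)) (at t)"
        unfolding frame2_def by (auto intro!: derivative_eq_intros)
      have B: "(\<phi> has_derivative (\<lambda>h. h \<bullet> grad \<phi> (frame2 v (s, t)))) (at (frame2 v (s, t)))"
        using C by (simp add: C1_grad_def)
      show ?thesis using has_derivative_compose[OF A B]
        by (simp add: has_field_derivative_def u_def[abs_def] u'_def inner_commute mult_commute_abs)
    qed
    have cu: "continuous_on UNIV u" "continuous_on UNIV u'" unfolding u_def u'_def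
      by (auto intro!: continuous_on_compose2[OF c(1) cf] continuous_on_inner continuous_on_compose2[OF c(2) cf])
    have out: "frame2 v (s, t) \<notin> K" if "t \<notin> {a<..<b}" for t
      using that st[of "frame2 v (s, t)"] K(2) frame2_inner(2)[OF v, of s t] by auto
    have zero: "u t = 0" "u' t = 0" if "t \<notin> {a<..<b}" for t
      using K(3,4)[OF out[OF that]] by (auto simp: u_def u'_def)
    have conv: "(LINT t|lborel. (f t)\<^sup>2) = integral {a..b} (\<lambda>t. (f t)\<^sup>2)"
      if "continuous_on UNIV f" "\<And>t. t \<notin> {a<..<b} \<Longrightarrow> f t = 0" for f :: "real \<Rightarrow> real"
    proof -
      have "continuous_on {a..b} (\<lambda>t. (f t)\<^sup>2)" using continuous_on_subset[OF that(1)] by (intro continuous_intros) auto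
      then have "integral {a..b} (\<lambda>t. (f t)\<^sup>2) = (LINT t|lborel. indicator {a..b} t * (f t)\<^sup>2)" by (rule integral_Icc_lborel)
      also have "\<dots> = (LINT t|lborel. (f t)\<^sup>2)"
      proof (intro Bochner_Integration.integral_cong refl)
        fix t show "indicator {a..b} t * (f t)\<^sup>2 = (f t)\<^sup>2"
          using that(2)[of t] by (cases "t \<in> {a<..<b}") auto
      qed
      finally show ?thesis by simp
    qed
    have "(pi / (b - a))\<^sup>2 * integral {a..b} (\<lambda>t. (u t)\<^sup>2) \<le> integral {a..b} (\<lambda>t. (u' t)\<^sup>2)"
      using u cu(2) zero ab by (intro wirtinger) (auto intro: has_field_derivative_at_within continuous_on_subset)
    then show ?thesis using conv[OF cu(1) zero(1)] conv[OF cu(2) zero(2)] by (simp add: u_def u'_def)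
  qed
  have "(pi / (b - a))\<^sup>2 * (LINT x|lborel. (\<phi> x)\<^sup>2) = (LINT s|lborel. (pi / (b - a))\<^sup>2 * (LINT t|lborel. (\<phi> (frame2 v (s, t)))\<^sup>2))"
    unfolding integral_frame2[OF v i(1)] by simp
  also have "\<dots> \<le> (LINT s|lborel. LINT t|lborel. (grad \<phi> (frame2 v (s, t)) \<bullet> ?e)\<^sup>2)"
    using lborel_pair.integrable_fst'[OF integrable_frame2[OF v i(1)]] lborel_pair.integrable_fst'[OF integrable_frame2[OF v i(2)]] inner
    by (intro integral_mono integrable_mult_right) auto
  also have "\<dots> = (LINT x|lborel. (grad \<phi> x \<bullet> ?e)\<^sup>2)" unfolding integral_frame2[OF v i(2)] ..
  finally show ?thesis unfolding mass_def w eq .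
qed

text \<open>The left-hand side is the first eigenvalue of the circumscribed rectangle with sides
  along \<open>v\<close> and \<open>rot2 v\<close>. The energy splits into its two directional
  parts.\<close>

lemma lambda1_lower:
  fixes \<Omega> :: "(real^2) set"
  assumes \<Omega>: "open \<Omega>" "bounded \<Omega>" "\<Omega> \<noteq> {}" and v: "norm v = 1"
  shows "(pi / width \<Omega> v)\<^sup>2 + (pi / width \<Omega> (rot2 v))\<^sup>2 \<le> lambda1 \<Omega>"
  unfolding lambda1_eq[OF \<Omega>]
proof (rule dirichlet_inf_greatest[OF \<Omega>])
  fix \<phi> assume \<phi>: "\<phi> \<in> test_functions \<Omega>"
  have rr: "rot2 (- rot2 v) = v" by (simp add: vec_eq_iff forall_2)
  have ls: "\<Omega> \<in> sets lebesgue" using \<Omega> by auto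
  have c: "continuous_on UNIV (grad \<phi>)" using test_function_C1[OF \<phi>] by (simp add: C1_grad_def)
  have i: "integrable (lebesgue_on \<Omega>) (\<lambda>x. (grad \<phi> x \<bullet> e)\<^sup>2)" for e
    by (intro integrable_continuous_bounded \<Omega> ls continuous_intros c)
  have "(norm x)\<^sup>2 = (x \<bullet> v)\<^sup>2 + (x \<bullet> rot2 v)\<^sup>2" for x
    using norm_frame2[OF v, of "x \<bullet> v" "x \<bullet> rot2 v"] by (simp add: frame2_decompose[OF v])
  then have "energy \<Omega> \<phi> = (LINT x|lebesgue_on \<Omega>. (grad \<phi> x \<bullet> v)\<^sup>2) + (LINT x|lebesgue_on \<Omega>. (grad \<phi> x \<bullet> rot2 v)\<^sup>2)"
    unfolding energy_def using i by simp
  moreover have "(pi / width \<Omega> v)\<^sup>2 * mass \<Omega> \<phi> \<le> (LINT x|lebesgue_on \<Omega>. (grad \<phi> x \<bullet> v)\<^sup>2)"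
    using wirtinger_slices[OF \<Omega>, of "- rot2 v" \<phi>] v \<phi> unfolding rr by simp
  moreover have "(pi / width \<Omega> (rot2 v))\<^sup>2 * mass \<Omega> \<phi> \<le> (LINT x|lebesgue_on \<Omega>. (grad \<phi> x \<bullet> rot2 v)\<^sup>2)"
    by (rule wirtinger_slices[OF \<Omega> v \<phi>])
  ultimately show "((pi / width \<Omega> v)\<^sup>2 + (pi / width \<Omega> (rot2 v))\<^sup>2) * mass \<Omega> \<phi> \<le> energy \<Omega> \<phi>"
    by (simp add: distrib_right)
qed

section \<open>Area, diameter and width\<close>

lemma triangle_area:
  fixes p x v :: "real^2"
  assumes "D \<ge> 0"
  shows "measure lebesgue (convex hull {p, p + D *\<^sub>R v, x}) = D * \<bar>(x - p) \<bullet> rot2 v\<bar> / 2"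
proof -
  have cp: "compact (convex hull {p, p + D *\<^sub>R v, x})" by (intro compact_convex_hull finite_imp_compact) auto
  have "measure lebesgue (convex hull {p, p + D *\<^sub>R v, x}) = measure lborel (convex hull {p, p + D *\<^sub>R v, x})"
    by (rule measure_completion) (simp add: borel_compact cp)
  also have "\<dots> = \<bar>(x $ 1 - p $ 1) * (D * v $ 2) - D * v $ 1 * (x $ 2 - p $ 2)\<bar> / 2"
    by (simp add: content_triangle)
  also have "(x $ 1 - p $ 1) * (D * v $ 2) - D * v $ 1 * (x $ 2 - p $ 2) = - (D * ((x - p) \<bullet> rot2 v))"
    by (simp add: inner_real2 algebra_simps)
  finally show ?thesis using assms by (simp add: abs_mult)
qed

text \<open>Triangles over the segment with apexes on opposite sides of its line overlap in a null
  set, and their heights add up. For two apexes on the same side a single triangle is already high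
  enough.\<close>

lemma area_ge_diameter_width:
  fixes \<Omega> :: "(real^2) set"
  assumes \<Omega>: "open \<Omega>" "convex \<Omega>" "bounded \<Omega>" "\<Omega> \<noteq> {}"
    and p: "p \<in> closure \<Omega>" "p + D *\<^sub>R v \<in> closure \<Omega>" and D: "D > 0" and v: "norm v = 1"
  shows "D * width \<Omega> (rot2 v) \<le> 2 * measure lebesgue \<Omega>"
proof -
  let ?e = "rot2 v" and ?q = "p + D *\<^sub>R v"
  \<comment> \<open>The segment ends in the closure only; the frontier of a convex set is null, so
    the area is unchanged.\<close>
  have cl: "measure lebesgue (closure \<Omega>) = measure lebesgue \<Omega>"
    by (rule measure_closure[OF \<Omega>(3) negligible_convex_frontier[OF \<Omega>(2)]])
  have lcl: "closure \<Omega> \<in> lmeasurable" using \<Omega>(3) by (intro lmeasurable_compact) (simp add: compact_closure)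
  define T where "T x = convex hull {p, ?q, x}" for x
  have Tc: "compact (T x)" for x unfolding T_def by (intro compact_convex_hull finite_imp_compact) auto
  have Tl: "T x \<in> lmeasurable" for x by (rule lmeasurable_compact[OF Tc])
  have Tsub: "T x \<subseteq> closure \<Omega>" if "x \<in> \<Omega>" for x
    unfolding T_def using p that closure_subset convex_closure[OF \<Omega>(2)] by (intro hull_minimal) auto
  have Ta: "measure lebesgue (T x) = D * \<bar>(x - p) \<bullet> ?e\<bar> / 2" for x
    unfolding T_def using D by (intro triangle_area) simp
  have qe: "?q \<bullet> ?e = p \<bullet> ?e" by (simp add: inner_add_left)
  have single: "D * \<bar>(x - p) \<bullet> ?e\<bar> \<le> 2 * measure lebesgue \<Omega>" if "x \<in> \<Omega>" for x
  proof -
    have "measure lebesgue (T x) \<le> measure lebesgue (closure \<Omega>)"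
      using Tl lcl Tsub[OF that] by (intro measure_mono_fmeasurable) auto
    then show ?thesis unfolding Ta cl by simp
  qed
  have double: "D * ((x - p) \<bullet> ?e) + D * ((p - y) \<bullet> ?e) \<le> 2 * measure lebesgue \<Omega>"
    if xy: "x \<in> \<Omega>" "y \<in> \<Omega>" and s: "(x - p) \<bullet> ?e \<ge> 0" "(p - y) \<bullet> ?e \<ge> 0" for x y
  proof -
    \<comment> \<open>The base line is a null set; removing it from one triangle makes the two
      disjoint.\<close>
    let ?L = "{z. ?e \<bullet> z = ?e \<bullet> p}"
    have "?e \<noteq> 0" using v by (metis norm_rot2 norm_zero zero_neq_one)
    then have neg: "negligible ?L" by (intro negligible_hyperplane) auto
    have mL: "measure lebesgue (T x - ?L) = measure lebesgue (T x)"
      using neg Tl by (intro measure_Diff_null_set) (auto simp: negligible_iff_null_sets)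
    have L: "T x - ?L \<in> lmeasurable" using neg Tl by (intro fmeasurable_Diff) (auto simp: negligible_iff_null_sets)
    have "T x \<subseteq> {z. ?e \<bullet> z \<ge> ?e \<bullet> p}"
      unfolding T_def using s(1) qe by (intro hull_minimal convex_halfspace_ge) (auto simp: inner_diff_left inner_commute[of ?e])
    moreover have "T y \<subseteq> {z. ?e \<bullet> z \<le> ?e \<bullet> p}"
      unfolding T_def using s(2) qe by (intro hull_minimal convex_halfspace_le) (auto simp: inner_diff_left inner_commute[of ?e])
    ultimately have "(T x - ?L) \<inter> T y = {}" by fastforce
    then have "measure lebesgue (T x - ?L) + measure lebesgue (T y) \<le> measure lebesgue (closure \<Omega>)"
      using Tsub[OF xy(1)] Tsub[OF xy(2)] by (intro measure_disjoint_le L Tl lcl) auto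
    moreover have "\<bar>(y - p) \<bullet> ?e\<bar> = (p - y) \<bullet> ?e" using s(2) by (simp add: inner_diff_left)
    ultimately show ?thesis unfolding mL Ta cl using s(1) by (simp add: add_divide_distrib[symmetric])
  qed
  have "width \<Omega> ?e \<le> 2 * measure lebesgue \<Omega> / D"
  proof (rule width_le[OF \<Omega>(4)])
    fix x y assume xy: "x \<in> \<Omega>" "y \<in> \<Omega>"
    have "D * ((x - y) \<bullet> ?e) \<le> 2 * measure lebesgue \<Omega>"
    proof (cases "(x - p) \<bullet> ?e \<ge> 0")
      case True
      show ?thesis
      proof (cases "(p - y) \<bullet> ?e \<ge> 0")
        case True
        have "D * ((x - y) \<bullet> ?e) = D * ((x - p) \<bullet> ?e) + D * ((p - y) \<bullet> ?e)" by (simp add: inner_diff_left algebra_simps)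
        then show ?thesis using double[OF xy \<open>(x - p) \<bullet> ?e \<ge> 0\<close> True] by simp
      next
        case False
        then have "(x - y) \<bullet> ?e \<le> \<bar>(x - p) \<bullet> ?e\<bar>" using True by (simp add: inner_diff_left)
        then show ?thesis using single[OF xy(1)] D by (meson less_imp_le mult_left_mono order_trans)
      qed
    next
      case False
      then have "(x - y) \<bullet> ?e \<le> \<bar>(y - p) \<bullet> ?e\<bar>" by (simp add: inner_diff_left)
      then show ?thesis using single[OF xy(2)] D by (meson less_imp_le mult_left_mono order_trans)
    qed
    then show "(x - y) \<bullet> ?e \<le> 2 * measure lebesgue \<Omega> / D" using D by (simp add: pos_le_divide_eq mult.commute)
  qed
  then show ?thesis using D by (simp add: pos_le_divide_eq mult.commute)
qed

section \<open>Assembling the lower bound\<close>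

definition neumann_quotients :: "(real^2) set \<Rightarrow> real set" where
  "neumann_quotients \<Omega> = {(LINT x|lebesgue_on \<Omega>. (norm (g x))\<^sup>2) / (LINT x|lebesgue_on \<Omega>. (u x)\<^sup>2) | u g.
     H1_with_grad \<Omega> u g \<and> nonzero_on \<Omega> u \<and> (LINT x|lebesgue_on \<Omega>. u x) = 0}"

lemma mu1_eq: "mu1 \<Omega> = Inf (neumann_quotients \<Omega>)"
  by (simp add: mu1_def neumann_quotients_def)

lemma nonzero_mass_pos:
  assumes "u square_integrable_on \<Omega>" "nonzero_on \<Omega> u"
  shows "(LINT x|lebesgue_on \<Omega>. (u x :: real)\<^sup>2) > 0"
proof -
  have "(LINT x|lebesgue_on \<Omega>. (u x)\<^sup>2) \<noteq> 0"
  proof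
    assume "(LINT x|lebesgue_on \<Omega>. (u x)\<^sup>2) = 0"
    then have "AE x in lebesgue_on \<Omega>. (u x)\<^sup>2 = 0"
      using assms(1) by (subst (asm) integral_nonneg_eq_0_iff_AE) (auto simp: square_integrable_real)
    then show False using assms(2) by (simp add: nonzero_on_def)
  qed
  then show ?thesis by (simp add: less_le)
qed

text \<open>\<open>Inf\<close> of the empty set is unspecified, hence the assumption
  \<open>ne\<close>; the trial function of the upper bound will provide it.\<close>

lemma mu1_lower:
  fixes \<Omega> :: "(real^2) set"
  assumes \<Omega>: "open \<Omega>" "convex \<Omega>" "bounded \<Omega>" "\<Omega> \<noteq> {}"
    and D: "D > 0" "\<And>x y. x \<in> \<Omega> \<Longrightarrow> y \<in> \<Omega> \<Longrightarrow> norm (x - y) \<le> D"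
    and ne: "neumann_quotients \<Omega> \<noteq> {}"
  shows "(pi / D)\<^sup>2 \<le> mu1 \<Omega>"
  unfolding mu1_eq
proof (rule cInf_greatest[OF ne])
  fix q assume "q \<in> neumann_quotients \<Omega>"
  then obtain u g where q: "q = (LINT x|lebesgue_on \<Omega>. (norm (g x))\<^sup>2) / (LINT x|lebesgue_on \<Omega>. (u x)\<^sup>2)"
    and H: "H1_with_grad \<Omega> u g" and nz: "nonzero_on \<Omega> u" and mean: "(LINT x|lebesgue_on \<Omega>. u x) = 0"
    unfolding neumann_quotients_def by blast
  have "(LINT x|lebesgue_on \<Omega>. (u x)\<^sup>2) > 0"
    using H nz by (intro nonzero_mass_pos) (auto simp: H1_with_grad_def)
  then show "(pi / D)\<^sup>2 \<le> q"
    unfolding q using payne_weinberger_H1[OF H \<Omega> D mean] by (simp add: pos_le_divide_eq)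
qed

lemma product_lower_bound:
  fixes \<Omega> :: "(real^2) set"
  assumes \<Omega>: "open \<Omega>" "convex \<Omega>" "bounded \<Omega>" "\<Omega> \<noteq> {}" and ne: "neumann_quotients \<Omega> \<noteq> {}"
  shows "pi ^ 4 / 4 < (measure lebesgue \<Omega>)\<^sup>2 * lambda1 \<Omega> * mu1 \<Omega>"
proof -
  let ?A = "measure lebesgue \<Omega>"
  \<comment> \<open>The diameter of an open set is attained only in its closure.\<close>
  have "compact (closure \<Omega>)" "closure \<Omega> \<noteq> {}" using \<Omega> by (auto simp: compact_closure)
  then obtain p q where pq: "p \<in> closure \<Omega>" "q \<in> closure \<Omega>" "dist p q = diameter (closure \<Omega>)"
    using diameter_compact_attained by blast
  define D where "D = dist p q"
  have diam: "norm (x - y) \<le> D" if "x \<in> \<Omega>" "y \<in> \<Omega>" for x y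
    unfolding D_def pq(3) dist_norm[symmetric]
    using that closure_subset[of \<Omega>] \<Omega>(3) by (intro diameter_bounded_bound) auto
  have D: "D > 0"
  proof -
    obtain x where x: "x \<in> \<Omega>" using \<Omega>(4) by blast
    then obtain e where e: "e > 0" "ball x e \<subseteq> \<Omega>" using \<Omega>(1) open_contains_ball by blast
    have "x + (e / 2) *\<^sub>R axis 1 1 \<in> \<Omega>" using e by (intro subsetD[OF e(2)]) (simp add: dist_norm)
    from diam[OF this x] e(1) show ?thesis by simp
  qed
  define v where "v = (1 / D) *\<^sub>R (q - p)"
  have v: "norm v = 1" using D by (simp add: v_def D_def dist_norm norm_minus_commute)
  have q: "p + D *\<^sub>R v = q" using D by (simp add: v_def)
  define W where "W = width \<Omega> (rot2 v)"
  have W: "W > 0" unfolding W_def using v \<Omega> by (intro width_pos) auto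
  have A: "D * W \<le> 2 * ?A" unfolding W_def
    by (rule area_ge_diameter_width[OF \<Omega> pq(1) _ D v]) (use pq(2) q in simp)
  have wv: "0 < width \<Omega> v" "width \<Omega> v \<le> D"
  proof -
    show "0 < width \<Omega> v" using v \<Omega> by (intro width_pos) auto
    show "width \<Omega> v \<le> D"
    proof (rule width_le[OF \<Omega>(4)])
      fix x y assume "x \<in> \<Omega>" "y \<in> \<Omega>"
      then show "(x - y) \<bullet> v \<le> D" using norm_cauchy_schwarz[of "x - y" v] diam[of x y] v by simp
    qed
  qed
  \<comment> \<open>Strict because the summand for the width along \<open>v\<close> is dropped; the
    strictness of the whole bound rests here.\<close>
  have l: "(pi / W)\<^sup>2 < lambda1 \<Omega>"
    using lambda1_lower[OF \<Omega>(1,3,4) v] wv(1) pi_gt_zero unfolding W_def[symmetric]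
    by (smt (verit) divide_pos_pos zero_less_power)
  have m: "(pi / D)\<^sup>2 \<le> mu1 \<Omega>" by (rule mu1_lower[OF \<Omega> D diam ne])
  have mpos: "(pi / D)\<^sup>2 > 0" using D by simp
  have "pi ^ 4 / 4 = (D * W / 2)\<^sup>2 * ((pi / W)\<^sup>2 * (pi / D)\<^sup>2)"
    using D W by (simp add: power_divide power_mult_distrib field_simps power4_eq_xxxx power2_eq_square)
  also have "\<dots> \<le> ?A\<^sup>2 * ((pi / W)\<^sup>2 * (pi / D)\<^sup>2)"
    using A D W by (intro mult_right_mono power_mono) auto
  also have "\<dots> < ?A\<^sup>2 * (lambda1 \<Omega> * mu1 \<Omega>)"
  proof (rule mult_strict_left_mono)
    have "(pi / W)\<^sup>2 * (pi / D)\<^sup>2 < lambda1 \<Omega> * (pi / D)\<^sup>2" using l mpos by (rule mult_strict_right_mono)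
    also have "\<dots> \<le> lambda1 \<Omega> * mu1 \<Omega>" using l m W by (intro mult_left_mono) (auto intro: less_imp_le order_le_less_trans[OF zero_le_power2])
    finally show "(pi / W)\<^sup>2 * (pi / D)\<^sup>2 < lambda1 \<Omega> * mu1 \<Omega>" .
    show "0 < ?A\<^sup>2" using measure_pos_open[OF \<Omega>(1,3,4)] by (rule zero_less_power)
  qed
  finally show ?thesis by (simp add: mult.assoc)
qed

section \<open>Radial Dirichlet eigenfunctions of discs\<close>

lemma power_series_deriv:
  fixes c :: "nat \<Rightarrow> real"
  assumes "\<And>y. summable (\<lambda>n. c n * y ^ n)"
  shows "((\<lambda>s. \<Sum>n. c n * s ^ n) has_real_derivative (\<Sum>n. diffs c n * s ^ n)) (at s)"
  by (rule termdiffs_strong_converges_everywhere[OF assms])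

lemma Ck_power_series:
  fixes c :: "nat \<Rightarrow> real"
  assumes "\<And>y. summable (\<lambda>n. c n * y ^ n)"
  shows "Ck k (\<lambda>s. \<Sum>n. c n * s ^ n)"
  using assms
proof (induction k arbitrary: c)
  case 0
  have "isCont (\<lambda>s. \<Sum>n. c n * s ^ n) s" for s by (rule DERIV_isCont[OF power_series_deriv[OF 0]])
  then show ?case by (simp add: continuous_on_eq_continuous_at)
next
  case (Suc k)
  have "Ck k (\<lambda>s. v * (\<Sum>n. diffs c n * s ^ n))" for v
    by (intro Ck_mult Ck_const Suc.IH termdiff_converges_all Suc.prems)
  moreover have "((\<lambda>s. \<Sum>n. c n * s ^ n) has_derivative (\<lambda>v. v * (\<Sum>n. diffs c n * s ^ n))) (at s)" for s
    by (rule has_derivative_eq_rhs[OF power_series_deriv[OF Suc.prems, unfolded has_field_derivative_def]])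
      (rule ext, rule mult.commute)
  ultimately show ?case by (intro Ck_SucI[where D="\<lambda>s v. v * (\<Sum>n. diffs c n * s ^ n)"])
qed

text \<open>Coefficients of J_0 in powers of \<open>s = x^2\<close>. In this variable the series is
  an everywhere convergent power series, so composition with a squared distance is smooth at the
  centre too.\<close>

definition bessel_coeff :: "nat \<Rightarrow> real" where
  "bessel_coeff n = (- 1) ^ n / ((fact n)\<^sup>2 * 4 ^ n)"

definition bessel_series :: "(nat \<Rightarrow> real) \<Rightarrow> real \<Rightarrow> real" where
  "bessel_series c s = (\<Sum>n. c n * s ^ n)"

abbreviation (input) "BS \<equiv> bessel_series bessel_coeff"
abbreviation (input) "BS1 \<equiv> bessel_series (diffs bessel_coeff)"
abbreviation (input) "BS2 \<equiv> bessel_series (diffs (diffs bessel_coeff))"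

lemma bessel_summable: "summable (\<lambda>n. bessel_coeff n * y ^ n)"
proof (rule summable_comparison_test'[OF summable_exp[of "\<bar>y\<bar>"]])
  fix n :: nat
  have "1 \<le> (fact n :: real) * 4 ^ n" by (rule mult_ge1_I) auto
  then have "(fact n :: real) * 1 \<le> fact n * (fact n * 4 ^ n)" by (intro mult_left_mono) auto
  then have "1 / ((fact n)\<^sup>2 * 4 ^ n) \<le> 1 / (fact n :: real)"
    by (intro divide_left_mono mult_pos_pos) (auto simp: power2_eq_square mult.assoc)
  then have "1 / ((fact n)\<^sup>2 * 4 ^ n) * \<bar>y\<bar> ^ n \<le> 1 / (fact n :: real) * \<bar>y\<bar> ^ n" by (intro mult_right_mono) auto
  then show "norm (bessel_coeff n * y ^ n) \<le> inverse (fact n) * \<bar>y\<bar> ^ n"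
    by (simp add: bessel_coeff_def abs_mult power_abs inverse_eq_divide)
qed

lemmas bessel_summable1 = termdiff_converges_all[OF bessel_summable]
lemmas bessel_summable2 = termdiff_converges_all[OF bessel_summable1]

lemma bessel_J0_eq: "bessel_J0 x = BS (x\<^sup>2)"
proof -
  have "(- 1) ^ k / (fact k)\<^sup>2 * (x / 2) ^ (2 * k) = bessel_coeff k * (x\<^sup>2) ^ k" for k
  proof -
    have "(x / 2) ^ (2 * k) = (x\<^sup>2 / 4) ^ k" by (simp add: power_mult power_divide)
    then show ?thesis by (simp add: bessel_coeff_def power_divide)
  qed
  then show ?thesis by (simp add: bessel_J0_def bessel_series_def)
qed

lemma BS_deriv: "(BS has_real_derivative BS1 s) (at s)" "(BS1 has_real_derivative BS2 s) (at s)"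
  unfolding bessel_series_def
  by (rule power_series_deriv[OF bessel_summable]) (rule power_series_deriv[OF bessel_summable1])

lemma BS_continuous: "continuous_on UNIV BS" "continuous_on UNIV BS1" "continuous_on UNIV BS2"
proof -
  have "isCont BS s" "isCont BS1 s" for s
    by (rule DERIV_isCont[OF BS_deriv(1)]) (rule DERIV_isCont[OF BS_deriv(2)])
  then show "continuous_on UNIV BS" "continuous_on UNIV BS1"
    by (simp_all add: continuous_on_eq_continuous_at)
  have "Ck 0 BS2" unfolding bessel_series_def by (rule Ck_power_series[OF bessel_summable2])
  then show "continuous_on UNIV BS2" by simp
qed

text \<open>Bessel's equation in the variable \<open>s = x^2\<close>; termwise it is the recursion
  \<open>4 (n + 1)^2 c_(n+1) = - c_n\<close>.\<close>

lemma bessel_ode: "4 * (BS1 s + s * BS2 s) = - BS s"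
proof -
  let ?c = "diffs bessel_coeff"
  have 1: "(\<lambda>n. ?c n * s ^ n) sums BS1 s"
    unfolding bessel_series_def by (rule summable_sums[OF bessel_summable1])
  have "(\<lambda>n. of_nat n * ?c n * s ^ (n - Suc 0)) sums BS2 s"
    unfolding bessel_series_def by (rule diffs_equiv[OF bessel_summable2])
  then have "(\<lambda>n. s * (of_nat n * ?c n * s ^ (n - Suc 0))) sums (s * BS2 s)" by (rule sums_mult)
  moreover have "s * (of_nat n * ?c n * s ^ (n - Suc 0)) = of_nat n * ?c n * s ^ n" for n
    by (cases n) simp_all
  ultimately have 2: "(\<lambda>n. of_nat n * ?c n * s ^ n) sums (s * BS2 s)" by simp
  have "(\<lambda>n. 4 * (?c n * s ^ n + of_nat n * ?c n * s ^ n)) sums (4 * (BS1 s + s * BS2 s))"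
    by (intro sums_mult sums_add 1 2)
  moreover have "4 * (?c n * s ^ n + of_nat n * ?c n * s ^ n) = - (bessel_coeff n * s ^ n)" for n
  proof -
    have "4 * (real (Suc n) * (real (Suc n) * bessel_coeff (Suc n))) = - bessel_coeff n"
    proof -
      have "real (Suc n) \<noteq> 0" by simp
      then show ?thesis unfolding bessel_coeff_def fact_Suc power_Suc
        by (simp add: power_mult_distrib power2_eq_square del: of_nat_Suc)
    qed
    then have "4 * ((1 + real n) * ?c n) = - bessel_coeff n" by (simp add: diffs_def)
    then have "4 * ((1 + real n) * ?c n) * s ^ n = - bessel_coeff n * s ^ n" by (rule arg_cong)
    then show ?thesis by (simp add: algebra_simps)
  qed
  ultimately have "(\<lambda>n. - (bessel_coeff n * s ^ n)) sums (4 * (BS1 s + s * BS2 s))" by simp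
  moreover have "(\<lambda>n. - (bessel_coeff n * s ^ n)) sums (- BS s)"
    unfolding bessel_series_def by (intro sums_minus summable_sums bessel_summable)
  ultimately show ?thesis by (rule sums_unique2)
qed

lemma bessel_J0_continuous: "continuous_on UNIV bessel_J0"
  unfolding bessel_J0_eq[abs_def] by (intro continuous_on_compose2[OF BS_continuous(1)] continuous_intros) auto

lemma bessel_J0_0: "bessel_J0 0 = 1"
proof -
  have "(\<lambda>n. bessel_coeff n * (0::real) ^ n) sums bessel_coeff 0" by (rule powser_sums_zero)
  then have "BS 0 = bessel_coeff 0" unfolding bessel_series_def by (rule sums_unique[symmetric])
  then show ?thesis by (simp add: bessel_J0_eq bessel_coeff_def)
qed

text \<open>At \<open>x = sqrt 8\<close> the series is \<open>1 - 2\<close> followed by an alternating tail of size less than \<open>1\<close>.\<close>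

lemma bessel_J0_negative: "bessel_J0 (sqrt 8) < 0"
proof -
  \<comment> \<open>The absolute value of the term of index \<open>i + 2\<close> at
    \<open>s = 8\<close>, where \<open>8^n / 4^n = 2^n\<close>.\<close>
  define a where "a i = (2 :: real) ^ (i + 2) / (fact (i + 2))\<^sup>2" for i :: nat
  have a_Suc: "a (Suc i) = a i * (2 / (real (i + 3))\<^sup>2)" for i
  proof -
    have "fact (Suc i + 2) = real (i + 3) * fact (i + 2)" by (simp add: algebra_simps)
    then show ?thesis unfolding a_def by (simp add: power_mult_distrib)
  qed
  have apos: "a i \<ge> 0" for i by (simp add: a_def)
  have ratio: "2 / (real (i + 3))\<^sup>2 \<le> 1 / 2" for i
  proof -
    have "(2 :: real)\<^sup>2 \<le> (real (i + 3))\<^sup>2" by (intro power_mono) auto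
    then show ?thesis by (simp add: divide_le_eq)
  qed
  have dec: "a (Suc i) \<le> a i * (1 / 2)" for i
    unfolding a_Suc using ratio apos by (intro mult_left_mono) auto
  have a_bound: "a i \<le> (1 / 2) ^ i" for i
  proof (induction i)
    case 0 show ?case by (simp add: a_def fact_numeral)
  next
    case (Suc i)
    then show ?case using dec[of i] by simp
  qed
  have lim: "a \<longlonglongrightarrow> 0"
  proof (rule tendsto_sandwich[of "\<lambda>_. 0" a _ "\<lambda>i. (1 / 2) ^ i"])
    show "(\<lambda>i. (1 / 2 :: real) ^ i) \<longlonglongrightarrow> 0" by (rule LIMSEQ_power_zero) simp
  qed (use apos a_bound in auto)
  have mono: "a (Suc i) \<le> a i" for i using dec[of i] apos[of i] by linarith
  \<comment> \<open>Odd partial sums of an alternating series with decreasing terms exceed the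
    limit. Three terms give \<open>1 - 2/9 + 1/36\<close>, which is below 1.\<close>
  have tail: "(\<Sum>i. (- 1) ^ i * a i) \<le> (\<Sum>i<2 * 1 + 1. (- 1) ^ i * a i)"
    by (rule summable_Leibniz'(4)[OF lim apos mono])
  have term_eq: "bessel_coeff n * 8 ^ n = (- 1) ^ n * 2 ^ n / (fact n)\<^sup>2" for n
  proof -
    have "(8 :: real) ^ n = 4 ^ n * 2 ^ n" by (simp flip: power_mult_distrib)
    then show ?thesis by (simp add: bessel_coeff_def)
  qed
  have "BS 8 = (\<Sum>i. bessel_coeff (i + 2) * 8 ^ (i + 2)) + (\<Sum>i<2. bessel_coeff i * 8 ^ i)"
    unfolding bessel_series_def by (rule suminf_split_initial_segment[OF bessel_summable])
  also have "(\<Sum>i. bessel_coeff (i + 2) * 8 ^ (i + 2)) = (\<Sum>i. (- 1) ^ i * a i)"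
    by (intro suminf_cong) (simp only: term_eq, simp add: a_def)
  also have "(\<Sum>i<2. bessel_coeff i * 8 ^ i) = - 1"
    by (simp only: term_eq, simp add: numeral_2_eq_2)
  finally have "BS 8 \<le> (\<Sum>i<2 * 1 + 1. (- 1) ^ i * a i) - 1" using tail by simp
  also have "(\<Sum>i<2 * 1 + 1. (- 1) ^ i * a i) = a 0 - a 1 + a 2"
    by (simp add: eval_nat_numeral)
  also have "a 0 - a 1 + a 2 - 1 < 0" by (simp add: a_def fact_numeral)
  finally show ?thesis by (simp add: bessel_J0_eq)
qed

text \<open>The zeros up to \<open>sqrt 8\<close> form a nonempty compact set that omits 0, so the
  \<open>LEAST\<close> in \<open>j01\<close> is attained. Positivity before it follows from the
  intermediate value theorem.\<close>

lemma j01_props: "0 < j01" "bessel_J0 j01 = 0" "\<And>x. 0 \<le> x \<Longrightarrow> x < j01 \<Longrightarrow> 0 < bessel_J0 x"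
proof -
  let ?S = "{0..sqrt 8} \<inter> bessel_J0 -` {0}"
  have cont: "continuous_on S bessel_J0" for S using bessel_J0_continuous continuous_on_subset by blast
  have "\<exists>x. 0 \<le> x \<and> x \<le> sqrt 8 \<and> bessel_J0 x = 0"
    using bessel_J0_0 bessel_J0_negative by (intro IVT2' cont) auto
  then have ne: "?S \<noteq> {}" by auto
  have "closed ?S" by (intro closed_Int closed_atLeastAtMost closed_vimage closed_singleton bessel_J0_continuous)
  then have "compact ?S" by (simp add: compact_eq_bounded_closed bounded_Int)
  then obtain z where z: "z \<in> ?S" "\<And>y. y \<in> ?S \<Longrightarrow> z \<le> y" using compact_attains_inf[OF _ ne] by blast
  have z0: "0 < z" using z(1) bessel_J0_0 by (cases "z = 0") auto
  have "j01 = z" unfolding j01_def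
  proof (rule Least_equality)
    show "0 < z \<and> bessel_J0 z = 0" using z(1) z0 by simp
    fix y assume "0 < y \<and> bessel_J0 y = 0"
    then show "z \<le> y" using z(1) z(2)[of y] by (cases "y \<le> sqrt 8") auto
  qed
  with z z0 show "0 < j01" "bessel_J0 j01 = 0" by auto
  fix x assume x: "0 \<le> x" "x < j01"
  show "0 < bessel_J0 x"
  proof (rule ccontr)
    assume "\<not> 0 < bessel_J0 x"
    then have "\<exists>y. 0 \<le> y \<and> y \<le> x \<and> bessel_J0 y = 0"
      using bessel_J0_0 x by (intro IVT2' cont) auto
    then obtain y where "0 \<le> y" "y \<le> x" "bessel_J0 y = 0" by blast
    then have "z \<le> y" using z(1) x \<open>j01 = z\<close> by (intro z(2)) auto
    then show False using \<open>y \<le> x\<close> x \<open>j01 = z\<close> by simp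
  qed
qed

section \<open>The eigenfunction of a disc and its cut-off\<close>

definition disc_fn :: "real \<Rightarrow> 'a::euclidean_space \<Rightarrow> 'a \<Rightarrow> real" where
  "disc_fn k c x = BS (k\<^sup>2 * (norm (x - c))\<^sup>2)"

text \<open>The factor of \<open>x - c\<close> in the gradient of \<open>disc_fn\<close>, which
  stays smooth at the centre.\<close>

definition disc_slope :: "real \<Rightarrow> 'a::euclidean_space \<Rightarrow> 'a \<Rightarrow> real" where
  "disc_slope k c x = 2 * k\<^sup>2 * BS1 (k\<^sup>2 * (norm (x - c))\<^sup>2)"

lemma disc_fn_eq: "disc_fn k c x = bessel_J0 (k * norm (x - c))"
  by (simp add: disc_fn_def bessel_J0_eq power_mult_distrib)

lemma C1_grad_norm_square: "C1_grad (\<lambda>x. k * (norm (x - c))\<^sup>2) (\<lambda>x. (2 * k) *\<^sub>R (x - c))"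
proof -
  have "((\<lambda>x. (x - c) \<bullet> (x - c)) has_derivative (\<lambda>h. 2 * (h \<bullet> (x - c)))) (at x)" for x
    by (auto intro!: derivative_eq_intros simp: inner_commute)
  then have "C1_grad (\<lambda>x. (norm (x - c))\<^sup>2) (\<lambda>x. 2 *\<^sub>R (x - c))"
    unfolding C1_grad_def power2_norm_eq_inner by (auto intro!: continuous_intros)
  from C1_grad_cmult[OF this, of k] show ?thesis by (simp add: mult.commute)
qed

lemma disc_fn_C1: "C1_grad (disc_fn k c) (\<lambda>x. disc_slope k c x *\<^sub>R (x - c))"
  using C1_grad_compose[OF C1_grad_norm_square BS_deriv(1) BS_continuous(2), of "k\<^sup>2" c]
  by (simp add: disc_fn_def[abs_def] disc_slope_def mult_ac)

lemma disc_slope_C1: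
  "C1_grad (disc_slope k c) (\<lambda>x. (4 * k\<^sup>2 * k\<^sup>2 * BS2 (k\<^sup>2 * (norm (x - c))\<^sup>2)) *\<^sub>R (x - c))"
  using C1_grad_cmult[OF C1_grad_compose[OF C1_grad_norm_square BS_deriv(2) BS_continuous(3)], of "2 * k\<^sup>2" "k\<^sup>2" c]
  by (simp add: disc_slope_def[abs_def] mult_ac)

lemma Ck_disc_fn: "Ck n (disc_fn k c)"
proof -
  have "Ck n (\<lambda>x. BS (k\<^sup>2 * (norm (x - c))\<^sup>2))"
    by (rule Ck_compose[where h=BS]) (auto intro: Ck_mult Ck_const Ck_norm_diff_square Ck_power_series[OF bessel_summable] simp: bessel_series_def[abs_def])
  then show ?thesis by (simp add: disc_fn_def[abs_def])
qed

text \<open>J_0 of \<open>k\<close> times the distance satisfies the Helmholtz equation in the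
  plane. The field \<open>\<phi>\<close> times \<open>disc_slope\<close> times \<open>x - c\<close>
  has compact support, so its divergence integrates to 0, and Bessel's equation turns the divergence
  into the difference of the two integrands.\<close>

lemma disc_fn_weak_equation:
  fixes \<Omega> :: "(real^2) set"
  assumes \<phi>: "\<phi> \<in> test_functions \<Omega>" and \<Omega>: "\<Omega> \<in> sets lebesgue"
  shows "(LINT x|lebesgue_on \<Omega>. grad \<phi> x \<bullet> (disc_slope k c x *\<^sub>R (x - c))) = k\<^sup>2 * (LINT x|lebesgue_on \<Omega>. \<phi> x * disc_fn k c x)"
proof -
  obtain K where K: "compact K" "K \<subseteq> \<Omega>" "\<And>x. x \<notin> K \<Longrightarrow> \<phi> x = 0" "\<And>x. x \<notin> K \<Longrightarrow> grad \<phi> x = 0"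
    and C: "C1_grad \<phi> (grad \<phi>)" using test_functionsE[OF \<phi>] by metis
  let ?h = "disc_slope k c" and ?B2 = "\<lambda>x. 4 * k\<^sup>2 * k\<^sup>2 * BS2 (k\<^sup>2 * (norm (x - c))\<^sup>2)"
  \<comment> \<open>The gradient of the component along \<open>b\<close> of that field; the sum of
    \<open>b \<bullet> ?F b x\<close> over the basis is the divergence.\<close>
  let ?F = "\<lambda>b x. (\<phi> x * ?h x) *\<^sub>R b + (x \<bullet> b - c \<bullet> b) *\<^sub>R (\<phi> x *\<^sub>R (?B2 x *\<^sub>R (x - c)) + ?h x *\<^sub>R grad \<phi> x)"
  have CF: "C1_grad (\<lambda>x. \<phi> x * ?h x * (x \<bullet> b - c \<bullet> b)) (?F b)" for b
    by (rule C1_grad_mult[OF C1_grad_mult[OF C disc_slope_C1] C1_grad_inner])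
  have cont: "continuous_on UNIV \<phi>" "continuous_on UNIV (grad \<phi>)" "continuous_on UNIV ?h" "continuous_on UNIV (disc_fn k c)"
    using C C1_grad_continuous[OF C] C1_grad_continuous[OF disc_slope_C1[of k c]] C1_grad_continuous[OF disc_fn_C1[of k c]]
    by (auto simp: C1_grad_def)
  have zero: "(LINT x|lborel. b \<bullet> ?F b x) = 0" for b
    using K(3) by (intro integral_grad_zero[OF CF K(1)]) auto
  have intF: "integrable lborel (\<lambda>x. b \<bullet> ?F b x)" for b
  proof (rule integrable_compact_support[OF _ K(1)])
    show "continuous_on UNIV (\<lambda>x. b \<bullet> ?F b x)" using CF[of b] by (auto simp: C1_grad_def intro!: continuous_on_inner)
    show "b \<bullet> ?F b x = 0" if "x \<notin> K" for x using K(3,4)[OF that] by simp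
  qed
  have point: "(\<Sum>b\<in>Basis. b \<bullet> ?F b x) = grad \<phi> x \<bullet> (?h x *\<^sub>R (x - c)) - k\<^sup>2 * (\<phi> x * disc_fn k c x)" for x
  proof -
    let ?y = "\<phi> x *\<^sub>R (?B2 x *\<^sub>R (x - c)) + ?h x *\<^sub>R grad \<phi> x" and ?s = "k\<^sup>2 * (norm (x - c))\<^sup>2"
    have "(\<Sum>b\<in>Basis. b \<bullet> ?F b x) = (\<Sum>b\<in>Basis. \<phi> x * ?h x + ((x - c) \<bullet> b) * (?y \<bullet> b))"
    proof (intro sum.cong refl)
      fix b :: "real^2" assume b: "b \<in> Basis"
      have "b \<bullet> (u *\<^sub>R b + r *\<^sub>R y) = u + r * (y \<bullet> b)" for u r y
        using b by (simp add: inner_add_right inner_commute)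
      then show "b \<bullet> ?F b x = \<phi> x * ?h x + ((x - c) \<bullet> b) * (?y \<bullet> b)"
        by (simp only: inner_diff_left)
    qed
    also have "\<dots> = 2 * (\<phi> x * ?h x) + (x - c) \<bullet> ?y"
      unfolding sum.distrib by (simp only: euclidean_inner[of "x - c" ?y] sum_constant) simp
    also have "(x - c) \<bullet> ?y = \<phi> x * ?B2 x * (norm (x - c))\<^sup>2 + grad \<phi> x \<bullet> (?h x *\<^sub>R (x - c))"
      by (simp add: inner_add_right power2_norm_eq_inner inner_commute)
    also have "2 * (\<phi> x * ?h x) + (\<phi> x * ?B2 x * (norm (x - c))\<^sup>2 + grad \<phi> x \<bullet> (?h x *\<^sub>R (x - c)))
       = grad \<phi> x \<bullet> (?h x *\<^sub>R (x - c)) + k\<^sup>2 * \<phi> x * (4 * (BS1 ?s + ?s * BS2 ?s))"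
      by (simp add: disc_slope_def algebra_simps)
    also have "\<dots> = grad \<phi> x \<bullet> (?h x *\<^sub>R (x - c)) - k\<^sup>2 * (\<phi> x * disc_fn k c x)"
      unfolding bessel_ode disc_fn_def by simp
    finally show ?thesis .
  qed
  have c1: "continuous_on UNIV (\<lambda>x. grad \<phi> x \<bullet> (?h x *\<^sub>R (x - c)))" and c2: "continuous_on UNIV (\<lambda>x. \<phi> x * disc_fn k c x)"
    using cont by (auto intro!: continuous_intros)
  have i1: "integrable lborel (\<lambda>x. grad \<phi> x \<bullet> (?h x *\<^sub>R (x - c)))"
    by (rule integrable_compact_support[OF c1 K(1)]) (simp add: K(4))
  have i2: "integrable lborel (\<lambda>x. \<phi> x * disc_fn k c x)"
    by (rule integrable_compact_support[OF c2 K(1)]) (simp add: K(3))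
  have "0 = (LINT x|lborel. (\<Sum>b\<in>Basis. b \<bullet> ?F b x))"
    using zero intF by (subst Bochner_Integration.integral_sum) auto
  also have "\<dots> = (LINT x|lborel. grad \<phi> x \<bullet> (?h x *\<^sub>R (x - c))) - k\<^sup>2 * (LINT x|lborel. \<phi> x * disc_fn k c x)"
    unfolding point using i1 i2 by simp
  finally have "(LINT x|lborel. grad \<phi> x \<bullet> (?h x *\<^sub>R (x - c))) = k\<^sup>2 * (LINT x|lborel. \<phi> x * disc_fn k c x)" by simp
  moreover have "(LINT x|lebesgue_on \<Omega>. grad \<phi> x \<bullet> (?h x *\<^sub>R (x - c))) = (LINT x|lborel. grad \<phi> x \<bullet> (?h x *\<^sub>R (x - c)))"
    by (rule integral_lebesgue_on_support[OF \<Omega> _ borel_measurable_continuous_onI[OF c1]]) (metis K(2) K(4) inner_zero_left subsetD)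
  moreover have "(LINT x|lebesgue_on \<Omega>. \<phi> x * disc_fn k c x) = (LINT x|lborel. \<phi> x * disc_fn k c x)"
    by (rule integral_lebesgue_on_support[OF \<Omega> _ borel_measurable_continuous_onI[OF c2]]) (metis K(2) K(3) mult_zero_left subsetD)
  ultimately show ?thesis by simp
qed

text \<open>A smooth substitute for the positive part; it moves the support of the eigenfunction into the open disc.\<close>

definition soft_ramp :: "real \<Rightarrow> real" where
  "soft_ramp y = y * flat_exp y"

lemma soft_ramp_bounds: "0 \<le> soft_ramp y" "y \<le> 0 \<Longrightarrow> soft_ramp y = 0" "0 \<le> y \<Longrightarrow> soft_ramp y \<le> y" "y - 1 \<le> soft_ramp y"
proof -
  show "0 \<le> soft_ramp y" "y \<le> 0 \<Longrightarrow> soft_ramp y = 0" by (auto simp: soft_ramp_def flat_exp_def)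
  show "soft_ramp y \<le> y" if "0 \<le> y"
  proof -
    have "flat_exp y \<le> 1" by (simp add: flat_exp_def)
    then show ?thesis using mult_left_mono[OF _ that] by (fastforce simp: soft_ramp_def)
  qed
  show "y - 1 \<le> soft_ramp y"
  proof (cases "y > 0")
    case True
    have "1 - 1 / y \<le> exp (- (1 / y))" using exp_ge_add_one_self[of "- (1 / y)"] by simp
    then have "y * (1 - 1 / y) \<le> y * exp (- (1 / y))" using True by (intro mult_left_mono) auto
    then show ?thesis using True by (simp add: soft_ramp_def flat_exp_def right_diff_distrib)
  qed (simp add: soft_ramp_def flat_exp_def)
qed

lemma Ck_soft_ramp: "Ck k soft_ramp"
proof -
  have "Ck k (\<lambda>y::real. y \<bullet> 1 * flat_exp y)" by (intro Ck_mult Ck_flat_exp Ck_inner)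
  then show ?thesis by (simp add: soft_ramp_def[abs_def])
qed

text \<open>For positive \<open>y\<close> this is \<open>(1 + 1/y) exp(-1/y)\<close>, the derivative
  of \<open>soft_ramp\<close>.\<close>

definition soft_step :: "real \<Rightarrow> real" where "soft_step = flat_poly [:1, 1:]"

lemma soft_ramp_deriv: "(soft_ramp has_real_derivative soft_step y) (at y)"
proof -
  have "((\<lambda>y. y * flat_poly 1 y) has_real_derivative
      (1 * flat_poly 1 y + flat_poly ([:0, 0, 1:] * (1 - pderiv 1)) y * y)) (at y)"
    by (rule DERIV_mult[OF DERIV_ident flat_poly_deriv])
  moreover have "1 * flat_poly 1 y + flat_poly ([:0, 0, 1:] * (1 - pderiv 1)) y * y = soft_step y"
    by (auto simp: flat_poly_def soft_step_def algebra_simps power2_eq_square)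
  ultimately show ?thesis by (simp add: soft_ramp_def[abs_def] flat_exp_eq)
qed

text \<open>With a slope in [0, 1] the squared gradient of the cut-off function is at most its inner
  product with the gradient of the eigenfunction.\<close>

lemma soft_step_bounds: "0 \<le> soft_step y" "soft_step y \<le> 1"
proof -
  show "0 \<le> soft_step y" by (simp add: soft_step_def flat_poly_def)
  show "soft_step y \<le> 1"
  proof (cases "y > 0")
    case True
    have "(1 + 1 / y) * exp (- (1 / y)) \<le> exp (1 / y) * exp (- (1 / y))"
      by (intro mult_right_mono exp_ge_add_one_self) auto
    then show ?thesis using True by (simp add: soft_step_def flat_poly_def exp_minus)
  qed (simp add: soft_step_def flat_poly_def)
qed

lemma lambda1_pos:
  fixes \<Omega> :: "(real^2) set"
  assumes \<Omega>: "open \<Omega>" "bounded \<Omega>" "\<Omega> \<noteq> {}" shows "lambda1 \<Omega> > 0"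
proof -
  obtain v :: "real^2" where v: "norm v = 1" using vector_choose_size[of 1] by auto
  have "0 < (pi / width \<Omega> v)\<^sup>2" using width_pos[OF \<Omega> v] by simp
  then have "0 < (pi / width \<Omega> v)\<^sup>2 + (pi / width \<Omega> (rot2 v))\<^sup>2" by (simp add: add_pos_nonneg)
  then show ?thesis using lambda1_lower[OF \<Omega> v] by linarith
qed

text \<open>\<open>J\<close> vanishes on the circle, so \<open>J < \<delta>\<close> near it, and
  there the ramp is 0. This gives a compact support inside the open disc and smoothness across the
  circle at once.\<close>

lemma disc_test_function:
  fixes c :: "real^2"
  assumes \<rho>: "\<rho> > 0" and \<delta>: "\<delta> > 0"
  defines "J \<equiv> disc_fn (j01 / \<rho>) c"
  defines "\<phi> \<equiv> \<lambda>x. if x \<in> ball c \<rho> then \<delta> * soft_ramp (J x / \<delta> - 1) else 0"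
  shows "\<phi> \<in> test_functions (ball c \<rho>)"
    "\<And>x. x \<in> ball c \<rho> \<Longrightarrow> grad \<phi> x = soft_step (J x / \<delta> - 1) *\<^sub>R (disc_slope (j01 / \<rho>) c x *\<^sub>R (x - c))"
proof -
  have J0: "J x = 0" if "dist c x = \<rho>" for x
    using that \<rho> j01_props(2) by (simp add: J_def disc_fn_eq dist_norm norm_minus_commute)
  have CJ: "C1_grad J (\<lambda>x. disc_slope (j01 / \<rho>) c x *\<^sub>R (x - c))" unfolding J_def by (rule disc_fn_C1)
  note contJ = C1_grad_continuous[OF CJ]
  have CkJ: "Ck n (\<lambda>x. \<delta> * soft_ramp (1 / \<delta> * J x + (- 1)))" for n
    by (intro Ck_mult Ck_const, rule Ck_compose[OF Ck_soft_ramp]) (unfold J_def, intro Ck_add Ck_mult Ck_const Ck_disc_fn)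
  have low: "soft_ramp (J x / \<delta> - 1) = 0" if "J x \<le> \<delta>" for x
    using that \<delta> by (intro soft_ramp_bounds(2)) (simp add: divide_le_eq)
  have Ck: "Ck n \<phi>" for n
  proof (rule Ck_local)
    fix x
    show "\<exists>U g. open U \<and> x \<in> U \<and> Ck n g \<and> (\<forall>y\<in>U. \<phi> y = g y)"
    proof (cases "x \<in> ball c \<rho>")
      case True
      have "\<forall>y\<in>ball c \<rho>. \<phi> y = \<delta> * soft_ramp (1 / \<delta> * J y + (- 1))" by (simp add: \<phi>_def)
      then show ?thesis using True CkJ open_ball by blast
    next
      case False
      have "open (- cball c \<rho> \<union> {y. J y < \<delta>})"
        by (intro open_Un open_Compl closed_cball open_Collect_less contJ continuous_on_const)
      moreover have "x \<in> - cball c \<rho> \<union> {y. J y < \<delta>}" using False J0[of x] \<delta> by (cases "dist c x = \<rho>") auto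
      moreover have "\<forall>y\<in>- cball c \<rho> \<union> {y. J y < \<delta>}. \<phi> y = 0" using low by (auto simp: \<phi>_def)
      ultimately show ?thesis using Ck_const[of n "0::real"] by blast
    qed
  qed
  have "compact (cball c \<rho> \<inter> {y. \<delta> \<le> J y})"
    by (intro compact_Int_closed compact_cball closed_Collect_le contJ continuous_on_const)
  moreover have "cball c \<rho> \<inter> {y. \<delta> \<le> J y} \<subseteq> ball c \<rho>"
  proof
    fix y assume "y \<in> cball c \<rho> \<inter> {y. \<delta> \<le> J y}"
    then show "y \<in> ball c \<rho>" using J0[of y] \<delta> by (cases "dist c y = \<rho>") auto
  qed
  moreover have "\<phi> x = 0" if "x \<notin> cball c \<rho> \<inter> {y. \<delta> \<le> J y}" for x
    using that low[of x] by (auto simp: \<phi>_def)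
  ultimately show "\<phi> \<in> test_functions (ball c \<rho>)" by (rule test_functionsI[OF Ck])
  fix x assume x: "x \<in> ball c \<rho>"
  have contS: "continuous_on UNIV (\<lambda>t. soft_step (t / \<delta> - 1))"
  proof -
    have "isCont soft_step t" for t unfolding soft_step_def by (rule DERIV_isCont[OF flat_poly_deriv])
    then have "continuous_on UNIV soft_step" by (simp add: continuous_on_eq_continuous_at)
    then show ?thesis by (rule continuous_on_compose2) (use \<delta> in \<open>auto intro!: continuous_intros\<close>)
  qed
  have der: "((\<lambda>t. \<delta> * soft_ramp (t / \<delta> - 1)) has_real_derivative soft_step (t / \<delta> - 1)) (at t)" for t
    using \<delta> by (auto intro!: derivative_eq_intros DERIV_chain2[OF soft_ramp_deriv])
  from C1_grad_compose[OF CJ der contS]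
  have "((\<lambda>x. \<delta> * soft_ramp (J x / \<delta> - 1)) has_derivative
      (\<lambda>h. h \<bullet> (soft_step (J x / \<delta> - 1) *\<^sub>R (disc_slope (j01 / \<rho>) c x *\<^sub>R (x - c))))) (at x)"
    unfolding C1_grad_def by blast
  then have "(\<phi> has_derivative
      (\<lambda>h. h \<bullet> (soft_step (J x / \<delta> - 1) *\<^sub>R (disc_slope (j01 / \<rho>) c x *\<^sub>R (x - c))))) (at x)"
    by (rule has_derivative_transform_within_open[OF _ open_ball x]) (simp add: \<phi>_def)
  then show "grad \<phi> x = soft_step (J x / \<delta> - 1) *\<^sub>R (disc_slope (j01 / \<rho>) c x *\<^sub>R (x - c))"
    by (rule grad_eqI)
qed

text \<open>The eigenfunction \<open>J\<close> of the inscribed disc enters through its cut-offs: by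
  the weak equation their energy is at most \<open>?k^2 * S\<close>, while their mass is at least
  \<open>S\<close> up to a term of order \<open>\<delta>\<close>.\<close>

lemma lambda1_upper:
  fixes \<Omega> :: "(real^2) set"
  assumes \<Omega>: "open \<Omega>" "bounded \<Omega>" "\<Omega> \<noteq> {}" and \<rho>: "\<rho> > 0" and ball: "ball c \<rho> \<subseteq> \<Omega>"
  shows "lambda1 \<Omega> \<le> (j01 / \<rho>)\<^sup>2"
proof -
  let ?k = "j01 / \<rho>" and ?B = "ball c \<rho>"
  define J where "J = disc_fn ?k c"
  define S where "S = (LINT x|lebesgue_on \<Omega>. indicator ?B x * (J x)\<^sup>2)"
  define T where "T = (LINT x|lebesgue_on \<Omega>. indicator ?B x * J x)"
  have ls: "\<Omega> \<in> sets lebesgue" using \<Omega> by auto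
  have cJ: "continuous_on UNIV J" unfolding J_def by (rule C1_grad_continuous[OF disc_fn_C1])
  have Jpos: "J x > 0" if "x \<in> ?B" for x
    unfolding J_def disc_fn_eq using that \<rho> j01_props(1)
    by (intro j01_props(3)) (auto simp: dist_norm norm_minus_commute field_simps)
  have iS: "integrable (lebesgue_on \<Omega>) (\<lambda>x. indicator ?B x * (J x)\<^sup>2)"
    by (rule integrable_indicator_mult[OF \<Omega>(2) ls open_ball]) (intro continuous_intros cJ)
  have iT: "integrable (lebesgue_on \<Omega>) (\<lambda>x. indicator ?B x * J x)"
    by (rule integrable_indicator_mult[OF \<Omega>(2) ls open_ball cJ])
  have S0: "S \<ge> 0" unfolding S_def by (intro Bochner_Integration.integral_nonneg) auto
  have Spos: "S > 0"
  proof (rule ccontr)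
    assume "\<not> S > 0"
    then have "S = 0" using S0 by simp
    then have "AE x in lebesgue_on \<Omega>. indicator ?B x * (J x)\<^sup>2 = 0"
      unfolding S_def using integral_nonneg_eq_0_iff_AE[OF iS] by simp
    then have "AE x in lebesgue_on \<Omega>. indicator ?B x * (1 :: real) = 0"
      by eventually_elim (use Jpos in \<open>force simp: indicator_def split: if_splits\<close>)
    then have "(LINT x|lebesgue_on \<Omega>. indicator ?B x * (1 :: real)) = 0" by (rule integral_eq_zero_AE)
    moreover have "(LINT x|lebesgue_on \<Omega>. indicator ?B x * (1 :: real)) = (LINT x|lebesgue_on (\<Omega> \<inter> ?B). 1)"
      by (rule integral_lebesgue_on_Int[OF ls, symmetric]) auto
    moreover have "\<Omega> \<inter> ?B = ?B" using ball by blast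
    moreover have "(LINT x|lebesgue_on ?B. 1) = measure lebesgue ?B * (1 :: real)"
      by (rule measure_lebesgue_on_const) simp
    moreover have "measure lebesgue ?B > 0" using \<rho> by (intro measure_pos_open) auto
    ultimately show False by simp
  qed
  let ?l = "lambda1 \<Omega>"
  have step: "?l * S - ?k\<^sup>2 * S \<le> \<delta> * (4 * ?l * T)" if \<delta>: "\<delta> > 0" for \<delta>
  proof -
    define \<phi> where "\<phi> = (\<lambda>x. if x \<in> ?B then \<delta> * soft_ramp (J x / \<delta> - 1) else 0)"
    have tB: "\<phi> \<in> test_functions ?B"
      and gB: "\<And>x. x \<in> ?B \<Longrightarrow> grad \<phi> x = soft_step (J x / \<delta> - 1) *\<^sub>R (disc_slope ?k c x *\<^sub>R (x - c))"
      unfolding \<phi>_def J_def by (rule disc_test_function[OF \<rho> \<delta>], rule disc_test_function[OF \<rho> \<delta>], assumption)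
    obtain K where K: "K \<subseteq> ?B" "\<And>x. x \<notin> K \<Longrightarrow> grad \<phi> x = 0" using test_functionsE[OF tB] by metis
    have g0: "grad \<phi> x = 0" if "x \<notin> ?B" for x using K that by blast
    have t: "\<phi> \<in> test_functions \<Omega>" using tB ball by (auto simp: test_functions_def)
    have c: "continuous_on UNIV \<phi>" "continuous_on UNIV (grad \<phi>)" "continuous_on UNIV (disc_slope ?k c)"
      using test_function_C1[OF t] C1_grad_continuous[OF test_function_C1[OF t]] C1_grad_continuous[OF disc_slope_C1]
      by (auto simp: C1_grad_def)
    have "energy \<Omega> \<phi> \<le> (LINT x|lebesgue_on \<Omega>. grad \<phi> x \<bullet> (disc_slope ?k c x *\<^sub>R (x - c)))"
      unfolding energy_def
    proof (intro integral_mono integrable_continuous_bounded[OF \<Omega>(2) ls] continuous_intros c)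
      fix x
      show "(norm (grad \<phi> x))\<^sup>2 \<le> grad \<phi> x \<bullet> (disc_slope ?k c x *\<^sub>R (x - c))"
      proof (cases "x \<in> ?B")
        case True
        have "(norm (s *\<^sub>R y))\<^sup>2 \<le> (s *\<^sub>R y) \<bullet> y" if "0 \<le> s" "s \<le> 1" for s and y :: "real^2"
        proof -
          have "s * (s * (y \<bullet> y)) \<le> 1 * (s * (y \<bullet> y))" using that by (intro mult_right_mono mult_nonneg_nonneg inner_ge_zero)
          then show ?thesis unfolding power2_norm_eq_inner by simp
        qed
        then show ?thesis unfolding gB[OF True] using soft_step_bounds by blast
      qed (simp add: g0)
    qed
    also have "\<dots> = ?k\<^sup>2 * (LINT x|lebesgue_on \<Omega>. \<phi> x * disc_fn ?k c x)"
      by (rule disc_fn_weak_equation[OF t ls])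
    also have "\<dots> \<le> ?k\<^sup>2 * S"
    proof (rule mult_left_mono)
      show "(LINT x|lebesgue_on \<Omega>. \<phi> x * disc_fn ?k c x) \<le> S"
        unfolding S_def J_def[symmetric]
      proof (rule integral_mono[OF _ iS])
        show "integrable (lebesgue_on \<Omega>) (\<lambda>x. \<phi> x * J x)"
          by (intro integrable_continuous_bounded[OF \<Omega>(2) ls] continuous_intros c cJ)
        fix x
        show "\<phi> x * J x \<le> indicator ?B x * (J x)\<^sup>2"
        proof (cases "x \<in> ?B")
          case True
          have "\<delta> * soft_ramp (J x / \<delta> - 1) \<le> J x"
          proof (cases "J x \<ge> \<delta>")
            case True
            then have "\<delta> * soft_ramp (J x / \<delta> - 1) \<le> \<delta> * (J x / \<delta> - 1)"
              using \<delta> by (intro mult_left_mono soft_ramp_bounds) (auto simp: le_divide_eq)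
            also have "\<dots> \<le> J x" using \<delta> by (simp add: right_diff_distrib)
            finally show ?thesis .
          next
            case False
            then have "soft_ramp (J x / \<delta> - 1) = 0"
              using \<delta> by (intro soft_ramp_bounds) (auto simp: divide_le_eq)
            then show ?thesis using Jpos[OF True] by simp
          qed
          then show ?thesis using True Jpos[OF True] by (simp add: \<phi>_def power2_eq_square)
        qed (simp add: \<phi>_def)
      qed
    qed simp
    finally have E: "energy \<Omega> \<phi> \<le> ?k\<^sup>2 * S" .
    have "S - 4 * \<delta> * T = (LINT x|lebesgue_on \<Omega>. indicator ?B x * (J x)\<^sup>2 - 4 * \<delta> * (indicator ?B x * J x))"
      unfolding S_def T_def using iS iT by simp
    also have "\<dots> \<le> mass \<Omega> \<phi>" unfolding mass_def
    proof (rule integral_mono)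
      show "integrable (lebesgue_on \<Omega>) (\<lambda>x. indicator ?B x * (J x)\<^sup>2 - 4 * \<delta> * (indicator ?B x * J x))"
        using iS iT by simp
      show "integrable (lebesgue_on \<Omega>) (\<lambda>x. (\<phi> x)\<^sup>2)"
        by (intro integrable_continuous_bounded[OF \<Omega>(2) ls] continuous_intros c)
      fix x
      show "indicator ?B x * (J x)\<^sup>2 - 4 * \<delta> * (indicator ?B x * J x) \<le> (\<phi> x)\<^sup>2"
      proof (cases "x \<in> ?B")
        case True
        \<comment> \<open>One \<open>\<delta>\<close> is lost by the shift of the argument and
          another by the ramp, hence the \<open>2 * \<delta>\<close> below.\<close>
        have "\<delta> * (J x / \<delta> - 1 - 1) \<le> \<delta> * soft_ramp (J x / \<delta> - 1)"
          using \<delta> by (intro mult_left_mono soft_ramp_bounds) auto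
        then have b: "J x - 2 * \<delta> \<le> \<phi> x" using \<delta> True by (simp add: \<phi>_def right_diff_distrib)
        have "(J x)\<^sup>2 - 4 * \<delta> * J x \<le> (\<phi> x)\<^sup>2"
        proof (cases "J x \<ge> 2 * \<delta>")
          case T: True
          have "(J x - 2 * \<delta>)\<^sup>2 \<le> (\<phi> x)\<^sup>2" using b T by (intro power_mono) auto
          moreover have "(J x - 2 * \<delta>)\<^sup>2 = (J x)\<^sup>2 - 4 * \<delta> * J x + 4 * \<delta>\<^sup>2"
            by (simp add: power2_eq_square algebra_simps)
          ultimately show ?thesis using zero_le_power2[of \<delta>] by linarith
        next
          case F: False
          have "J x * (J x - 4 * \<delta>) \<le> 0" using F \<delta> Jpos[OF True] by (intro mult_nonneg_nonpos) auto
          moreover have "J x * (J x - 4 * \<delta>) = (J x)\<^sup>2 - 4 * \<delta> * J x" by (simp add: power2_eq_square algebra_simps)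
          ultimately show ?thesis using zero_le_power2[of "\<phi> x"] by linarith
        qed
        then show ?thesis using True by simp
      qed simp
    qed
    finally have M: "S - 4 * \<delta> * T \<le> mass \<Omega> \<phi>" .
    have "?l * (S - 4 * \<delta> * T) \<le> ?l * mass \<Omega> \<phi>" using M lambda1_pos[OF \<Omega>] by (intro mult_left_mono) auto
    also have "\<dots> \<le> energy \<Omega> \<phi>" unfolding lambda1_eq[OF \<Omega>] by (rule dirichlet_inf_le[OF t])
    finally show ?thesis using E by (simp add: algebra_simps)
  qed
  have lim: "((\<lambda>\<delta>. \<delta> * (4 * ?l * T)) \<longlongrightarrow> 0 * (4 * ?l * T)) (at_right 0)" by (intro tendsto_intros)
  have "?l * S - ?k\<^sup>2 * S \<le> 0 * (4 * ?l * T)"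
    by (rule tendsto_lowerbound[OF lim]) (auto simp: eventually_at_right_less step intro: eventually_mono[OF eventually_at_right_less])
  then have "?l * S \<le> ?k\<^sup>2 * S" by simp
  then show ?thesis using Spos by simp
qed

section \<open>The upper bound\<close>

lemma has_real_derivative_If_le:
  fixes f g :: "real \<Rightarrow> real"
  assumes "\<And>t. (f has_real_derivative f' t) (at t)" "\<And>t. (g has_real_derivative g' t) (at t)"
    and "f a = g a" "f' a = g' a"
  shows "((\<lambda>t. if t \<le> a then f t else g t) has_real_derivative (if t \<le> a then f' t else g' t)) (at t)"
proof -
  have "((\<lambda>t. if t \<in> {..a} then f t else g t) has_vector_derivative (if t \<in> {..a} then f' t else g' t)) (at t within UNIV)"
  proof (rule has_vector_derivative_If_within_closures[where T="{a<..}"])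
    show "t \<in> {..a} \<union> {a<..}" "UNIV = {..a} \<union> {a<..}" by auto
    show "(f has_vector_derivative f' t) (at t within {..a} \<union> (closure {..a} \<inter> closure {a<..}))"
      "(g has_vector_derivative g' t) (at t within {a<..} \<union> (closure {..a} \<inter> closure {a<..}))"
      using assms(1,2) by (auto simp flip: has_real_derivative_iff_has_vector_derivative intro: has_field_derivative_at_within)
    assume "t \<in> closure {..a}" "t \<in> closure {a<..}"
    then have "t = a" by simp
    then show "f t = g t" "f' t = g' t" using assms(3,4) by auto
  qed
  then show ?thesis by (simp add: has_real_derivative_iff_has_vector_derivative)
qed

section \<open>The sine profile\<close>

definition clamp_to :: "real \<Rightarrow> real \<Rightarrow> real" where
  "clamp_to h t = max (- h) (min h t)"

text \<open>The first nonconstant Neumann eigenfunction of an interval of length \<open>2 h\<close>,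
  continued by its end values. Its slope vanishes at the ends, so the continuation is C1.\<close>

definition sine_step :: "real \<Rightarrow> real \<Rightarrow> real" where
  "sine_step h t = sin (pi / (2 * h) * clamp_to h t)"

definition cosine_hump :: "real \<Rightarrow> real \<Rightarrow> real" where
  "cosine_hump h t = cos (pi / (2 * h) * clamp_to h t)"

context
  fixes h :: real
  assumes h: "h > 0"
begin

lemma sine_step_deriv: "(sine_step h has_real_derivative pi / (2 * h) * cosine_hump h t) (at t)"
proof -
  let ?k = "pi / (2 * h)"
  have kh: "?k * h = pi / 2" using h by simp
  have edge: "sin (?k * h) = 1" "cos (?k * h) = 0" "sin (?k * (- h)) = - 1" "cos (?k * (- h)) = 0"
    by (simp_all only: mult_minus_right kh sin_minus cos_minus sin_pi_half cos_pi_half)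
  have 1: "((\<lambda>t. sin (?k * t)) has_real_derivative ?k * cos (?k * t)) (at t)" for t
    by (rule derivative_eq_intros refl)+ simp
  have 2: "((\<lambda>t. if t \<le> h then sin (?k * t) else 1) has_real_derivative (if t \<le> h then ?k * cos (?k * t) else 0)) (at t)" for t
    by (rule has_real_derivative_If_le[OF 1]) (simp_all only: edge mult_zero_right DERIV_const)
  have 3: "((\<lambda>t. if t \<le> - h then - 1 else if t \<le> h then sin (?k * t) else 1) has_real_derivative
     (if t \<le> - h then 0 else if t \<le> h then ?k * cos (?k * t) else 0)) (at t)" for t
    using h by (intro has_real_derivative_If_le[OF _ 2]) (simp_all only: edge mult_zero_right DERIV_const, auto simp: edge)
  have "sine_step h = (\<lambda>t. if t \<le> - h then - 1 else if t \<le> h then sin (?k * t) else 1)"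
    using h edge by (auto simp: sine_step_def clamp_to_def max_def min_def fun_eq_iff)
  moreover have "?k * cosine_hump h t = (if t \<le> - h then 0 else if t \<le> h then ?k * cos (?k * t) else 0)"
    using h edge by (auto simp: cosine_hump_def clamp_to_def max_def min_def)
  ultimately show ?thesis using 3 by simp
qed

lemma cosine_hump_continuous: "continuous_on UNIV (cosine_hump h)"
  unfolding cosine_hump_def clamp_to_def by (intro continuous_intros)

lemma sine_step_cosine_hump: "(sine_step h t)\<^sup>2 = 1 - (cosine_hump h t)\<^sup>2"
  by (simp add: sine_step_def cosine_hump_def sin_squared_eq)

lemma sine_step_const: "t \<le> - h \<Longrightarrow> sine_step h t = - 1" "h \<le> t \<Longrightarrow> sine_step h t = 1"
  using h by (simp_all add: sine_step_def clamp_to_def)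

lemma cosine_hump_pos: "- h < t \<Longrightarrow> t < h \<Longrightarrow> cosine_hump h t > 0"
proof -
  assume t: "- h < t" "t < h"
  let ?k = "pi / (2 * h)"
  have k: "?k > 0" "?k * h = pi / 2" using h by auto
  have "?k * (- h) < ?k * t" "?k * t < ?k * h" using t k(1) by (intro mult_strict_left_mono; simp)+
  then have "- (pi / 2) < ?k * t" "?k * t < pi / 2" by (simp_all only: k(2) mult_minus_right)
  moreover have "clamp_to h t = t" using t by (simp add: clamp_to_def)
  ultimately show "cosine_hump h t > 0" unfolding cosine_hump_def by (simp only: cos_gt_zero_pi)
qed

lemma cosine_hump_outside: "t \<notin> {-h..h} \<Longrightarrow> cosine_hump h t = 0"
  using h by (auto simp: cosine_hump_def clamp_to_def)

lemma sine_step_lipschitz: "\<bar>sine_step h a - sine_step h b\<bar> \<le> pi / (2 * h) * \<bar>a - b\<bar>"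
proof -
  have "norm (sine_step h a - sine_step h b) \<le> pi / (2 * h) * norm (a - b)"
  proof (rule field_differentiable_bound[of UNIV _ "\<lambda>t. pi / (2 * h) * cosine_hump h t"])
    fix t
    show "(sine_step h has_field_derivative pi / (2 * h) * cosine_hump h t) (at t within UNIV)"
      using sine_step_deriv by simp
    have "pi / (2 * h) * \<bar>cosine_hump h t\<bar> \<le> pi / (2 * h) * 1"
      using h by (intro mult_left_mono) (auto simp: cosine_hump_def)
    then show "norm (pi / (2 * h) * cosine_hump h t) \<le> pi / (2 * h)" using h by (simp add: abs_mult)
  qed auto
  then show ?thesis by simp
qed

lemma integral_cosine_hump_square:
  "integrable lborel (\<lambda>s. (cosine_hump h (s - c))\<^sup>2)" "(LINT s|lborel. (cosine_hump h (s - c))\<^sup>2) = h"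
proof -
  let ?k = "pi / (2 * h)"
  let ?F = "\<lambda>s. (s - c) / 2 + sin (2 * (?k * (s - c))) / (4 * ?k)"
  have k: "?k > 0" using h by simp
  have eq: "(cosine_hump h (s - c))\<^sup>2 = (cos (?k * (s - c)))\<^sup>2 * indicator {c - h..c + h} s" for s
  proof (cases "s \<in> {c - h..c + h}")
    case True
    then have "clamp_to h (s - c) = s - c" by (simp add: clamp_to_def)
    then show ?thesis using True by (simp add: cosine_hump_def)
  next
    case False
    then have "cosine_hump h (s - c) = 0" by (intro cosine_hump_outside) auto
    then show ?thesis using False by simp
  qed
  have d: "(?F has_real_derivative (cos (?k * (s - c)))\<^sup>2) (at s)" for s
  proof -
    have "(?F has_real_derivative 1 / 2 + (cos (2 * (?k * (s - c))) * (2 * ?k)) / (4 * ?k)) (at s)"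
      using k by (auto intro!: derivative_eq_intros)
    moreover have "1 / 2 + (cos (2 * y) * (2 * ?k)) / (4 * ?k) = (cos y)\<^sup>2" for y
    proof -
      have "(X * (2 * ?k)) / (4 * ?k) = X / 2" for X using h by (simp add: field_simps)
      then show ?thesis by (simp only: cos_double_cos) (simp add: field_simps)
    qed
    ultimately show ?thesis by (simp only:)
  qed
  have cont: "continuous_on UNIV (\<lambda>s. (cosine_hump h (s - c))\<^sup>2)"
    by (intro continuous_intros continuous_on_compose2[OF cosine_hump_continuous]) auto
  show "integrable lborel (\<lambda>s. (cosine_hump h (s - c))\<^sup>2)"
    by (rule integrable_compact_support[OF cont compact_Icc[of "c - h" "c + h"]]) (simp add: eq)
  have "(LINT s|lborel. (cos (?k * (s - c)))\<^sup>2 * indicator {c - h..c + h} s) = ?F (c + h) - ?F (c - h)"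
    using h by (intro integral_FTC_Icc_real d continuous_intros) auto
  also have "\<dots> = h"
  proof -
    have "2 * (?k * (c + h - c)) = pi" "2 * (?k * (c - h - c)) = - pi" using h by auto
    then show ?thesis by (simp only: sin_minus sin_pi) simp
  qed
  finally show "(LINT s|lborel. (cosine_hump h (s - c))\<^sup>2) = h" by (simp only: eq)
qed

end

section \<open>Direction of minimal width and position of the profile\<close>

lemma width_inner_le:
  fixes P :: "(real^2) set"
  assumes "bounded P" "x \<in> P" "y \<in> P" shows "(x - y) \<bullet> v \<le> width P v"
  using inner_Sup_Inf(1)[OF assms(1,2), of v] inner_Sup_Inf(2)[OF assms(1,3), of v]
  by (simp add: width_def inner_diff_left)

text \<open>The width is a Lipschitz function of the direction, with twice a bound for the points of
  \<open>P\<close> as constant, so it attains its minimum on the unit circle.\<close>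

lemma width_minimizer:
  fixes P :: "(real^2) set"
  assumes P: "bounded P" "P \<noteq> {}"
  obtains e where "norm e = 1" "\<forall>v. norm v = 1 \<longrightarrow> width P e \<le> width P v"
proof -
  obtain B where B: "B > 0" "\<And>x. x \<in> P \<Longrightarrow> norm x \<le> B" using P(1) bounded_pos by metis
  have le: "width P u \<le> width P v + (2 * B) * norm (u - v)" for u v
  proof (rule width_le[OF P(2)])
    fix x y assume xy: "x \<in> P" "y \<in> P"
    have "(x - y) \<bullet> (u - v) \<le> norm (x - y) * norm (u - v)" by (rule norm_cauchy_schwarz)
    also have "\<dots> \<le> (2 * B) * norm (u - v)"
      using norm_triangle_ineq4[of x y] B(2)[OF xy(1)] B(2)[OF xy(2)] by (intro mult_right_mono) auto
    finally show "(x - y) \<bullet> u \<le> width P v + (2 * B) * norm (u - v)"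
      using width_inner_le[OF P(1) xy, of v] by (simp add: inner_diff_right)
  qed
  have "(2 * B)-lipschitz_on (sphere 0 1) (width P)"
  proof (rule lipschitz_onI)
    fix u v
    show "dist (width P u) (width P v) \<le> 2 * B * dist u v"
      using le[of u v] le[of v u] by (simp add: dist_norm norm_minus_commute abs_le_iff)
  qed (use B in simp)
  then have "continuous_on (sphere 0 1) (width P)" by (rule lipschitz_on_continuous_on)
  moreover have "compact (sphere (0 :: real^2) 1)" "sphere (0 :: real^2) 1 \<noteq> {}" by auto
  ultimately obtain e where "e \<in> sphere 0 1" "\<forall>v\<in>sphere 0 1. width P e \<le> width P v"
    using continuous_attains_inf by blast
  then show thesis by (intro that) auto
qed

text \<open>The shift \<open>c\<close> enforces mean zero: moved far to either side the profile is
  constantly 1 or -1 on \<Omega>, and the integral depends continuously on \<open>c\<close>.\<close>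

lemma sine_step_balance:
  fixes \<Omega> :: "(real^2) set"
  assumes \<Omega>: "open \<Omega>" "bounded \<Omega>" "\<Omega> \<noteq> {}" and v: "norm v = 1" and h: "h > 0"
  obtains c where "(LINT x|lebesgue_on \<Omega>. sine_step h (x \<bullet> v - c)) = 0"
proof -
  define I where "I c = (LINT x|lebesgue_on \<Omega>. sine_step h (x \<bullet> v - c))" for c
  let ?A = "measure lebesgue \<Omega>" and ?k = "pi / (2 * h)"
  have lm: "\<Omega> \<in> lmeasurable" and ls: "\<Omega> \<in> sets lebesgue" using \<Omega> lmeasurable_open by auto
  have cs: "continuous_on UNIV (sine_step h)"
    using DERIV_isCont[OF sine_step_deriv[OF h]] by (simp add: continuous_on_eq_continuous_at)
  have int: "integrable (lebesgue_on \<Omega>) (\<lambda>x. sine_step h (x \<bullet> v - c))" for c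
    by (intro integrable_continuous_bounded[OF \<Omega>(2) ls] continuous_on_compose2[OF cs] continuous_intros) auto
  have A: "?A > 0" by (rule measure_pos_open[OF \<Omega>])
  have cint: "integrable (lebesgue_on \<Omega>) (\<lambda>x. r)" for r :: real
    by (intro integrable_continuous_bounded[OF \<Omega>(2) ls] continuous_intros)
  have le: "I a - I b \<le> (?A * ?k) * \<bar>a - b\<bar>" for a b
  proof -
    have "I a - I b = (LINT x|lebesgue_on \<Omega>. sine_step h (x \<bullet> v - a) - sine_step h (x \<bullet> v - b))"
      unfolding I_def by (rule Bochner_Integration.integral_diff[OF int int, symmetric])
    also have "\<dots> \<le> (LINT x|lebesgue_on \<Omega>. ?k * \<bar>a - b\<bar>)"
    proof (intro integral_mono Bochner_Integration.integrable_diff int cint)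
      fix x
      show "sine_step h (x \<bullet> v - a) - sine_step h (x \<bullet> v - b) \<le> ?k * \<bar>a - b\<bar>"
        using sine_step_lipschitz[OF h, of "x \<bullet> v - a" "x \<bullet> v - b"] by (simp add: abs_minus_commute)
    qed
    also have "\<dots> = ?A * (?k * \<bar>a - b\<bar>)" by (rule measure_lebesgue_on_const[OF lm])
    finally show ?thesis by simp
  qed
  have "(?A * ?k)-lipschitz_on UNIV I"
  proof (rule lipschitz_onI)
    fix a b
    show "dist (I a) (I b) \<le> ?A * ?k * dist a b"
      using le[of a b] le[of b a] by (simp add: dist_real_def abs_minus_commute abs_le_iff)
  qed (use h A in simp)
  then have cI: "continuous_on UNIV I" by (rule lipschitz_on_continuous_on)
  obtain B where B: "B > 0" "\<And>x v. x \<in> \<Omega> \<Longrightarrow> norm v = 1 \<Longrightarrow> \<bar>x \<bullet> v\<bar> \<le> B" using bounded_inner_bounds[OF \<Omega>(2)] by metis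
  have "I (- B - h) = (LINT x|lebesgue_on \<Omega>. 1)" unfolding I_def
  proof (intro Bochner_Integration.integral_cong refl)
    fix x assume "x \<in> space (lebesgue_on \<Omega>)"
    then show "sine_step h (x \<bullet> v - (- B - h)) = 1" using B(2)[of x v] v by (intro sine_step_const[OF h]) auto
  qed
  then have p: "I (- B - h) \<ge> 0" using A measure_lebesgue_on_const[OF lm, of 1] by simp
  have "I (B + h) = (LINT x|lebesgue_on \<Omega>. - 1)" unfolding I_def
  proof (intro Bochner_Integration.integral_cong refl)
    fix x assume "x \<in> space (lebesgue_on \<Omega>)"
    then show "sine_step h (x \<bullet> v - (B + h)) = - 1" using B(2)[of x v] v by (intro sine_step_const[OF h]) auto
  qed
  then have n: "I (B + h) \<le> 0" using A measure_lebesgue_on_const[OF lm, of "- 1"] by simp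
  have "\<exists>c. - B - h \<le> c \<and> c \<le> B + h \<and> I c = 0"
    using p n B h by (intro IVT2' continuous_on_subset[OF cI]) auto
  then show thesis using that by (auto simp: I_def)
qed

section \<open>Trial function and the case of equality\<close>

lemma AE_lborel_interval:
  fixes a b :: real
  assumes "AE s in lborel. P s" "a < b" obtains s where "a < s" "s < b" "P s"
proof (rule ccontr)
  assume "\<not> thesis"
  then have "\<And>s. P s \<Longrightarrow> s \<notin> {a<..<b}" using that by auto
  then have "AE s in lborel. s \<notin> {a<..<b}" using assms(1) by (auto elim: eventually_mono)
  then have "{a<..<b} \<in> null_sets lborel" by (subst AE_iff_null_sets) auto
  then show False using assms(2) by (simp add: null_sets_def)
qed

text \<open>The hypotheses describe a rectangle with sides \<open>2 h\<close> and \<open>w\<close>,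
  where \<open>w \<le> 2 * h\<close>. Chords are known only almost everywhere, so two full chords
  near the ends are joined by convexity; this is why the radius is \<open>2 w / 5\<close> instead of
  \<open>w / 2\<close>.\<close>

lemma ball_of_full_chords:
  fixes \<Omega> :: "(real^2) set"
  assumes \<Omega>: "open \<Omega>" "convex \<Omega>" "bounded \<Omega>" "\<Omega> \<noteq> {}" and v: "norm v = 1" and h: "h > 0"
    and w: "w = width \<Omega> (rot2 v)" "w \<le> width \<Omega> v"
    and full: "AE s in lborel. c - h < s \<and> s < c + h \<longrightarrow> chord v \<Omega> s = w"
    and empty: "AE s in lborel. \<not> (c - h < s \<and> s < c + h) \<longrightarrow> chord v \<Omega> s = 0"
  obtains p where "ball p (2 * w / 5) \<subseteq> \<Omega>"
proof -
  define m M where "m = (INF x\<in>\<Omega>. x \<bullet> rot2 v)" and "M = (SUP x\<in>\<Omega>. x \<bullet> rot2 v)"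
  define \<alpha> \<beta> where "\<alpha> = (INF x\<in>\<Omega>. x \<bullet> v)" and "\<beta> = (SUP x\<in>\<Omega>. x \<bullet> v)"
  have ne: "norm (rot2 v) = 1" using v by simp
  have wM: "w = M - m" unfolding w(1) width_def m_def M_def ..
  have wp: "w > 0" unfolding w(1) by (rule width_pos[OF \<Omega>(1,3,4) ne])
  have img: "(\<lambda>x. x \<bullet> v) ` \<Omega> = {\<alpha><..<\<beta>}"
    unfolding \<alpha>_def \<beta>_def by (rule inner_image_interval[OF \<Omega> v])
  have pos: "chord v \<Omega> s > 0" if "\<alpha> < s" "s < \<beta>" for s
    using chord_eq(3)[OF \<Omega>(1-3) v] slice_nonempty_iff[OF v, of \<Omega> s] that img by auto
  have w\<beta>: "w \<le> \<beta> - \<alpha>" using w(2) unfolding width_def \<alpha>_def \<beta>_def .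
  \<comment> \<open>Every line between \<open>\<alpha>\<close> and \<open>\<beta>\<close> has a
    positive chord, so this interval cannot exceed the one outside which chords vanish. Its length
    is at least \<open>w\<close>.\<close>
  have "\<beta> \<le> c + h"
  proof (rule ccontr)
    assume "\<not> \<beta> \<le> c + h"
    then have "max \<alpha> (c + h) < \<beta>" using w\<beta> wp by simp
    from AE_lborel_interval[OF empty this] obtain s where "max \<alpha> (c + h) < s" "s < \<beta>" "chord v \<Omega> s = 0" by auto
    then show False using pos[of s] by simp
  qed
  moreover have "c - h \<le> \<alpha>"
  proof (rule ccontr)
    assume "\<not> c - h \<le> \<alpha>"
    then have "\<alpha> < min \<beta> (c - h)" using w\<beta> wp by simp
    from AE_lborel_interval[OF empty this] obtain s where "\<alpha> < s" "s < min \<beta> (c - h)" "chord v \<Omega> s = 0" by auto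
    then show False using pos[of s] by simp
  qed
  ultimately have wh: "w \<le> 2 * h" using w\<beta> by linarith
  \<comment> \<open>A chord of length \<open>w\<close> has to reach from one side of the strip to
    the other.\<close>
  have sl: "frame2 v (s, t) \<in> \<Omega>" if s: "chord v \<Omega> s = w" and t: "m < t" "t < M" for s t
  proof -
    have nes: "slice v \<Omega> s \<noteq> {}" using s wp by (auto simp: chord_def)
    have b: "m \<le> t" "t \<le> M" if "t \<in> slice v \<Omega> s" for t
    proof -
      have "frame2 v (s, t) \<in> \<Omega>" using that by (simp add: slice_def)
      from inner_Sup_Inf[OF \<Omega>(3) this, of "rot2 v"] show "m \<le> t" "t \<le> M"
        by (simp_all add: m_def M_def frame2_inner[OF v])
    qed
    have "m \<le> Inf (slice v \<Omega> s)" "Sup (slice v \<Omega> s) \<le> M"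
      using b nes by (auto intro!: cInf_greatest cSup_least)
    then have "Inf (slice v \<Omega> s) = m" "Sup (slice v \<Omega> s) = M"
      using chord_eq(2)[OF \<Omega>(1-3) v nes] s wM by auto
    then have "t \<in> slice v \<Omega> s" using chord_eq(1)[OF \<Omega>(1-3) v nes] t by simp
    then show ?thesis by (simp add: slice_def)
  qed
  \<comment> \<open>A full chord within \<open>w / 10\<close> of each end; from the half-length
    \<open>h \<ge> w / 2\<close> there remains at least
    \<open>w / 2 - w / 10 = 2 w / 5\<close>.\<close>
  have "c - h < c - h + w / 10" using wp by simp
  from AE_lborel_interval[OF full this]
  obtain s1 where "c - h < s1" "s1 < c - h + w / 10" "c - h < s1 \<and> s1 < c + h \<longrightarrow> chord v \<Omega> s1 = w" .
  then have s1: "c - h < s1" "s1 < c - h + w / 10" "chord v \<Omega> s1 = w" using wh wp by auto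
  have "c + h - w / 10 < c + h" using wp by simp
  from AE_lborel_interval[OF full this]
  obtain s2 where "c + h - w / 10 < s2" "s2 < c + h" "c - h < s2 \<and> s2 < c + h \<longrightarrow> chord v \<Omega> s2 = w" .
  then have s2: "c + h - w / 10 < s2" "s2 < c + h" "chord v \<Omega> s2 = w" using wh wp by auto
  have "ball (frame2 v (c, (m + M) / 2)) (2 * w / 5) \<subseteq> \<Omega>"
  proof
    fix x assume x: "x \<in> ball (frame2 v (c, (m + M) / 2)) (2 * w / 5)"
    let ?p = "frame2 v (c, (m + M) / 2)"
    define s t where "s = x \<bullet> v" and "t = x \<bullet> rot2 v"
    have xeq: "x = frame2 v (s, t)" unfolding s_def t_def by (simp add: frame2_decompose[OF v])
    have nx: "norm (x - ?p) < 2 * w / 5" using x by (simp add: dist_norm norm_minus_commute)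
    have "\<bar>(x - ?p) \<bullet> v\<bar> < 2 * w / 5" "\<bar>(x - ?p) \<bullet> rot2 v\<bar> < 2 * w / 5"
      using Cauchy_Schwarz_ineq2[of "x - ?p" v] Cauchy_Schwarz_ineq2[of "x - ?p" "rot2 v"] nx v by simp_all
    then have st: "\<bar>s - c\<bar> < 2 * w / 5" "\<bar>t - (m + M) / 2\<bar> < 2 * w / 5"
      by (simp_all add: inner_diff_left frame2_inner[OF v] s_def t_def)
    have "t - (m + M) / 2 < 2 * w / 5" "- (t - (m + M) / 2) < 2 * w / 5"
      using st(2) by (simp_all only: abs_less_iff)
    then have t: "m < t" "t < M" using wM wp by argo+
    have sb: "s1 < s" "s < s2" using st(1) s1 s2 wh wp unfolding abs_less_iff by linarith+
    define \<theta> where "\<theta> = (s - s1) / (s2 - s1)"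
    have \<theta>: "0 \<le> \<theta>" "\<theta> \<le> 1" "s = (1 - \<theta>) * s1 + \<theta> * s2"
    proof -
      show "0 \<le> \<theta>" "\<theta> \<le> 1" using sb by (auto simp: \<theta>_def)
      have "\<theta> * (s2 - s1) = s - s1" using sb by (simp add: \<theta>_def)
      then show "s = (1 - \<theta>) * s1 + \<theta> * s2" by (simp add: algebra_simps)
    qed
    have "(1 - \<theta>) *\<^sub>R frame2 v (s1, t) + \<theta> *\<^sub>R frame2 v (s2, t) \<in> \<Omega>"
      using \<Omega>(2) sl[OF s1(3) t] sl[OF s2(3) t] \<theta> by (intro convexD) auto
    moreover have "(1 - \<theta>) *\<^sub>R frame2 v (s1, t) + \<theta> *\<^sub>R frame2 v (s2, t) = x"
      unfolding xeq \<theta>(3) by (simp add: frame2_def algebra_simps)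
    ultimately show "x \<in> \<Omega>" by simp
  qed
  then show thesis by (rule that)
qed

lemma chord_le_width:
  fixes P :: "(real^2) set"
  assumes P: "open P" "bounded P" "P \<noteq> {}" and v: "norm v = 1"
  shows "chord v P s \<le> width P (rot2 v)"
  unfolding width_def
proof (rule chord_le[OF v])
  show "(INF x\<in>P. x \<bullet> rot2 v) \<le> (SUP x\<in>P. x \<bullet> rot2 v)"
    using width_pos[OF P, of "rot2 v"] v by (simp add: width_def)
qed (use inner_Sup_Inf[OF P(2)] in blast)

text \<open>Since the squares of sine and cosine add up to 1, the trial function has energy
  \<open>?k^2 * Q\<close> and mass \<open>?A - Q\<close>, where \<open>Q\<close> weighs the chords
  with the squared cosine. From \<open>Q \<le> h * w\<close>, half the area, the quotient is at most
  \<open>?k^2\<close>; \<open>Q\<close> is kept in the statement so that equality can be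
  analysed.\<close>

lemma mu1_upper:
  fixes \<Omega> :: "(real^2) set"
  assumes \<Omega>: "open \<Omega>" "convex \<Omega>" "bounded \<Omega>" "\<Omega> \<noteq> {}" and v: "norm v = 1" and h: "h > 0"
    and w: "w = width \<Omega> (rot2 v)" and area: "measure lebesgue \<Omega> = 2 * h * w"
  obtains c Q where "Q = (LINT s|lborel. (cosine_hump h (s - c))\<^sup>2 * chord v \<Omega> s)"
    "integrable lborel (\<lambda>s. (cosine_hump h (s - c))\<^sup>2 * chord v \<Omega> s)"
    "Q \<le> h * w" "mu1 \<Omega> \<le> (pi / (2 * h))\<^sup>2 * (Q / (measure lebesgue \<Omega> - Q))" "neumann_quotients \<Omega> \<noteq> {}"
proof -
  let ?A = "measure lebesgue \<Omega>" and ?k = "pi / (2 * h)"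
  have ne: "norm (rot2 v) = 1" using v by simp
  have lm: "\<Omega> \<in> lmeasurable" and ls: "\<Omega> \<in> sets lebesgue" using \<Omega> lmeasurable_open by auto
  have wp: "w > 0" unfolding w by (rule width_pos[OF \<Omega>(1,3,4) ne])
  obtain c where c: "(LINT x|lebesgue_on \<Omega>. sine_step h (x \<bullet> v - c)) = 0"
    using sine_step_balance[OF \<Omega>(1,3,4) v h] .
  define q where "q s = (cosine_hump h (s - c))\<^sup>2" for s
  define u where "u x = sine_step h (x \<bullet> v - c)" for x
  define g where "g x = (?k * cosine_hump h (x \<bullet> v - c)) *\<^sub>R v" for x
  have cq: "continuous_on UNIV q" unfolding q_def
    by (intro continuous_intros continuous_on_compose2[OF cosine_hump_continuous[OF h]]) auto
  have cqx: "continuous_on UNIV (\<lambda>x. q (x \<bullet> v))"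
    by (intro continuous_on_compose2[OF cq] continuous_intros) auto
  have iq: "integrable (lebesgue_on \<Omega>) (\<lambda>x. q (x \<bullet> v))" by (rule integrable_continuous_bounded[OF \<Omega>(3) ls cqx])
  define Q where "Q = (LINT s|lborel. q s * chord v \<Omega> s)"
  note slices = integral_chord[OF \<Omega>(1,3) v borel_measurable_continuous_onI[OF cq] iq]
  have Q: "(LINT x|lebesgue_on \<Omega>. q (x \<bullet> v)) = Q" unfolding Q_def by (rule slices(1))
  have Cu: "C1_grad u g"
    unfolding u_def g_def
    by (rule C1_grad_compose[OF C1_grad_inner sine_step_deriv[OF h]])
      (intro continuous_intros cosine_hump_continuous[OF h])
  have H: "H1_with_grad \<Omega> u g" by (rule C1_grad_H1[OF Cu \<Omega>(3) ls])
  have u2: "(u x)\<^sup>2 = 1 - q (x \<bullet> v)" for x by (simp add: u_def q_def sine_step_cosine_hump[OF h])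
  have g2: "(norm (g x))\<^sup>2 = ?k\<^sup>2 * q (x \<bullet> v)" for x by (simp only: g_def q_def norm_scaleR v mult_1_right real_norm_def power2_abs power_mult_distrib)
  have i1: "integrable (lebesgue_on \<Omega>) (\<lambda>x. 1 :: real)"
    by (intro integrable_continuous_bounded[OF \<Omega>(3) ls] continuous_intros)
  have mass: "(LINT x|lebesgue_on \<Omega>. (u x)\<^sup>2) = ?A - Q"
    unfolding u2 using Bochner_Integration.integral_diff[OF i1 iq] measure_lebesgue_on_const[OF lm, of 1] Q by simp
  have energy: "(LINT x|lebesgue_on \<Omega>. (norm (g x))\<^sup>2) = ?k\<^sup>2 * Q" unfolding g2 using Q by simp
  have ch: "chord v \<Omega> s \<le> w" for s unfolding w by (rule chord_le_width[OF \<Omega>(1,3,4) v])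
  have "Q \<le> (LINT s|lborel. q s * w)" unfolding Q_def
  proof (rule integral_mono[OF slices(2)])
    show "integrable lborel (\<lambda>s. q s * w)" using integral_cosine_hump_square(1)[OF h] by (simp add: q_def)
  qed (use ch in \<open>auto simp: q_def intro!: mult_left_mono\<close>)
  also have "\<dots> = h * w" using integral_cosine_hump_square(2)[OF h] by (simp add: q_def)
  finally have Qw: "Q \<le> h * w" .
  have "h * w > 0" using h wp by simp
  then have den: "?A - Q > 0" using Qw area by linarith
  have nz: "nonzero_on \<Omega> u" unfolding nonzero_on_def
  proof
    assume "AE x in lebesgue_on \<Omega>. u x = 0"
    then have "AE x in lebesgue_on \<Omega>. (u x)\<^sup>2 = 0" by (auto elim: eventually_mono)
    then have "(LINT x|lebesgue_on \<Omega>. (u x)\<^sup>2) = 0" by (rule integral_eq_zero_AE)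
    then show False using den mass by simp
  qed
  have mem: "(?k\<^sup>2 * Q) / (?A - Q) \<in> neumann_quotients \<Omega>"
    unfolding neumann_quotients_def mass[symmetric] energy[symmetric]
    using H nz c by (auto simp flip: u_def)
  have bdd: "bdd_below (neumann_quotients \<Omega>)"
    unfolding neumann_quotients_def by (rule bdd_belowI[of _ 0]) (auto intro!: divide_nonneg_nonneg Bochner_Integration.integral_nonneg)
  have "mu1 \<Omega> \<le> (?k\<^sup>2 * Q) / (?A - Q)" unfolding mu1_eq by (rule cInf_lower[OF mem bdd])
  then have mu: "mu1 \<Omega> \<le> ?k\<^sup>2 * (Q / (?A - Q))" by simp
  show thesis
  proof (rule that[of Q c])
    show "neumann_quotients \<Omega> \<noteq> {}" using mem by blast
  qed (use Q_def slices(2) Qw mu in \<open>simp_all add: q_def\<close>)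
qed

text \<open>Equality forces a full chord wherever the cosine is positive. These chords already
  account for the whole area \<open>2 * h * w\<close>, so nothing is left for the others.\<close>

lemma full_chords:
  fixes \<Omega> :: "(real^2) set"
  assumes \<Omega>: "open \<Omega>" "convex \<Omega>" "bounded \<Omega>" "\<Omega> \<noteq> {}" and v: "norm v = 1" and h: "h > 0"
    and w: "w = width \<Omega> (rot2 v)" and area: "measure lebesgue \<Omega> = 2 * h * w"
    and int: "integrable lborel (\<lambda>s. (cosine_hump h (s - c))\<^sup>2 * chord v \<Omega> s)"
    and eq: "(LINT s|lborel. (cosine_hump h (s - c))\<^sup>2 * chord v \<Omega> s) = h * w"
  shows "AE s in lborel. c - h < s \<and> s < c + h \<longrightarrow> chord v \<Omega> s = w"
    "AE s in lborel. \<not> (c - h < s \<and> s < c + h) \<longrightarrow> chord v \<Omega> s = 0"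
proof -
  let ?q = "\<lambda>s. (cosine_hump h (s - c))\<^sup>2" and ?I = "{c - h<..<c + h}"
  have lm: "\<Omega> \<in> lmeasurable" and ls: "\<Omega> \<in> sets lebesgue" using \<Omega> lmeasurable_open by auto
  have ch: "chord v \<Omega> s \<le> w" for s unfolding w by (rule chord_le_width[OF \<Omega>(1,3,4) v])
  have iw: "integrable lborel (\<lambda>s. ?q s * w)" using integral_cosine_hump_square(1)[OF h] by simp
  have id: "integrable lborel (\<lambda>s. ?q s * w - ?q s * chord v \<Omega> s)"
    by (rule Bochner_Integration.integrable_diff[OF iw int])
  have "(LINT s|lborel. ?q s * w - ?q s * chord v \<Omega> s) = 0"
    unfolding Bochner_Integration.integral_diff[OF iw int] eq using integral_cosine_hump_square(2)[OF h] by simp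
  moreover have "AE s in lborel. 0 \<le> ?q s * w - ?q s * chord v \<Omega> s"
    using ch by (auto intro!: mult_left_mono AE_I2)
  ultimately have "AE s in lborel. ?q s * w - ?q s * chord v \<Omega> s = 0"
    using integral_nonneg_eq_0_iff_AE[OF id] by blast
  then show full: "AE s in lborel. c - h < s \<and> s < c + h \<longrightarrow> chord v \<Omega> s = w"
  proof eventually_elim
    case (elim s)
    show ?case
    proof
      assume "c - h < s \<and> s < c + h"
      then have "cosine_hump h (s - c) > 0" by (intro cosine_hump_pos[OF h]) auto
      then show "chord v \<Omega> s = w" using elim by simp
    qed
  qed
  have i1: "integrable (lebesgue_on \<Omega>) (\<lambda>x. 1 :: real)"
    by (intro integrable_continuous_bounded[OF \<Omega>(3) ls] continuous_intros)
  have one: "(\<lambda>s::real. 1 :: real) \<in> borel_measurable borel" by simp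
  have total: "(LINT s|lborel. chord v \<Omega> s) = 2 * h * w" "integrable lborel (chord v \<Omega>)"
    using integral_chord[OF \<Omega>(1,3) v one i1] measure_lebesgue_on_const[OF lm, of 1] area by simp_all
  have "integrable lborel (\<lambda>s. indicator ?I s * w)" "(LINT s|lborel. indicator ?I s * w) = 2 * h * w"
    using h by auto
  note rect = this
  have ae: "AE s in lborel. chord v \<Omega> s - indicator ?I s * w = indicator (- ?I) s * chord v \<Omega> s"
    using full by eventually_elim (auto simp: indicator_def)
  have i: "integrable lborel (\<lambda>s. indicator (- ?I) s * chord v \<Omega> s)"
    by (rule integrable_mult_indicator[OF _ total(2), of "- ?I", unfolded real_scaleR_def]) simp
  have "(LINT s|lborel. indicator (- ?I) s * chord v \<Omega> s) = (LINT s|lborel. chord v \<Omega> s - indicator ?I s * w)"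
    using chord_measurable[OF \<Omega>(1), of v] ae by (intro integral_cong_AE) (auto elim: eventually_mono)
  also have "\<dots> = 0" by (simp only: Bochner_Integration.integral_diff[OF total(2) rect(1)] total(1) rect(2) diff_self)
  finally have "AE s in lborel. indicator (- ?I) s * chord v \<Omega> s = 0"
    by (subst (asm) integral_nonneg_eq_0_iff_AE[OF i]) (auto simp: chord_def)
  then show "AE s in lborel. \<not> (c - h < s \<and> s < c + h) \<longrightarrow> chord v \<Omega> s = 0"
    by eventually_elim auto
qed

lemma product_upper_bound:
  fixes \<Omega> :: "(real^2) set"
  assumes \<Omega>: "open \<Omega>" "convex \<Omega>" "bounded \<Omega>" "\<Omega> \<noteq> {}"
  shows "(measure lebesgue \<Omega>)\<^sup>2 * lambda1 \<Omega> * mu1 \<Omega> < 9 * pi\<^sup>2 * j01\<^sup>2" "neumann_quotients \<Omega> \<noteq> {}"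
proof -
  obtain e where e: "norm e = 1" "\<forall>v. norm v = 1 \<longrightarrow> width \<Omega> e \<le> width \<Omega> v"
    using width_minimizer[OF \<Omega>(3,4)] by metis
  \<comment> \<open>Makes \<open>rot2 v\<close> the direction \<open>e\<close> of minimal
    width.\<close>
  define v where "v = - rot2 e"
  have v: "norm v = 1" using e(1) by (simp add: v_def)
  have rv: "rot2 v = e" by (simp add: v_def vec_eq_iff forall_2)
  let ?A = "measure lebesgue \<Omega>" and ?l = "lambda1 \<Omega>"
  define w where "w = width \<Omega> (rot2 v)"
  have wp: "w > 0" unfolding w_def rv by (rule width_pos[OF \<Omega>(1,3,4) e(1)])
  have A: "?A > 0" by (rule measure_pos_open[OF \<Omega>(1,3,4)])
  \<comment> \<open>\<open>2 * h\<close> is the length of the rectangle with the area of \<Omega>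
    and width \<open>w\<close>.\<close>
  define h where "h = ?A / (2 * w)"
  have h: "h > 0" using A wp by (simp add: h_def)
  have area: "?A = 2 * h * w" using wp by (simp add: h_def)
  define k where "k = pi / (2 * h)"
  have k: "k > 0" using h by (simp add: k_def)
  have Ak: "?A * k = pi * w" using h by (simp add: area k_def)
  have l: "?l > 0" by (rule lambda1_pos[OF \<Omega>(1,3,4)])
  obtain c Q where Q: "Q = (LINT s|lborel. (cosine_hump h (s - c))\<^sup>2 * chord v \<Omega> s)"
    "integrable lborel (\<lambda>s. (cosine_hump h (s - c))\<^sup>2 * chord v \<Omega> s)"
    and Qw: "Q \<le> h * w" and mu: "mu1 \<Omega> \<le> k\<^sup>2 * (Q / (?A - Q))" and ne: "neumann_quotients \<Omega> \<noteq> {}"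
    using mu1_upper[OF \<Omega> v h w_def area] unfolding k_def .
  show "neumann_quotients \<Omega> \<noteq> {}" by (rule ne)
  have hw: "h * w > 0" using h wp by simp
  have scale: "?A\<^sup>2 * k\<^sup>2 * (j01 / \<rho>)\<^sup>2 = pi\<^sup>2 * j01\<^sup>2 * (w / \<rho>)\<^sup>2" for \<rho>
    by (simp only: power_mult_distrib[symmetric] Ak) (simp add: mult_ac)
  have jp: "j01 > 0" by (rule j01_props)
  show "?A\<^sup>2 * ?l * mu1 \<Omega> < 9 * pi\<^sup>2 * j01\<^sup>2"
  \<comment> \<open>In the first case the Neumann estimate is strict and the disc of radius
    \<open>w / 3\<close> suffices; otherwise the larger disc makes the Dirichlet estimate strict,
    25/4 replacing 9.\<close>
  proof (cases "Q < h * w")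
    case True
    have "Q / (?A - Q) < 1" using True area hw by (simp add: divide_less_eq)
    then have "k\<^sup>2 * (Q / (?A - Q)) < k\<^sup>2 * 1" using k by (intro mult_strict_left_mono) auto
    then have "mu1 \<Omega> < k\<^sup>2" using mu by linarith
    then have "?A\<^sup>2 * ?l * mu1 \<Omega> < ?A\<^sup>2 * ?l * k\<^sup>2" using A l by (intro mult_strict_left_mono) auto
    also have "\<dots> \<le> ?A\<^sup>2 * k\<^sup>2 * (j01 / (w / 3))\<^sup>2"
    proof -
      have wmin: "w \<le> width \<Omega> v'" if "norm v' = 1" for v' using e(2) that unfolding w_def rv by blast
      obtain p where "ball p (w / 3) \<subseteq> \<Omega>" using width_ball[OF \<Omega> wmin] .
      then have "?l \<le> (j01 / (w / 3))\<^sup>2" using wp by (intro lambda1_upper[OF \<Omega>(1,3,4)]) auto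
      then have "?A\<^sup>2 * k\<^sup>2 * ?l \<le> ?A\<^sup>2 * k\<^sup>2 * (j01 / (w / 3))\<^sup>2" by (intro mult_left_mono) auto
      then show ?thesis by (simp only: mult_ac)
    qed
    also have "\<dots> = 9 * pi\<^sup>2 * j01\<^sup>2" unfolding scale using wp by simp
    finally show ?thesis .
  next
    case False
    then have Qe: "Q = h * w" using Qw by simp
    have "Q / (?A - Q) = 1" using h wp by (simp add: area Qe)
    then have mu': "mu1 \<Omega> \<le> k\<^sup>2" using mu by simp
    note fc = full_chords[OF \<Omega> v h w_def area Q(2) Q(1)[symmetric, unfolded Qe]]
    have wv: "w \<le> width \<Omega> v" using e(2) v unfolding w_def rv by blast
    obtain p where "ball p (2 * w / 5) \<subseteq> \<Omega>" using ball_of_full_chords[OF \<Omega> v h w_def wv fc] .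
    then have "?l \<le> (j01 / (2 * w / 5))\<^sup>2" using wp by (intro lambda1_upper[OF \<Omega>(1,3,4)]) auto
    then have "?A\<^sup>2 * k\<^sup>2 * ?l \<le> ?A\<^sup>2 * k\<^sup>2 * (j01 / (2 * w / 5))\<^sup>2" by (intro mult_left_mono) auto
    also have "\<dots> = pi\<^sup>2 * j01\<^sup>2 * (25 / 4)" unfolding scale using wp by (simp add: power_divide)
    also have "\<dots> < pi\<^sup>2 * j01\<^sup>2 * 9" using jp by (intro mult_strict_left_mono) auto
    finally have "?A\<^sup>2 * k\<^sup>2 * ?l < 9 * pi\<^sup>2 * j01\<^sup>2" by simp
    moreover have "?A\<^sup>2 * ?l * mu1 \<Omega> \<le> ?A\<^sup>2 * ?l * k\<^sup>2" using mu' A l by (intro mult_left_mono) auto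
    ultimately show ?thesis by (simp only: mult_ac)
  qed
qed

theorem theorem3p3:
  fixes \<Omega> :: "(real ^ 2) set"
  assumes "\<Omega> \<noteq> {}" and "bounded \<Omega>" and "open \<Omega>" and "convex \<Omega>"
  shows "pi ^ 4 / 4 < (measure lebesgue \<Omega>)\<^sup>2 * lambda1 \<Omega> * mu1 \<Omega>
      \<and> (measure lebesgue \<Omega>)\<^sup>2 * lambda1 \<Omega> * mu1 \<Omega> < 9 * pi\<^sup>2 * j01\<^sup>2"
  using product_upper_bound[OF assms(3,4,2,1)] product_lower_bound[OF assms(3,4,2,1)] by blast

end
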